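(* Let $n,m$ be positive integers, let $n_1,\ldots,n_m\le n$ be positive integers and let $p_1,\ldots,p_m$ be (nonzero) real numbers such that $$\sum_{i=1}^m\frac{n_i}{p_i}=n.$$ For $1\le i\le m$ let $U_i$ be a real $n_i\times n$ matrix of rank $n_i$. Set $N=\sum_{i=1}^m n_i$ and let $U$ be the $N\times n$ matrix with block rows $U_1,\ldots,U_m$, i.e. $U^*=(U_1^*,\ldots,U_m^* )$. Let $B$ be an $n\times n$ real symmetric positive definite matrix, and set $$P=\mathrm{diag}(p_1I_{n_1},\ldots,p_mI_{n_m}),\qquad D_{UBU^*}=\mathrm{diag}(U_1BU_1^*,\ldots,U_mBU_m^* ).$$ Let $f_i\in L_{p_i}(\mathbb{R}^{n_i})$ be nonnegative for $1\le i\le m$. Then the following hold. (i) If $UBU^*\le P\,D_{UBU^*}$, then $$\int_{\mathbb{R}^n}\prod_{i=1}^m f_i(U_ix)\,dx\le\left(\frac{\det(B)}{\prod_{i=1}^m\det(U_iBU_i^* )^{1/p_i}}\right)^{1/2}\prod_{i=1}^m\|f_i\|_{p_i},$$ and equality holds if $f_i(x_i)=\exp\left(-p_i^{-1}\langle (U_iBU_i^* )^{-1}x_i,x_i\rangle\right)$ for all $1\le i\le m$. (ii) If $UBU^*\ge P\,D_{UBU^*}$, then $$\int_{\mathbb{R}^n}\prod_{i=1}^m f_i(U_ix)\,dx\ge\left(\frac{\det(B)}{\prod_{i=1}^m\det(U_iBU_i^* )^{1/p_i}}\right)^{1/2}\prod_{i=1}^m\|f_i\|_{p_i}.$$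
   Context: $M^*$ denotes the transpose of a real matrix $M$. For real symmetric matrices, $A\le B$ (equivalently $B\ge A$) means $B-A$ is positive semi-definite. For a nonzero real number $p$ (possibly negative or in $(0,1)$) and a nonnegative measurable $f$ on $\mathbb{R}^k$, $\|f\|_p=\left(\int_{\mathbb{R}^k}f(x)^p\,dx\right)^{1/p}$, and $f\in L_p(\mathbb{R}^k)$ means $\int f^p\,dx<\infty$ (with $0^p=\infty$ for $p<0$). *)

theory Defs
  imports
    "HOL-Analysis.Analysis"
    "Jordan_Normal_Form.Matrix"
    "Jordan_Normal_Form.Determinant"
    "Jordan_Normal_Form.Gauss_Jordan_Elimination"
    "Jordan_Normal_Form.DL_Rank"
begin

(* Several spaces of different dimensions n, n_1, ..., n_m occur in one statement, so R^k is the
   carrier carrier_vec k of the Jordan_Normal_Form vectors. The clashing names and notations of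
   HOL-Analysis are switched off. *)

unbundle no inner_syntax
unbundle no vec_syntax
hide_const (open) Determinants.det Finite_Cartesian_Product.vec Finite_Cartesian_Product.row
  Finite_Cartesian_Product.rows Finite_Cartesian_Product.mat
  Finite_Cartesian_Product.transpose
hide_type (open) Finite_Cartesian_Product.vec


subsection \<open>Lebesgue measure on R^k\<close>

(* The k-fold product of the one-dimensional Lebesgue-Borel measure lives on extensional
   functions; "vec k" maps that space bijectively onto carrier_vec k. The completion makes
   measurability mean Lebesgue measurability. *)
definition lebesgue_vec :: "nat \<Rightarrow> real vec measure" where
  "lebesgue_vec k = completion (embed_measure (\<Pi>\<^sub>M i\<in>{..<k}. lborel) (vec k))"

lemma inj_on_vec: "inj_on (vec k) (space (\<Pi>\<^sub>M i\<in>{..<k}. (lborel :: real measure)))"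
proof (rule inj_onI)
  fix f g :: "nat \<Rightarrow> real"
  assume f: "f \<in> space (\<Pi>\<^sub>M i\<in>{..<k}. lborel)" and g: "g \<in> space (\<Pi>\<^sub>M i\<in>{..<k}. lborel)"
    and eq: "vec k f = vec k g"
  have "f i = g i" if "i < k" for i
    using arg_cong[OF eq, of "\<lambda>v. vec_index v i"] that by simp
  then show "f = g"
    using f g by (intro PiE_ext[of f "{..<k}" "\<lambda>_. UNIV" g]) (auto simp: space_PiM)
qed

lemma space_lebesgue_vec: "space (lebesgue_vec k) = carrier_vec k"
proof -
  have "v \<in> vec k ` (\<Pi>\<^sub>E i\<in>{..<k}. UNIV)" if "v \<in> carrier_vec k" for v :: "real vec"
    using that
    by (intro image_eqI[of _ _ "restrict (vec_index v) {..<k}"]) auto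
  then show ?thesis
    by (auto simp: lebesgue_vec_def space_embed_measure space_PiM)
qed

lemma emeasure_lebesgue_vec_box:
  assumes "\<And>i. i < k \<Longrightarrow> a i \<le> b i"
  shows "emeasure (lebesgue_vec k) {x \<in> carrier_vec k. \<forall>i<k. a i \<le> vec_index x i \<and> vec_index x i \<le> b i}
    = ennreal (\<Prod>i<k. b i - a i)"
proof -
  interpret product_sigma_finite "\<lambda>_::nat. lborel :: real measure" ..
  let ?X = "\<Pi>\<^sub>E i\<in>{..<k}. {a i..b i}"
  have X: "?X \<in> sets (\<Pi>\<^sub>M i\<in>{..<k}. lborel)"
    by (intro sets_PiM_I_finite) auto
  have im: "vec k ` ?X = {x \<in> carrier_vec k. \<forall>i<k. a i \<le> vec_index x i \<and> vec_index x i \<le> b i}"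
    (is "_ = ?R")
  proof -
    have "v \<in> vec k ` ?X" if "v \<in> ?R" for v
      using that
      by (intro image_eqI[of _ _ "restrict (vec_index v) {..<k}"]) auto
    then show ?thesis by auto
  qed
  have "emeasure (lebesgue_vec k) (vec k ` ?X) = emeasure (\<Pi>\<^sub>M i\<in>{..<k}. lborel) ?X"
  proof -
    have S: "vec k ` ?X \<in> sets (embed_measure (\<Pi>\<^sub>M i\<in>{..<k}. (lborel :: real measure)) (vec k))"
      using X by (auto simp: sets_embed_measure'[OF inj_on_vec])
    have "vec k -` (vec k ` ?X) \<inter> space (\<Pi>\<^sub>M i\<in>{..<k}. lborel) = ?X"
      using inj_on_vec[of k] sets.sets_into_space[OF X]
      by (auto dest: inj_onD)
    then show ?thesis
      using S by (simp add: lebesgue_vec_def emeasure_embed_measure'[OF inj_on_vec])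
  qed
  also have "\<dots> = (\<Prod>i<k. emeasure lborel {a i..b i})"
    by (rule emeasure_PiM) auto
  also have "\<dots> = ennreal (\<Prod>i<k. b i - a i)"
    using assms by (subst prod_ennreal[symmetric]) auto
  finally show ?thesis by (simp add: im)
qed


subsection \<open>Lp functionals for arbitrary nonzero real exponents\<close>

(* Extended power on [0, \<infinity>], used for p \<noteq> 0 only: 0 to a negative power is \<infinity>, \<infinity> to a negative
   power is 0. *)
definition enn_powr :: "ennreal \<Rightarrow> real \<Rightarrow> ennreal" where
  "enn_powr x p =
    (if x = 0 then (if p < 0 then \<infinity> else 0)
     else if x = \<infinity> then (if p < 0 then 0 else \<infinity>)
     else ennreal (enn2real x powr p))"

definition Lp_integral :: "nat \<Rightarrow> real \<Rightarrow> (real vec \<Rightarrow> real) \<Rightarrow> ennreal" where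
  "Lp_integral k p f = (\<integral>\<^sup>+ x. enn_powr (ennreal (f x)) p \<partial>lebesgue_vec k)"

definition Lp_norm :: "nat \<Rightarrow> real \<Rightarrow> (real vec \<Rightarrow> real) \<Rightarrow> ennreal" where
  "Lp_norm k p f = enn_powr (Lp_integral k p f) (1 / p)"

(* nonnegative members of Lp(R^k) *)
definition Lp_nonneg :: "nat \<Rightarrow> real \<Rightarrow> (real vec \<Rightarrow> real) set" where
  "Lp_nonneg k p = {f \<in> borel_measurable (lebesgue_vec k).
     (\<forall>x\<in>carrier_vec k. 0 \<le> f x) \<and> Lp_integral k p f < \<infinity>}"


subsection \<open>Symmetric matrices and block matrices\<close>

(* transpose_mat A = A forces A to be square *)
definition symmetric_mat :: "real mat \<Rightarrow> bool" where
  "symmetric_mat A \<longleftrightarrow> transpose_mat A = A"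

definition pos_def_mat :: "real mat \<Rightarrow> bool" where
  "pos_def_mat A \<longleftrightarrow> symmetric_mat A \<and>
     (\<forall>x\<in>carrier_vec (dim_row A). x \<noteq> 0\<^sub>v (dim_row A) \<longrightarrow> 0 < x \<bullet> (A *\<^sub>v x))"

definition pos_semidef_mat :: "real mat \<Rightarrow> bool" where
  "pos_semidef_mat A \<longleftrightarrow> symmetric_mat A \<and>
     (\<forall>x\<in>carrier_vec (dim_row A). 0 \<le> x \<bullet> (A *\<^sub>v x))"

definition loewner_le :: "real mat \<Rightarrow> real mat \<Rightarrow> bool" (infix \<open>\<le>\<^sub>L\<close> 50) where
  "A \<le>\<^sub>L B \<longleftrightarrow> symmetric_mat A \<and> symmetric_mat B \<and> dim_row A = dim_row B \<and>
     pos_semidef_mat (B - A)"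

(* vertical concatenation of A 0, ..., A (m - 1), each with n columns *)
definition stack_mat :: "nat \<Rightarrow> nat \<Rightarrow> (nat \<Rightarrow> real mat) \<Rightarrow> real mat" where
  "stack_mat n m A = mat_of_rows n (concat (map (\<lambda>i. rows (A i)) [0..<m]))"

definition diag_mat_seq :: "nat \<Rightarrow> (nat \<Rightarrow> real mat) \<Rightarrow> real mat" where
  "diag_mat_seq m A = diag_block_mat (map A [0..<m])"

end

theory Submission
  imports Defs "HOL-Probability.Distributions" "HOL-Real_Asymp.Real_Asymp"
begin

text \<open>
  Put \<open>a\<^sub>i = 1 / p\<^sub>i\<close>, \<open>g\<^sub>i = f\<^sub>i powr p\<^sub>i\<close>, \<open>B = R R\<^sup>*\<close> and \<open>A\<^sub>i = U\<^sub>i R\<close>, and let \<open>\<xi>\<close> be a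
  standard Gaussian vector.
  For smooth positive \<open>g\<^sub>i\<close>, viewed as functions of \<open>x\<close> through \<open>A\<^sub>i\<close>, a step of size \<open>s\<close> of the
  heat flow gives
  \<open>E (\<Prod> g\<^sub>i (x + s \<xi>) powr a\<^sub>i) - (\<Prod> (E g\<^sub>i (x + s \<xi>)) powr a\<^sub>i)
     = s\<^sup>2 / 2 * (\<Prod> g\<^sub>i x powr a\<^sub>i) * (\<bar>\<Sum> v\<^sub>i\<bar>\<^sup>2 - \<Sum> p\<^sub>i * \<bar>v\<^sub>i\<bar>\<^sup>2) + O(s\<^sup>3)\<close>,
  where \<open>v\<^sub>i = a\<^sub>i \<nabla>g\<^sub>i / g\<^sub>i\<close> lies in the range of \<open>A\<^sub>i\<^sup>*\<close>. The matrix hypothesis says precisely that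
  this quadratic form is \<open>\<le> 0\<close> (resp. \<open>\<ge> 0\<close>) on such vectors. Iterating \<open>N\<close> steps of size
  \<open>t / sqrt N\<close> makes the accumulated error vanish and yields
  \<open>E (\<Prod> g\<^sub>i (t A\<^sub>i \<xi>) powr a\<^sub>i) \<le> (\<Prod> (E g\<^sub>i (t A\<^sub>i \<xi>)) powr a\<^sub>i)\<close> (resp. \<open>\<ge>\<close>), which passes to
  measurable \<open>g\<^sub>i\<close> by approximation. After multiplication by \<open>t\<^sup>n\<close>, the scaling condition
  \<open>\<Sum> n\<^sub>i / p\<^sub>i = n\<close> lets \<open>t \<longrightarrow> \<infinity>\<close> turn Gaussian expectations into Lebesgue integrals.
\<close>

unbundle no inner_syntax
unbundle no vec_syntax
hide_const (open) Determinants.det Finite_Cartesian_Product.vec Finite_Cartesian_Product.row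
  Finite_Cartesian_Product.rows Finite_Cartesian_Product.mat
  Finite_Cartesian_Product.transpose
hide_type (open) Finite_Cartesian_Product.vec

subsection \<open>Gaussian measures on sequence space\<close>

text \<open>A discrete flow is used so that regularity of a heat semigroup in time never has to be
  discussed: the analysis rests on one Taylor expansion whose error constant is uniform over a class
  of functions that Gaussian averaging preserves with the same constants. Since the exponents a_i
  may be negative, it can only be run for functions squeezed between two positive constants, and
  afterwards the squeeze has to be removed. From there on the two directions part ways. The upper
  hypothesis forces every a_i to be positive, so truncation moves the right-hand side in a
  controlled way and Fatou's lemma handles the left. In the lower direction the signs are mixed, and
  a second, one-sided truncation is needed that never increases a power. Gradients of g_i are kept
  in the row span of A_i throughout, because the quadratic form is known to have a sign on such
  vectors only. Linear substitutions are split into triangular factors, handled by Fubini one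
  coordinate at a time, and orthogonal ones, handled by rotation invariance.\<close>

text \<open>Points of \<open>\<real>\<^sup>n\<close> are sequences vanishing from index \<open>n\<close> on, so that all dimensions share
  one type and the Borel sets of the product topology on \<^typ>\<open>nat \<Rightarrow> real\<close>.\<close>

definition zext :: "nat \<Rightarrow> (nat \<Rightarrow> real) \<Rightarrow> nat \<Rightarrow> real" where
  "zext n x = (\<lambda>j. if j < n then x j else 0)"

definition zprod :: "real measure \<Rightarrow> nat \<Rightarrow> (nat \<Rightarrow> real) measure" where
  "zprod M n = distr (PiM {..<n} (\<lambda>_. M)) borel (zext n)"

abbreviation stdn :: "real measure" where
  "stdn \<equiv> density lborel (\<lambda>x. ennreal (std_normal_density x))"

definition gauss :: "nat \<Rightarrow> (nat \<Rightarrow> real) measure" where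
  "gauss n = zprod stdn n"

lemma borel_measurable_coordI:
  fixes f :: "'a \<Rightarrow> nat \<Rightarrow> real"
  assumes "\<And>i. (\<lambda>x. f x i) \<in> borel_measurable M"
  shows "f \<in> borel_measurable M"
  using assms by (rule measurable_coordinatewise_then_product)

lemma fun_upd_borel [measurable]:
  fixes f :: "'a \<Rightarrow> nat \<Rightarrow> real"
  assumes [measurable]: "f \<in> borel_measurable M" "g \<in> borel_measurable M"
  shows "(\<lambda>x. (f x)(n := g x)) \<in> borel_measurable M"
proof (rule borel_measurable_coordI)
  fix i
  have [measurable]: "(\<lambda>x. f x i) \<in> borel_measurable M"
    by (rule measurable_product_then_coordinatewise) measurable
  show "(\<lambda>x. ((f x)(n := g x)) i) \<in> borel_measurable M"
    by (cases "i = n") auto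
qed

lemma scale_borel [measurable]:
  fixes f :: "'a \<Rightarrow> nat \<Rightarrow> real"
  assumes "f \<in> borel_measurable M"
  shows "(\<lambda>x j. s * f x j) \<in> borel_measurable M"
  using measurable_product_then_coordinatewise[OF assms]
  by (intro borel_measurable_coordI borel_measurable_times) auto

lemma add_borel [measurable]:
  fixes f g :: "'a \<Rightarrow> nat \<Rightarrow> real"
  assumes "f \<in> borel_measurable M" "g \<in> borel_measurable M"
  shows "(\<lambda>x j. f x j + g x j) \<in> borel_measurable M"
  using assms[THEN measurable_product_then_coordinatewise]
  by (intro borel_measurable_coordI borel_measurable_add) auto

lemma diff_borel [measurable]:
  fixes f g :: "'a \<Rightarrow> nat \<Rightarrow> real"
  assumes "f \<in> borel_measurable M" "g \<in> borel_measurable M"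
  shows "(\<lambda>x j. f x j - g x j) \<in> borel_measurable M"
  using assms[THEN measurable_product_then_coordinatewise]
  by (intro borel_measurable_coordI borel_measurable_diff) auto

lemma sets_zprod [measurable_cong, simp]: "sets (zprod M n) = sets borel"
  and space_zprod [simp]: "space (zprod M n) = UNIV"
  by (auto simp: zprod_def)

lemma sets_gauss [measurable_cong, simp]: "sets (gauss n) = sets borel"
  and space_gauss [simp]: "space (gauss n) = UNIV"
  by (auto simp: gauss_def)

text \<open>One set of lemmas for the two factor measures that occur, Lebesgue measure and the
  standard normal law.\<close>

locale zp =
  fixes M :: "real measure"
  assumes sf: "sigma_finite_measure M" and setsM [measurable_cong, simp]: "sets M = sets borel"
begin

lemma spaceM [simp]: "space M = UNIV"
  using setsM sets_eq_imp_space_eq by fastforce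

sublocale PS: product_sigma_finite "\<lambda>_::nat. M"
  using sf by (auto simp: product_sigma_finite_def)

lemma zext_measurable [measurable]: "zext n \<in> borel_measurable (PiM {..<n} (\<lambda>_. M))"
proof (rule borel_measurable_coordI)
  fix i
  show "(\<lambda>x. zext n x i) \<in> borel_measurable (PiM {..<n} (\<lambda>_. M))"
  proof (cases "i < n")
    case True
    have "(\<lambda>x. x i) \<in> measurable (PiM {..<n} (\<lambda>_. M)) M"
      using True by (intro measurable_component_singleton) auto
    then have "(\<lambda>x. x i) \<in> borel_measurable (PiM {..<n} (\<lambda>_. M))"
      using measurable_cong_sets[OF refl setsM] by blast
    then show ?thesis using True by (simp add: zext_def)
  qed (simp add: zext_def)
qed

lemma nn_integral_zprod:
  assumes [measurable]: "F \<in> borel_measurable borel"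
  shows "(\<integral>\<^sup>+x. F x \<partial>zprod M n) = (\<integral>\<^sup>+x. F (zext n x) \<partial>PiM {..<n} (\<lambda>_. M))"
  unfolding zprod_def by (rule nn_integral_distr) auto

lemma sigma_finite_PiM: "sigma_finite_measure (PiM {..<n::nat} (\<lambda>_. M))"
  by (rule PS.sigma_finite) simp

lemma zprod_Fubini:
  assumes [measurable]: "case_prod F \<in> borel_measurable (borel \<Otimes>\<^sub>M borel)"
  shows "(\<integral>\<^sup>+x. \<integral>\<^sup>+y. F x y \<partial>zprod M k \<partial>zprod M n) = (\<integral>\<^sup>+y. \<integral>\<^sup>+x. F x y \<partial>zprod M n \<partial>zprod M k)"
    and "(\<lambda>x. \<integral>\<^sup>+y. F x y \<partial>zprod M k) \<in> borel_measurable borel"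
proof -
  interpret A: sigma_finite_measure "PiM {..<n} (\<lambda>_. M)" by (rule sigma_finite_PiM)
  interpret B: sigma_finite_measure "PiM {..<k} (\<lambda>_. M)" by (rule sigma_finite_PiM)
  interpret pair_sigma_finite "PiM {..<n} (\<lambda>_. M)" "PiM {..<k} (\<lambda>_. M)" ..
  have *: "(\<lambda>x. \<integral>\<^sup>+y. F x (zext k y) \<partial>PiM {..<k} (\<lambda>_. M)) \<in> borel_measurable borel"
    by measurable
  have **: "(\<lambda>y. \<integral>\<^sup>+x. F (zext n x) y \<partial>PiM {..<n} (\<lambda>_. M)) \<in> borel_measurable borel"
    by measurable
  show "(\<lambda>x. \<integral>\<^sup>+y. F x y \<partial>zprod M k) \<in> borel_measurable borel"
    using * by (subst nn_integral_zprod) auto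
  show "(\<integral>\<^sup>+x. \<integral>\<^sup>+y. F x y \<partial>zprod M k \<partial>zprod M n) = (\<integral>\<^sup>+y. \<integral>\<^sup>+x. F x y \<partial>zprod M n \<partial>zprod M k)"
    using * ** by (simp add: nn_integral_zprod) (rule Fubini'[symmetric], measurable)
qed

lemma nn_integral_zprod_0:
  assumes [measurable]: "F \<in> borel_measurable borel"
  shows "(\<integral>\<^sup>+x. F x \<partial>zprod M 0) = F (\<lambda>_. 0)"
  by (simp add: nn_integral_zprod zext_def PiM_empty nn_integral_count_space_finite)

text \<open>Peeling off the last coordinate is the induction step behind the integral identities in
  arbitrary dimension.\<close>

lemma nn_integral_zprod_Suc:
  assumes [measurable]: "F \<in> borel_measurable borel"
  shows "(\<integral>\<^sup>+x. F x \<partial>zprod M (Suc n)) = (\<integral>\<^sup>+y. \<integral>\<^sup>+x. F (x(n := y)) \<partial>zprod M n \<partial>M)"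
proof -
  have e: "{..<Suc n} = insert n {..<n}" by auto
  have z: "zext (Suc n) (x(n := y)) = (zext n x)(n := y)" for x y
    by (auto simp: zext_def fun_eq_iff)
  have "(\<integral>\<^sup>+x. F x \<partial>zprod M (Suc n)) = (\<integral>\<^sup>+x. F (zext (Suc n) x) \<partial>PiM (insert n {..<n}) (\<lambda>_. M))"
    using nn_integral_zprod[of F "Suc n"] by (simp add: e)
  also have "\<dots> = (\<integral>\<^sup>+y. \<integral>\<^sup>+x. F (zext (Suc n) (x(n := y))) \<partial>PiM {..<n} (\<lambda>_. M) \<partial>M)"
    using zext_measurable[of "Suc n"]
    by (intro PS.product_nn_integral_insert_rev) (auto simp: e)
  also have "\<dots> = (\<integral>\<^sup>+y. \<integral>\<^sup>+x. F (x(n := y)) \<partial>zprod M n \<partial>M)"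
    by (simp add: z nn_integral_zprod)
  finally show ?thesis .
qed

end

interpretation lb: zp lborel
  by (simp add: zp_def sigma_finite_lborel)

interpretation sn: prob_space stdn
  by (rule prob_space_normal_density) simp

interpretation gs: zp stdn
  by unfold_locales auto

lemma prob_space_gauss: "prob_space (gauss n)"
  unfolding gauss_def zprod_def
  by (intro prob_space.prob_space_distr prob_space_PiM gs.zext_measurable sn.prob_space_axioms)

interpretation G: prob_space "gauss n" for n
  by (rule prob_space_gauss)

lemma emeasure_gauss_UNIV [simp]: "emeasure (gauss n) UNIV = 1"
  using G.emeasure_space_1[of n] by simp

lemmas nn_integral_gauss_Suc = gs.nn_integral_zprod_Suc[folded gauss_def]
lemmas nn_integral_gauss_0 = gs.nn_integral_zprod_0[folded gauss_def]

lemma gauss_density: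
  assumes [measurable]: "F \<in> borel_measurable borel"
  shows "(\<integral>\<^sup>+x. F x \<partial>gauss n) =
    (\<integral>\<^sup>+x. F x * ennreal (\<Prod>j<n. std_normal_density (x j)) \<partial>zprod lborel n)"
  using assms
proof (induction n arbitrary: F)
  case 0
  then show ?case by (simp add: nn_integral_gauss_0 lb.nn_integral_zprod_0)
next
  case (Suc n)
  note [measurable] = Suc.prems
  define D where "D = (\<lambda>x::nat \<Rightarrow> real. ennreal (\<Prod>j<n. std_normal_density (x j)))"
  have [measurable]: "D \<in> borel_measurable borel"
    unfolding D_def by measurable
  have "(\<integral>\<^sup>+x. F x \<partial>gauss (Suc n)) = (\<integral>\<^sup>+y. \<integral>\<^sup>+x. F (x(n := y)) \<partial>gauss n \<partial>stdn)"
    by (rule nn_integral_gauss_Suc) measurable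
  also have "\<dots> = (\<integral>\<^sup>+y. \<integral>\<^sup>+x. F (x(n := y)) * D x \<partial>zprod lborel n \<partial>stdn)"
    by (subst Suc.IH) (auto simp: D_def)
  also have "\<dots> = (\<integral>\<^sup>+y. ennreal (std_normal_density y) * 
      (\<integral>\<^sup>+x. F (x(n := y)) * D x \<partial>zprod lborel n) \<partial>lborel)"
  proof (rule nn_integral_density)
    interpret sigma_finite_measure "PiM {..<n} (\<lambda>_. lborel::real measure)" by (rule lb.sigma_finite_PiM)
    show "(\<lambda>y. \<integral>\<^sup>+x. F (x(n := y)) * D x \<partial>zprod lborel n) \<in> borel_measurable lborel"
      by (subst lb.nn_integral_zprod) (measurable)
  qed auto
  also have "\<dots> = (\<integral>\<^sup>+y. \<integral>\<^sup>+x. F (x(n := y)) * ennreal (\<Prod>j<Suc n. std_normal_density ((x(n := y)) j)) \<partial>zprod lborel n \<partial>lborel)"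
    by (auto intro!: nn_integral_cong simp: nn_integral_cmult[symmetric] ennreal_mult' prod_nonneg mult_ac D_def)
  also have "\<dots> = (\<integral>\<^sup>+x. F x * ennreal (\<Prod>j<Suc n. std_normal_density (x j)) \<partial>zprod lborel (Suc n))"
    by (rule lb.nn_integral_zprod_Suc[symmetric]) measurable
  finally show ?case .
qed

section \<open>Scaling and convolution of standard Gaussians\<close>

lemma normal_density_scale:
  assumes "0 < s"
  shows "normal_density 0 s (s * x) = std_normal_density x / s"
  using assms by (simp add: normal_density_def power_mult_distrib real_sqrt_mult)

lemma nn_integral_stdn_scale:
  assumes [measurable]: "F \<in> borel_measurable borel" and s: "0 < s"
  shows "(\<integral>\<^sup>+x. F (s * x) \<partial>stdn) = (\<integral>\<^sup>+u. F u * ennreal (normal_density 0 s u) \<partial>lborel)"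
proof -
  have "(\<integral>\<^sup>+u. F u * ennreal (normal_density 0 s u) \<partial>lborel) = 
    ennreal s * (\<integral>\<^sup>+x. F (s * x) * ennreal (normal_density 0 s (s * x)) \<partial>lborel)"
    using nn_integral_real_affine[of "\<lambda>u. F u * ennreal (normal_density 0 s u)" s 0] s by simp
  also have "\<dots> = (\<integral>\<^sup>+x. F (s * x) * (ennreal s * ennreal (std_normal_density x / s)) \<partial>lborel)"
    using normal_density_scale[OF s] by (simp add: nn_integral_cmult[symmetric] mult.left_commute)
  also have "\<dots> = (\<integral>\<^sup>+x. ennreal (std_normal_density x) * F (s * x) \<partial>lborel)"
    using s by (intro nn_integral_cong) (simp add: ennreal_mult'[symmetric] mult_ac)
  also have "\<dots> = (\<integral>\<^sup>+x. F (s * x) \<partial>stdn)"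
    by (rule nn_integral_density[symmetric]) auto
  finally show ?thesis ..
qed

lemma stdn_conv:
  assumes [measurable]: "F \<in> borel_measurable borel" and s: "0 \<le> s" and t: "0 \<le> t"
  shows "(\<integral>\<^sup>+x. \<integral>\<^sup>+y. F (s * x + t * y) \<partial>stdn \<partial>stdn) = (\<integral>\<^sup>+z. F (sqrt (s\<^sup>2 + t\<^sup>2) * z) \<partial>stdn)"
proof -
  have e: "emeasure stdn UNIV = 1"
    using sn.emeasure_space_1 by simp
  \<comment> \<open>A normal density with standard deviation 0 is not a density, so a vanishing
    coefficient is treated apart; there one of the two integrations is over a constant.\<close>
  consider "s = 0" | "t = 0" | "s > 0" "t > 0" using s t by linarith
  then show ?thesis
  proof cases
    case 1
    then show ?thesis using t e by simp
  next
    case 2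
    then show ?thesis using s e by simp
  next
    case 3
    have "(\<integral>\<^sup>+x. \<integral>\<^sup>+y. F (s * x + t * y) \<partial>stdn \<partial>stdn) =
      (\<integral>\<^sup>+x. \<integral>\<^sup>+v. F (s * x + v) * ennreal (normal_density 0 t v) \<partial>lborel \<partial>stdn)"
      using 3 by (simp add: nn_integral_stdn_scale[of "\<lambda>v. F (s * _ + v)"])
    also have "\<dots> = (\<integral>\<^sup>+u. (\<integral>\<^sup>+v. F (u + v) * ennreal (normal_density 0 t v) \<partial>lborel) * ennreal (normal_density 0 s u) \<partial>lborel)"
      using 3 by (intro nn_integral_stdn_scale[where F="\<lambda>u. (\<integral>\<^sup>+v. F (u + v) * ennreal (normal_density 0 t v) \<partial>lborel)"]) auto
    also have "\<dots> = (\<integral>\<^sup>+u. (\<integral>\<^sup>+v. F (u + v) * ennreal (normal_density 0 t v) * ennreal (normal_density 0 s u) \<partial>lborel) \<partial>lborel)"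
      by (simp add: nn_integral_multc)
    also have "\<dots> = (\<integral>\<^sup>+v. (\<integral>\<^sup>+u. F (u + v) * ennreal (normal_density 0 t v) * ennreal (normal_density 0 s u) \<partial>lborel) \<partial>lborel)"
      by (rule lborel_pair.Fubini'[symmetric]) measurable
    also have "\<dots> = (\<integral>\<^sup>+v. (\<integral>\<^sup>+u. F u * ennreal (normal_density 0 t v) * ennreal (normal_density 0 s (u - v)) \<partial>lborel) \<partial>lborel)"
    proof (rule nn_integral_cong)
      fix v :: real
      show "(\<integral>\<^sup>+u. F (u + v) * ennreal (normal_density 0 t v) * ennreal (normal_density 0 s u) \<partial>lborel) =
        (\<integral>\<^sup>+u. F u * ennreal (normal_density 0 t v) * ennreal (normal_density 0 s (u - v)) \<partial>lborel)"
        using nn_integral_real_affine[of "\<lambda>u. F u * ennreal (normal_density 0 t v) * ennreal (normal_density 0 s (u - v))" 1 v]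
        by (simp add: add.commute)
    qed
    also have "\<dots> = (\<integral>\<^sup>+u. (\<integral>\<^sup>+v. F u * ennreal (normal_density 0 t v) * ennreal (normal_density 0 s (u - v)) \<partial>lborel) \<partial>lborel)"
      by (rule lborel_pair.Fubini') measurable
    also have "\<dots> = (\<integral>\<^sup>+u. F u * ennreal (normal_density 0 (sqrt (s\<^sup>2 + t\<^sup>2)) u) \<partial>lborel)"
    proof (rule nn_integral_cong)
      fix u :: real
      have "(\<integral>\<^sup>+v. F u * ennreal (normal_density 0 t v) * ennreal (normal_density 0 s (u - v)) \<partial>lborel) =
        (\<integral>\<^sup>+v. F u * ennreal (normal_density 0 s (u - v) * normal_density 0 t v) \<partial>lborel)"
        by (simp add: ennreal_mult' mult_ac)
      also have "\<dots> = F u * (\<integral>\<^sup>+v. ennreal (normal_density 0 s (u - v) * normal_density 0 t v) \<partial>lborel)"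
        by (rule nn_integral_cmult) measurable
      also have "\<dots> = F u * ennreal (normal_density 0 (sqrt (s\<^sup>2 + t\<^sup>2)) u)"
        using fun_cong[OF conv_normal_density_zero_mean[OF 3], of u] by simp
      finally show "(\<integral>\<^sup>+v. F u * ennreal (normal_density 0 t v) * ennreal (normal_density 0 s (u - v)) \<partial>lborel) =
         F u * ennreal (normal_density 0 (sqrt (s\<^sup>2 + t\<^sup>2)) u)" .
    qed
    also have "\<dots> = (\<integral>\<^sup>+z. F (sqrt (s\<^sup>2 + t\<^sup>2) * z) \<partial>stdn)"
      using 3 by (intro nn_integral_stdn_scale[symmetric]) (auto simp: sum_power2_gt_zero_iff)
    finally show ?thesis .
  qed
qed

lemma nn_integral_gauss_measurable [measurable]:
  assumes [measurable]: "case_prod F \<in> borel_measurable (M \<Otimes>\<^sub>M borel)"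
  shows "(\<lambda>x. \<integral>\<^sup>+y. F x y \<partial>gauss n) \<in> borel_measurable M"
  by measurable

lemma gauss_stdn_swap:
  assumes [measurable]: "case_prod F \<in> borel_measurable (borel \<Otimes>\<^sub>M borel)"
  shows "(\<integral>\<^sup>+x. \<integral>\<^sup>+y. F x y \<partial>stdn \<partial>gauss n) = (\<integral>\<^sup>+y. \<integral>\<^sup>+x. F x y \<partial>gauss n \<partial>stdn)"
proof -
  interpret pair_sigma_finite "gauss n" stdn ..
  show ?thesis by (rule Fubini'[symmetric]) measurable
qed

text \<open>The semigroup law of the flow: variances add, so N steps of size t / sqrt N compose to
  one step of size t. The induction peels the last coordinate off both variables and treats that
  pair by \<open>stdn_conv\<close>.\<close>

lemma gauss_conv:
  assumes "F \<in> borel_measurable borel" and s: "0 \<le> s" and t: "0 \<le> t"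
  shows "(\<integral>\<^sup>+x. \<integral>\<^sup>+y. F (\<lambda>j. s * x j + t * y j) \<partial>gauss n \<partial>gauss n) =
    (\<integral>\<^sup>+z. F (\<lambda>j. sqrt (s\<^sup>2 + t\<^sup>2) * z j) \<partial>gauss n)"
  using assms(1)
proof (induction n arbitrary: F)
  case 0
  note [measurable] = 0
  show ?case by (simp add: nn_integral_gauss_0)
next
  case (Suc n)
  note [measurable] = Suc.prems
  define r where "r = sqrt (s\<^sup>2 + t\<^sup>2)"
  define K where "K x = (\<integral>\<^sup>+b. \<integral>\<^sup>+y. F (\<lambda>j. s * x j + t * (y(n := b)) j) \<partial>gauss n \<partial>stdn)" for x
  have m: "(\<lambda>p. F (\<lambda>j. s * (fst (fst p)) j + t * ((snd p)(n := snd (fst p))) j)) \<in> borel_measurable ((borel \<Otimes>\<^sub>M borel) \<Otimes>\<^sub>M borel)"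
    by measurable
  have K [measurable]: "K \<in> borel_measurable borel"
    unfolding K_def using m by measurable
  have K': "(\<integral>\<^sup>+y. F (\<lambda>j. s * x j + t * y j) \<partial>gauss (Suc n)) = K x" for x
    unfolding K_def by (rule nn_integral_gauss_Suc) measurable
  have "(\<integral>\<^sup>+x. \<integral>\<^sup>+y. F (\<lambda>j. s * x j + t * y j) \<partial>gauss (Suc n) \<partial>gauss (Suc n)) =
    (\<integral>\<^sup>+a. \<integral>\<^sup>+x. K (x(n := a)) \<partial>gauss n \<partial>stdn)"
    unfolding K' by (rule nn_integral_gauss_Suc) measurable
  also have "\<dots> = (\<integral>\<^sup>+a. \<integral>\<^sup>+b. \<integral>\<^sup>+x. \<integral>\<^sup>+y. F (\<lambda>j. s * (x(n := a)) j + t * (y(n := b)) j) \<partial>gauss n \<partial>gauss n \<partial>stdn \<partial>stdn)"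
    unfolding K_def by (intro nn_integral_cong gauss_stdn_swap) measurable
  also have "\<dots> = (\<integral>\<^sup>+a. \<integral>\<^sup>+b. \<integral>\<^sup>+x. \<integral>\<^sup>+y. F ((\<lambda>j. s * x j + t * y j)(n := s * a + t * b)) \<partial>gauss n \<partial>gauss n \<partial>stdn \<partial>stdn)"
    by (intro nn_integral_cong arg_cong[where f=F]) auto
  also have "\<dots> = (\<integral>\<^sup>+a. \<integral>\<^sup>+b. \<integral>\<^sup>+z. F ((\<lambda>j. r * z j)(n := s * a + t * b)) \<partial>gauss n \<partial>stdn \<partial>stdn)"
    unfolding r_def
  proof (rule nn_integral_cong, rule nn_integral_cong)
    fix a b :: real
    show "(\<integral>\<^sup>+x. \<integral>\<^sup>+y. F ((\<lambda>j. s * x j + t * y j)(n := s * a + t * b)) \<partial>gauss n \<partial>gauss n) =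
      (\<integral>\<^sup>+z. F ((\<lambda>j. sqrt (s\<^sup>2 + t\<^sup>2) * z j)(n := s * a + t * b)) \<partial>gauss n)"
      by (rule Suc.IH[where F="\<lambda>x. F (x(n := s * a + t * b))"]) measurable
  qed
  also have "\<dots> = (\<integral>\<^sup>+c. \<integral>\<^sup>+z. F ((\<lambda>j. r * z j)(n := r * c)) \<partial>gauss n \<partial>stdn)"
    unfolding r_def by (rule stdn_conv[OF _ s t]) measurable
  also have "\<dots> = (\<integral>\<^sup>+c. \<integral>\<^sup>+z. F (\<lambda>j. r * (z(n := c)) j) \<partial>gauss n \<partial>stdn)"
    by (intro nn_integral_cong arg_cong[where f=F]) auto
  also have "\<dots> = (\<integral>\<^sup>+z. F (\<lambda>j. r * z j) \<partial>gauss (Suc n))"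
    by (rule nn_integral_gauss_Suc[symmetric]) measurable
  finally show ?case unfolding r_def .
qed


lemma gauss_conv_integral:
  fixes g :: "(nat \<Rightarrow> real) \<Rightarrow> real"
  assumes [measurable]: "g \<in> borel_measurable borel" and g: "\<And>x. 0 \<le> g x" "\<And>x. g x \<le> C"
    and s: "0 \<le> s" and t: "0 \<le> t"
  shows "(\<integral>x. (\<integral>y. g (\<lambda>j. s * x j + t * y j) \<partial>gauss n) \<partial>gauss n) =
    (\<integral>z. g (\<lambda>j. sqrt (s\<^sup>2 + t\<^sup>2) * z j) \<partial>gauss n)"
proof -
  have i: "integrable (gauss n) (\<lambda>x. g (h x))" if "h \<in> borel_measurable borel" for h
    using that g by (intro G.integrable_const_bound[where B=C]) (auto simp: abs_of_nonneg)
  have m: "(\<lambda>x. \<integral>y. g (\<lambda>j. s * x j + t * y j) \<partial>gauss n) \<in> borel_measurable borel"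
    by measurable
  have b: "(\<integral>y. g (\<lambda>j. s * x j + t * y j) \<partial>gauss n) \<le> C" "0 \<le> (\<integral>y. g (\<lambda>j. s * x j + t * y j) \<partial>gauss n)" for x
    using g by (auto intro!: G.integral_le_const i AE_I2)
  have i2: "integrable (gauss n) (\<lambda>x. \<integral>y. g (\<lambda>j. s * x j + t * y j) \<partial>gauss n)"
    using m b by (intro G.integrable_const_bound[where B=C]) (auto simp: abs_of_nonneg)
  have "ennreal (\<integral>x. (\<integral>y. g (\<lambda>j. s * x j + t * y j) \<partial>gauss n) \<partial>gauss n) =
    (\<integral>\<^sup>+x. ennreal (\<integral>y. g (\<lambda>j. s * x j + t * y j) \<partial>gauss n) \<partial>gauss n)"
    using i2 b by (intro nn_integral_eq_integral[symmetric]) auto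
  also have "\<dots> = (\<integral>\<^sup>+x. \<integral>\<^sup>+y. ennreal (g (\<lambda>j. s * x j + t * y j)) \<partial>gauss n \<partial>gauss n)"
    using i g by (intro nn_integral_cong nn_integral_eq_integral[symmetric]) auto
  also have "\<dots> = (\<integral>\<^sup>+z. ennreal (g (\<lambda>j. sqrt (s\<^sup>2 + t\<^sup>2) * z j)) \<partial>gauss n)"
    using s t by (intro gauss_conv[where F="\<lambda>x. ennreal (g x)"]) auto
  also have "\<dots> = ennreal (\<integral>z. g (\<lambda>j. sqrt (s\<^sup>2 + t\<^sup>2) * z j) \<partial>gauss n)"
    using i g by (intro nn_integral_eq_integral) auto
  finally show ?thesis
    using g b by (subst (asm) ennreal_inj) (auto intro!: Bochner_Integration.integral_nonneg)
qed

section \<open>Moments of the Gaussian measure\<close>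

lemma stdn_moment:
  shows "integrable stdn (\<lambda>x. x ^ k)" "integrable stdn (\<lambda>x. \<bar>x\<bar> ^ k)"
    and "(\<integral>x. x \<partial>stdn) = 0" "(\<integral>x. x\<^sup>2 \<partial>stdn) = 1"
proof -
  show "integrable stdn (\<lambda>x. x ^ k)"
    using integrable_std_normal_moment[of k] by (subst integrable_real_density) (auto simp: mult_ac)
  show "integrable stdn (\<lambda>x. \<bar>x\<bar> ^ k)"
    using integrable_std_normal_moment_abs[of k] by (subst integrable_real_density) (auto simp: mult_ac)
  show "(\<integral>x. x \<partial>stdn) = 0"
    using integral_std_normal_moment_odd[of 0] by (subst integral_real_density) (auto simp: mult_ac)
  show "(\<integral>x. x\<^sup>2 \<partial>stdn) = 1"
    using integral_std_normal_moment_even[of 1] by (subst integral_real_density) (auto simp: mult_ac)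
qed

lemma stdn_affine_square:
  "(\<integral>\<^sup>+y. ennreal ((a + w * y)\<^sup>2 + c) \<partial>stdn) = ennreal (a\<^sup>2 + w\<^sup>2 + c)" if "0 \<le> c"
proof -
  note [simp] = stdn_moment(1)[of 2] stdn_moment(1)[of 1, simplified]
  have e: "(a + w * y)\<^sup>2 + c = a\<^sup>2 + c + 2 * a * w * y + w\<^sup>2 * y\<^sup>2" for y
    by (simp add: power2_eq_square algebra_simps)
  have "(\<integral>\<^sup>+y. ennreal ((a + w * y)\<^sup>2 + c) \<partial>stdn) = ennreal (\<integral>y. (a + w * y)\<^sup>2 + c \<partial>stdn)"
  proof (rule nn_integral_eq_integral)
    show "integrable stdn (\<lambda>y. (a + w * y)\<^sup>2 + c)" unfolding e by simp
  qed (use that in auto)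
  also have "(\<integral>y. (a + w * y)\<^sup>2 + c \<partial>stdn) = a\<^sup>2 + w\<^sup>2 + c"
    unfolding e using sn.prob_space by (simp add: stdn_moment)
  finally show ?thesis .
qed

text \<open>The offset a makes the induction close: the term of the peeled coordinate is absorbed
  into it, and the one-dimensional formula then turns that term into its variance.\<close>

lemma gauss_affine_square:
  "(\<integral>\<^sup>+x. ennreal ((a + (\<Sum>j<n. w j * x j))\<^sup>2) \<partial>gauss n) = ennreal (a\<^sup>2 + (\<Sum>j<n. (w j)\<^sup>2))"
proof (induction n arbitrary: a)
  case 0
  then show ?case by (simp add: nn_integral_gauss_0)
next
  case (Suc n)
  have "(\<integral>\<^sup>+x. ennreal ((a + (\<Sum>j<Suc n. w j * x j))\<^sup>2) \<partial>gauss (Suc n)) =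
    (\<integral>\<^sup>+y. \<integral>\<^sup>+x. ennreal ((a + (\<Sum>j<Suc n. w j * (x(n := y)) j))\<^sup>2) \<partial>gauss n \<partial>stdn)"
    by (rule nn_integral_gauss_Suc) measurable
  also have "\<dots> = (\<integral>\<^sup>+y. \<integral>\<^sup>+x. ennreal (((a + w n * y) + (\<Sum>j<n. w j * x j))\<^sup>2) \<partial>gauss n \<partial>stdn)"
    by (intro nn_integral_cong) (simp add: add_ac)
  also have "\<dots> = (\<integral>\<^sup>+y. ennreal ((a + w n * y)\<^sup>2 + (\<Sum>j<n. (w j)\<^sup>2)) \<partial>stdn)"
    by (simp add: Suc.IH)
  also have "\<dots> = ennreal (a\<^sup>2 + (\<Sum>j<Suc n. (w j)\<^sup>2))"
    by (subst stdn_affine_square) (auto simp: sum_nonneg add_ac)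
  finally show ?case .
qed

lemma distr_gauss_coord:
  assumes "j < n"
  shows "distr (gauss n) borel (\<lambda>x. x j) = stdn"
proof -
  have "(\<integral>\<^sup>+x. h (x j) \<partial>gauss n) = (\<integral>\<^sup>+y. h y \<partial>stdn)" if [measurable]: "h \<in> borel_measurable borel" for h
    using assms
  proof (induction n)
    case (Suc n)
    have "(\<integral>\<^sup>+x. h (x j) \<partial>gauss (Suc n)) = (\<integral>\<^sup>+y. \<integral>\<^sup>+x. h ((x(n := y)) j) \<partial>gauss n \<partial>stdn)"
      by (rule nn_integral_gauss_Suc) measurable
    also have "\<dots> = (\<integral>\<^sup>+y. h y \<partial>stdn)"
    proof (cases "j = n")
      case True
      then show ?thesis by simp
    next
      case False
      then show ?thesis using Suc sn.emeasure_space_1 by simp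
    qed
    finally show ?case .
  qed simp
  note * = this
  show ?thesis
  proof (rule measure_eqI)
    fix A assume "A \<in> sets (distr (gauss n) borel (\<lambda>x. x j))"
    then have A [measurable]: "A \<in> sets borel" by simp
    have "emeasure (distr (gauss n) borel (\<lambda>x. x j)) A = (\<integral>\<^sup>+x. indicator A (x j) \<partial>gauss n)"
      by (subst nn_integral_indicator[symmetric], simp, subst nn_integral_distr) auto
    also have "\<dots> = emeasure stdn A"
      by (subst *) auto
    finally show "emeasure (distr (gauss n) borel (\<lambda>x. x j)) A = emeasure stdn A" .
  qed simp
qed

lemma gauss_coord:
  assumes "j < n"
  shows "integrable (gauss n) (\<lambda>x. x j ^ k)" "integrable (gauss n) (\<lambda>x. \<bar>x j\<bar> ^ k)" "(\<integral>x. x j \<partial>gauss n) = 0"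
proof -
  have 1: "integrable (distr (gauss n) borel (\<lambda>x. x j)) (\<lambda>x. x ^ k)"
    "integrable (distr (gauss n) borel (\<lambda>x. x j)) (\<lambda>x. \<bar>x\<bar> ^ k)"
    "(\<integral>x. x \<partial>distr (gauss n) borel (\<lambda>x. x j)) = 0"
    unfolding distr_gauss_coord[OF assms] by (simp_all add: stdn_moment)
  show "integrable (gauss n) (\<lambda>x. x j ^ k)" "integrable (gauss n) (\<lambda>x. \<bar>x j\<bar> ^ k)"
    using 1 by (auto simp: integrable_distr_eq)
  show "(\<integral>x. x j \<partial>gauss n) = 0"
    using 1(3) by (subst (asm) integral_distr) auto
qed

text \<open>The l1 norm of the first n coordinates: a linear form with coefficients bounded by M is
  bounded by M times it, with no further constant.\<close>

definition nrm :: "nat \<Rightarrow> (nat \<Rightarrow> real) \<Rightarrow> real" where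
  "nrm n x = (\<Sum>j<n. \<bar>x j\<bar>)"

lemma nrm_measurable [measurable]: "nrm n \<in> borel_measurable borel"
  unfolding nrm_def by measurable

lemma nrm_nonneg [simp]: "0 \<le> nrm n x"
  by (simp add: nrm_def sum_nonneg)

lemma gauss_nrm: "integrable (gauss n) (\<lambda>x. nrm n x ^ k)"
proof (rule Bochner_Integration.integrable_bound)
  show "integrable (gauss n) (\<lambda>x. real n ^ k * (\<Sum>j<n. \<bar>x j\<bar> ^ k) + 1)"
    using gauss_coord(2) by (intro Bochner_Integration.integrable_add integrable_mult_right Bochner_Integration.integrable_sum) auto
  \<comment> \<open>The largest coordinate bounds the sum. The summand 1 covers
    \<open>n = 0\<close>, \<open>k = 0\<close>, where the left side is 0 ^ 0 = 1 and the sum on the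
    right is empty.\<close>
  have "nrm n x ^ k \<le> real n ^ k * (\<Sum>j<n. \<bar>x j\<bar> ^ k) + 1" for x :: "nat \<Rightarrow> real"
  proof (cases "n = 0")
    case True
    then show ?thesis by (cases k) (auto simp: nrm_def)
  next
    case False
    define m where "m = Max ((\<lambda>j. \<bar>x j\<bar>) ` {..<n})"
    have fin: "finite ((\<lambda>j. \<bar>x j\<bar>) ` {..<n})" "(\<lambda>j. \<bar>x j\<bar>) ` {..<n} \<noteq> {}" using False by auto
    then have "m \<in> (\<lambda>j. \<bar>x j\<bar>) ` {..<n}" unfolding m_def by (rule Max_in)
    then obtain i where i: "i < n" "m = \<bar>x i\<bar>" by auto
    have "nrm n x \<le> (\<Sum>j<n. m)"
      unfolding nrm_def m_def using fin by (intro sum_mono Max_ge) auto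
    then have "nrm n x ^ k \<le> (real n * m) ^ k"
      by (intro power_mono) auto
    also have "\<dots> = real n ^ k * \<bar>x i\<bar> ^ k"
      using i by (simp add: power_mult_distrib)
    also have "\<dots> \<le> real n ^ k * (\<Sum>j<n. \<bar>x j\<bar> ^ k)"
      using i by (intro mult_left_mono member_le_sum) auto
    finally show ?thesis by simp
  qed
  then show "AE x in gauss n. norm (nrm n x ^ k) \<le> norm (real n ^ k * (\<Sum>j<n. \<bar>x j\<bar> ^ k) + 1)"
    by (intro AE_I2) (auto simp: abs_of_nonneg sum_nonneg)
qed measurable

lemma gauss_linear:
  shows "integrable (gauss n) (\<lambda>x. \<Sum>j<n. w j * x j)" "(\<integral>x. (\<Sum>j<n. w j * x j) \<partial>gauss n) = 0"
    and "integrable (gauss n) (\<lambda>x. (\<Sum>j<n. w j * x j)\<^sup>2)"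
    and "(\<integral>x. (\<Sum>j<n. w j * x j)\<^sup>2 \<partial>gauss n) = (\<Sum>j<n. (w j)\<^sup>2)"
proof -
  have *: "\<And>j. j < n \<Longrightarrow> integrable (gauss n) (\<lambda>x. x j)"
    using gauss_coord(1)[where k=1] by simp
  show "integrable (gauss n) (\<lambda>x. \<Sum>j<n. w j * x j)"
    using * by (intro Bochner_Integration.integrable_sum integrable_mult_right) auto
  show "(\<integral>x. (\<Sum>j<n. w j * x j) \<partial>gauss n) = 0"
    using * by (subst Bochner_Integration.integral_sum) (auto simp: gauss_coord intro!: integrable_mult_right)
  have s: "(\<integral>\<^sup>+x. ennreal ((\<Sum>j<n. w j * x j)\<^sup>2) \<partial>gauss n) = ennreal (\<Sum>j<n. (w j)\<^sup>2)"
    using gauss_affine_square[where a=0 and n=n and w=w] by simp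
  then show i: "integrable (gauss n) (\<lambda>x. (\<Sum>j<n. w j * x j)\<^sup>2)"
    by (intro integrableI_nonneg) auto
  show "(\<integral>x. (\<Sum>j<n. w j * x j)\<^sup>2 \<partial>gauss n) = (\<Sum>j<n. (w j)\<^sup>2)"
    using s by (intro integral_eq_nn_integral[THEN trans]) (auto simp: sum_nonneg)
qed

subsection \<open>Second-order expansion of one step of the flow\<close>

text \<open>The remainder has derivative t^2 / (1 + t), which is at most r^2 / \<kappa> between 0
  and r: there 1 + t is at least \<kappa>, at the end 0 because \<kappa> \<le> 1.\<close>

lemma ln_taylor2:
  fixes r \<kappa> :: real
  assumes "0 < \<kappa>" "\<kappa> \<le> 1" "\<kappa> \<le> 1 + r"
  shows "\<bar>ln (1 + r) - r + r\<^sup>2 / 2\<bar> \<le> \<bar>r\<bar> ^ 3 / \<kappa>"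
proof -
  define f where "f t = ln (1 + t) - t + t\<^sup>2 / 2" for t :: real
  have d: "(f has_field_derivative (t\<^sup>2 / (1 + t))) (at t within {min 0 r..max 0 r})" if "t \<in> {min 0 r..max 0 r}" for t :: real
  proof -
    have "0 < 1 + t" using that assms by auto
    then show ?thesis unfolding f_def
      by (auto intro!: derivative_eq_intros simp: field_simps power2_eq_square)
  qed
  have "\<bar>f r - f 0\<bar> \<le> (r\<^sup>2 / \<kappa>) * \<bar>r - 0\<bar>"
  proof -
    have b: "norm (t\<^sup>2 / (1 + t)) \<le> r\<^sup>2 / \<kappa>" if "t \<in> {min 0 r..max 0 r}" for t
    proof -
      have "\<kappa> \<le> 1 + t" "\<bar>t\<bar> \<le> \<bar>r\<bar>" using that assms by auto
      then show ?thesis using assms by (auto simp: abs_le_square_iff intro!: frac_le)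
    qed
    have "norm (f r - f 0) \<le> (r\<^sup>2 / \<kappa>) * norm (r - 0)"
      by (rule field_differentiable_bound[OF _ d b]) auto
    then show ?thesis by simp
  qed
  then show ?thesis by (simp add: f_def power2_eq_square power3_eq_cube field_simps abs_mult)
qed

lemma exp_taylor2: "\<bar>exp (L::real) - 1 - L - L\<^sup>2 / 2\<bar> \<le> exp \<bar>L\<bar> * \<bar>L\<bar> ^ 3"
proof -
  obtain t where t: "\<bar>t\<bar> \<le> \<bar>L\<bar>" "exp L = (\<Sum>m<3. L ^ m / fact m) + exp t / fact 3 * L ^ 3"
    using Maclaurin_exp_le[of L 3] by blast
  have "exp L - 1 - L - L\<^sup>2 / 2 = exp t / 6 * L ^ 3"
    unfolding t(2) by (simp add: eval_nat_numeral)
  moreover have "\<bar>exp t / 6 * L ^ 3\<bar> = exp t / 6 * \<bar>L\<bar> ^ 3" by (simp add: abs_mult power_abs)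
  moreover have "exp t / 6 * \<bar>L\<bar> ^ 3 \<le> exp \<bar>L\<bar> * \<bar>L\<bar> ^ 3"
  proof (intro mult_right_mono)
    have "exp t \<le> exp \<bar>L\<bar>" using t(1) by simp
    moreover have "exp t > 0" by simp
    ultimately show "exp t / 6 \<le> exp \<bar>L\<bar>" by linarith
  qed auto
  ultimately show ?thesis by simp
qed

text \<open>\<open>L\<close> stands for the logarithm of the product in
  \<open>prod_powr_taylor2\<close>, \<open>A\<close> and \<open>B\<close> for the sums in its first
  and second order parts. The a priori bound \<open>Sm\<close> trades surplus powers of
  \<open>S\<close> for constants, so that \<open>L\<close> is O(S), \<open>L - A\<close> is O(S^2)
  and every remainder is O(S^3); \<open>L1\<close> is the constant of the first estimate.\<close>

lemma taylor_combine:
  fixes A B e L S a T Sm :: real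
  assumes L: "L = A - B / 2 + e" and A: "\<bar>A\<bar> \<le> a * S" and B: "\<bar>B\<bar> \<le> a * S\<^sup>2" and e: "\<bar>e\<bar> \<le> a * T * S ^ 3"
    and S: "0 \<le> S" "S \<le> Sm" and a: "0 \<le> a" "0 \<le> T"
  defines "L1 \<equiv> a + a * Sm / 2 + a * T * Sm\<^sup>2"
  shows "\<bar>exp L - 1 - A - (A\<^sup>2 - B) / 2\<bar> \<le>
    (exp (L1 * Sm) * L1 ^ 3 + a * T + (a / 2 + a * T * Sm) * (L1 + a) / 2) * S ^ 3"
proof -
  have Sm: "0 \<le> Sm" using S by linarith
  have L1: "0 \<le> L1" using a Sm by (simp add: L1_def)
  have S2: "S\<^sup>2 \<le> Sm * S" "S ^ 3 \<le> Sm * S\<^sup>2" "S ^ 3 \<le> Sm\<^sup>2 * S"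
  proof -
    show "S\<^sup>2 \<le> Sm * S" using S by (simp add: power2_eq_square mult_right_mono)
    show "S ^ 3 \<le> Sm * S\<^sup>2" using S by (simp add: power3_eq_cube power2_eq_square mult_right_mono mult.assoc)
    have "S\<^sup>2 \<le> Sm\<^sup>2" using S by (intro power_mono) auto
    then show "S ^ 3 \<le> Sm\<^sup>2 * S" using S by (simp add: power3_eq_cube power2_eq_square mult_right_mono)
  qed
  have Lb: "\<bar>L\<bar> \<le> L1 * S"
  proof -
    have "\<bar>L\<bar> \<le> a * S + a * S\<^sup>2 / 2 + a * T * S ^ 3" using L A B e by (smt (verit) field_sum_of_halves)
    also have "\<dots> \<le> a * S + a * (Sm * S) / 2 + a * T * (Sm\<^sup>2 * S)"
      using S2 a by (intro add_mono divide_right_mono mult_left_mono) auto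
    finally show ?thesis by (simp add: L1_def algebra_simps)
  qed
  have LA: "\<bar>L - A\<bar> \<le> (a / 2 + a * T * Sm) * S\<^sup>2"
  proof -
    have "\<bar>L - A\<bar> \<le> a * S\<^sup>2 / 2 + a * T * S ^ 3" using L B e by (smt (verit) field_sum_of_halves)
    also have "\<dots> \<le> a * S\<^sup>2 / 2 + a * T * (Sm * S\<^sup>2)"
      using S2 a by (intro add_mono mult_left_mono) auto
    finally show ?thesis by (simp add: algebra_simps)
  qed
  have LA2: "\<bar>L + A\<bar> \<le> (L1 + a) * S" using Lb A by (simp add: algebra_simps)
  have "\<bar>L\<^sup>2 - A\<^sup>2\<bar> = \<bar>L - A\<bar> * \<bar>L + A\<bar>"
    by (simp add: abs_mult[symmetric] power2_eq_square algebra_simps)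
  also have "\<dots> \<le> ((a / 2 + a * T * Sm) * S\<^sup>2) * ((L1 + a) * S)"
    using LA LA2 by (intro mult_mono) auto
  finally have sq: "\<bar>L\<^sup>2 - A\<^sup>2\<bar> \<le> (a / 2 + a * T * Sm) * (L1 + a) * S ^ 3"
    by (simp add: power2_eq_square power3_eq_cube mult_ac)
  have "\<bar>L\<bar> \<le> L1 * Sm" using Lb L1 S by (meson mult_left_mono order_trans)
  then have "exp \<bar>L\<bar> * \<bar>L\<bar> ^ 3 \<le> exp (L1 * Sm) * (L1 * S) ^ 3"
    using Lb by (intro mult_mono power_mono) auto
  then have ex: "\<bar>exp L - 1 - L - L\<^sup>2 / 2\<bar> \<le> exp (L1 * Sm) * L1 ^ 3 * S ^ 3"
    using exp_taylor2[of L] by (simp add: power_mult_distrib mult_ac)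
  have "exp L - 1 - A - (A\<^sup>2 - B) / 2 = (exp L - 1 - L - L\<^sup>2 / 2) + e + (L\<^sup>2 - A\<^sup>2) / 2"
    unfolding L by (simp add: algebra_simps diff_divide_distrib)
  then have "\<bar>exp L - 1 - A - (A\<^sup>2 - B) / 2\<bar> \<le> \<bar>exp L - 1 - L - L\<^sup>2 / 2\<bar> + \<bar>e\<bar> + \<bar>L\<^sup>2 - A\<^sup>2\<bar> / 2"
    using abs_triangle_ineq[of "exp L - 1 - L - L\<^sup>2 / 2 + e" "(L\<^sup>2 - A\<^sup>2) / 2"]
      abs_triangle_ineq[of "exp L - 1 - L - L\<^sup>2 / 2" e] by (simp only: abs_divide abs_numeral)
  also have "\<dots> \<le> exp (L1 * Sm) * L1 ^ 3 * S ^ 3 + a * T * S ^ 3 + (a / 2 + a * T * Sm) * (L1 + a) * S ^ 3 / 2"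
    using ex e sq by (intro add_mono divide_right_mono) auto
  finally show ?thesis by (simp add: algebra_simps)
qed

text \<open>The product is the exponential of the sum of a_i ln (1 + r_i). The constant T depends on
  the range of the factors and on the exponents but not on r, which makes the later step estimate
  uniform.\<close>

lemma prod_powr_taylor2:
  fixes a :: "nat \<Rightarrow> real"
  assumes k: "0 < \<kappa>" "\<kappa> \<le> 1"
  shows "\<exists>T\<ge>0. \<forall>r. (\<forall>i<m. \<kappa> \<le> 1 + r i \<and> 1 + r i \<le> \<Lambda>) \<longrightarrow>
    \<bar>(\<Prod>i<m. (1 + r i) powr a i) - 1 - (\<Sum>i<m. a i * r i)
       - ((\<Sum>i<m. a i * r i)\<^sup>2 - (\<Sum>i<m. a i * (r i)\<^sup>2)) / 2\<bar> \<le> T * (\<Sum>i<m. \<bar>r i\<bar>) ^ 3"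
proof -
  define aa where "aa = (\<Sum>i<m. \<bar>a i\<bar>)"
  have aa: "0 \<le> aa" "\<And>i. i < m \<Longrightarrow> \<bar>a i\<bar> \<le> aa"
    unfolding aa_def by (auto intro!: sum_nonneg member_le_sum)
  \<comment> \<open>The increments exceed -1 because \<kappa> > 0, hence each is at most
    \<open>1 + \<bar>\<Lambda>\<bar>\<close> in modulus.\<close>
  define Sm where "Sm = real m * (1 + \<bar>\<Lambda>\<bar>)"
  define T1 where "T1 = 1 / \<kappa>"
  define L1 where "L1 = aa + aa * Sm / 2 + aa * T1 * Sm\<^sup>2"
  define T where "T = (exp (L1 * Sm) * L1 ^ 3 + aa * T1 + (aa / 2 + aa * T1 * Sm) * (L1 + aa) / 2)"
  have p: "0 \<le> T1" "0 \<le> Sm" using k by (auto simp: T1_def Sm_def)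
  then have "0 \<le> L1" using aa by (simp add: L1_def)
  then have "0 \<le> T" using p aa by (simp add: T_def)
  moreover have "\<bar>(\<Prod>i<m. (1 + r i) powr a i) - 1 - (\<Sum>i<m. a i * r i)
       - ((\<Sum>i<m. a i * r i)\<^sup>2 - (\<Sum>i<m. a i * (r i)\<^sup>2)) / 2\<bar> \<le> T * (\<Sum>i<m. \<bar>r i\<bar>) ^ 3"
    if r: "\<forall>i<m. \<kappa> \<le> 1 + r i \<and> 1 + r i \<le> \<Lambda>" for r
  proof -
    define S where "S = (\<Sum>i<m. \<bar>r i\<bar>)"
    have rS: "\<bar>r i\<bar> \<le> S" if "i < m" for i
      unfolding S_def using that by (intro member_le_sum) auto
    have S0: "0 \<le> S" unfolding S_def by (simp add: sum_nonneg)
    have SSm: "S \<le> Sm"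
    proof -
      have "S \<le> (\<Sum>i<m. 1 + \<bar>\<Lambda>\<bar>)" unfolding S_def
      proof (rule sum_mono)
        fix i assume "i \<in> {..<m}"
        then have "\<kappa> \<le> 1 + r i" "1 + r i \<le> \<Lambda>" using r by auto
        then show "\<bar>r i\<bar> \<le> 1 + \<bar>\<Lambda>\<bar>" using k by linarith
      qed
      then show ?thesis by (simp add: Sm_def)
    qed
    define L where "L = (\<Sum>i<m. a i * ln (1 + r i))"
    define e where "e = (\<Sum>i<m. a i * (ln (1 + r i) - r i + (r i)\<^sup>2 / 2))"
    have pos: "0 < 1 + r i" if "i < m" for i using r that k by (meson less_le_trans)
    have "(\<Prod>i<m. (1 + r i) powr a i) = (\<Prod>i<m. exp (a i * ln (1 + r i)))"
      using pos by (intro prod.cong) (fastforce simp: powr_def)+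
    also have "\<dots> = exp L" by (simp add: L_def exp_sum)
    finally have 1: "(\<Prod>i<m. (1 + r i) powr a i) = exp L" .
    have 2: "L = (\<Sum>i<m. a i * r i) - (\<Sum>i<m. a i * (r i)\<^sup>2) / 2 + e"
      unfolding L_def e_def by (simp add: sum_divide_distrib sum_subtractf[symmetric] sum.distrib[symmetric] algebra_simps)
    have 3: "\<bar>\<Sum>i<m. a i * r i\<bar> \<le> aa * S"
    proof -
      have "\<bar>\<Sum>i<m. a i * r i\<bar> \<le> (\<Sum>i<m. \<bar>a i\<bar> * \<bar>r i\<bar>)"
        using sum_abs[of "\<lambda>i. a i * r i" "{..<m}"] by (simp add: abs_mult)
      also have "\<dots> \<le> (\<Sum>i<m. \<bar>a i\<bar> * S)" using rS by (intro sum_mono mult_left_mono) auto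
      finally show ?thesis by (simp add: aa_def sum_distrib_right)
    qed
    have 4: "\<bar>\<Sum>i<m. a i * (r i)\<^sup>2\<bar> \<le> aa * S\<^sup>2"
    proof -
      have "\<bar>\<Sum>i<m. a i * (r i)\<^sup>2\<bar> \<le> (\<Sum>i<m. \<bar>a i\<bar> * \<bar>r i\<bar>\<^sup>2)"
        using sum_abs[of "\<lambda>i. a i * (r i)\<^sup>2" "{..<m}"] by (simp add: abs_mult)
      also have "\<dots> \<le> (\<Sum>i<m. \<bar>a i\<bar> * S\<^sup>2)" using rS by (intro sum_mono mult_left_mono power_mono) auto
      finally show ?thesis by (simp add: aa_def sum_distrib_right)
    qed
    have 5: "\<bar>e\<bar> \<le> aa * T1 * S ^ 3"
    proof -
      have "\<bar>e\<bar> \<le> (\<Sum>i<m. \<bar>a i\<bar> * \<bar>ln (1 + r i) - r i + (r i)\<^sup>2 / 2\<bar>)"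
        unfolding e_def using sum_abs[of "\<lambda>i. a i * (ln (1 + r i) - r i + (r i)\<^sup>2 / 2)" "{..<m}"] by (simp add: abs_mult)
      also have "\<dots> \<le> (\<Sum>i<m. \<bar>a i\<bar> * (T1 * S ^ 3))"
      proof (intro sum_mono mult_left_mono)
        fix i assume i: "i \<in> {..<m}"
        have "\<bar>ln (1 + r i) - r i + (r i)\<^sup>2 / 2\<bar> \<le> \<bar>r i\<bar> ^ 3 / \<kappa>"
          using r i k by (intro ln_taylor2) auto
        also have "\<dots> = T1 * \<bar>r i\<bar> ^ 3" by (simp add: T1_def)
        also have "\<dots> \<le> T1 * S ^ 3" using rS i p by (intro mult_left_mono power_mono) auto
        finally show "\<bar>ln (1 + r i) - r i + (r i)\<^sup>2 / 2\<bar> \<le> T1 * S ^ 3" .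
      qed auto
      finally show ?thesis by (simp add: aa_def sum_distrib_right mult.assoc)
    qed
    show ?thesis
      using taylor_combine[OF 2 3 4 5 S0 SSm aa(1) p(1)] unfolding 1 T_def L1_def S_def by simp
  qed
  ultimately show ?thesis by blast
qed

text \<open>Since \<open>0 powr b = 0\<close> for every b, a vanishing factor kills the product even
  for a negative exponent; the limit arguments below have to treat this case apart.\<close>

definition Phi :: "nat \<Rightarrow> (nat \<Rightarrow> real) \<Rightarrow> (nat \<Rightarrow> real) \<Rightarrow> real" where
  "Phi m a u = (\<Prod>i<m. u i powr a i)"

lemma Phi_measurable [measurable]:
  assumes "\<And>i. i < m \<Longrightarrow> (\<lambda>x. g i x) \<in> borel_measurable M"
  shows "(\<lambda>x. Phi m a (\<lambda>i. g i x)) \<in> borel_measurable M"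
  unfolding Phi_def using assms by (intro borel_measurable_prod) auto

lemma Phi_nonneg: "0 \<le> Phi m a u"
  by (simp add: Phi_def prod_nonneg)

text \<open>A power is monotone in one direction or the other, so it is largest at an end point; the
  sum over both end points avoids a case split on the sign of a in later bounds.\<close>

lemma powr_between:
  fixes c C u a :: real
  assumes "0 < c" "c \<le> u" "u \<le> C"
  shows "u powr a \<le> c powr a + C powr a"
proof (cases "0 \<le> a")
  case True
  then have "u powr a \<le> C powr a" using assms by (intro powr_mono2) auto
  then show ?thesis by (simp add: add_increasing)
next
  case False
  then have "u powr a \<le> c powr a" using assms by (intro powr_mono2') auto
  then show ?thesis by (simp add: add_increasing2)
qed

lemma Phi_bounded:
  assumes "0 < c" "\<And>i. i < m \<Longrightarrow> c \<le> u i \<and> u i \<le> C"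
  shows "Phi m a u \<le> (\<Prod>i<m. c powr a i + C powr a i)"
  unfolding Phi_def using assms powr_between by (intro prod_mono) auto

lemma gauss_integral_comb:
  fixes f g h :: "(nat \<Rightarrow> real) \<Rightarrow> real"
  assumes "integrable (gauss n) f" "integrable (gauss n) g" "integrable (gauss n) h"
  shows "integrable (gauss n) (\<lambda>y. f y - 1 - g y - h y / 2)"
    and "(\<integral>y. f y - 1 - g y - h y / 2 \<partial>gauss n) = (\<integral>y. f y \<partial>gauss n) - 1 - (\<integral>y. g y \<partial>gauss n) - (\<integral>y. h y \<partial>gauss n) / 2"
  using assms G.prob_space by simp_all

text \<open>The functions are recentred, so that 0 stands for the current point x.
  \<open>D i\<close> plays the role of the gradient there, and one constant \<open>M\<close> serves
  the Lipschitz bound, the second order bound and the gradient.\<close>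

definition step_hyp :: "nat \<Rightarrow> nat \<Rightarrow> real \<Rightarrow> real \<Rightarrow> real \<Rightarrow> (nat \<Rightarrow> (nat \<Rightarrow> real) \<Rightarrow> real) \<Rightarrow> (nat \<Rightarrow> nat \<Rightarrow> real) \<Rightarrow> bool" where
  "step_hyp n m c C M G D \<longleftrightarrow> (\<forall>i<m. G i \<in> borel_measurable borel \<and> (\<forall>y. c \<le> G i y \<and> G i y \<le> C) \<and>
      (\<forall>y. \<bar>G i y - G i (\<lambda>_. 0)\<bar> \<le> M * nrm n y) \<and>
      (\<forall>y. \<bar>G i y - G i (\<lambda>_. 0) - (\<Sum>j<n. D i j * y j)\<bar> \<le> M * (nrm n y)\<^sup>2) \<and>
      (\<forall>j<n. \<bar>D i j\<bar> \<le> M))"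

text \<open>With v_i = a_i D_i / G_i(0) and a_i = 1 / p_i the second factor is the quadratic form of
  the overview, |sum v_i|^2 minus the sum of p_i |v_i|^2, written without dividing by a_i.\<close>

definition step_main :: "nat \<Rightarrow> nat \<Rightarrow> (nat \<Rightarrow> real) \<Rightarrow> (nat \<Rightarrow> (nat \<Rightarrow> real) \<Rightarrow> real) \<Rightarrow> (nat \<Rightarrow> nat \<Rightarrow> real) \<Rightarrow> real" where
  "step_main n m a G D = Phi m a (\<lambda>i. G i (\<lambda>_. 0)) *
     ((\<Sum>j<n. (\<Sum>i<m. a i * (D i j / G i (\<lambda>_. 0)))\<^sup>2) - (\<Sum>i<m. a i * (\<Sum>j<n. (D i j / G i (\<lambda>_. 0))\<^sup>2)))"

text \<open>After division by the values at 0, both terms are expanded by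
  \<open>prod_powr_taylor2\<close>. The first order parts of the mean of the product and of the
  product of the means agree and cancel. The means of the increments are O(s^2), since a centred
  Gaussian kills linear terms, so the second product contributes nothing quadratic; what is left is
  the mean of the quadratic form. K is chosen before G, D and s, which makes the estimate uniform
  over the class.\<close>

lemma step_expansion:
  fixes a :: "nat \<Rightarrow> real"
  assumes c: "0 < c" "c \<le> C" and M: "0 \<le> M"
  shows "\<exists>K\<ge>0. \<forall>G D s. step_hyp n m c C M G D \<longrightarrow> 0 \<le> s \<longrightarrow> s \<le> 1 \<longrightarrow>
    \<bar>(\<integral>y. Phi m a (\<lambda>i. G i (\<lambda>j. s * y j)) \<partial>gauss n) - Phi m a (\<lambda>i. \<integral>y. G i (\<lambda>j. s * y j) \<partial>gauss n)
      - s\<^sup>2 / 2 * step_main n m a G D\<bar> \<le> K * s ^ 3"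
proof -
  \<comment> \<open>All quotients of values of G i by its value at 0 lie between c / C and C /
    c.\<close>
  define \<kappa> where "\<kappa> = c / C"
  define \<Lambda> where "\<Lambda> = C / c"
  have k: "0 < \<kappa>" "\<kappa> \<le> 1" using c by (auto simp: \<kappa>_def)
  define q where "q r = ((\<Sum>i<m. a i * r i)\<^sup>2 - (\<Sum>i<m. a i * (r i)\<^sup>2))" for r
  obtain T where T: "0 \<le> T" and Ttay: "\<And>r. (\<forall>i<m. \<kappa> \<le> 1 + r i \<and> 1 + r i \<le> \<Lambda>) \<Longrightarrow>
    \<bar>(\<Prod>i<m. (1 + r i) powr a i) - 1 - (\<Sum>i<m. a i * r i) - q r / 2\<bar> \<le> T * (\<Sum>i<m. \<bar>r i\<bar>) ^ 3"
    using prod_powr_taylor2[OF k, of m \<Lambda> a] unfolding q_def by blast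
  define aa where "aa = (\<Sum>i<m. \<bar>a i\<bar>)"
  have aa0: "0 \<le> aa" by (simp add: aa_def sum_nonneg)
  define M1 where "M1 = M / c"
  have M1: "0 \<le> M1" using M c by (simp add: M1_def)
  \<comment> \<open>The first part is the Taylor error of the product, the second the cost of
    replacing the increments by their linear parts inside the quadratic form.\<close>
  define K1 where "K1 = T * (real m * M1) ^ 3 + (aa * M1 * (aa * (2 * M1)) + aa * (M1 * (2 * M1))) / 2"
  define E2 where "E2 = (\<integral>y. nrm n y ^ 2 \<partial>gauss n)"
  define E3 where "E3 = (\<integral>y. nrm n y ^ 3 \<partial>gauss n)"
  have E: "0 \<le> E2" "0 \<le> E3" by (auto simp: E2_def E3_def)
  \<comment> \<open>The means of the increments are at most \<open>M1 * E2 * s\<^sup>2\<close>. The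
    quadratic form of the means is therefore of size s^4 and their Taylor error of size s^6, both at
    most s^3 times a constant for s \<le> 1.\<close>
  define K2 where "K2 = (aa * aa + aa) * (M1 * E2)\<^sup>2 / 2 + T * (real m * (M1 * E2)) ^ 3"
  have K1: "0 \<le> K1" unfolding K1_def using T M1 aa0 by simp
  have K2: "0 \<le> K2" unfolding K2_def using T M1 aa0 E by simp
  define PB where "PB = (\<Prod>i<m. c powr a i + C powr a i)"
  have PB: "0 \<le> PB" unfolding PB_def by (intro prod_nonneg) auto
  define K where "K = PB * (K1 * E3 + K2)"
  have "0 \<le> K" unfolding K_def using PB K1 K2 E by simp
  moreover have "\<bar>(\<integral>y. Phi m a (\<lambda>i. G i (\<lambda>j. s * y j)) \<partial>gauss n) - Phi m a (\<lambda>i. \<integral>y. G i (\<lambda>j. s * y j) \<partial>gauss n)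
      - s\<^sup>2 / 2 * Phi m a (\<lambda>i. G i (\<lambda>_. 0)) * 
       ((\<Sum>j<n. (\<Sum>i<m. a i * (D i j / G i (\<lambda>_. 0)))\<^sup>2) - (\<Sum>i<m. a i * (\<Sum>j<n. (D i j / G i (\<lambda>_. 0))\<^sup>2)))\<bar>
    \<le> K * s ^ 3"
    if Gm': "\<And>i. i < m \<Longrightarrow> G i \<in> borel_measurable borel"
      and Gb: "\<And>i y. i < m \<Longrightarrow> c \<le> G i y" "\<And>i y. i < m \<Longrightarrow> G i y \<le> C"
      and GL: "\<And>i y. i < m \<Longrightarrow> \<bar>G i y - G i (\<lambda>_. 0)\<bar> \<le> M * nrm n y"
      and GQ: "\<And>i y. i < m \<Longrightarrow> \<bar>G i y - G i (\<lambda>_. 0) - (\<Sum>j<n. D i j * y j)\<bar> \<le> M * (nrm n y)\<^sup>2"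
      and D: "\<And>i j. i < m \<Longrightarrow> j < n \<Longrightarrow> \<bar>D i j\<bar> \<le> M"
      and s: "0 \<le> s" "s \<le> 1" for G D s
  proof -
    \<comment> \<open>Below, \<open>r i\<close> is the relative increment of \<open>G i\<close> from
      the current point, and \<open>\<delta> i\<close> its linear part.\<close>
    define w where "w i = G i (\<lambda>_. 0)" for i
    define r where "r i y = G i y / w i - 1" for i y
    define \<delta> where "\<delta> i y = (\<Sum>j<n. D i j / w i * y j)" for i and y :: "nat \<Rightarrow> real"
    have w: "0 < w i" "c \<le> w i" "w i \<le> C" if "i < m" for i
      using Gb[OF that, of "\<lambda>_. 0"] c unfolding w_def by linarith+
    have wb: "x / w i \<le> x / c" if "i < m" "0 \<le> x" for x i
      using w[OF that(1)] that c by (intro divide_left_mono) auto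
    have rL: "\<bar>r i y\<bar> \<le> M1 * nrm n y" if "i < m" for i y
    proof -
      have "\<bar>r i y\<bar> = \<bar>G i y - w i\<bar> / w i"
      proof -
        have "r i y = (G i y - w i) / w i" using w(1)[OF that] by (simp add: r_def diff_divide_distrib)
        then show ?thesis using w(1)[OF that] by (simp only: abs_divide)
      qed
      also have "\<dots> \<le> (M * nrm n y) / w i"
        using GL[OF that, of y] w(1)[OF that] unfolding w_def by (intro divide_right_mono) auto
      also have "\<dots> \<le> (M * nrm n y) / c" using that M by (intro wb) auto
      finally show ?thesis by (simp add: M1_def)
    qed
    have rQ: "\<bar>r i y - \<delta> i y\<bar> \<le> M1 * (nrm n y)\<^sup>2" if "i < m" for i y
    proof -
      have "\<delta> i y = (\<Sum>j<n. D i j * y j) / w i" by (simp add: \<delta>_def sum_divide_distrib)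
      then have "r i y - \<delta> i y = (G i y - w i - (\<Sum>j<n. D i j * y j)) / w i"
        using w(1)[OF that] by (simp add: r_def diff_divide_distrib)
      then have "\<bar>r i y - \<delta> i y\<bar> = \<bar>G i y - w i - (\<Sum>j<n. D i j * y j)\<bar> / w i"
        using w(1)[OF that] by (simp add: abs_divide)
      also have "\<dots> \<le> (M * (nrm n y)\<^sup>2) / w i"
        using GQ[OF that, of y] w(1)[OF that] unfolding w_def by (intro divide_right_mono) auto
      also have "\<dots> \<le> (M * (nrm n y)\<^sup>2) / c" using that M by (intro wb) auto
      finally show ?thesis by (simp add: M1_def)
    qed
    have dL: "\<bar>\<delta> i y\<bar> \<le> M1 * nrm n y" if "i < m" for i y
    proof -
      have "\<bar>\<delta> i y\<bar> \<le> (\<Sum>j<n. \<bar>D i j / w i * y j\<bar>)" unfolding \<delta>_def by (rule sum_abs)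
      also have "\<dots> \<le> (\<Sum>j<n. M1 * \<bar>y j\<bar>)"
      proof (intro sum_mono)
        fix j assume j: "j \<in> {..<n}"
        have "\<bar>D i j\<bar> / w i \<le> \<bar>D i j\<bar> / c" using that by (intro wb) auto
        also have "\<dots> \<le> M1" unfolding M1_def using D[OF that, of j] j c by (intro divide_right_mono) auto
        finally show "\<bar>D i j / w i * y j\<bar> \<le> M1 * \<bar>y j\<bar>"
          using w(1)[OF that] mult_right_mono[of "\<bar>D i j\<bar> / w i" M1 "\<bar>y j\<bar>"] by (simp add: abs_mult abs_divide)
      qed
      finally show ?thesis by (simp add: nrm_def sum_distrib_left)
    qed
    have r1: "1 + r i y = G i y / w i" for i y by (simp add: r_def)
    have box: "\<kappa> \<le> z / w i \<and> z / w i \<le> \<Lambda>" if "i < m" "c \<le> z" "z \<le> C" for i z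
      unfolding \<kappa>_def \<Lambda>_def using w[OF that(1)] that c by (auto intro!: frac_le)
    \<comment> \<open>Differences of squares: the factor r - \<delta> is of second order and the
      factor r + \<delta> of first order.\<close>
    have qd: "\<bar>q (\<lambda>i. r i y) - q (\<lambda>i. \<delta> i y)\<bar> \<le> (aa * M1 * (aa * (2 * M1)) + aa * (M1 * (2 * M1))) * (nrm n y) ^ 3" for y
    proof -
      let ?S = "nrm n y"
      have sb: "\<bar>\<Sum>i<m. a i * z i\<bar> \<le> aa * b" if "\<And>i. i < m \<Longrightarrow> \<bar>z i\<bar> \<le> b" for z b
      proof -
        have "\<bar>\<Sum>i<m. a i * z i\<bar> \<le> (\<Sum>i<m. \<bar>a i\<bar> * \<bar>z i\<bar>)"
          using sum_abs[of "\<lambda>i. a i * z i" "{..<m}"] by (simp add: abs_mult)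
        also have "\<dots> \<le> (\<Sum>i<m. \<bar>a i\<bar> * b)" using that by (intro sum_mono mult_left_mono) auto
        finally show ?thesis by (simp add: aa_def sum_distrib_right)
      qed
      have rd: "\<bar>r i y + \<delta> i y\<bar> \<le> 2 * M1 * ?S" if "i < m" for i
        using rL[OF that, of y] dL[OF that, of y] by linarith
      have "\<bar>(\<Sum>i<m. a i * (r i y - \<delta> i y)) * (\<Sum>i<m. a i * (r i y + \<delta> i y))\<bar> \<le> (aa * (M1 * ?S\<^sup>2)) * (aa * (2 * M1 * ?S))"
        unfolding abs_mult using rQ rd M1 aa0 by (intro mult_mono sb) auto
      moreover have "\<bar>\<Sum>i<m. a i * ((r i y - \<delta> i y) * (r i y + \<delta> i y))\<bar> \<le> aa * ((M1 * ?S\<^sup>2) * (2 * M1 * ?S))"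
        using rQ rd M1 by (intro sb) (auto simp: abs_mult intro!: mult_mono)
      moreover have "q (\<lambda>i. r i y) - q (\<lambda>i. \<delta> i y) = 
        (\<Sum>i<m. a i * (r i y - \<delta> i y)) * (\<Sum>i<m. a i * (r i y + \<delta> i y)) - (\<Sum>i<m. a i * ((r i y - \<delta> i y) * (r i y + \<delta> i y)))"
      proof -
        have f1: "(\<Sum>i<m. a i * ((r i y - \<delta> i y) * (r i y + \<delta> i y))) = (\<Sum>i<m. a i * (r i y)\<^sup>2) - (\<Sum>i<m. a i * (\<delta> i y)\<^sup>2)"
          by (simp add: sum_subtractf[symmetric] power2_eq_square algebra_simps)
        have f2: "(\<Sum>i<m. a i * (r i y - \<delta> i y)) = (\<Sum>i<m. a i * r i y) - (\<Sum>i<m. a i * \<delta> i y)"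
          "(\<Sum>i<m. a i * (r i y + \<delta> i y)) = (\<Sum>i<m. a i * r i y) + (\<Sum>i<m. a i * \<delta> i y)"
          by (simp_all add: sum_subtractf sum.distrib algebra_simps)
        show ?thesis unfolding q_def f1 f2 by (simp add: power2_eq_square algebra_simps)
      qed
      ultimately have "\<bar>q (\<lambda>i. r i y) - q (\<lambda>i. \<delta> i y)\<bar> \<le> (aa * (M1 * ?S\<^sup>2)) * (aa * (2 * M1 * ?S)) + aa * ((M1 * ?S\<^sup>2) * (2 * M1 * ?S))"
        by linarith
      then show ?thesis by (simp add: power2_eq_square power3_eq_cube algebra_simps)
    qed
    define \<Psi> where "\<Psi> y = (\<Prod>i<m. (1 + r i y) powr a i)" for y
    have pw: "\<bar>\<Psi> y - 1 - (\<Sum>i<m. a i * r i y) - q (\<lambda>i. \<delta> i y) / 2\<bar> \<le> K1 * nrm n y ^ 3" for y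
    proof -
      have "\<bar>\<Psi> y - 1 - (\<Sum>i<m. a i * r i y) - q (\<lambda>i. r i y) / 2\<bar> \<le> T * (\<Sum>i<m. \<bar>r i y\<bar>) ^ 3"
        unfolding \<Psi>_def by (rule Ttay) (use box Gb in \<open>auto simp: r1\<close>)
      also have "\<dots> \<le> T * (real m * (M1 * nrm n y)) ^ 3"
      proof (intro mult_left_mono power_mono)
        have "(\<Sum>i<m. \<bar>r i y\<bar>) \<le> (\<Sum>i<m. M1 * nrm n y)" using rL by (intro sum_mono) auto
        then show "(\<Sum>i<m. \<bar>r i y\<bar>) \<le> real m * (M1 * nrm n y)" by simp
      qed (use T in \<open>auto simp: sum_nonneg\<close>)
      finally have "\<bar>\<Psi> y - 1 - (\<Sum>i<m. a i * r i y) - q (\<lambda>i. r i y) / 2\<bar> \<le> T * (real m * M1) ^ 3 * nrm n y ^ 3"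
        by (simp add: power_mult_distrib mult_ac)
      moreover have "\<bar>x - v / 2\<bar> \<le> t + z / 2" if "\<bar>x - u / 2\<bar> \<le> t" "\<bar>u - v\<bar> \<le> z" for x u v t z :: real
        using that by linarith
      ultimately have "\<bar>\<Psi> y - 1 - (\<Sum>i<m. a i * r i y) - q (\<lambda>i. \<delta> i y) / 2\<bar> \<le> T * (real m * M1) ^ 3 * nrm n y ^ 3 +
        (aa * M1 * (aa * (2 * M1)) + aa * (M1 * (2 * M1))) * (nrm n y) ^ 3 / 2"
        using qd[of y] by blast
      then show ?thesis by (simp only: K1_def distrib_right times_divide_eq_left)
    qed
    define Y where "Y y = (\<lambda>j. s * y j)" for y :: "nat \<Rightarrow> real"
    have Ym [measurable]: "Y \<in> borel_measurable borel" unfolding Y_def by measurable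
    have nY: "nrm n (Y y) = s * nrm n y" for y
      using s by (simp add: nrm_def Y_def abs_mult sum_distrib_left)
    have rm: "r i \<in> borel_measurable borel" if "i < m" for i
      unfolding r_def using Gm'[OF that] by measurable
    have rbd: "\<bar>r i y\<bar> \<le> \<bar>\<Lambda>\<bar> + 1" if "i < m" for i y
      using box[OF that Gb[OF that], of y] k by (simp add: r_def abs_le_iff)
    have ri: "integrable (gauss n) (\<lambda>y. r i (Y y))" if "i < m" for i
      using rm[OF that] rbd[OF that] by (intro G.integrable_const_bound[where B="\<bar>\<Lambda>\<bar> + 1"]) auto
    define \<rho> where "\<rho> i = (\<integral>y. r i (Y y) \<partial>gauss n)" for i
    have Gi: "integrable (gauss n) (\<lambda>y. G i (Y y))" if "i < m" for i
    proof (rule G.integrable_const_bound)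
      have "\<bar>G i (Y y)\<bar> \<le> C" for y using Gb[OF that, of "Y y"] c by linarith
      then show "AE y in gauss n. norm (G i (Y y)) \<le> C" by simp
    qed (use Gm'[OF that] in measurable)
    have \<rho>1: "1 + \<rho> i = (\<integral>y. G i (Y y) \<partial>gauss n) / w i" if "i < m" for i
      unfolding \<rho>_def r_def using Gi[OF that] G.prob_space by simp
    have EGb: "c \<le> (\<integral>y. G i (Y y) \<partial>gauss n)" "(\<integral>y. G i (Y y) \<partial>gauss n) \<le> C" if "i < m" for i
      using Gi[OF that] Gb[OF that] by (auto intro!: G.integral_ge_const G.integral_le_const)
    have dY: "\<delta> i (Y y) = s * \<delta> i y" for i y
      by (simp add: \<delta>_def Y_def sum_distrib_left mult_ac)
    have di: "integrable (gauss n) (\<lambda>y. \<delta> i (Y y))" and d0: "(\<integral>y. \<delta> i (Y y) \<partial>gauss n) = 0" for i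
      unfolding dY unfolding \<delta>_def using gauss_linear(1,2)[where n=n and w="\<lambda>j. D i j / w i"] by simp_all
    \<comment> \<open>The linear part has mean zero, so it may be subtracted for free, and only the
      second order remainder is left.\<close>
    have \<rho>b: "\<bar>\<rho> i\<bar> \<le> M1 * E2 * s\<^sup>2" if "i < m" for i
    proof -
      have "\<rho> i = (\<integral>y. r i (Y y) - \<delta> i (Y y) \<partial>gauss n)"
        using ri[OF that] di d0 by (simp add: \<rho>_def)
      also have "\<bar>\<dots>\<bar> \<le> (\<integral>y. \<bar>r i (Y y) - \<delta> i (Y y)\<bar> \<partial>gauss n)"
        by (rule integral_abs_bound)
      also have "\<dots> \<le> (\<integral>y. M1 * s\<^sup>2 * nrm n y ^ 2 \<partial>gauss n)"
      proof (rule integral_mono)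
        show "integrable (gauss n) (\<lambda>y. \<bar>r i (Y y) - \<delta> i (Y y)\<bar>)" using ri[OF that] di by auto
        show "integrable (gauss n) (\<lambda>y. M1 * s\<^sup>2 * nrm n y ^ 2)" by (intro integrable_mult_right gauss_nrm)
        show "\<bar>r i (Y y) - \<delta> i (Y y)\<bar> \<le> M1 * s\<^sup>2 * nrm n y ^ 2" for y
          using rQ[OF that, of "Y y"] unfolding nY power_mult_distrib mult.assoc .
      qed
      also have "\<dots> = M1 * E2 * s\<^sup>2" by (simp add: E2_def)
      finally show ?thesis .
    qed
    define Q where "Q = (\<Sum>j<n. (\<Sum>i<m. a i * (D i j / w i))\<^sup>2) - (\<Sum>i<m. a i * (\<Sum>j<n. (D i j / w i)\<^sup>2))"
    have lin: "(\<Sum>i<m. a i * \<delta> i y) = (\<Sum>j<n. (\<Sum>i<m. a i * (D i j / w i)) * y j)" for y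
      unfolding \<delta>_def sum_distrib_left sum_distrib_right by (subst sum.swap) (simp add: mult_ac)
    have qi: "integrable (gauss n) (\<lambda>y. q (\<lambda>i. \<delta> i (Y y)))" and qI: "(\<integral>y. q (\<lambda>i. \<delta> i (Y y)) \<partial>gauss n) = s\<^sup>2 * Q"
    proof -
      have e: "q (\<lambda>i. \<delta> i (Y y)) = s\<^sup>2 * ((\<Sum>j<n. (\<Sum>i<m. a i * (D i j / w i)) * y j)\<^sup>2 - (\<Sum>i<m. a i * (\<Sum>j<n. D i j / w i * y j)\<^sup>2))" for y
      proof -
        have f1: "(\<Sum>i<m. a i * (s * \<delta> i y)) = s * (\<Sum>i<m. a i * \<delta> i y)" by (simp add: sum_distrib_left mult_ac)
        have f2: "(\<Sum>i<m. a i * (s * \<delta> i y)\<^sup>2) = s\<^sup>2 * (\<Sum>i<m. a i * (\<delta> i y)\<^sup>2)"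
          by (simp add: sum_distrib_left power_mult_distrib mult_ac)
        show ?thesis unfolding q_def dY f1 f2 lin
          by (simp only: \<delta>_def power_mult_distrib right_diff_distrib)
      qed
      have i1: "integrable (gauss n) (\<lambda>y. (\<Sum>j<n. (\<Sum>i<m. a i * (D i j / w i)) * y j)\<^sup>2)" by (rule gauss_linear(3))
      have i2: "integrable (gauss n) (\<lambda>y. \<Sum>i<m. a i * (\<Sum>j<n. D i j / w i * y j)\<^sup>2)"
        by (intro Bochner_Integration.integrable_sum integrable_mult_right gauss_linear(3))
      have i3: "(\<integral>y. (\<Sum>i<m. a i * (\<Sum>j<n. D i j / w i * y j)\<^sup>2) \<partial>gauss n) = (\<Sum>i<m. a i * (\<Sum>j<n. (D i j / w i)\<^sup>2))"
      proof -
        have "(\<integral>y. (\<Sum>i<m. a i * (\<Sum>j<n. D i j / w i * y j)\<^sup>2) \<partial>gauss n) = (\<Sum>i<m. \<integral>y. a i * (\<Sum>j<n. D i j / w i * y j)\<^sup>2 \<partial>gauss n)"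
          by (intro Bochner_Integration.integral_sum integrable_mult_right gauss_linear(3))
        then show ?thesis by (simp only: integral_mult_right_zero gauss_linear(4))
      qed
      have i4: "(\<integral>y. (\<Sum>j<n. (\<Sum>i<m. a i * (D i j / w i)) * y j)\<^sup>2 \<partial>gauss n) = (\<Sum>j<n. (\<Sum>i<m. a i * (D i j / w i))\<^sup>2)"
        by (rule gauss_linear(4))
      show "integrable (gauss n) (\<lambda>y. q (\<lambda>i. \<delta> i (Y y)))"
        unfolding e by (intro integrable_mult_right Bochner_Integration.integrable_diff i1 i2)
      have "(\<integral>y. q (\<lambda>i. \<delta> i (Y y)) \<partial>gauss n) = s\<^sup>2 * ((\<integral>y. (\<Sum>j<n. (\<Sum>i<m. a i * (D i j / w i)) * y j)\<^sup>2 \<partial>gauss n) -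
          (\<integral>y. (\<Sum>i<m. a i * (\<Sum>j<n. D i j / w i * y j)\<^sup>2) \<partial>gauss n))"
        unfolding e integral_mult_right_zero Bochner_Integration.integral_diff[OF i1 i2] ..
      then show "(\<integral>y. q (\<lambda>i. \<delta> i (Y y)) \<partial>gauss n) = s\<^sup>2 * Q"
        unfolding i3 i4 Q_def .
    qed
    have \<Psi>e: "\<Psi> y = Phi m a (\<lambda>i. G i y / w i)" for y by (simp add: \<Psi>_def Phi_def r1)
    have \<Psi>i: "integrable (gauss n) (\<lambda>y. \<Psi> (Y y))"
    proof (rule G.integrable_const_bound)
      show "AE y in gauss n. norm (\<Psi> (Y y)) \<le> (\<Prod>i<m. \<kappa> powr a i + \<Lambda> powr a i)"
        unfolding \<Psi>e using box Gb k by (intro AE_I2) (auto simp: Phi_nonneg intro!: Phi_bounded)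
      show "(\<lambda>y. \<Psi> (Y y)) \<in> borel_measurable (gauss n)"
        unfolding \<Psi>_def using rm by (intro borel_measurable_prod) auto
    qed
    have A: "\<bar>(\<integral>y. \<Psi> (Y y) \<partial>gauss n) - 1 - (\<Sum>i<m. a i * \<rho> i) - s\<^sup>2 * Q / 2\<bar> \<le> K1 * E3 * s ^ 3"
    proof -
      have si: "integrable (gauss n) (\<lambda>y. \<Sum>i<m. a i * r i (Y y))"
        using ri by (intro Bochner_Integration.integrable_sum integrable_mult_right) auto
      have sI: "(\<integral>y. (\<Sum>i<m. a i * r i (Y y)) \<partial>gauss n) = (\<Sum>i<m. a i * \<rho> i)"
        using ri by (subst Bochner_Integration.integral_sum) (auto intro!: integrable_mult_right simp: \<rho>_def)
      have ti: "integrable (gauss n) (\<lambda>y. \<Psi> (Y y) - 1 - (\<Sum>i<m. a i * r i (Y y)) - q (\<lambda>i. \<delta> i (Y y)) / 2)"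
        by (rule gauss_integral_comb(1)[OF \<Psi>i si qi])
      have ae: "(\<integral>y. \<Psi> (Y y) \<partial>gauss n) - 1 - (\<Sum>i<m. a i * \<rho> i) - s\<^sup>2 * Q / 2 =
        (\<integral>y. \<Psi> (Y y) - 1 - (\<Sum>i<m. a i * r i (Y y)) - q (\<lambda>i. \<delta> i (Y y)) / 2 \<partial>gauss n)"
        unfolding gauss_integral_comb(2)[OF \<Psi>i si qi] sI qI ..
      have "\<bar>(\<integral>y. \<Psi> (Y y) \<partial>gauss n) - 1 - (\<Sum>i<m. a i * \<rho> i) - s\<^sup>2 * Q / 2\<bar> \<le> (\<integral>y. \<bar>\<Psi> (Y y) - 1 - (\<Sum>i<m. a i * r i (Y y)) - q (\<lambda>i. \<delta> i (Y y)) / 2\<bar> \<partial>gauss n)"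
        unfolding ae by (rule integral_abs_bound)
      also have "\<dots> \<le> (\<integral>y. K1 * s ^ 3 * nrm n y ^ 3 \<partial>gauss n)"
      proof (rule integral_mono)
        show "integrable (gauss n) (\<lambda>y. K1 * s ^ 3 * nrm n y ^ 3)" by (intro integrable_mult_right gauss_nrm)
        show "\<bar>\<Psi> (Y y) - 1 - (\<Sum>i<m. a i * r i (Y y)) - q (\<lambda>i. \<delta> i (Y y)) / 2\<bar> \<le> K1 * s ^ 3 * nrm n y ^ 3" for y
          using pw[of "Y y"] unfolding nY power_mult_distrib mult.assoc .
      qed (rule integrable_abs[OF ti])
      also have "\<dots> = K1 * E3 * s ^ 3" by (simp add: E3_def)
      finally show ?thesis .
    qed
    \<comment> \<open>No quadratic term appears here: the means are already of order s^2, so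
      \<open>q \<rho>\<close> belongs to the error.\<close>
    have B: "\<bar>(\<Prod>i<m. (1 + \<rho> i) powr a i) - 1 - (\<Sum>i<m. a i * \<rho> i)\<bar> \<le> K2 * s ^ 3"
    proof -
      let ?t = "M1 * E2 * s\<^sup>2"
      have t0: "0 \<le> ?t" using M1 E by simp
      have "\<bar>(\<Prod>i<m. (1 + \<rho> i) powr a i) - 1 - (\<Sum>i<m. a i * \<rho> i) - q \<rho> / 2\<bar> \<le> T * (\<Sum>i<m. \<bar>\<rho> i\<bar>) ^ 3"
        by (rule Ttay) (use box EGb in \<open>auto simp: \<rho>1\<close>)
      also have "\<dots> \<le> T * (real m * ?t) ^ 3"
      proof (intro mult_left_mono power_mono)
        have "(\<Sum>i<m. \<bar>\<rho> i\<bar>) \<le> (\<Sum>i<m. ?t)" using \<rho>b by (intro sum_mono) auto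
        then show "(\<Sum>i<m. \<bar>\<rho> i\<bar>) \<le> real m * ?t" by simp
      qed (use T in \<open>auto simp: sum_nonneg\<close>)
      also have "\<dots> = T * (real m * (M1 * E2)) ^ 3 * s ^ 6"
        by (simp add: power_mult_distrib power_mult[symmetric])
      also have "\<dots> \<le> T * (real m * (M1 * E2)) ^ 3 * s ^ 3"
        using T M1 E s by (intro mult_left_mono power_decreasing) auto
      finally have 1: "\<bar>(\<Prod>i<m. (1 + \<rho> i) powr a i) - 1 - (\<Sum>i<m. a i * \<rho> i) - q \<rho> / 2\<bar> \<le> T * (real m * (M1 * E2)) ^ 3 * s ^ 3" .
      have "\<bar>q \<rho>\<bar> \<le> (aa * ?t)\<^sup>2 + aa * ?t\<^sup>2"
      proof -
        have "\<bar>\<Sum>i<m. a i * \<rho> i\<bar> \<le> (\<Sum>i<m. \<bar>a i\<bar> * ?t)"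
          using \<rho>b by (intro order_trans[OF sum_abs] sum_mono) (auto simp: abs_mult intro!: mult_left_mono)
        then have "\<bar>\<Sum>i<m. a i * \<rho> i\<bar> \<le> aa * ?t" by (simp add: aa_def sum_distrib_right)
        then have "(\<Sum>i<m. a i * \<rho> i)\<^sup>2 \<le> (aa * ?t)\<^sup>2"
          by (metis abs_ge_zero power2_abs power_mono)
        moreover have "\<bar>\<Sum>i<m. a i * (\<rho> i)\<^sup>2\<bar> \<le> (\<Sum>i<m. \<bar>a i\<bar> * ?t\<^sup>2)"
        proof (intro order_trans[OF sum_abs] sum_mono)
          fix i assume i: "i \<in> {..<m}"
          have "(\<rho> i)\<^sup>2 \<le> ?t\<^sup>2" using \<rho>b[of i] i by (metis abs_ge_zero lessThan_iff power2_abs power_mono)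
          then show "\<bar>a i * (\<rho> i)\<^sup>2\<bar> \<le> \<bar>a i\<bar> * ?t\<^sup>2" by (simp add: abs_mult mult_left_mono)
        qed
        then have "\<bar>\<Sum>i<m. a i * (\<rho> i)\<^sup>2\<bar> \<le> aa * ?t\<^sup>2" by (simp add: aa_def sum_distrib_right)
        ultimately show ?thesis unfolding q_def by (smt (verit) zero_le_power2)
      qed
      also have "\<dots> = (aa * aa + aa) * (M1 * E2)\<^sup>2 * s ^ 4"
        by (simp add: power2_eq_square algebra_simps eval_nat_numeral)
      also have "\<dots> \<le> (aa * aa + aa) * (M1 * E2)\<^sup>2 * s ^ 3"
        using aa0 s by (intro mult_left_mono power_decreasing) auto
      finally have 2: "\<bar>q \<rho>\<bar> \<le> (aa * aa + aa) * (M1 * E2)\<^sup>2 * s ^ 3" .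
      have "\<bar>x\<bar> \<le> z / 2 + t" if "\<bar>x - u / 2\<bar> \<le> t" "\<bar>u\<bar> \<le> z" for x u t z :: real
        using that by linarith
      from this[OF 1 2] show ?thesis unfolding K2_def distrib_right times_divide_eq_left .
    qed
    have q0: "u powr b = w i powr b * (u / w i) powr b" if "i < m" "c \<le> u" for i u b
    proof -
      have "0 < u" using that c by linarith
      then show ?thesis using w(1)[OF that(1)] by (simp add: powr_divide)
    qed
    have PhiG: "Phi m a (\<lambda>i. G i (Y y)) = Phi m a w * \<Psi> (Y y)" for y
      unfolding \<Psi>e Phi_def prod.distrib[symmetric] using Gb by (intro prod.cong refl q0) auto
    have PhiE: "Phi m a (\<lambda>i. \<integral>y. G i (Y y) \<partial>gauss n) = Phi m a w * (\<Prod>i<m. (1 + \<rho> i) powr a i)"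
    proof -
      have "Phi m a (\<lambda>i. \<integral>y. G i (Y y) \<partial>gauss n) = (\<Prod>i<m. w i powr a i * ((\<integral>y. G i (Y y) \<partial>gauss n) / w i) powr a i)"
        unfolding Phi_def using EGb by (intro prod.cong refl q0) auto
      also have "\<dots> = (\<Prod>i<m. w i powr a i * (1 + \<rho> i) powr a i)"
        by (intro prod.cong) (auto simp: \<rho>1)
      finally show ?thesis by (simp add: Phi_def prod.distrib)
    qed
    have Pw: "0 \<le> Phi m a w" "Phi m a w \<le> PB"
      unfolding PB_def using w c by (auto simp: Phi_nonneg intro!: Phi_bounded)
    let ?a = "(\<integral>y. \<Psi> (Y y) \<partial>gauss n) - 1 - (\<Sum>i<m. a i * \<rho> i) - s\<^sup>2 * Q / 2"
    let ?b = "(\<Prod>i<m. (1 + \<rho> i) powr a i) - 1 - (\<Sum>i<m. a i * \<rho> i)"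
    \<comment> \<open>The letter u stands for the common first order sum, which drops out of the
      difference.\<close>
    have "Phi m a w * x - Phi m a w * z - s\<^sup>2 / 2 * Phi m a w * Q = Phi m a w * ((x - 1 - u - s\<^sup>2 * Q / 2) - (z - 1 - u))" for x z u
      by (simp add: algebra_simps)
    then have eq: "(\<integral>y. Phi m a (\<lambda>i. G i (Y y)) \<partial>gauss n) - Phi m a (\<lambda>i. \<integral>y. G i (Y y) \<partial>gauss n) - s\<^sup>2 / 2 * Phi m a w * Q
      = Phi m a w * (?a - ?b)"
      unfolding PhiG PhiE integral_mult_right_zero by blast
    have dab: "\<bar>?a - ?b\<bar> \<le> K1 * E3 * s ^ 3 + K2 * s ^ 3" 
      by (rule order_trans[OF abs_triangle_ineq4 add_mono[OF A B]])
    have pab: "\<bar>Phi m a w\<bar> \<le> PB" using Pw by simp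
    have "\<bar>Phi m a w * (?a - ?b)\<bar> \<le> PB * (K1 * E3 * s ^ 3 + K2 * s ^ 3)"
      unfolding abs_mult by (rule mult_mono[OF pab dab PB abs_ge_zero])
    also have "\<dots> = K * s ^ 3" by (simp add: K_def algebra_simps)
    finally show ?thesis unfolding eq[symmetric] unfolding Y_def w_def Q_def .
  qed
  ultimately show ?thesis
    unfolding step_hyp_def step_main_def mult.assoc[symmetric]
    by (intro exI[of _ K] conjI allI impI) (assumption, blast)
qed

subsection \<open>Monotonicity along the discrete heat flow\<close>

text \<open>The parameter s is a standard deviation, not a time: steps of sizes s and t compose to
  \<open>sqrt (s\<^sup>2 + t\<^sup>2)\<close>.\<close>

definition heat :: "nat \<Rightarrow> real \<Rightarrow> ((nat \<Rightarrow> real) \<Rightarrow> real) \<Rightarrow> (nat \<Rightarrow> real) \<Rightarrow> real" where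
  "heat n s g x = (\<integral>y. g (\<lambda>j. x j + s * y j) \<partial>gauss n)"

lemma heat_measurable [measurable]:
  assumes [measurable]: "g \<in> borel_measurable borel"
  shows "heat n s g \<in> borel_measurable borel"
  unfolding heat_def by measurable

lemma bounded_integrable_gauss:
  fixes g :: "(nat \<Rightarrow> real) \<Rightarrow> real"
  assumes "g \<in> borel_measurable borel" and "\<And>x. \<bar>g x\<bar> \<le> C" and "h \<in> borel_measurable borel"
  shows "integrable (gauss n) (\<lambda>x. g (h x))"
  using assms by (intro G.integrable_const_bound[where B=C]) auto

lemma heat_shift_measurable [measurable]:
  fixes x :: "nat \<Rightarrow> real"
  shows "(\<lambda>y. \<lambda>j. x j + s * y j) \<in> borel_measurable borel"
  by measurable

lemma heat_bounds:
  assumes "g \<in> borel_measurable borel" and "\<And>x. c \<le> g x \<and> g x \<le> C"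
  shows "c \<le> heat n s g x \<and> heat n s g x \<le> C"
proof -
  have "\<bar>g x\<bar> \<le> \<bar>c\<bar> + \<bar>C\<bar>" for x using assms(2)[of x] by linarith
  from bounded_integrable_gauss[OF assms(1) this heat_shift_measurable]
  show ?thesis unfolding heat_def using assms(2)
    by (auto intro!: G.integral_ge_const G.integral_le_const)
qed

lemma heat_0: "heat n 0 g x = g x"
  using G.prob_space by (simp add: heat_def)

lemma heat_heat:
  assumes [measurable]: "g \<in> borel_measurable borel" and g: "\<And>x. 0 \<le> g x" "\<And>x. g x \<le> C"
    and s: "0 \<le> s" and t: "0 \<le> t"
  shows "heat n s (heat n t g) x = heat n (sqrt (s\<^sup>2 + t\<^sup>2)) g x"
proof -
  have "(\<integral>y. (\<integral>z. g (\<lambda>j. x j + (s * y j + t * z j)) \<partial>gauss n) \<partial>gauss n) =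
    (\<integral>z. g (\<lambda>j. x j + sqrt (s\<^sup>2 + t\<^sup>2) * z j) \<partial>gauss n)"
    by (rule gauss_conv_integral[where g="\<lambda>z. g (\<lambda>j. x j + z j)" and C=C]) (use g s t in auto)
  then show ?thesis by (simp add: heat_def add.assoc)
qed

text \<open>The class on which the flow is run. The gradient has to be a combination of the rows of
  A, since the hypothesis on the quadratic form says nothing about other directions; its
  coefficients d are measurable so that they can be averaged along with g. Smoothness is expressed
  by difference bounds at all x and y instead of derivatives, because such bounds survive averaging
  over translates.\<close>

definition nice :: "nat \<Rightarrow> nat \<Rightarrow> (nat \<Rightarrow> nat \<Rightarrow> real) \<Rightarrow> real \<Rightarrow> ((nat \<Rightarrow> real) \<Rightarrow> real) \<Rightarrow> bool" where
  "nice n k A M g \<longleftrightarrow> g \<in> borel_measurable borel \<and>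
    (\<forall>x y. \<bar>g (\<lambda>j. x j + y j) - g x\<bar> \<le> M * nrm n y) \<and>
    (\<exists>d. (\<forall>r<k. d r \<in> borel_measurable borel \<and> (\<forall>x. \<bar>d r x\<bar> \<le> M)) \<and>
      (\<forall>x y. \<bar>g (\<lambda>j. x j + y j) - g x - (\<Sum>r<k. d r x * (\<Sum>j<n. A r j * y j))\<bar> \<le> M * (nrm n y)\<^sup>2))"

text \<open>Averaging over translates preserves each bound, and the averaged coefficients serve as
  the new ones. That M does not grow is essential: the error constant of a step depends on
  it.\<close>

lemma nice_heat:
  assumes nice: "nice n k A M g" and b: "\<And>x. \<bar>g x\<bar> \<le> C"
  shows "nice n k A M (heat n s g)"
proof -
  have gm [measurable]: "g \<in> borel_measurable borel" using nice by (simp add: nice_def)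
  obtain d where dm: "\<And>r. r < k \<Longrightarrow> d r \<in> borel_measurable borel" and db: "\<And>r x. r < k \<Longrightarrow> \<bar>d r x\<bar> \<le> M"
    and dq: "\<And>x y. \<bar>g (\<lambda>j. x j + y j) - g x - (\<Sum>r<k. d r x * (\<Sum>j<n. A r j * y j))\<bar> \<le> M * (nrm n y)\<^sup>2"
    using nice unfolding nice_def by blast
  have gl: "\<And>x y. \<bar>g (\<lambda>j. x j + y j) - g x\<bar> \<le> M * nrm n y"
    using nice unfolding nice_def by blast
  have gi: "integrable (gauss n) (\<lambda>z. g (\<lambda>j. x j + s * z j))" for x
    by (rule bounded_integrable_gauss[OF gm b]) measurable
  have di: "integrable (gauss n) (\<lambda>z. d r (\<lambda>j. x j + s * z j))" if "r < k" for r x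
    by (rule bounded_integrable_gauss[OF dm db]) (use that in measurable)
  \<comment> \<open>Shifting the base point commutes with averaging, so increments of the average
    are averages of increments.\<close>
  have sh: "(\<lambda>j. (x j + y j) + s * z j) = (\<lambda>j. (x j + s * z j) + y j)" for x y z :: "nat \<Rightarrow> real"
    by (auto simp: add_ac)
  have gi2: "integrable (gauss n) (\<lambda>z. g (\<lambda>j. (x j + s * z j) + y j))" for x y
    using gi[of "\<lambda>j. x j + y j"] unfolding sh .
  have ab: "\<bar>\<integral>z. h z \<partial>gauss n\<bar> \<le> B" if "integrable (gauss n) h" "\<And>z. \<bar>h z\<bar> \<le> B" for h :: "(nat \<Rightarrow> real) \<Rightarrow> real" and B
  proof -
    have "\<bar>\<integral>z. h z \<partial>gauss n\<bar> \<le> (\<integral>z. \<bar>h z\<bar> \<partial>gauss n)" by (rule integral_abs_bound)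
    also have "\<dots> \<le> B" using that by (intro G.integral_le_const) auto
    finally show ?thesis .
  qed
  have "\<bar>heat n s g (\<lambda>j. x j + y j) - heat n s g x\<bar> \<le> M * nrm n y" for x y
  proof -
    have "heat n s g (\<lambda>j. x j + y j) - heat n s g x = 
      (\<integral>z. g (\<lambda>j. (x j + s * z j) + y j) - g (\<lambda>j. x j + s * z j) \<partial>gauss n)"
      unfolding heat_def sh using gi gi2 by simp
    also have "\<bar>\<dots>\<bar> \<le> M * nrm n y"
      by (rule ab) (use gi gi2 gl in auto)
    finally show ?thesis .
  qed
  moreover have "\<bar>heat n s g (\<lambda>j. x j + y j) - heat n s g x - (\<Sum>r<k. heat n s (d r) x * (\<Sum>j<n. A r j * y j))\<bar> \<le> M * (nrm n y)\<^sup>2" for x y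
  proof -
    have si: "integrable (gauss n) (\<lambda>z. \<Sum>r<k. d r (\<lambda>j. x j + s * z j) * (\<Sum>j<n. A r j * y j))"
      using di by (intro Bochner_Integration.integrable_sum integrable_mult_left) auto
    have "(\<integral>z. (\<Sum>r<k. d r (\<lambda>j. x j + s * z j) * (\<Sum>j<n. A r j * y j)) \<partial>gauss n) = (\<Sum>r<k. heat n s (d r) x * (\<Sum>j<n. A r j * y j))"
      using di unfolding heat_def by (subst Bochner_Integration.integral_sum) (auto intro!: integrable_mult_left)
    then have "heat n s g (\<lambda>j. x j + y j) - heat n s g x - (\<Sum>r<k. heat n s (d r) x * (\<Sum>j<n. A r j * y j)) = 
      (\<integral>z. g (\<lambda>j. (x j + s * z j) + y j) - g (\<lambda>j. x j + s * z j) - (\<Sum>r<k. d r (\<lambda>j. x j + s * z j) * (\<Sum>j<n. A r j * y j)) \<partial>gauss n)"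
      unfolding heat_def[of n s g] sh using gi gi2 si by simp
    also have "\<bar>\<dots>\<bar> \<le> M * (nrm n y)\<^sup>2"
      by (rule ab) (use gi gi2 si dq in auto)
    finally show ?thesis .
  qed
  moreover have "\<bar>heat n s (d r) x\<bar> \<le> M" if "r < k" for r x
    unfolding heat_def by (rule ab) (use di db that in auto)
  ultimately show ?thesis
    unfolding nice_def using dm by (intro conjI allI exI[of _ "\<lambda>r. heat n s (d r)"]) auto
qed

text \<open>Block i contributes the combination of the rows of A_i with coefficients e_i, the
  general form of the logarithmic gradient of g_i. In matrix terms the value is |sum a_i A_i^T
  e_i|^2 minus the sum of a_i |A_i^T e_i|^2.\<close>

definition QF :: "nat \<Rightarrow> nat \<Rightarrow> (nat \<Rightarrow> nat) \<Rightarrow> (nat \<Rightarrow> nat \<Rightarrow> nat \<Rightarrow> real) \<Rightarrow> (nat \<Rightarrow> real) \<Rightarrow> (nat \<Rightarrow> nat \<Rightarrow> real) \<Rightarrow> real" where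
  "QF n m k A a e = (\<Sum>j<n. (\<Sum>i<m. a i * (\<Sum>r<k i. e i r * A i r j))\<^sup>2) -
     (\<Sum>i<m. a i * (\<Sum>j<n. (\<Sum>r<k i. e i r * A i r j)\<^sup>2))"

text \<open>The sign \<sigma>, which is 1 or -1, selects the direction of the inequality, so that
  one argument serves both. The second order term has the favourable sign by hypothesis, and only
  the cubic error survives.\<close>

lemma heat_step:
  assumes c: "0 < c" "c \<le> C" and M: "0 \<le> M" and \<sigma>: "\<bar>\<sigma>\<bar> = (1::real)"
    and Q: "\<And>e. \<sigma> * QF n m k A a e \<le> 0"
  shows "\<exists>K\<ge>0. \<forall>g s x. (\<forall>i<m. nice n (k i) (A i) M (g i) \<and> (\<forall>y. c \<le> g i y \<and> g i y \<le> C)) \<longrightarrow> 0 \<le> s \<longrightarrow> s \<le> 1 \<longrightarrow>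
    \<sigma> * (heat n s (\<lambda>x. Phi m a (\<lambda>i. g i x)) x - Phi m a (\<lambda>i. heat n s (g i) x)) \<le> K * s ^ 3"
proof -
  \<comment> \<open>Large enough to bound the gradient entries as well: they are combinations of
    entries of A with coefficients at most M.\<close>
  define M' where "M' = M * (1 + (\<Sum>i<m. \<Sum>r<k i. \<Sum>j<n. \<bar>A i r j\<bar>))"
  have MM: "M \<le> M'" unfolding M'_def using M mult_left_mono[of 1 "1 + (\<Sum>i<m. \<Sum>r<k i. \<Sum>j<n. \<bar>A i r j\<bar>)" M]
    by (simp add: sum_nonneg)
  then have "0 \<le> M'" using M by linarith
  from step_expansion[OF c this, where m=m and n=n and a=a]
  obtain K where K: "0 \<le> K" and st: "\<And>G D s. step_hyp n m c C M' G D \<Longrightarrow> 0 \<le> s \<Longrightarrow> s \<le> 1 \<Longrightarrow>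
    \<bar>(\<integral>y. Phi m a (\<lambda>i. G i (\<lambda>j. s * y j)) \<partial>gauss n) - Phi m a (\<lambda>i. \<integral>y. G i (\<lambda>j. s * y j) \<partial>gauss n)
      - s\<^sup>2 / 2 * step_main n m a G D\<bar> \<le> K * s ^ 3" by blast
  have "\<sigma> * (heat n s (\<lambda>x. Phi m a (\<lambda>i. g i x)) x - Phi m a (\<lambda>i. heat n s (g i) x)) \<le> K * s ^ 3"
    if g: "\<And>i. i < m \<Longrightarrow> nice n (k i) (A i) M (g i)" and gb: "\<And>i y. i < m \<Longrightarrow> c \<le> g i y \<and> g i y \<le> C"
      and s: "0 \<le> s" "s \<le> 1" for g s x
  proof -
    let ?P = "\<lambda>i d. (\<forall>r<k i. d r \<in> borel_measurable borel \<and> (\<forall>x. \<bar>d r x\<bar> \<le> M)) \<and>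
      (\<forall>x y. \<bar>g i (\<lambda>j. x j + y j) - g i x - (\<Sum>r<k i. d r x * (\<Sum>j<n. A i r j * y j))\<bar> \<le> M * (nrm n y)\<^sup>2)"
    have "\<exists>d. i < m \<longrightarrow> ?P i d" for i
      using g[of i] unfolding nice_def by blast
    then have "\<exists>d. \<forall>i. i < m \<longrightarrow> ?P i (d i)" by (intro choice allI)
    then obtain d where d: "\<forall>i. i < m \<longrightarrow> ?P i (d i)" by (rule exE)
    have db: "\<bar>d i r x\<bar> \<le> M" if "i < m" "r < k i" for i r x using d that by blast
    have dq: "\<bar>g i (\<lambda>j. x j + y j) - g i x - (\<Sum>r<k i. d i r x * (\<Sum>j<n. A i r j * y j))\<bar> \<le> M * (nrm n y)\<^sup>2" if "i < m" for i x y
      using d that by blast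
    have gl: "\<bar>g i (\<lambda>j. x j + y j) - g i x\<bar> \<le> M * nrm n y" if "i < m" for i y
      using g[OF that] unfolding nice_def by blast
    define G where "G i y = g i (\<lambda>j. x j + y j)" for i y
    define D where "D i j = (\<Sum>r<k i. d i r x * A i r j)" for i j
    have G0: "G i (\<lambda>_. 0) = g i x" for i by (simp add: G_def)
    have lin: "(\<Sum>r<k i. d i r x * (\<Sum>j<n. A i r j * y j)) = (\<Sum>j<n. D i j * y j)" for i y
      unfolding D_def sum_distrib_left sum_distrib_right by (subst sum.swap) (simp add: mult_ac)
    have mono: "M * z \<le> M' * z" if "0 \<le> z" for z using MM that by (rule mult_right_mono)
    have DM: "\<bar>D i j\<bar> \<le> M'" if i: "i < m" and j: "j < n" for i j
    proof -
      have "\<bar>D i j\<bar> \<le> (\<Sum>r<k i. \<bar>d i r x * A i r j\<bar>)" unfolding D_def by (rule sum_abs)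
      also have "\<dots> \<le> (\<Sum>r<k i. M * \<bar>A i r j\<bar>)"
        unfolding abs_mult using db i by (intro sum_mono mult_right_mono) auto
      also have "\<dots> = M * (\<Sum>r<k i. \<bar>A i r j\<bar>)" by (simp add: sum_distrib_left)
      finally have 1: "\<bar>D i j\<bar> \<le> M * (\<Sum>r<k i. \<bar>A i r j\<bar>)" .
      have "(\<Sum>r<k i. \<bar>A i r j\<bar>) \<le> (\<Sum>r<k i. \<Sum>j<n. \<bar>A i r j\<bar>)"
        using j by (intro sum_mono member_le_sum) auto
      also have "\<dots> \<le> (\<Sum>i<m. \<Sum>r<k i. \<Sum>j<n. \<bar>A i r j\<bar>)"
        using i by (intro member_le_sum[where f="\<lambda>i. \<Sum>r<k i. \<Sum>j<n. \<bar>A i r j\<bar>"]) (auto intro!: sum_nonneg)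
      finally have "(\<Sum>r<k i. \<bar>A i r j\<bar>) \<le> 1 + (\<Sum>i<m. \<Sum>r<k i. \<Sum>j<n. \<bar>A i r j\<bar>)" by simp
      from mult_left_mono[OF this M] 1 show ?thesis unfolding M'_def by (rule order_trans[rotated])
    qed
    have "step_hyp n m c C M' G D"
      unfolding step_hyp_def
    proof (intro allI impI conjI)
      fix i assume i: "i < m"
      have [measurable]: "g i \<in> borel_measurable borel" using g[OF i] by (simp add: nice_def)
      show "G i \<in> borel_measurable borel" unfolding G_def by measurable
      show "c \<le> G i y" "G i y \<le> C" for y using gb[OF i] by (auto simp: G_def)
      show "\<bar>G i y - G i (\<lambda>_. 0)\<bar> \<le> M' * nrm n y" for y
        using gl[OF i, of y] mono[of "nrm n y"] unfolding G0 by (simp add: G_def)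
      show "\<bar>G i y - G i (\<lambda>_. 0) - (\<Sum>j<n. D i j * y j)\<bar> \<le> M' * (nrm n y)\<^sup>2" for y
        using dq[OF i, of x y] mono[of "(nrm n y)\<^sup>2"] unfolding G0 lin by (simp add: G_def)
      show "\<bar>D i j\<bar> \<le> M'" if "j < n" for j using DM[OF i that] .
    qed
    from st[OF this s]
    have 1: "\<bar>(\<integral>y. Phi m a (\<lambda>i. G i (\<lambda>j. s * y j)) \<partial>gauss n) - Phi m a (\<lambda>i. \<integral>y. G i (\<lambda>j. s * y j) \<partial>gauss n)
      - s\<^sup>2 / 2 * step_main n m a G D\<bar> \<le> K * s ^ 3" .
    \<comment> \<open>The logarithmic gradient at x has coefficients d / g with respect to the rows
      of A, so the hypothesis on \<open>QF\<close> applies.\<close>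
    have "step_main n m a G D = Phi m a (\<lambda>i. G i (\<lambda>_. 0)) * QF n m k A a (\<lambda>i r. d i r x / g i x)"
      unfolding QF_def G0 D_def step_main_def by (simp add: sum_divide_distrib)
    then have "\<sigma> * step_main n m a G D = Phi m a (\<lambda>i. G i (\<lambda>_. 0)) * (\<sigma> * QF n m k A a (\<lambda>i r. d i r x / g i x))"
      by simp
    also have "\<dots> \<le> 0" by (intro mult_nonneg_nonpos Phi_nonneg Q)
    finally have 2: "\<sigma> * step_main n m a G D \<le> 0" .
    have aux: "\<sigma> * z \<le> t" if "\<bar>z - w * q\<bar> \<le> t" "\<sigma> * q \<le> 0" "0 \<le> w" for z w q t
    proof -
      have "\<sigma> * z = \<sigma> * (z - w * q) + w * (\<sigma> * q)" by (simp add: algebra_simps)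
      moreover have "\<sigma> * (z - w * q) \<le> \<bar>z - w * q\<bar>"
        using abs_ge_self[of "\<sigma> * (z - w * q)"] \<sigma> by (simp add: abs_mult)
      moreover have "w * (\<sigma> * q) \<le> 0" by (rule mult_nonneg_nonpos[OF that(3,2)])
      ultimately show ?thesis using that by linarith
    qed
    have "\<sigma> * ((\<integral>y. Phi m a (\<lambda>i. G i (\<lambda>j. s * y j)) \<partial>gauss n) - Phi m a (\<lambda>i. \<integral>y. G i (\<lambda>j. s * y j) \<partial>gauss n)) \<le> K * s ^ 3"
      by (rule aux[OF 1 2]) simp
    then show ?thesis unfolding heat_def G_def by simp
  qed
  then show ?thesis using K by blast
qed

text \<open>Telescoping: after N steps the deficit is at most N K at every point, one more averaging
  keeps this bound, and the new step costs another K because the functions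
  \<open>heat n t (g i)\<close> are still in the class. The claim is carried for all x, since the
  next step averages over other points.\<close>

lemma heat_iterate:
  assumes c: "0 < c" "c \<le> C" and \<sigma>: "\<bar>\<sigma>\<bar> = (1::real)" and K: "0 \<le> K"
    and step: "\<And>g x. (\<And>i. i < m \<Longrightarrow> nice n (k i) (A i) M (g i) \<and> (\<forall>y. c \<le> g i y \<and> g i y \<le> C)) \<Longrightarrow>
      \<sigma> * (heat n s (\<lambda>x. Phi m a (\<lambda>i. g i x)) x - Phi m a (\<lambda>i. heat n s (g i) x)) \<le> K"
    and g: "\<And>i. i < m \<Longrightarrow> nice n (k i) (A i) M (g i)" and gb: "\<And>i y. i < m \<Longrightarrow> c \<le> g i y \<and> g i y \<le> C"
    and s: "0 \<le> s"
  shows "\<sigma> * (heat n (sqrt (real N) * s) (\<lambda>x. Phi m a (\<lambda>i. g i x)) x - Phi m a (\<lambda>i. heat n (sqrt (real N) * s) (g i) x)) \<le> real N * K"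
proof (induction N arbitrary: x)
  case 0
  then show ?case by (simp add: heat_0)
next
  case (Suc N)
  define t where "t = sqrt (real N) * s"
  define F where "F x = Phi m a (\<lambda>i. g i x)" for x
  define PB where "PB = (\<Prod>i<m. c powr a i + C powr a i)"
  have t: "0 \<le> t" using s by (simp add: t_def)
  have st: "sqrt (s\<^sup>2 + t\<^sup>2) = sqrt (real (Suc N)) * s"
  proof -
    have "s\<^sup>2 + t\<^sup>2 = real (Suc N) * s\<^sup>2" by (simp add: t_def power_mult_distrib algebra_simps)
    then show ?thesis using s by (simp add: real_sqrt_mult)
  qed
  have gm [measurable]: "g i \<in> borel_measurable borel" if "i < m" for i
    using g[OF that] by (simp add: nice_def)
  have Fm [measurable]: "F \<in> borel_measurable borel" unfolding F_def by measurable
  have Fb: "0 \<le> F x" "F x \<le> PB" for x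
    unfolding F_def PB_def using gb c by (auto intro!: Phi_nonneg Phi_bounded)
  have hb: "c \<le> heat n t (g i) x \<and> heat n t (g i) x \<le> C" if "i < m" for i x
    using gm gb that by (intro heat_bounds) auto
  have hn: "nice n (k i) (A i) M (heat n t (g i))" if "i < m" for i
  proof (rule nice_heat[OF g[OF that]])
    show "\<bar>g i x\<bar> \<le> C" for x using gb[OF that, of x] c by linarith
  qed
  have hF: "heat n (sqrt (real (Suc N)) * s) F x = heat n s (heat n t F) x" for x
    unfolding st[symmetric] using Fm Fb s t by (intro heat_heat[symmetric]) auto
  have hg: "heat n (sqrt (real (Suc N)) * s) (g i) x = heat n s (heat n t (g i)) x" if "i < m" for i x
    unfolding st[symmetric]
  proof (rule heat_heat[symmetric])
    show "0 \<le> g i x" for x using gb[OF that, of x] c by linarith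
  qed (use gm[OF that] gb[OF that] s t in auto)
  define P where "P x = Phi m a (\<lambda>i. heat n t (g i) x)" for x
  have Pm [measurable]: "P \<in> borel_measurable borel" unfolding P_def by measurable
  have Pb: "0 \<le> P x" "P x \<le> PB" for x
    unfolding P_def PB_def using hb c by (auto intro!: Phi_nonneg Phi_bounded)
  have IH: "\<sigma> * (heat n t F x - P x) \<le> real N * K" for x
    using Suc.IH[of x] unfolding t_def[symmetric] F_def P_def .
  have hFb: "0 \<le> heat n t F x \<and> heat n t F x \<le> PB" for x
    using Fm Fb by (intro heat_bounds) auto
  have i1: "integrable (gauss n) (\<lambda>y. heat n t F (\<lambda>j. x j + s * y j))"
  proof (rule bounded_integrable_gauss[where g="heat n t F" and C=PB and h="\<lambda>y. \<lambda>j. x j + s * y j"])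
    show "\<bar>heat n t F x\<bar> \<le> PB" for x using hFb[of x] by linarith
  qed measurable
  have i2: "integrable (gauss n) (\<lambda>y. P (\<lambda>j. x j + s * y j))"
    by (rule bounded_integrable_gauss[where g=P and C=PB and h="\<lambda>y. \<lambda>j. x j + s * y j"]) (use Pb Pm in auto)
  have "\<sigma> * (heat n s (heat n t F) x - heat n s P x) =
    (\<integral>y. \<sigma> * (heat n t F (\<lambda>j. x j + s * y j) - P (\<lambda>j. x j + s * y j)) \<partial>gauss n)"
    unfolding heat_def[of n s] using i1 i2 by simp
  also have "\<dots> \<le> real N * K"
    using i1 i2 IH by (intro G.integral_le_const) auto
  finally have 1: "\<sigma> * (heat n s (heat n t F) x - heat n s P x) \<le> real N * K" .
  have 2: "\<sigma> * (heat n s P x - Phi m a (\<lambda>i. heat n s (heat n t (g i)) x)) \<le> K"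
    unfolding P_def using hn hb by (intro step) auto
  have 3: "Phi m a (\<lambda>i. heat n (sqrt (real (Suc N)) * s) (g i) x) = Phi m a (\<lambda>i. heat n s (heat n t (g i)) x)"
    unfolding Phi_def using hg by (intro prod.cong) auto
  have "\<sigma> * (heat n (sqrt (real (Suc N)) * s) F x - Phi m a (\<lambda>i. heat n (sqrt (real (Suc N)) * s) (g i) x)) \<le> real (Suc N) * K"
    unfolding hF 3 using 1 2 by (simp add: algebra_simps)
  then show ?case unfolding F_def .
qed

lemma gaussian_nice:
  assumes c: "0 < c" "c \<le> C" and M: "0 \<le> M" and \<sigma>: "\<bar>\<sigma>\<bar> = (1::real)"
    and Q: "\<And>e. \<sigma> * QF n m k A a e \<le> 0"
    and g: "\<And>i. i < m \<Longrightarrow> nice n (k i) (A i) M (g i)" and gb: "\<And>i y. i < m \<Longrightarrow> c \<le> g i y \<and> g i y \<le> C"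
    and t: "0 \<le> t"
  shows "\<sigma> * ((\<integral>y. Phi m a (\<lambda>i. g i (\<lambda>j. t * y j)) \<partial>gauss n) - Phi m a (\<lambda>i. \<integral>y. g i (\<lambda>j. t * y j) \<partial>gauss n)) \<le> 0"
proof -
  obtain K where K: "0 \<le> K" and st: "\<And>g s x. (\<forall>i<m. nice n (k i) (A i) M (g i) \<and> (\<forall>y. c \<le> g i y \<and> g i y \<le> C)) \<Longrightarrow> 0 \<le> s \<Longrightarrow> s \<le> 1 \<Longrightarrow>
    \<sigma> * (heat n s (\<lambda>x. Phi m a (\<lambda>i. g i x)) x - Phi m a (\<lambda>i. heat n s (g i) x)) \<le> K * s ^ 3"
    using heat_step[OF c M \<sigma> Q] by metis
  define x :: "nat \<Rightarrow> real" where "x = (\<lambda>_. 0)"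
  define z where "z = \<sigma> * (heat n t (\<lambda>x. Phi m a (\<lambda>i. g i x)) x - Phi m a (\<lambda>i. heat n t (g i) x))"
  have ev: "eventually (\<lambda>N::nat. z \<le> K * t ^ 3 * inverse (sqrt (real N))) sequentially"
  proof -
    \<comment> \<open>This makes the step size t / sqrt N at most 1, as the expansion requires; the
      summand 1 keeps N positive when t = 0.\<close>
    have "eventually (\<lambda>N::nat. real N \<ge> t\<^sup>2 + 1) sequentially" by real_asymp
    then show ?thesis
    proof eventually_elim
      case (elim N)
      define s where "s = t / sqrt (real N)"
      have N: "0 < real N" using elim by (smt (verit) zero_le_power2)
      have "t \<le> sqrt (real N)" using elim t by (intro real_le_rsqrt) auto
      then have s: "0 \<le> s" "s \<le> 1" using t N by (auto simp: s_def)
      have ts: "sqrt (real N) * s = t" using N by (simp add: s_def)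
      have "z \<le> real N * (K * s ^ 3)"
        unfolding z_def ts[symmetric]
        by (rule heat_iterate[where c=c and C=C and M=M]) (use c \<sigma> K s g gb st in auto)
      also have "\<dots> = K * t ^ 3 * inverse (sqrt (real N))"
      proof -
        have "s ^ 3 = t ^ 3 / (real N * sqrt (real N))"
          using N by (simp add: s_def power_divide power3_eq_cube)
        then show ?thesis using N by (simp add: field_simps)
      qed
      finally show ?case .
    qed
  qed
  have "(\<lambda>N::nat. K * t ^ 3 * inverse (sqrt (real N))) \<longlonglongrightarrow> 0" by real_asymp
  then have "z \<le> 0" using ev by (intro tendsto_lowerbound[where F=sequentially]) auto
  then show ?thesis by (simp add: z_def heat_def x_def)
qed

subsection \<open>Approximation by nice functions\<close>

text \<open>The image is padded by zeros, so it is again a point of the sequence encoding, now of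
  dimension k.\<close>

definition lmap :: "nat \<Rightarrow> nat \<Rightarrow> (nat \<Rightarrow> nat \<Rightarrow> real) \<Rightarrow> (nat \<Rightarrow> real) \<Rightarrow> nat \<Rightarrow> real" where
  "lmap n k A x = (\<lambda>r. if r < k then (\<Sum>j<n. A r j * x j) else 0)"

lemma lmap_measurable [measurable]: "lmap n k A \<in> borel_measurable borel"
proof (rule borel_measurable_coordI)
  fix r show "(\<lambda>x. lmap n k A x r) \<in> borel_measurable borel"
    by (cases "r < k") (auto simp: lmap_def)
qed

lemma nice_mono:
  assumes "nice n k A M g" "M \<le> M'"
  shows "nice n k A M' g"
proof -
  have *: "M * z \<le> M' * z" if "0 \<le> z" for z using assms(2) that by (rule mult_right_mono)
  obtain d where d: "\<And>r. r < k \<Longrightarrow> d r \<in> borel_measurable borel \<and> (\<forall>x. \<bar>d r x\<bar> \<le> M)"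
    "\<And>x y. \<bar>g (\<lambda>j. x j + y j) - g x - (\<Sum>r<k. d r x * (\<Sum>j<n. A r j * y j))\<bar> \<le> M * (nrm n y)\<^sup>2"
    using assms(1) unfolding nice_def by blast
  have "\<bar>g (\<lambda>j. x j + y j) - g x\<bar> \<le> M' * nrm n y" for x y
    using assms(1) *[of "nrm n y"] unfolding nice_def by (meson nrm_nonneg order_trans)
  moreover have "\<bar>g (\<lambda>j. x j + y j) - g x - (\<Sum>r<k. d r x * (\<Sum>j<n. A r j * y j))\<bar> \<le> M' * (nrm n y)\<^sup>2" for x y
    using d(2)[of x y] *[of "(nrm n y)\<^sup>2"] by (meson zero_le_power2 order_trans)
  moreover have "\<bar>d r x\<bar> \<le> M'" if "r < k" for r x using d(1)[OF that] assms(2) by (meson order_trans)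
  ultimately show ?thesis using assms(1) d(1) unfolding nice_def by blast
qed

lemma nice_const: "0 \<le> M \<Longrightarrow> nice n k A M (\<lambda>_. b)"
  unfolding nice_def by (auto intro!: exI[of _ "\<lambda>_ _. 0"])

lemma nice_lincomb:
  assumes g: "nice n k A M g" and h: "nice n k A M h"
  shows "nice n k A ((\<bar>a\<bar> + \<bar>b\<bar>) * M) (\<lambda>x. a * g x + b * h x)"
proof -
  obtain d where d: "\<And>r. r < k \<Longrightarrow> d r \<in> borel_measurable borel" "\<And>r x. r < k \<Longrightarrow> \<bar>d r x\<bar> \<le> M"
    "\<And>x y. \<bar>g (\<lambda>j. x j + y j) - g x - (\<Sum>r<k. d r x * (\<Sum>j<n. A r j * y j))\<bar> \<le> M * (nrm n y)\<^sup>2"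
    using g unfolding nice_def by blast
  obtain d' where d': "\<And>r. r < k \<Longrightarrow> d' r \<in> borel_measurable borel" "\<And>r x. r < k \<Longrightarrow> \<bar>d' r x\<bar> \<le> M"
    "\<And>x y. \<bar>h (\<lambda>j. x j + y j) - h x - (\<Sum>r<k. d' r x * (\<Sum>j<n. A r j * y j))\<bar> \<le> M * (nrm n y)\<^sup>2"
    using h unfolding nice_def by blast
  have lg: "\<bar>g (\<lambda>j. x j + y j) - g x\<bar> \<le> M * nrm n y" "\<bar>h (\<lambda>j. x j + y j) - h x\<bar> \<le> M * nrm n y" for x y
    using g h unfolding nice_def by blast+
  have [measurable]: "g \<in> borel_measurable borel" "h \<in> borel_measurable borel"
    using g h by (auto simp: nice_def)
  have ab: "\<bar>a * u + b * v\<bar> \<le> (\<bar>a\<bar> + \<bar>b\<bar>) * B" if "\<bar>u\<bar> \<le> B" "\<bar>v\<bar> \<le> B" for u v B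
  proof -
    have "\<bar>a * u + b * v\<bar> \<le> \<bar>a\<bar> * \<bar>u\<bar> + \<bar>b\<bar> * \<bar>v\<bar>" using abs_triangle_ineq[of "a * u" "b * v"] by (simp add: abs_mult)
    also have "\<dots> \<le> \<bar>a\<bar> * B + \<bar>b\<bar> * B" using that by (intro add_mono mult_left_mono) auto
    finally show ?thesis by (simp add: distrib_right)
  qed
  show ?thesis unfolding nice_def
  proof (intro conjI allI exI[of _ "\<lambda>r x. a * d r x + b * d' r x"] impI)
    show "(\<lambda>x. a * g x + b * h x) \<in> borel_measurable borel" by measurable
    fix x y
    show "\<bar>a * g (\<lambda>j. x j + y j) + b * h (\<lambda>j. x j + y j) - (a * g x + b * h x)\<bar> \<le> (\<bar>a\<bar> + \<bar>b\<bar>) * M * nrm n y"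
      using ab[OF lg[of x y]] by (simp add: algebra_simps)
    have e: "(\<Sum>r<k. (a * d r x + b * d' r x) * (\<Sum>j<n. A r j * y j)) =
      a * (\<Sum>r<k. d r x * (\<Sum>j<n. A r j * y j)) + b * (\<Sum>r<k. d' r x * (\<Sum>j<n. A r j * y j))"
      unfolding sum_distrib_left[of a] sum_distrib_left[of b] sum.distrib[symmetric] by (intro sum.cong refl) (simp only: distrib_right mult.assoc)
    show "\<bar>a * g (\<lambda>j. x j + y j) + b * h (\<lambda>j. x j + y j) - (a * g x + b * h x) -
        (\<Sum>r<k. (a * d r x + b * d' r x) * (\<Sum>j<n. A r j * y j))\<bar> \<le> (\<bar>a\<bar> + \<bar>b\<bar>) * M * (nrm n y)\<^sup>2"
      using ab[OF d(3)[of x y] d'(3)[of x y]] unfolding e by (simp add: algebra_simps)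
  next
    fix r assume r: "r < k"
    show "(\<lambda>x. a * d r x + b * d' r x) \<in> borel_measurable borel" using d(1)[OF r] d'(1)[OF r] by measurable
    show "\<bar>a * d r x + b * d' r x\<bar> \<le> (\<bar>a\<bar> + \<bar>b\<bar>) * M" for x by (rule ab[OF d(2)[OF r] d'(2)[OF r]])
  qed
qed

text \<open>The product rule, with new coefficients \<open>h * d + g * d'\<close>. The term
  \<open>M * M\<close> comes from the product of the two increments, which is itself of second
  order.\<close>

lemma nice_mult:
  assumes g: "nice n k A M g" and h: "nice n k A M h" and b: "\<And>x. \<bar>g x\<bar> \<le> 1" "\<And>x. \<bar>h x\<bar> \<le> 1" and M: "0 \<le> M"
  shows "nice n k A (2 * M + M * M) (\<lambda>x. g x * h x)"
proof -
  obtain d where d: "\<And>r. r < k \<Longrightarrow> d r \<in> borel_measurable borel" "\<And>r x. r < k \<Longrightarrow> \<bar>d r x\<bar> \<le> M"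
    "\<And>x y. \<bar>g (\<lambda>j. x j + y j) - g x - (\<Sum>r<k. d r x * (\<Sum>j<n. A r j * y j))\<bar> \<le> M * (nrm n y)\<^sup>2"
    using g unfolding nice_def by blast
  obtain d' where d': "\<And>r. r < k \<Longrightarrow> d' r \<in> borel_measurable borel" "\<And>r x. r < k \<Longrightarrow> \<bar>d' r x\<bar> \<le> M"
    "\<And>x y. \<bar>h (\<lambda>j. x j + y j) - h x - (\<Sum>r<k. d' r x * (\<Sum>j<n. A r j * y j))\<bar> \<le> M * (nrm n y)\<^sup>2"
    using h unfolding nice_def by blast
  have lg: "\<bar>g (\<lambda>j. x j + y j) - g x\<bar> \<le> M * nrm n y" "\<bar>h (\<lambda>j. x j + y j) - h x\<bar> \<le> M * nrm n y" for x y
    using g h unfolding nice_def by blast+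
  have [measurable]: "g \<in> borel_measurable borel" "h \<in> borel_measurable borel"
    using g h by (auto simp: nice_def)
  have ab: "\<bar>s * u + t * v\<bar> \<le> 2 * B" if "\<bar>u\<bar> \<le> B" "\<bar>v\<bar> \<le> B" "\<bar>s\<bar> \<le> 1" "\<bar>t\<bar> \<le> 1" for u v B s t :: real
  proof -
    have "0 \<le> B" using that by linarith
    have "\<bar>s * u + t * v\<bar> \<le> \<bar>s\<bar> * \<bar>u\<bar> + \<bar>t\<bar> * \<bar>v\<bar>" using abs_triangle_ineq[of "s * u" "t * v"] by (simp add: abs_mult)
    also have "\<dots> \<le> 1 * B + 1 * B" using that \<open>0 \<le> B\<close> by (intro add_mono mult_mono) auto
    finally show ?thesis by simp
  qed
  have MM: "2 * M \<le> 2 * M + M * M" using M by simp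
  show ?thesis unfolding nice_def
  proof (intro conjI allI exI[of _ "\<lambda>r x. h x * d r x + g x * d' r x"] impI)
    show "(\<lambda>x. g x * h x) \<in> borel_measurable borel" by measurable
    fix x y
    let ?g = "g (\<lambda>j. x j + y j)" and ?h = "h (\<lambda>j. x j + y j)"
    have "?g * ?h - g x * h x = ?h * (?g - g x) + g x * (?h - h x)" by (simp add: algebra_simps)
    also have "\<bar>\<dots>\<bar> \<le> 2 * (M * nrm n y)" by (rule ab) (use lg b in auto)
    also have "\<dots> \<le> (2 * M + M * M) * nrm n y" using mult_right_mono[OF MM, of "nrm n y"] by simp
    finally show "\<bar>?g * ?h - g x * h x\<bar> \<le> (2 * M + M * M) * nrm n y" .
    let ?D = "\<Sum>r<k. d r x * (\<Sum>j<n. A r j * y j)" and ?D' = "\<Sum>r<k. d' r x * (\<Sum>j<n. A r j * y j)"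
    have e: "(\<Sum>r<k. (h x * d r x + g x * d' r x) * (\<Sum>j<n. A r j * y j)) = h x * ?D + g x * ?D'"
      unfolding sum_distrib_left[of "h x"] sum_distrib_left[of "g x"] sum.distrib[symmetric] by (intro sum.cong refl) (simp only: distrib_right mult.assoc)
    have eq: "G * H - g0 * h0 - (h0 * D + g0 * D') = (h0 * (G - g0 - D) + g0 * (H - h0 - D')) + (G - g0) * (H - h0)"
      for G H g0 h0 D D' :: real
      by (simp add: algebra_simps)
    have b1: "\<bar>h x * (?g - g x - ?D) + g x * (?h - h x - ?D')\<bar> \<le> 2 * (M * (nrm n y)\<^sup>2)"
      by (rule ab[OF d(3) d'(3) b(2) b(1)])
    have b2: "\<bar>(?g - g x) * (?h - h x)\<bar> \<le> (M * nrm n y) * (M * nrm n y)"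
      unfolding abs_mult by (rule mult_mono[OF lg]) (use M in auto)
    have eM: "2 * (M * (nrm n y)\<^sup>2) + (M * nrm n y) * (M * nrm n y) = (2 * M + M * M) * (nrm n y)\<^sup>2"
      by (simp add: power2_eq_square algebra_simps)
    show "\<bar>?g * ?h - g x * h x - (\<Sum>r<k. (h x * d r x + g x * d' r x) * (\<Sum>j<n. A r j * y j))\<bar> \<le> (2 * M + M * M) * (nrm n y)\<^sup>2"
      unfolding e eq eM[symmetric] by (rule order_trans[OF abs_triangle_ineq add_mono[OF b1 b2]])
  next
    fix r assume r: "r < k"
    show "(\<lambda>x. h x * d r x + g x * d' r x) \<in> borel_measurable borel" using d(1)[OF r] d'(1)[OF r] by measurable
    show "\<bar>h x * d r x + g x * d' r x\<bar> \<le> 2 * M + M * M" for x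
      using ab[OF d(2)[OF r] d'(2)[OF r] b(2) b(1)] MM by (meson order_trans)
  qed
qed

text \<open>For the second bound, the derivative of arctan x - x / (1 + u^2) at z is (u - z) (u + z)
  / ((1 + z^2) (1 + u^2)). It is at most |u - z| in modulus, because |u + z| is below the
  denominator by |x| \<le> (1 + x^2) / 2.\<close>

lemma arctan_diff_bound: "\<bar>arctan (u + v) - arctan u\<bar> \<le> \<bar>v\<bar>" 
  and arctan_taylor1: "\<bar>arctan (u + v) - arctan u - v / (1 + u\<^sup>2)\<bar> \<le> v\<^sup>2"
proof -
  have d: "(arctan has_field_derivative inverse (1 + x\<^sup>2)) (at x within S)" for x S
    by (rule DERIV_subset[OF DERIV_arctan]) simp
  have "norm (arctan (u + v) - arctan u) \<le> 1 * norm (u + v - u)"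
  proof (rule field_differentiable_bound[OF convex_UNIV d])
    fix z :: real
    have "1 \<le> 1 + z\<^sup>2" by simp
    then have "inverse (1 + z\<^sup>2) \<le> 1" by (rule inverse_le_1_iff[THEN iffD2, OF disjI2])
    then show "norm (inverse (1 + z\<^sup>2)) \<le> 1" by simp
  qed auto
  then show "\<bar>arctan (u + v) - arctan u\<bar> \<le> \<bar>v\<bar>" by simp
  have d2: "((\<lambda>x. arctan x - x / (1 + u\<^sup>2)) has_field_derivative (inverse (1 + x\<^sup>2) - 1 / (1 + u\<^sup>2))) (at x within S)" for x S
    by (intro DERIV_diff d DERIV_cdivide DERIV_ident)
  have "norm ((arctan (u + v) - (u + v) / (1 + u\<^sup>2)) - (arctan u - u / (1 + u\<^sup>2))) \<le> \<bar>v\<bar> * norm (u + v - u)"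
  proof (rule field_differentiable_bound[OF _ d2])
    show "convex {min u (u + v)..max u (u + v)}" by simp
    fix z assume z: "z \<in> {min u (u + v)..max u (u + v)}"
    have p: "0 < (1 + z\<^sup>2) * (1 + u\<^sup>2)" by (intro mult_pos_pos) (auto intro: add_pos_nonneg)
    have nz: "1 + z\<^sup>2 \<noteq> 0" "1 + u\<^sup>2 \<noteq> 0" by (auto simp: add_nonneg_eq_0_iff)
    have "inverse (1 + z\<^sup>2) - 1 / (1 + u\<^sup>2) = (u - z) * (u + z) / ((1 + z\<^sup>2) * (1 + u\<^sup>2))"
      using nz by (simp add: divide_simps) (simp add: power2_eq_square algebra_simps)
    also have "\<bar>\<dots>\<bar> = \<bar>u - z\<bar> * (\<bar>u + z\<bar> / ((1 + z\<^sup>2) * (1 + u\<^sup>2)))"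
      using p by (simp add: abs_mult)
    also have "\<dots> \<le> \<bar>v\<bar> * 1"
    proof (intro mult_mono)
      show "\<bar>u - z\<bar> \<le> \<bar>v\<bar>" using z by (auto simp: min_def max_def split: if_splits)
      have half: "\<bar>x\<bar> \<le> (1 + x\<^sup>2) / 2" for x :: real
      proof -
        have "0 \<le> (\<bar>x\<bar> - 1)\<^sup>2" by simp
        also have "\<dots> = 1 + x\<^sup>2 - 2 * \<bar>x\<bar>" by (simp add: power2_diff)
        finally show ?thesis by simp
      qed
      have "\<bar>u + z\<bar> \<le> (1 + u\<^sup>2) / 2 + (1 + z\<^sup>2) / 2"
        by (rule order_trans[OF abs_triangle_ineq add_mono[OF half half]])
      also have "\<dots> \<le> (1 + z\<^sup>2) * (1 + u\<^sup>2)"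
      proof -
        have e: "(1 + z\<^sup>2) * (1 + u\<^sup>2) - ((1 + u\<^sup>2) / 2 + (1 + z\<^sup>2) / 2) = (z\<^sup>2 + u\<^sup>2) / 2 + u\<^sup>2 * z\<^sup>2"
          by (simp add: field_simps)
        have "0 \<le> (z\<^sup>2 + u\<^sup>2) / 2 + u\<^sup>2 * z\<^sup>2" by simp
        then show ?thesis unfolding e[symmetric] by simp
      qed
      finally show "\<bar>u + z\<bar> / ((1 + z\<^sup>2) * (1 + u\<^sup>2)) \<le> 1" using p by (simp add: divide_le_eq_1)
    qed (use p in auto)
    finally show "norm (inverse (1 + z\<^sup>2) - 1 / (1 + u\<^sup>2)) \<le> \<bar>v\<bar>" by simp
  qed (auto simp: min_def max_def)
  then show "\<bar>arctan (u + v) - arctan u - v / (1 + u\<^sup>2)\<bar> \<le> v\<^sup>2"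
    by (simp add: add_divide_distrib power2_eq_square algebra_simps flip: abs_mult)
qed

text \<open>The building block of the approximation: a smooth step with values between 0 and 1 that
  depends on x through row r alone, so its gradient lies in the row span.\<close>

lemma nice_arctan:
  assumes r: "r < k"
  shows "\<exists>M\<ge>0. nice n k A M (\<lambda>x. 1 / 2 + arctan (b * lmap n k A x r + c) / pi)"
proof -
  define B where "B = \<bar>b\<bar> * (\<Sum>j<n. \<bar>A r j\<bar>)"
  have B: "0 \<le> B" by (simp add: B_def sum_nonneg)
  \<comment> \<open>The summands serve the Lipschitz bound, the second order bound and the bound on
    the coefficient, in this order.\<close>
  define M where "M = B + B\<^sup>2 + \<bar>b\<bar>"
  have M: "B \<le> M" "B\<^sup>2 \<le> M" "\<bar>b\<bar> \<le> M" "0 \<le> M" using B by (auto simp: M_def)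
  define u where "u x = b * lmap n k A x r + c" for x
  define w where "w y = b * (\<Sum>j<n. A r j * y j)" for y
  have [measurable]: "u \<in> borel_measurable borel"
    unfolding u_def lmap_def using r by simp
  have uw: "u (\<lambda>j. x j + y j) = u x + w y" for x y
    using r by (simp add: u_def w_def lmap_def sum.distrib distrib_left)
  have wb: "\<bar>w y\<bar> \<le> B * nrm n y" for y
  proof -
    have "\<bar>\<Sum>j<n. A r j * y j\<bar> \<le> (\<Sum>j<n. \<bar>A r j\<bar> * \<bar>y j\<bar>)"
      using sum_abs[of "\<lambda>j. A r j * y j" "{..<n}"] by (simp add: abs_mult)
    also have "\<dots> \<le> (\<Sum>j<n. \<bar>A r j\<bar> * nrm n y)"
      unfolding nrm_def by (intro sum_mono mult_left_mono member_le_sum) auto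
    also have "\<dots> = (\<Sum>j<n. \<bar>A r j\<bar>) * nrm n y" by (simp add: sum_distrib_right)
    finally show ?thesis unfolding w_def B_def abs_mult mult.assoc by (intro mult_left_mono) auto
  qed
  have pi1: "z / pi \<le> z" if "0 \<le> z" for z :: real
    using that pi_ge_two by (simp add: divide_le_eq mult_le_cancel_left1)
  have "nice n k A M (\<lambda>x. 1 / 2 + arctan (u x) / pi)"
    unfolding nice_def
  proof (intro conjI allI impI exI[of _ "\<lambda>r' x. if r' = r then b / (1 + (u x)\<^sup>2) / pi else 0"])
    show "(\<lambda>x. 1 / 2 + arctan (u x) / pi) \<in> borel_measurable borel" by measurable
    fix x y
    have "1 / 2 + arctan (u (\<lambda>j. x j + y j)) / pi - (1 / 2 + arctan (u x) / pi) = (arctan (u x + w y) - arctan (u x)) / pi"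
      unfolding uw by (simp add: diff_divide_distrib)
    also have "\<bar>\<dots>\<bar> \<le> \<bar>arctan (u x + w y) - arctan (u x)\<bar>"
      using pi1[of "\<bar>arctan (u x + w y) - arctan (u x)\<bar>"] by (simp add: abs_divide)
    also have "\<dots> \<le> \<bar>w y\<bar>" by (rule arctan_diff_bound)
    also have "\<dots> \<le> M * nrm n y" using wb[of y] mult_right_mono[OF M(1), of "nrm n y"] by simp
    finally show "\<bar>1 / 2 + arctan (u (\<lambda>j. x j + y j)) / pi - (1 / 2 + arctan (u x) / pi)\<bar> \<le> M * nrm n y" .
    have e: "(\<Sum>r'<k. (if r' = r then b / (1 + (u x)\<^sup>2) / pi else 0) * (\<Sum>j<n. A r' j * y j)) = w y / (1 + (u x)\<^sup>2) / pi"
    proof -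
      have "(\<Sum>r'<k. (if r' = r then b / (1 + (u x)\<^sup>2) / pi else 0) * (\<Sum>j<n. A r' j * y j)) =
        (\<Sum>r'<k. if r' = r then b / (1 + (u x)\<^sup>2) / pi * (\<Sum>j<n. A r' j * y j) else 0)"
        by (intro sum.cong) auto
      also have "\<dots> = b / (1 + (u x)\<^sup>2) / pi * (\<Sum>j<n. A r j * y j)" using r by simp
      finally show ?thesis by (simp add: w_def)
    qed
    have "1 / 2 + arctan (u (\<lambda>j. x j + y j)) / pi - (1 / 2 + arctan (u x) / pi) - w y / (1 + (u x)\<^sup>2) / pi = (arctan (u x + w y) - arctan (u x) - w y / (1 + (u x)\<^sup>2)) / pi"
      unfolding uw by (simp add: diff_divide_distrib)
    also have "\<bar>\<dots>\<bar> \<le> \<bar>arctan (u x + w y) - arctan (u x) - w y / (1 + (u x)\<^sup>2)\<bar>"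
      using pi1[of "\<bar>arctan (u x + w y) - arctan (u x) - w y / (1 + (u x)\<^sup>2)\<bar>"] by (simp add: abs_divide)
    also have "\<dots> \<le> \<bar>w y\<bar>\<^sup>2" using arctan_taylor1[of "u x" "w y"] by simp
    also have "\<dots> \<le> (B * nrm n y)\<^sup>2" using wb by (intro power_mono) auto
    also have "\<dots> \<le> M * (nrm n y)\<^sup>2" using mult_right_mono[OF M(2), of "(nrm n y)\<^sup>2"] by (simp add: power_mult_distrib)
    finally show "\<bar>1 / 2 + arctan (u (\<lambda>j. x j + y j)) / pi - (1 / 2 + arctan (u x) / pi) -
       (\<Sum>r'<k. (if r' = r then b / (1 + (u x)\<^sup>2) / pi else 0) * (\<Sum>j<n. A r' j * y j))\<bar> \<le> M * (nrm n y)\<^sup>2"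
      unfolding e .
  next
    fix r' x
    show "(\<lambda>x. if r' = r then b / (1 + (u x)\<^sup>2) / pi else 0) \<in> borel_measurable borel" by (cases "r' = r") auto
    have "\<bar>b / (1 + (u x)\<^sup>2) / pi\<bar> \<le> \<bar>b / (1 + (u x)\<^sup>2)\<bar>"
      using pi1[of "\<bar>b / (1 + (u x)\<^sup>2)\<bar>"] by simp
    also have "\<dots> = \<bar>b\<bar> / (1 + (u x)\<^sup>2)" by (simp add: abs_divide add_nonneg_nonneg)
    also have "\<dots> \<le> \<bar>b\<bar> / 1" by (intro divide_left_mono) (auto intro: add_pos_nonneg)
    finally show "\<bar>if r' = r then b / (1 + (u x)\<^sup>2) / pi else 0\<bar> \<le> M" using M by auto
  qed
  then show ?thesis using M(4) unfolding u_def by blast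
qed

definition apx :: "nat \<Rightarrow> nat \<Rightarrow> (nat \<Rightarrow> nat \<Rightarrow> real) \<Rightarrow> real \<Rightarrow> (nat \<Rightarrow> real) set \<Rightarrow> bool" where
  "apx n k A t S \<longleftrightarrow> S \<in> sets borel \<and> (\<forall>\<epsilon>>0. \<exists>M\<ge>0. \<exists>\<phi>. nice n k A M \<phi> \<and> (\<forall>x. 0 \<le> \<phi> x \<and> \<phi> x \<le> 1) \<and>
     (\<integral>y. \<bar>\<phi> (\<lambda>j. t * y j) - indicator S (lmap n k A (\<lambda>j. t * y j))\<bar> \<partial>gauss n) < \<epsilon>)"

lemma apx_integrable:
  fixes g h :: "(nat \<Rightarrow> real) \<Rightarrow> real"
  assumes [measurable]: "g \<in> borel_measurable borel" "h \<in> borel_measurable borel"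
    and b: "\<And>x. \<bar>g x\<bar> \<le> C" "\<And>x. \<bar>h x\<bar> \<le> C"
  shows "integrable (gauss n) (\<lambda>y. \<bar>g (\<lambda>j. t * y j) - h (lmap n k A (\<lambda>j. t * y j))\<bar>)"
proof (rule G.integrable_const_bound)
  show "AE y in gauss n. norm \<bar>g (\<lambda>j. t * y j) - h (lmap n k A (\<lambda>j. t * y j))\<bar> \<le> 2 * C"
  proof (rule AE_I2)
    fix y show "norm \<bar>g (\<lambda>j. t * y j) - h (lmap n k A (\<lambda>j. t * y j))\<bar> \<le> 2 * C"
      using b(1)[of "\<lambda>j. t * y j"] b(2)[of "lmap n k A (\<lambda>j. t * y j)"] by simp
  qed
qed measurable

lemma nice_borel: "nice n k A M g \<Longrightarrow> g \<in> borel_measurable borel"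
  by (simp add: nice_def)

lemma apxD:
  assumes "apx n k A t S" "0 < \<epsilon>"
  obtains M \<phi> where "0 \<le> M" "nice n k A M \<phi>" "\<And>x. 0 \<le> \<phi> x" "\<And>x. \<phi> x \<le> 1"
     "(\<integral>y. \<bar>\<phi> (\<lambda>j. t * y j) - indicator S (lmap n k A (\<lambda>j. t * y j))\<bar> \<partial>gauss n) < \<epsilon>"
  using assms unfolding apx_def by blast

lemma apx_compl:
  assumes "apx n k A t S"
  shows "apx n k A t (- S)"
  unfolding apx_def
proof (intro conjI allI impI)
  show "- S \<in> sets borel" using assms unfolding apx_def by auto
  fix \<epsilon> :: real assume e: "0 < \<epsilon>"
  from apxD[OF assms e] obtain M \<phi> where \<phi>: "0 \<le> M" "nice n k A M \<phi>" "\<And>x. 0 \<le> \<phi> x" "\<And>x. \<phi> x \<le> 1"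
     "(\<integral>y. \<bar>\<phi> (\<lambda>j. t * y j) - indicator S (lmap n k A (\<lambda>j. t * y j))\<bar> \<partial>gauss n) < \<epsilon>"
    by blast
  have "nice n k A ((\<bar>1\<bar> + \<bar>- 1\<bar>) * M) (\<lambda>x. 1 * 1 + (- 1) * \<phi> x)"
    using \<phi>(1,2) by (intro nice_lincomb nice_const)
  then have "nice n k A (2 * M) (\<lambda>x. 1 - \<phi> x)" by simp
  moreover have "\<bar>1 - \<phi> (\<lambda>j. t * y j) - indicator (- S) (lmap n k A (\<lambda>j. t * y j))\<bar> = 
    \<bar>\<phi> (\<lambda>j. t * y j) - indicator S (lmap n k A (\<lambda>j. t * y j))\<bar>" for y
    by (auto simp: indicator_def abs_minus_commute)
  ultimately show "\<exists>M\<ge>0. \<exists>\<phi>. nice n k A M \<phi> \<and> (\<forall>x. 0 \<le> \<phi> x \<and> \<phi> x \<le> 1) \<and>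
     (\<integral>y. \<bar>\<phi> (\<lambda>j. t * y j) - indicator (- S) (lmap n k A (\<lambda>j. t * y j))\<bar> \<partial>gauss n) < \<epsilon>"
    using \<phi> by (intro exI[of _ "2 * M"] conjI exI[of _ "\<lambda>x. 1 - \<phi> x"]) auto
qed

text \<open>Multiply the approximants: with all functions bounded by 1 the L1 errors add.\<close>

lemma apx_inter:
  assumes "apx n k A t S" "apx n k A t S'"
  shows "apx n k A t (S \<inter> S')"
  unfolding apx_def
proof (intro conjI allI impI)
  have [measurable]: "S \<in> sets borel" "S' \<in> sets borel" using assms unfolding apx_def by auto
  then show "S \<inter> S' \<in> sets borel" by auto
  fix \<epsilon> :: real assume e: "0 < \<epsilon>"
  then have e2: "0 < \<epsilon> / 2" by simp
  from apxD[OF assms(1) e2] obtain M \<phi> where \<phi>: "0 \<le> M" "nice n k A M \<phi>" "\<And>x. 0 \<le> \<phi> x" "\<And>x. \<phi> x \<le> 1"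
     "(\<integral>y. \<bar>\<phi> (\<lambda>j. t * y j) - indicator S (lmap n k A (\<lambda>j. t * y j))\<bar> \<partial>gauss n) < \<epsilon> / 2"
    by blast
  from apxD[OF assms(2) e2] obtain M' \<phi>' where \<phi>': "0 \<le> M'" "nice n k A M' \<phi>'" "\<And>x. 0 \<le> \<phi>' x" "\<And>x. \<phi>' x \<le> 1"
     "(\<integral>y. \<bar>\<phi>' (\<lambda>j. t * y j) - indicator S' (lmap n k A (\<lambda>j. t * y j))\<bar> \<partial>gauss n) < \<epsilon> / 2"
    by blast
  note [measurable] = nice_borel[OF \<phi>(2)] nice_borel[OF \<phi>'(2)]
  define B where "B = M + M'"
  have B: "nice n k A B \<phi>" "nice n k A B \<phi>'" "0 \<le> B"
    using nice_mono[OF \<phi>(2), of B] nice_mono[OF \<phi>'(2), of B] \<phi>(1) \<phi>'(1) by (auto simp: B_def)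
  have ab: "\<bar>\<phi> x\<bar> \<le> 1" "\<bar>\<phi>' x\<bar> \<le> 1" for x using \<phi>(3,4)[of x] \<phi>'(3,4)[of x] by auto
  have n: "nice n k A (2 * B + B * B) (\<lambda>x. \<phi> x * \<phi>' x)"
    by (rule nice_mult[OF B(1,2) ab B(3)])
  have pb: "0 \<le> \<phi> x * \<phi>' x \<and> \<phi> x * \<phi>' x \<le> 1" for x
    using \<phi>(3,4)[of x] \<phi>'(3,4)[of x] by (auto intro: mult_le_one)
  have i1: "integrable (gauss n) (\<lambda>y. \<bar>\<phi> (\<lambda>j. t * y j) - indicator S (lmap n k A (\<lambda>j. t * y j))\<bar>)"
    by (rule apx_integrable[where C=1]) (auto simp: ab)
  have i2: "integrable (gauss n) (\<lambda>y. \<bar>\<phi>' (\<lambda>j. t * y j) - indicator S' (lmap n k A (\<lambda>j. t * y j))\<bar>)"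
    by (rule apx_integrable[where C=1]) (auto simp: ab)
  have i3: "integrable (gauss n) (\<lambda>y. \<bar>\<phi> (\<lambda>j. t * y j) * \<phi>' (\<lambda>j. t * y j) - indicator (S \<inter> S') (lmap n k A (\<lambda>j. t * y j))\<bar>)"
    by (rule apx_integrable[where C=1 and g="\<lambda>x. \<phi> x * \<phi>' x"]) (use pb in \<open>auto simp: abs_of_nonneg\<close>)
  have "(\<integral>y. \<bar>\<phi> (\<lambda>j. t * y j) * \<phi>' (\<lambda>j. t * y j) - indicator (S \<inter> S') (lmap n k A (\<lambda>j. t * y j))\<bar> \<partial>gauss n) \<le> 
    (\<integral>y. \<bar>\<phi> (\<lambda>j. t * y j) - indicator S (lmap n k A (\<lambda>j. t * y j))\<bar> + \<bar>\<phi>' (\<lambda>j. t * y j) - indicator S' (lmap n k A (\<lambda>j. t * y j))\<bar> \<partial>gauss n)"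
  proof (rule integral_mono[OF i3 Bochner_Integration.integrable_add[OF i1 i2]])
    fix y
    have *: "\<bar>u * v - i * i'\<bar> \<le> \<bar>u - i\<bar> + \<bar>v - i'\<bar>" if "\<bar>u\<bar> \<le> 1" "\<bar>i'\<bar> \<le> 1" for u v i i' :: real
    proof -
      have "u * v - i * i' = u * (v - i') + (u - i) * i'" by (simp add: algebra_simps)
      then have "\<bar>u * v - i * i'\<bar> \<le> \<bar>u\<bar> * \<bar>v - i'\<bar> + \<bar>u - i\<bar> * \<bar>i'\<bar>"
        using abs_triangle_ineq[of "u * (v - i')" "(u - i) * i'"] by (simp add: abs_mult)
      also have "\<dots> \<le> 1 * \<bar>v - i'\<bar> + \<bar>u - i\<bar> * 1"
        using that by (intro add_mono mult_right_mono mult_left_mono) auto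
      finally show ?thesis by simp
    qed
    show "\<bar>\<phi> (\<lambda>j. t * y j) * \<phi>' (\<lambda>j. t * y j) - indicator (S \<inter> S') (lmap n k A (\<lambda>j. t * y j))\<bar> \<le>
      \<bar>\<phi> (\<lambda>j. t * y j) - indicator S (lmap n k A (\<lambda>j. t * y j))\<bar> + \<bar>\<phi>' (\<lambda>j. t * y j) - indicator S' (lmap n k A (\<lambda>j. t * y j))\<bar>"
      unfolding indicator_inter_arith by (rule *) (auto simp: ab indicator_def)
  qed
  also have "\<dots> < \<epsilon>"
    unfolding Bochner_Integration.integral_add[OF i1 i2] using \<phi>(5) \<phi>'(5) by linarith
  finally show "\<exists>M\<ge>0. \<exists>\<phi>. nice n k A M \<phi> \<and> (\<forall>x. 0 \<le> \<phi> x \<and> \<phi> x \<le> 1) \<and>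
     (\<integral>y. \<bar>\<phi> (\<lambda>j. t * y j) - indicator (S \<inter> S') (lmap n k A (\<lambda>j. t * y j))\<bar> \<partial>gauss n) < \<epsilon>"
    using n pb B(3) by (intro exI[of _ "2 * B + B * B"] conjI exI[of _ "\<lambda>x. \<phi> x * \<phi>' x"]) auto
qed

text \<open>Closedness under L1 limits, the way from finite to countable unions.\<close>

lemma apx_approx:
  assumes S: "S \<in> sets borel"
    and ex: "\<And>\<epsilon>. 0 < \<epsilon> \<Longrightarrow> \<exists>S'. apx n k A t S' \<and> (\<integral>y. \<bar>indicator S' (lmap n k A (\<lambda>j. t * y j)) - indicator S (lmap n k A (\<lambda>j. t * y j))\<bar> \<partial>gauss n) < (\<epsilon>::real)"
  shows "apx n k A t S"
  unfolding apx_def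
proof (intro conjI allI impI)
  note [measurable] = S
  show "S \<in> sets borel" by fact
  fix \<epsilon> :: real assume "0 < \<epsilon>"
  then have e2: "0 < \<epsilon> / 2" by simp
  from ex[OF this] obtain S' where S': "apx n k A t S'" "(\<integral>y. \<bar>indicator S' (lmap n k A (\<lambda>j. t * y j)) - indicator S (lmap n k A (\<lambda>j. t * y j))\<bar> \<partial>gauss n) < \<epsilon> / 2"
    by blast
  have [measurable]: "S' \<in> sets borel" using S' by (simp add: apx_def)
  from apxD[OF S'(1) e2] obtain M \<phi> where \<phi>: "0 \<le> M" "nice n k A M \<phi>" "\<And>x. 0 \<le> \<phi> x" "\<And>x. \<phi> x \<le> 1"
     "(\<integral>y. \<bar>\<phi> (\<lambda>j. t * y j) - indicator S' (lmap n k A (\<lambda>j. t * y j))\<bar> \<partial>gauss n) < \<epsilon> / 2"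
    by blast
  note [measurable] = nice_borel[OF \<phi>(2)]
  have ab: "\<bar>\<phi> x\<bar> \<le> 1" for x using \<phi>(3,4)[of x] by auto
  have i1: "integrable (gauss n) (\<lambda>y. \<bar>\<phi> (\<lambda>j. t * y j) - indicator S' (lmap n k A (\<lambda>j. t * y j))\<bar>)"
    by (rule apx_integrable[where C=1]) (auto simp: ab)
  have i3: "integrable (gauss n) (\<lambda>y. \<bar>\<phi> (\<lambda>j. t * y j) - indicator S (lmap n k A (\<lambda>j. t * y j))\<bar>)"
    by (rule apx_integrable[where C=1]) (auto simp: ab)
  have i2: "integrable (gauss n) (\<lambda>y. \<bar>indicator S' (lmap n k A (\<lambda>j. t * y j)) - indicator S (lmap n k A (\<lambda>j. t * y j))\<bar> :: real)"
    by (rule apx_integrable[where C=1 and g="\<lambda>x. indicator S' (lmap n k A x)"]) auto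
  have "(\<integral>y. \<bar>\<phi> (\<lambda>j. t * y j) - indicator S (lmap n k A (\<lambda>j. t * y j))\<bar> \<partial>gauss n) \<le> 
    (\<integral>y. \<bar>\<phi> (\<lambda>j. t * y j) - indicator S' (lmap n k A (\<lambda>j. t * y j))\<bar> + \<bar>indicator S' (lmap n k A (\<lambda>j. t * y j)) - indicator S (lmap n k A (\<lambda>j. t * y j))\<bar> \<partial>gauss n)"
    by (rule integral_mono[OF i3 Bochner_Integration.integrable_add[OF i1 i2]]) linarith
  also have "\<dots> < \<epsilon>"
    unfolding Bochner_Integration.integral_add[OF i1 i2] using \<phi>(5) S'(2) by linarith
  finally show "\<exists>M\<ge>0. \<exists>\<phi>. nice n k A M \<phi> \<and> (\<forall>x. 0 \<le> \<phi> x \<and> \<phi> x \<le> 1) \<and>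
     (\<integral>y. \<bar>\<phi> (\<lambda>j. t * y j) - indicator S (lmap n k A (\<lambda>j. t * y j))\<bar> \<partial>gauss n) < \<epsilon>"
    using \<phi> by blast
qed

lemma apx_empty: "apx n k A t {}"
  unfolding apx_def
  by (auto intro!: exI[of _ "1::real"] exI[of _ "\<lambda>_. 0"] nice_const)

lemma apx_Un: "apx n k A t S \<Longrightarrow> apx n k A t S' \<Longrightarrow> apx n k A t (S \<union> S')"
  using apx_compl[OF apx_inter[OF apx_compl apx_compl]] by simp

lemma apx_UN_finite: "(\<And>i::nat. apx n k A t (S i)) \<Longrightarrow> apx n k A t (\<Union>i<N. S i)"
  by (induction N) (auto simp: lessThan_Suc apx_empty apx_Un)

lemma apx_UN:
  assumes S: "\<And>i::nat. apx n k A t (S i)"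
  shows "apx n k A t (\<Union>i. S i)"
proof (rule apx_approx)
  have [measurable]: "\<And>i. S i \<in> sets borel" using S by (simp add: apx_def)
  show "(\<Union>i. S i) \<in> sets borel" by measurable
  fix \<epsilon> :: real assume e: "0 < \<epsilon>"
  define U where "U N = (\<Union>i<N. S i)" for N
  have [measurable]: "\<And>N. U N \<in> sets borel" unfolding U_def by measurable
  have "(\<lambda>N. \<integral>y. \<bar>indicator (U N) (lmap n k A (\<lambda>j. t * y j)) - indicator (\<Union>i. S i) (lmap n k A (\<lambda>j. t * y j))\<bar> \<partial>gauss n)
    \<longlonglongrightarrow> (\<integral>y. (0::real) \<partial>gauss n)"
  proof (rule integral_dominated_convergence[where w="\<lambda>_. 1"])
    show "AE y in gauss n. (\<lambda>N. \<bar>indicator (U N) (lmap n k A (\<lambda>j. t * y j)) - indicator (\<Union>i. S i) (lmap n k A (\<lambda>j. t * y j))\<bar>) \<longlonglongrightarrow> (0::real)"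
    proof (rule AE_I2)
      fix y
      define z where "z = lmap n k A (\<lambda>j. t * y j)"
      have "eventually (\<lambda>N. \<bar>indicator (U N) z - indicator (\<Union>i. S i) z\<bar> = (0::real)) sequentially"
      proof (cases "z \<in> (\<Union>i. S i)")
        case True
        then obtain i where i: "z \<in> S i" by blast
        show ?thesis using eventually_gt_at_top[of i]
        proof eventually_elim
          case (elim N)
          then have "z \<in> U N" using i by (auto simp: U_def)
          then show ?case using True by simp
        qed
      next
        case False
        then have "z \<notin> U N" for N by (auto simp: U_def)
        then show ?thesis using False by simp
      qed
      then show "(\<lambda>N. \<bar>indicator (U N) (lmap n k A (\<lambda>j. t * y j)) - indicator (\<Union>i. S i) (lmap n k A (\<lambda>j. t * y j))\<bar>) \<longlonglongrightarrow> (0::real)"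
        unfolding z_def by (rule tendsto_eventually)
    qed
  qed (auto simp: indicator_def)
  then have "eventually (\<lambda>N. (\<integral>y. \<bar>indicator (U N) (lmap n k A (\<lambda>j. t * y j)) - indicator (\<Union>i. S i) (lmap n k A (\<lambda>j. t * y j))\<bar> \<partial>gauss n) < \<epsilon>) sequentially"
    using e by (simp add: order_tendstoD(2))
  then obtain N where "(\<integral>y. \<bar>indicator (U N) (lmap n k A (\<lambda>j. t * y j)) - indicator (\<Union>i. S i) (lmap n k A (\<lambda>j. t * y j))\<bar> \<partial>gauss n) < \<epsilon>"
    by (auto simp: eventually_sequentially)
  moreover have "apx n k A t (U N)" unfolding U_def by (rule apx_UN_finite[OF S])
  ultimately show "\<exists>S'. apx n k A t S' \<and> (\<integral>y. \<bar>indicator S' (lmap n k A (\<lambda>j. t * y j)) - indicator (\<Union>i. S i) (lmap n k A (\<lambda>j. t * y j))\<bar> \<partial>gauss n) < \<epsilon>"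
    by blast
qed

lemma apx_halfspace: "apx n k A t {z. b < z r}"
  unfolding apx_def
proof (intro conjI allI impI)
  show "{z. b < z r} \<in> sets borel" by measurable
  fix \<epsilon> :: real assume e: "0 < \<epsilon>"
  show "\<exists>M\<ge>0. \<exists>\<phi>. nice n k A M \<phi> \<and> (\<forall>x. 0 \<le> \<phi> x \<and> \<phi> x \<le> 1) \<and>
     (\<integral>y. \<bar>\<phi> (\<lambda>j. t * y j) - indicator {z. b < z r} (lmap n k A (\<lambda>j. t * y j))\<bar> \<partial>gauss n) < \<epsilon>"
  proof (cases "r < k")
    case False
    \<comment> \<open>In a padded coordinate the indicator is constant, so a constant function
      approximates it exactly.\<close>
    then have "lmap n k A x r = 0" for x by (simp add: lmap_def)
    then show ?thesis using e
      by (intro exI[of _ 0] conjI exI[of _ "\<lambda>_. if b < 0 then 1 else 0"]) (auto intro!: nice_const)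
  next
    case True
    \<comment> \<open>The extra shift by \<open>sqrt (real N)\<close> decides the boundary
      \<open>u = b\<close>: without it the steps would stay at 1 / 2 there, while the indicator of
      the open half-space is 0. For \<open>b < u\<close> the shift is dominated by the linear
      term.\<close>
    define \<theta> where "\<theta> N u = 1 / 2 + arctan (real N * u + (- real N * b - sqrt (real N))) / pi" for N :: nat and u
    have \<theta>b: "0 \<le> \<theta> N u \<and> \<theta> N u \<le> 1" for N u
      using arctan_lbound[of "real N * u + (- real N * b - sqrt (real N))"] arctan_ubound[of "real N * u + (- real N * b - sqrt (real N))"]
      unfolding \<theta>_def by (auto simp: field_simps)
    have lim: "(\<lambda>N. \<bar>\<theta> N u - (if b < u then 1 else 0)\<bar>) \<longlonglongrightarrow> 0" for u
    proof (cases "b < u")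
      case True
      define v where "v = u - b"
      have v: "0 < v" using True by (simp add: v_def)
      have "(\<lambda>N. 1 / 2 + arctan (real N * v - sqrt (real N)) / pi) \<longlonglongrightarrow> 1 / 2 + (pi / 2) / pi"
      proof (intro tendsto_intros filterlim_compose[OF tendsto_arctan_at_top])
        show "filterlim (\<lambda>N. real N * v - sqrt (real N)) at_top sequentially" using v by real_asymp
      qed simp
      then have "(\<lambda>N. \<theta> N u) \<longlonglongrightarrow> 1" by (simp add: \<theta>_def v_def algebra_simps)
      then have "(\<lambda>N. \<bar>\<theta> N u - 1\<bar>) \<longlonglongrightarrow> \<bar>1 - 1\<bar>" by (intro tendsto_intros)
      then show ?thesis using True by simp
    next
      case False
      define v where "v = b - u"
      have v: "0 \<le> v" using False by (simp add: v_def)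
      have "(\<lambda>N. 1 / 2 + arctan (- (real N * v + sqrt (real N))) / pi) \<longlonglongrightarrow> 1 / 2 + (- (pi / 2)) / pi"
      proof (intro tendsto_intros filterlim_compose[OF tendsto_arctan_at_bot])
        have "filterlim (\<lambda>N. real N * v + sqrt (real N)) at_top sequentially"
        proof (rule filterlim_at_top_mono)
          show "filterlim (\<lambda>N. sqrt (real N)) at_top sequentially" by real_asymp
        qed (use v in auto)
        then show "filterlim (\<lambda>N. - (real N * v + sqrt (real N))) at_bot sequentially"
          by (simp only: filterlim_uminus_at_bot minus_minus)
      qed simp
      then have "(\<lambda>N. \<theta> N u) \<longlonglongrightarrow> 0" by (simp add: \<theta>_def v_def algebra_simps)
      then have "(\<lambda>N. \<bar>\<theta> N u - 0\<bar>) \<longlonglongrightarrow> \<bar>0 - 0\<bar>" by (intro tendsto_intros)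
      then show ?thesis using False by simp
    qed
    have [measurable]: "(\<lambda>x. lmap n k A x r) \<in> borel_measurable borel"
      by (rule measurable_product_then_coordinatewise) measurable
    have [measurable]: "\<theta> N \<in> borel_measurable borel" for N unfolding \<theta>_def by measurable
    have "(\<lambda>N. \<integral>y. \<bar>\<theta> N (lmap n k A (\<lambda>j. t * y j) r) - indicator {z. b < z r} (lmap n k A (\<lambda>j. t * y j))\<bar> \<partial>gauss n)
      \<longlonglongrightarrow> (\<integral>y. (0::real) \<partial>gauss n)"
    proof (rule integral_dominated_convergence[where w="\<lambda>_. 1"])
      show "AE y in gauss n. (\<lambda>N. \<bar>\<theta> N (lmap n k A (\<lambda>j. t * y j) r) - indicator {z. b < z r} (lmap n k A (\<lambda>j. t * y j))\<bar>) \<longlonglongrightarrow> (0::real)"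
      proof (rule AE_I2)
        fix y
        have "(indicator {z. b < z r} (lmap n k A (\<lambda>j. t * y j)) :: real) = (if b < lmap n k A (\<lambda>j. t * y j) r then 1 else 0)"
          by simp
        then show "(\<lambda>N. \<bar>\<theta> N (lmap n k A (\<lambda>j. t * y j) r) - indicator {z. b < z r} (lmap n k A (\<lambda>j. t * y j))\<bar>) \<longlonglongrightarrow> (0::real)"
          using lim by (simp only:)
      qed
      show "AE y in gauss n. norm \<bar>\<theta> N (lmap n k A (\<lambda>j. t * y j) r) - indicator {z. b < z r} (lmap n k A (\<lambda>j. t * y j))\<bar> \<le> 1" for N
      proof (rule AE_I2)
        fix y
        show "norm \<bar>\<theta> N (lmap n k A (\<lambda>j. t * y j) r) - indicator {z. b < z r} (lmap n k A (\<lambda>j. t * y j))\<bar> \<le> 1"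
          using \<theta>b[of N "lmap n k A (\<lambda>j. t * y j) r"] by (auto simp: indicator_def)
      qed
    qed auto
    then have "eventually (\<lambda>N. (\<integral>y. \<bar>\<theta> N (lmap n k A (\<lambda>j. t * y j) r) - indicator {z. b < z r} (lmap n k A (\<lambda>j. t * y j))\<bar> \<partial>gauss n) < \<epsilon>) sequentially"
      using e by (simp add: order_tendstoD(2))
    then obtain N where N: "(\<integral>y. \<bar>\<theta> N (lmap n k A (\<lambda>j. t * y j) r) - indicator {z. b < z r} (lmap n k A (\<lambda>j. t * y j))\<bar> \<partial>gauss n) < \<epsilon>"
      by (auto simp: eventually_sequentially)
    obtain M where M: "0 \<le> M" "nice n k A M (\<lambda>x. \<theta> N (lmap n k A x r))"
      using nice_arctan[OF True, of n A "real N" "- real N * b - sqrt (real N)"] unfolding \<theta>_def by blast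
    show ?thesis
      by (rule exI[of _ M], rule conjI[OF M(1)], rule exI[of _ "\<lambda>x. \<theta> N (lmap n k A x r)"])
        (use M(2) N \<theta>b in auto)
  qed
qed

lemma apx_borel:
  assumes "S \<in> sets borel"
  shows "apx n k A t S"
proof -
  define \<A> where "\<A> = {S. apx n k A t S}"
  have sa: "sigma_algebra UNIV \<A>"
    unfolding sigma_algebra_iff2 \<A>_def
    by (auto simp: apx_empty Compl_eq_Diff_UNIV[symmetric] intro: apx_compl apx_UN)
  define N where "N = sigma UNIV \<A>"
  have sN: "sets N = \<A>" "space N = UNIV"
    unfolding N_def using sa by (auto simp: sigma_algebra.sigma_sets_eq)
  \<comment> \<open>A map into the product topology is Borel measurable as soon as its coordinates
    are, so measurability of the identity puts every Borel set into \<A>.\<close>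
  have "(\<lambda>z::nat \<Rightarrow> real. z) \<in> borel_measurable N"
  proof (rule borel_measurable_coordI)
    fix r
    show "(\<lambda>z. z r) \<in> borel_measurable N"
      unfolding borel_measurable_iff_greater using apx_halfspace by (auto simp: sN \<A>_def)
  qed
  from measurable_sets[OF this assms] show ?thesis by (simp add: sN \<A>_def)
qed

text \<open>The sum counts the positive integers strictly below u; their number
  \<open>nat (\<lceil>u\<rceil> - 1)\<close> is within 1 of u, also at u = 0.\<close>

lemma layer_count:
  fixes u :: real
  assumes "0 \<le> u" "u \<le> real N"
  shows "\<bar>u - (\<Sum>l=1..N. if real l < u then 1 else 0)\<bar> \<le> 1"
proof -
  have "(\<Sum>l=1..N. if real l < u then 1 else 0::real) = real (card {l\<in>{1..N}. real l < u})"
    by (simp add: sum.If_cases Int_def)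
  moreover have "{l\<in>{1..N}. real l < u} = {1..nat (\<lceil>u\<rceil> - 1)}"
    using assms by (auto simp: less_ceiling_iff) linarith+
  ultimately show ?thesis using assms by (simp) linarith
qed

text \<open>Layer cake: h is within D / N of c plus D / N times the number of levels c + D l / N
  below it. Replacing each level indicator by an approximant between 0 and 1 keeps the result in
  [c, C], which the Gaussian inequality for nice functions requires.\<close>

lemma nice_dense:
  fixes h :: "(nat \<Rightarrow> real) \<Rightarrow> real"
  assumes [measurable]: "h \<in> borel_measurable borel" and h: "\<And>x. c \<le> h x \<and> h x \<le> C" and cC: "c < C" and e: "0 < \<epsilon>"
  shows "\<exists>M\<ge>0. \<exists>\<psi>. nice n k A M \<psi> \<and> (\<forall>x. c \<le> \<psi> x \<and> \<psi> x \<le> C) \<and>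
     (\<integral>y. \<bar>\<psi> (\<lambda>j. t * y j) - h (lmap n k A (\<lambda>j. t * y j))\<bar> \<partial>gauss n) < \<epsilon>"
proof -
  define D where "D = C - c"
  have D: "0 < D" using cC by (simp add: D_def)
  \<comment> \<open>The discretization costs D / N < \<epsilon> / 2, and the N layers, each within
    \<epsilon> / (2 D) and weighted by D / N, cost at most another \<epsilon> / 2.\<close>
  obtain N :: nat where N: "2 * D / \<epsilon> < real N" using reals_Archimedean2 by blast
  have N0: "0 < real N" using N D e by (smt (verit) divide_pos_pos)
  define S where "S l = {z. c + D * real l / real N < h z}" for l
  have [measurable]: "S l \<in> sets borel" for l unfolding S_def by measurable
  let ?P = "\<lambda>l \<phi>. \<exists>M\<ge>0. nice n k A M \<phi> \<and> (\<forall>x. 0 \<le> \<phi> x \<and> \<phi> x \<le> 1) \<and>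
     (\<integral>y. \<bar>\<phi> (\<lambda>j. t * y j) - indicator (S l) (lmap n k A (\<lambda>j. t * y j))\<bar> \<partial>gauss n) < \<epsilon> / (2 * D)"
  have eD: "0 < \<epsilon> / (2 * D)" using e D by simp
  have "\<exists>\<phi>. ?P l \<phi>" for l
  proof -
    have "apx n k A t (S l)" by (rule apx_borel) measurable
    then show ?thesis using eD unfolding apx_def by (elim conjE) (drule spec, drule mp, assumption, elim exE conjE, rule exI, rule exI, intro conjI, assumption+)
  qed
  then have "\<exists>\<phi>. \<forall>l. ?P l (\<phi> l)" by (intro choice allI)
  then obtain \<phi> where \<phi>: "\<forall>l. ?P l (\<phi> l)" by (rule exE)
  have \<phi>n: "\<exists>M\<ge>0. nice n k A M (\<phi> l)" and \<phi>b: "0 \<le> \<phi> l x" "\<phi> l x \<le> 1" and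
    \<phi>i: "(\<integral>y. \<bar>\<phi> l (\<lambda>j. t * y j) - indicator (S l) (lmap n k A (\<lambda>j. t * y j))\<bar> \<partial>gauss n) < \<epsilon> / (2 * D)" for l x
    using spec[OF \<phi>, of l] by (elim exE conjE, blast)+
  have [measurable]: "\<phi> l \<in> borel_measurable borel" for l using \<phi>n[of l] nice_borel by blast
  define Q where "Q x = (\<Sum>l=1..N. \<phi> l x)" for x
  have sn: "\<exists>M\<ge>0. nice n k A M (\<lambda>x. \<Sum>l=1..K. \<phi> l x)" for K
  proof (induction K)
    case 0
    show ?case by (auto intro!: exI[of _ 0] nice_const)
  next
    case (Suc K)
    then obtain M where M: "0 \<le> M" "nice n k A M (\<lambda>x. \<Sum>l=1..K. \<phi> l x)" by blast
    obtain M' where M': "0 \<le> M'" "nice n k A M' (\<phi> (Suc K))" using \<phi>n by blast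
    have "nice n k A ((\<bar>1\<bar> + \<bar>1\<bar>) * (M + M')) (\<lambda>x. 1 * (\<Sum>l=1..K. \<phi> l x) + 1 * \<phi> (Suc K) x)"
      using M M' by (intro nice_lincomb nice_mono[OF M(2)] nice_mono[OF M'(2)]) auto
    then show ?case using M M' by (intro exI[of _ "2 * (M + M')"]) auto
  qed
  then obtain M where M: "0 \<le> M" "nice n k A M Q" unfolding Q_def by blast
  have Qb: "0 \<le> Q x" "Q x \<le> real N" for x
  proof -
    show "0 \<le> Q x" unfolding Q_def using \<phi>b by (intro sum_nonneg) auto
    have "Q x \<le> (\<Sum>l=1..N. 1)" unfolding Q_def using \<phi>b by (intro sum_mono) auto
    then show "Q x \<le> real N" by simp
  qed
  have [measurable]: "Q \<in> borel_measurable borel" unfolding Q_def by measurable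
  define \<psi> where "\<psi> x = c + D / real N * Q x" for x
  have \<psi>b: "c \<le> \<psi> x" "\<psi> x \<le> C" for x
  proof -
    show "c \<le> \<psi> x" unfolding \<psi>_def using Qb D N0 by simp
    have "D / real N * Q x \<le> D / real N * real N" using Qb D N0 by (intro mult_left_mono) auto
    then show "\<psi> x \<le> C" unfolding \<psi>_def using N0 by (simp add: D_def)
  qed
  have "nice n k A ((\<bar>1\<bar> + \<bar>D / real N\<bar>) * M) (\<lambda>x. 1 * c + D / real N * Q x)"
    using M by (intro nice_lincomb nice_const)
  then have \<psi>n: "nice n k A ((1 + \<bar>D / real N\<bar>) * M) \<psi>" unfolding \<psi>_def by simp
  note [measurable] = nice_borel[OF \<psi>n]
  have hm: "\<bar>h x\<bar> \<le> \<bar>c\<bar> + \<bar>C\<bar>" for x using h[of x] by linarith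
  have \<psi>m: "\<bar>\<psi> x\<bar> \<le> \<bar>c\<bar> + \<bar>C\<bar>" for x using \<psi>b[of x] by linarith
  define Z where "Z l y = \<bar>\<phi> l (\<lambda>j. t * y j) - indicator (S l) (lmap n k A (\<lambda>j. t * y j))\<bar>" for l y
  have Zi: "integrable (gauss n) (Z l)" for l
    unfolding Z_def using \<phi>b by (intro apx_integrable[where C=1]) auto
  have Zs: "integrable (gauss n) (\<lambda>y. \<Sum>l=1..N. Z l y)" by (intro Bochner_Integration.integrable_sum Zi)
  have pt: "\<bar>\<psi> (\<lambda>j. t * y j) - h (lmap n k A (\<lambda>j. t * y j))\<bar> \<le> D / real N * (\<Sum>l=1..N. Z l y) + D / real N" for y
  proof -
    define z where "z = lmap n k A (\<lambda>j. t * y j)"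
    define u where "u = (h z - c) * real N / D"
    have u: "0 \<le> u" "u \<le> real N"
    proof -
      show "0 \<le> u" unfolding u_def using h[of z] D by simp
      have "(h z - c) * real N \<le> D * real N" using h[of z] by (intro mult_right_mono) (auto simp: D_def)
      then show "u \<le> real N" unfolding u_def using D by (simp add: divide_le_eq mult.commute)
    qed
    have ind: "indicator (S l) z = (if real l < u then 1 else 0::real)" for l
      unfolding S_def u_def using D N0 by (auto simp: indicator_def field_simps)
    have 1: "\<bar>u - (\<Sum>l=1..N. indicator (S l) z)\<bar> \<le> 1"
      unfolding ind by (rule layer_count[OF u])
    have 2: "\<bar>Q (\<lambda>j. t * y j) - (\<Sum>l=1..N. indicator (S l) z)\<bar> \<le> (\<Sum>l=1..N. Z l y)"
      unfolding Q_def Z_def z_def sum_subtractf[symmetric] by (rule sum_abs)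
    have 3: "\<bar>Q (\<lambda>j. t * y j) - u\<bar> \<le> (\<Sum>l=1..N. Z l y) + 1" using 1 2 by linarith
    have "h z = c + D / real N * u" unfolding u_def using D N0 by simp
    then have "\<psi> (\<lambda>j. t * y j) - h z = D / real N * (Q (\<lambda>j. t * y j) - u)"
      unfolding \<psi>_def by (simp add: right_diff_distrib)
    then have "\<bar>\<psi> (\<lambda>j. t * y j) - h z\<bar> = D / real N * \<bar>Q (\<lambda>j. t * y j) - u\<bar>"
      using D N0 by (simp add: abs_mult)
    also have "\<dots> \<le> D / real N * ((\<Sum>l=1..N. Z l y) + 1)"
      using 3 D N0 by (intro mult_left_mono) auto
    finally show ?thesis by (simp add: z_def distrib_left)
  qed
  have "(\<integral>y. \<bar>\<psi> (\<lambda>j. t * y j) - h (lmap n k A (\<lambda>j. t * y j))\<bar> \<partial>gauss n) \<le> (\<integral>y. D / real N * (\<Sum>l=1..N. Z l y) + D / real N \<partial>gauss n)"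
  proof (rule integral_mono[OF _ _ pt])
    show "integrable (gauss n) (\<lambda>y. \<bar>\<psi> (\<lambda>j. t * y j) - h (lmap n k A (\<lambda>j. t * y j))\<bar>)"
      by (rule apx_integrable[OF _ _ \<psi>m hm]) measurable
  qed (use Zs in auto)
  also have "\<dots> = D / real N * (\<Sum>l=1..N. \<integral>y. Z l y \<partial>gauss n) + D / real N"
    using Zs Zi G.prob_space by (simp add: Bochner_Integration.integral_sum)
  also have "\<dots> \<le> D / real N * (\<Sum>l=1..N. \<epsilon> / (2 * D)) + D / real N"
    using \<phi>i D N0 unfolding Z_def by (intro add_mono mult_left_mono sum_mono) (auto intro: less_imp_le)
  also have "\<dots> = \<epsilon> / 2 + D / real N" using D N0 by simp
  also have "\<dots> < \<epsilon>" using N N0 e D by (simp add: field_simps)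
  finally have "(\<integral>y. \<bar>\<psi> (\<lambda>j. t * y j) - h (lmap n k A (\<lambda>j. t * y j))\<bar> \<partial>gauss n) < \<epsilon>" .
  moreover have "0 \<le> (1 + \<bar>D / real N\<bar>) * M" using M by simp
  ultimately show ?thesis using \<psi>n \<psi>b by blast
qed

section \<open>Extension to bounded measurable functions\<close>

lemma powr_lipschitz:
  fixes c C u w a :: real
  assumes c: "0 < c" and u: "c \<le> u" "u \<le> C" and w: "c \<le> w" "w \<le> C"
  shows "\<bar>u powr a - w powr a\<bar> \<le> \<bar>a\<bar> * (c powr (a - 1) + C powr (a - 1)) * \<bar>u - w\<bar>"
proof -
  have "norm (u powr a - w powr a) \<le> \<bar>a\<bar> * (c powr (a - 1) + C powr (a - 1)) * norm (u - w)"
  proof (rule field_differentiable_bound[where S="{c..C}" and f="\<lambda>x. x powr a" and f'="\<lambda>x. a * x powr (a - 1)"])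
    fix z assume z: "z \<in> {c..C}"
    then show "((\<lambda>x. x powr a) has_field_derivative a * z powr (a - 1)) (at z within {c..C})"
      using c by (auto intro!: derivative_eq_intros)
    show "norm (a * z powr (a - 1)) \<le> \<bar>a\<bar> * (c powr (a - 1) + C powr (a - 1))"
      using powr_between[of c z C "a - 1"] z c by (simp add: abs_mult mult_left_mono)
  qed (use u w in auto)
  then show ?thesis by simp
qed

text \<open>Telescoping over the factors. This is how an L1 error in the functions passes to both
  sides of the Gaussian inequality.\<close>

lemma Phi_lipschitz:
  assumes c: "0 < c"
  shows "\<exists>L\<ge>0. \<forall>u w. (\<forall>i<m. c \<le> u i \<and> u i \<le> C \<and> c \<le> w i \<and> w i \<le> C) \<longrightarrow>
    \<bar>Phi m a u - Phi m a w\<bar> \<le> L * (\<Sum>i<m. \<bar>u i - w i\<bar>)"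
proof (induction m)
  case 0
  show ?case by (auto simp: Phi_def)
next
  case (Suc m)
  then obtain L where L: "0 \<le> L" "\<And>u w. (\<forall>i<m. c \<le> u i \<and> u i \<le> C \<and> c \<le> w i \<and> w i \<le> C) \<Longrightarrow>
    \<bar>Phi m a u - Phi m a w\<bar> \<le> L * (\<Sum>i<m. \<bar>u i - w i\<bar>)" by blast
  define B where "B = (\<Prod>i<m. c powr a i + C powr a i)"
  define l where "l = \<bar>a m\<bar> * (c powr (a m - 1) + C powr (a m - 1))"
  define b where "b = c powr a m + C powr a m"
  have nn: "0 \<le> B" "0 \<le> l" "0 \<le> b" by (auto simp: B_def l_def b_def intro!: prod_nonneg)
  show ?case
  proof (intro exI[of _ "B * l + L * b"] conjI allI impI)
    show "0 \<le> B * l + L * b" using nn L by simp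
    fix u w assume uw: "\<forall>i<Suc m. c \<le> u i \<and> u i \<le> C \<and> c \<le> w i \<and> w i \<le> C"
    let ?S = "\<Sum>i<m. \<bar>u i - w i\<bar>"
    have S: "0 \<le> ?S" by (simp add: sum_nonneg)
    have 1: "\<bar>Phi m a u - Phi m a w\<bar> \<le> L * ?S" using L(2) uw by auto
    have 2: "\<bar>u m powr a m - w m powr a m\<bar> \<le> l * \<bar>u m - w m\<bar>"
      unfolding l_def using uw c by (intro powr_lipschitz) auto
    have 3: "\<bar>w m powr a m\<bar> \<le> b" unfolding b_def using powr_between[of c "w m" C "a m"] uw c by simp
    have 4: "\<bar>Phi m a u\<bar> \<le> B"
      unfolding B_def using Phi_bounded[of c m u C a] Phi_nonneg[of m a u] uw c by simp
    have e: "Phi (Suc m) a u - Phi (Suc m) a w = Phi m a u * (u m powr a m - w m powr a m) + (Phi m a u - Phi m a w) * w m powr a m"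
      unfolding Phi_def by (simp add: algebra_simps)
    have "\<bar>Phi m a u * (u m powr a m - w m powr a m)\<bar> \<le> B * (l * \<bar>u m - w m\<bar>)"
      unfolding abs_mult by (rule mult_mono[OF 4 2 nn(1) abs_ge_zero])
    moreover have "\<bar>(Phi m a u - Phi m a w) * w m powr a m\<bar> \<le> (L * ?S) * b"
      unfolding abs_mult by (rule mult_mono[OF 1 3 _ abs_ge_zero]) (use L S in auto)
    ultimately have "\<bar>Phi (Suc m) a u - Phi (Suc m) a w\<bar> \<le> B * (l * \<bar>u m - w m\<bar>) + (L * ?S) * b"
      unfolding e by (rule order_trans[OF abs_triangle_ineq add_mono])
    also have "\<dots> \<le> (B * l) * (?S + \<bar>u m - w m\<bar>) + (L * b) * (?S + \<bar>u m - w m\<bar>)"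
    proof (rule add_mono)
      show "B * (l * \<bar>u m - w m\<bar>) \<le> (B * l) * (?S + \<bar>u m - w m\<bar>)"
        unfolding mult.assoc[symmetric] using nn S by (intro mult_left_mono) auto
      have "(L * b) * ?S \<le> (L * b) * (?S + \<bar>u m - w m\<bar>)"
        using nn L by (intro mult_left_mono) auto
      then show "(L * ?S) * b \<le> (L * b) * (?S + \<bar>u m - w m\<bar>)" by (simp only: mult_ac)
    qed
    also have "\<dots> = (B * l + L * b) * (\<Sum>i<Suc m. \<bar>u i - w i\<bar>)"
      by (simp only: distrib_right sum.lessThan_Suc)
    finally show "\<bar>Phi (Suc m) a u - Phi (Suc m) a w\<bar> \<le> (B * l + L * b) * (\<Sum>i<Suc m. \<bar>u i - w i\<bar>)" .
  qed
qed

lemma gauss_integral_abs_diff: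
  fixes f g :: "(nat \<Rightarrow> real) \<Rightarrow> real"
  assumes "integrable (gauss n) f" "integrable (gauss n) g"
  shows "\<bar>(\<integral>y. f y \<partial>gauss n) - (\<integral>y. g y \<partial>gauss n)\<bar> \<le> (\<integral>y. \<bar>f y - g y\<bar> \<partial>gauss n)"
  unfolding Bochner_Integration.integral_diff[OF assms, symmetric] by (rule integral_abs_bound)

lemma gaussian_bounded:
  fixes h :: "nat \<Rightarrow> (nat \<Rightarrow> real) \<Rightarrow> real"
  assumes c: "0 < c" "c < C" and \<sigma>: "\<bar>\<sigma>\<bar> = (1::real)"
    and Q: "\<And>e. \<sigma> * QF n m k A a e \<le> 0"
    and hm: "\<And>i. i < m \<Longrightarrow> h i \<in> borel_measurable borel" and hb: "\<And>i y. i < m \<Longrightarrow> c \<le> h i y \<and> h i y \<le> C"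
    and t: "0 \<le> t"
  shows "\<sigma> * ((\<integral>y. Phi m a (\<lambda>i. h i (lmap n (k i) (A i) (\<lambda>j. t * y j))) \<partial>gauss n)
     - Phi m a (\<lambda>i. \<integral>y. h i (lmap n (k i) (A i) (\<lambda>j. t * y j)) \<partial>gauss n)) \<le> 0"
proof -
  define u where "u i y = h i (lmap n (k i) (A i) (\<lambda>j. t * y j))" for i y
  have um: "u i \<in> borel_measurable borel" if "i < m" for i
    unfolding u_def using hm[OF that] by measurable
  have ub: "c \<le> u i y" "u i y \<le> C" if "i < m" for i y using hb[OF that] by (auto simp: u_def)
  have abs_u: "\<bar>u i y\<bar> \<le> C" if "i < m" for i y using ub[OF that, of y] c by linarith
  have ui: "integrable (gauss n) (u i)" if "i < m" for i
    using um[OF that] abs_u[OF that] by (intro G.integrable_const_bound[where B=C]) auto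
  obtain L where L: "0 \<le> L" "\<And>u w. (\<forall>i<m. c \<le> u i \<and> u i \<le> C \<and> c \<le> w i \<and> w i \<le> C) \<Longrightarrow>
    \<bar>Phi m a u - Phi m a w\<bar> \<le> L * (\<Sum>i<m. \<bar>u i - w i\<bar>)" using Phi_lipschitz[OF c(1)] by blast
  define B where "B = (\<Prod>i<m. c powr a i + C powr a i)"
  let ?D = "\<sigma> * ((\<integral>y. Phi m a (\<lambda>i. u i y) \<partial>gauss n) - Phi m a (\<lambda>i. \<integral>y. u i y \<partial>gauss n))"
  \<comment> \<open>Each of the two terms moves by at most \<open>L * real m * \<epsilon>\<close>
    when the functions are replaced by their approximants.\<close>
  have "?D \<le> 2 * L * real m * \<epsilon>" if e: "0 < \<epsilon>" for \<epsilon>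
  proof -
    let ?P = "\<lambda>i \<psi>. \<exists>M\<ge>0. nice n (k i) (A i) M \<psi> \<and> (\<forall>x. c \<le> \<psi> x \<and> \<psi> x \<le> C) \<and>
     (\<integral>y. \<bar>\<psi> (\<lambda>j. t * y j) - u i y\<bar> \<partial>gauss n) < \<epsilon>"
    have ex0: "\<exists>\<psi>. ?P i \<psi>" if "i < m" for i
      using nice_dense[OF hm[OF that] hb[OF that] c(2) e, of n "k i" "A i" t] unfolding u_def
      by (elim exE conjE) (rule exI, rule exI, intro conjI, assumption+)
    have "\<exists>\<psi>. i < m \<longrightarrow> ?P i \<psi>" for i
    proof (cases "i < m")
      case True
      from ex0[OF this] obtain \<psi> where "?P i \<psi>" by (rule exE)
      then show ?thesis by (intro exI[of _ \<psi>] impI)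
    qed auto
    then have "\<exists>\<psi>. \<forall>i. i < m \<longrightarrow> ?P i (\<psi> i)" by (intro choice allI)
    then obtain \<psi> where \<psi>: "\<forall>i. i < m \<longrightarrow> ?P i (\<psi> i)" by (rule exE)
    have \<psi>': "?P i (\<psi> i)" if "i < m" for i by (rule mp[OF spec[OF \<psi>] that])
    have \<psi>b: "c \<le> \<psi> i x" "\<psi> i x \<le> C" if "i < m" for i x using \<psi>'[OF that] by (elim exE conjE, blast)+
    have \<psi>e: "(\<integral>y. \<bar>\<psi> i (\<lambda>j. t * y j) - u i y\<bar> \<partial>gauss n) < \<epsilon>" if "i < m" for i
      using \<psi>'[OF that] by (elim exE conjE)
    have "\<exists>M. i < m \<longrightarrow> 0 \<le> M \<and> nice n (k i) (A i) M (\<psi> i)" for i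
    proof (cases "i < m")
      case True
      from \<psi>'[OF this] show ?thesis by (elim exE conjE) (rule exI, intro impI conjI, assumption+)
    qed auto
    then have "\<exists>M. \<forall>i. i < m \<longrightarrow> 0 \<le> M i \<and> nice n (k i) (A i) (M i) (\<psi> i)" by (intro choice allI)
    then obtain M where M: "\<And>i. i < m \<Longrightarrow> 0 \<le> M i" "\<And>i. i < m \<Longrightarrow> nice n (k i) (A i) (M i) (\<psi> i)" by blast
    \<comment> \<open>The approximants come with different constants, whereas
      \<open>gaussian_nice\<close> takes one for all of them.\<close>
    define MM where "MM = (\<Sum>i<m. M i)"
    have "M i \<le> MM" if "i < m" for i unfolding MM_def using that M(1) by (intro member_le_sum) auto
    then have \<psi>n: "nice n (k i) (A i) MM (\<psi> i)" if "i < m" for i using nice_mono[OF M(2)] that by blast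
    have MM0: "0 \<le> MM" unfolding MM_def using M(1) by (intro sum_nonneg) auto
    define v where "v i y = \<psi> i (\<lambda>j. t * y j)" for i y
    have vm: "v i \<in> borel_measurable borel" if "i < m" for i
      unfolding v_def using nice_borel[OF \<psi>n[OF that]] by measurable
    have vb: "c \<le> v i y" "v i y \<le> C" if "i < m" for i y using \<psi>b[OF that] by (auto simp: v_def)
    have abs_v: "\<bar>v i y\<bar> \<le> C" if "i < m" for i y using vb[OF that, of y] c by linarith
    have vi: "integrable (gauss n) (v i)" if "i < m" for i
      using vm[OF that] abs_v[OF that] by (intro G.integrable_const_bound[where B=C]) auto
    have main: "\<sigma> * ((\<integral>y. Phi m a (\<lambda>i. v i y) \<partial>gauss n) - Phi m a (\<lambda>i. \<integral>y. v i y \<partial>gauss n)) \<le> 0"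
      unfolding v_def using \<psi>b by (intro gaussian_nice[OF c(1) less_imp_le[OF c(2)] MM0 \<sigma> Q \<psi>n _ t]) auto
    have Pi: "integrable (gauss n) (\<lambda>y. Phi m a (\<lambda>i. z i y))" if "\<And>i. i < m \<Longrightarrow> z i \<in> borel_measurable borel" "\<And>i y. i < m \<Longrightarrow> c \<le> z i y \<and> z i y \<le> C" for z
    proof (rule G.integrable_const_bound)
      show "AE y in gauss n. norm (Phi m a (\<lambda>i. z i y)) \<le> B"
        unfolding B_def using that(2) c(1) by (intro AE_I2) (simp add: Phi_nonneg Phi_bounded)
      show "(\<lambda>y. Phi m a (\<lambda>i. z i y)) \<in> borel_measurable (gauss n)"
        using that(1) by measurable
    qed
    have Pu: "integrable (gauss n) (\<lambda>y. Phi m a (\<lambda>i. u i y))" using um ub by (intro Pi) auto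
    have Pv: "integrable (gauss n) (\<lambda>y. Phi m a (\<lambda>i. v i y))" using vm vb by (intro Pi) auto
    have di: "integrable (gauss n) (\<lambda>y. \<bar>u i y - v i y\<bar>)" if "i < m" for i
      using ui[OF that] vi[OF that] by auto
    have de: "(\<integral>y. \<bar>u i y - v i y\<bar> \<partial>gauss n) \<le> \<epsilon>" if "i < m" for i
      using \<psi>e[OF that] unfolding v_def by (simp add: abs_minus_commute)
    have 1: "\<bar>(\<integral>y. Phi m a (\<lambda>i. u i y) \<partial>gauss n) - (\<integral>y. Phi m a (\<lambda>i. v i y) \<partial>gauss n)\<bar> \<le> L * (real m * \<epsilon>)"
    proof -
      have "\<bar>(\<integral>y. Phi m a (\<lambda>i. u i y) \<partial>gauss n) - (\<integral>y. Phi m a (\<lambda>i. v i y) \<partial>gauss n)\<bar> \<le> 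
        (\<integral>y. \<bar>Phi m a (\<lambda>i. u i y) - Phi m a (\<lambda>i. v i y)\<bar> \<partial>gauss n)"
        by (rule gauss_integral_abs_diff[OF Pu Pv])
      also have "\<dots> \<le> (\<integral>y. L * (\<Sum>i<m. \<bar>u i y - v i y\<bar>) \<partial>gauss n)"
      proof (rule integral_mono)
        show "integrable (gauss n) (\<lambda>y. \<bar>Phi m a (\<lambda>i. u i y) - Phi m a (\<lambda>i. v i y)\<bar>)" using Pu Pv by auto
        show "integrable (gauss n) (\<lambda>y. L * (\<Sum>i<m. \<bar>u i y - v i y\<bar>))"
          using di by (intro integrable_mult_right Bochner_Integration.integrable_sum) auto
        show "\<bar>Phi m a (\<lambda>i. u i y) - Phi m a (\<lambda>i. v i y)\<bar> \<le> L * (\<Sum>i<m. \<bar>u i y - v i y\<bar>)" for y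
          using ub vb by (intro L(2)) auto
      qed
      also have "\<dots> = L * (\<Sum>i<m. \<integral>y. \<bar>u i y - v i y\<bar> \<partial>gauss n)"
        using di by (subst integral_mult_right_zero, subst Bochner_Integration.integral_sum) auto
      also have "\<dots> \<le> L * (\<Sum>i<m. \<epsilon>)" using de L(1) by (intro mult_left_mono sum_mono) auto
      finally show ?thesis by simp
    qed
    have 2: "\<bar>Phi m a (\<lambda>i. \<integral>y. u i y \<partial>gauss n) - Phi m a (\<lambda>i. \<integral>y. v i y \<partial>gauss n)\<bar> \<le> L * (real m * \<epsilon>)"
    proof -
      have "\<bar>Phi m a (\<lambda>i. \<integral>y. u i y \<partial>gauss n) - Phi m a (\<lambda>i. \<integral>y. v i y \<partial>gauss n)\<bar> \<le> 
        L * (\<Sum>i<m. \<bar>(\<integral>y. u i y \<partial>gauss n) - (\<integral>y. v i y \<partial>gauss n)\<bar>)"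
        using ub vb ui vi by (intro L(2)) (auto intro!: G.integral_ge_const G.integral_le_const)
      also have "\<dots> \<le> L * (\<Sum>i<m. \<epsilon>)"
        using L(1) by (intro mult_left_mono sum_mono order_trans[OF gauss_integral_abs_diff de] ui vi) auto
      finally show ?thesis by simp
    qed
    have aux: "\<sigma> * (x - y) \<le> 2 * z" if "\<bar>x - x'\<bar> \<le> z" "\<bar>y - y'\<bar> \<le> z" "\<sigma> * (x' - y') \<le> 0" for x y x' y' z
    proof -
      have "\<sigma> = 1 \<or> \<sigma> = -1" using \<sigma> by linarith
      then show ?thesis using that by (elim disjE) auto
    qed
    show ?thesis using aux[OF 1 2 main] by (simp only: mult.assoc)
  qed
  note D = this
  have "?D \<le> 0"
  proof (rule field_le_epsilon)
    fix e :: real assume e: "0 < e"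
    \<comment> \<open>The summand 1 avoids a division by 0 when L or m vanishes.\<close>
    define \<epsilon> where "\<epsilon> = e / (2 * L * real m + 1)"
    have p: "0 < 2 * L * real m + 1" using L(1) by (simp add: add_nonneg_pos)
    have "0 < \<epsilon>" unfolding \<epsilon>_def using e p by (rule divide_pos_pos)
    then have "?D \<le> 2 * L * real m * \<epsilon>" by (rule D)
    also have "\<dots> \<le> (2 * L * real m + 1) * \<epsilon>" using e p by (intro mult_right_mono) (auto simp: \<epsilon>_def)
    also have "\<dots> = e" using p by (simp add: \<epsilon>_def)
    finally show "?D \<le> 0 + e" by simp
  qed
  then show ?thesis unfolding u_def .
qed

section \<open>Removal of the bounds by truncation\<close>

definition trunc :: "nat \<Rightarrow> real \<Rightarrow> real" where
  "trunc N x = max (1 / real (Suc N)) (min (real (Suc N)) x)"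

lemma trunc_measurable [measurable]: "trunc N \<in> borel_measurable borel"
  unfolding trunc_def by measurable

lemma trunc_bounds: "1 / real (Suc N) \<le> trunc N x" "trunc N x \<le> real (Suc N)"
proof -
  have "1 / real (Suc N) \<le> 1" by simp
  then have "1 / real (Suc N) \<le> real (Suc N)" by linarith
  then show "1 / real (Suc N) \<le> trunc N x" "trunc N x \<le> real (Suc N)" by (auto simp: trunc_def)
qed

lemma trunc_le:
  assumes "0 \<le> x"
  shows "trunc N x \<le> x + 1 / real (Suc N)"
proof -
  have "0 < 1 / real (Suc N)" by simp
  then show ?thesis using assms unfolding trunc_def max_def min_def by (smt (verit))
qed

lemma trunc_tendsto:
  assumes "0 \<le> x"
  shows "(\<lambda>N. trunc N x) \<longlonglongrightarrow> x"
proof -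
  have "(\<lambda>N. max (1 / real (Suc N)) x) \<longlonglongrightarrow> max 0 x"
    by (intro tendsto_intros LIMSEQ_inverse_real_of_nat[unfolded inverse_eq_divide])
  moreover have "eventually (\<lambda>N. max (1 / real (Suc N)) x = trunc N x) sequentially"
  proof -
    obtain N0 :: nat where "x < real N0" using reals_Archimedean2 by blast
    then show ?thesis
      by (intro eventually_sequentiallyI[of N0]) (auto simp: trunc_def min_def)
  qed
  ultimately show ?thesis using assms Lim_transform_eventually by fastforce
qed

lemma Phi_tendsto:
  assumes "\<And>i. i < m \<Longrightarrow> (\<lambda>N. u N i) \<longlonglongrightarrow> w i" 
    and "\<And>i. i < m \<Longrightarrow> 0 < w i \<or> (0 < a i \<and> (\<forall>N. 0 \<le> u N i))"
  shows "(\<lambda>N. Phi m a (u N)) \<longlonglongrightarrow> Phi m a w"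
  unfolding Phi_def
proof (rule tendsto_prod)
  fix i assume "i \<in> {..<m}"
  then have i: "i < m" by simp
  show "(\<lambda>N. u N i powr a i) \<longlonglongrightarrow> w i powr a i"
    using assms(1)[OF i] assms(2)[OF i] by (intro tendsto_powr') (auto intro!: tendsto_const always_eventually)
qed

text \<open>Truncation to [1 / (N + 1), N + 1] raises a mean by at most 1 / (N + 1). With positive
  exponents this controls the right side, and Fatou's lemma carries the left side to the
  limit.\<close>

lemma gaussian_upper:
  fixes h :: "nat \<Rightarrow> (nat \<Rightarrow> real) \<Rightarrow> real"
  assumes Q: "\<And>e. QF n m k A a e \<le> 0" and a: "\<And>i. i < m \<Longrightarrow> 0 < a i"
    and hm: "\<And>i. i < m \<Longrightarrow> h i \<in> borel_measurable borel" and h0: "\<And>i y. i < m \<Longrightarrow> 0 \<le> h i y"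
    and hi: "\<And>i. i < m \<Longrightarrow> integrable (gauss n) (\<lambda>y. h i (lmap n (k i) (A i) (\<lambda>j. t * y j)))"
    and t: "0 \<le> t"
  shows "(\<integral>\<^sup>+y. ennreal (Phi m a (\<lambda>i. h i (lmap n (k i) (A i) (\<lambda>j. t * y j)))) \<partial>gauss n)
     \<le> ennreal (Phi m a (\<lambda>i. \<integral>y. h i (lmap n (k i) (A i) (\<lambda>j. t * y j)) \<partial>gauss n))"
proof -
  define u where "u i y = h i (lmap n (k i) (A i) (\<lambda>j. t * y j))" for i y
  have um [measurable]: "u i \<in> borel_measurable borel" if "i < m" for i
    unfolding u_def using hm[OF that] by measurable
  have u0: "0 \<le> u i y" if "i < m" for i y using h0[OF that] by (simp add: u_def)
  have ui: "integrable (gauss n) (u i)" if "i < m" for i using hi[OF that] unfolding u_def .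
  define e where "e i = (\<integral>y. u i y \<partial>gauss n)" for i
  have e0: "0 \<le> e i" if "i < m" for i unfolding e_def using u0[OF that] by (simp add: Bochner_Integration.integral_nonneg)
  define v where "v N i y = trunc N (u i y)" for N i y
  have vm: "v N i \<in> borel_measurable borel" if "i < m" for N i
    unfolding v_def using um[OF that] by measurable
  have vb: "1 / real (Suc N) \<le> v N i y" "v N i y \<le> real (Suc N)" for N i y
    unfolding v_def by (rule trunc_bounds)+
  have v_pos: "0 < v N i y" for N i y using vb(1)[of N i y] by (meson less_le_trans of_nat_0_less_iff zero_less_Suc zero_less_divide_1_iff)
  have vi: "integrable (gauss n) (v N i)" if "i < m" for N i
    using vm[OF that] vb(2) v_pos by (intro G.integrable_const_bound[where B="real (Suc N)"]) (auto simp: less_imp_le abs_of_pos)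
  \<comment> \<open>For \<open>N = 0\<close> both truncation levels are 1, while
    \<open>gaussian_bounded\<close> asks for c < C.\<close>
  have bound: "(\<integral>\<^sup>+y. ennreal (Phi m a (\<lambda>i. v N i y)) \<partial>gauss n) \<le> ennreal (Phi m a (\<lambda>i. e i + 1 / real (Suc N)))" if N: "1 \<le> N" for N
  proof -
    let ?c = "1 / real (Suc N)" and ?C = "real (Suc N)"
    have c: "0 < ?c" by simp
    have "?c < 1" using N by simp
    moreover have "1 < ?C" using N by simp
    ultimately have cC: "?c < ?C" by linarith
    have "1 * ((\<integral>y. Phi m a (\<lambda>i. v N i y) \<partial>gauss n) - Phi m a (\<lambda>i. \<integral>y. v N i y \<partial>gauss n)) \<le> 0"
      unfolding v_def u_def
      by (rule gaussian_bounded[where c="?c" and C="?C" and h="\<lambda>i z. trunc N (h i z)", OF c cC _ _ _ _ t])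
        (use Q hm trunc_bounds in auto)
    then have 1: "(\<integral>y. Phi m a (\<lambda>i. v N i y) \<partial>gauss n) \<le> Phi m a (\<lambda>i. \<integral>y. v N i y \<partial>gauss n)" by simp
    have "(\<integral>\<^sup>+y. ennreal (Phi m a (\<lambda>i. v N i y)) \<partial>gauss n) = ennreal (\<integral>y. Phi m a (\<lambda>i. v N i y) \<partial>gauss n)"
    proof (rule nn_integral_eq_integral)
      show "integrable (gauss n) (\<lambda>y. Phi m a (\<lambda>i. v N i y))"
      proof (rule G.integrable_const_bound)
        show "AE y in gauss n. norm (Phi m a (\<lambda>i. v N i y)) \<le> (\<Prod>i<m. ?c powr a i + ?C powr a i)"
          using vb by (intro AE_I2) (simp add: Phi_nonneg Phi_bounded)
      qed (use vm in measurable)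
    qed (simp add: Phi_nonneg)
    also have "\<dots> \<le> ennreal (Phi m a (\<lambda>i. e i + ?c))"
    proof (rule ennreal_leI, rule order_trans[OF 1])
      show "Phi m a (\<lambda>i. \<integral>y. v N i y \<partial>gauss n) \<le> Phi m a (\<lambda>i. e i + ?c)"
        unfolding Phi_def
      proof (rule prod_mono, intro conjI powr_mono2)
        fix i assume "i \<in> {..<m}"
        then have i: "i < m" by simp
        show "0 \<le> a i" using a[OF i] by simp
        show "0 \<le> (\<integral>y. v N i y \<partial>gauss n)" using v_pos by (intro Bochner_Integration.integral_nonneg) (simp add: less_imp_le)
        have "(\<integral>y. v N i y \<partial>gauss n) \<le> (\<integral>y. u i y + ?c \<partial>gauss n)"
        proof (rule integral_mono[OF vi[OF i]])
          show "integrable (gauss n) (\<lambda>y. u i y + ?c)" using ui[OF i] by auto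
          show "v N i y \<le> u i y + ?c" for y unfolding v_def by (rule trunc_le[OF u0[OF i]])
        qed
        also have "\<dots> = e i + ?c" using ui[OF i] G.prob_space by (simp add: e_def)
        finally show "(\<integral>y. v N i y \<partial>gauss n) \<le> e i + ?c" .
      qed simp
    qed
    finally show ?thesis .
  qed
  have lim1: "(\<lambda>N. Phi m a (\<lambda>i. v N i y)) \<longlonglongrightarrow> Phi m a (\<lambda>i. u i y)" for y
  proof (rule Phi_tendsto)
    fix i assume i: "i < m"
    show "(\<lambda>N. v N i y) \<longlonglongrightarrow> u i y" unfolding v_def by (rule trunc_tendsto[OF u0[OF i]])
    show "0 < u i y \<or> (0 < a i \<and> (\<forall>N. 0 \<le> v N i y))" using a[OF i] v_pos by (simp add: less_imp_le)
  qed
  have lim2: "(\<lambda>N. Phi m a (\<lambda>i. e i + 1 / real (Suc N))) \<longlonglongrightarrow> Phi m a e"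
  proof (rule Phi_tendsto)
    fix i assume i: "i < m"
    have "(\<lambda>N. e i + 1 / real (Suc N)) \<longlonglongrightarrow> e i + 0"
      by (intro tendsto_intros LIMSEQ_inverse_real_of_nat[unfolded inverse_eq_divide])
    then show "(\<lambda>N. e i + 1 / real (Suc N)) \<longlonglongrightarrow> e i" by simp
    show "0 < e i \<or> (0 < a i \<and> (\<forall>N. 0 \<le> e i + 1 / real (Suc N)))" using a[OF i] e0[OF i] by simp
  qed
  have "(\<integral>\<^sup>+y. ennreal (Phi m a (\<lambda>i. u i y)) \<partial>gauss n) = (\<integral>\<^sup>+y. liminf (\<lambda>N. ennreal (Phi m a (\<lambda>i. v N i y))) \<partial>gauss n)"
    using lim1 by (intro nn_integral_cong lim_imp_Liminf[symmetric] tendsto_ennrealI) auto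
  also have "\<dots> \<le> liminf (\<lambda>N. \<integral>\<^sup>+y. ennreal (Phi m a (\<lambda>i. v N i y)) \<partial>gauss n)"
    using vm by (intro nn_integral_liminf) measurable
  also have "\<dots> \<le> liminf (\<lambda>N. ennreal (Phi m a (\<lambda>i. e i + 1 / real (Suc N))))"
    using bound by (intro Liminf_mono eventually_sequentiallyI[of 1])
  also have "\<dots> = ennreal (Phi m a e)"
    using lim2 by (intro lim_imp_Liminf tendsto_ennrealI) auto
  finally show ?thesis unfolding u_def e_def .
qed

text \<open>The cut depends on the sign of the exponent, from above for a positive one and from
  below for a negative one. Either way it can only lower the power of a positive x, and it bounds
  that power.\<close>

definition htrunc :: "nat \<Rightarrow> real \<Rightarrow> real \<Rightarrow> real" where
  "htrunc N b x = (if 0 < b then min (real (Suc N)) x else max (1 / real (Suc N)) x)"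

lemma htrunc_measurable [measurable]: "htrunc N b \<in> borel_measurable borel"
  unfolding htrunc_def by measurable

lemma htrunc_tendsto:
  assumes "0 \<le> x"
  shows "(\<lambda>N. htrunc N b x) \<longlonglongrightarrow> x"
proof (cases "0 < b")
  case True
  obtain N0 :: nat where "x < real N0" using reals_Archimedean2 by blast
  then have "eventually (\<lambda>N. htrunc N b x = x) sequentially"
    using True by (intro eventually_sequentiallyI[of N0]) (auto simp: htrunc_def min_def)
  then show ?thesis by (rule tendsto_eventually)
next
  case False
  have "(\<lambda>N. max (1 / real (Suc N)) x) \<longlonglongrightarrow> max 0 x"
    by (intro tendsto_intros LIMSEQ_inverse_real_of_nat[unfolded inverse_eq_divide])
  then show ?thesis using False assms by (simp add: htrunc_def)
qed

lemma htrunc_abs_le: "0 \<le> x \<Longrightarrow> 0 \<le> htrunc N b x \<and> htrunc N b x \<le> x + 1"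
  by (auto simp: htrunc_def max_def min_def) (smt (verit) divide_le_eq_1 of_nat_Suc of_nat_0_le_iff)+

text \<open>Positivity matters for b < 0: \<open>0 powr b\<close> is 0 and would be smaller than the
  power of the cut value.\<close>

lemma htrunc_powr_le:
  assumes "0 \<le> x" "b < 0 \<Longrightarrow> 0 < x" "b \<noteq> 0"
  shows "htrunc N b x powr b \<le> x powr b"
proof (cases "0 < b")
  case True
  then show ?thesis using assms by (intro powr_mono2) (auto simp: htrunc_def)
next
  case False
  then have "b < 0" using assms by simp
  then show ?thesis using assms by (intro powr_mono2') (auto simp: htrunc_def)
qed

text \<open>The bound is free of K: it is the dominating constant for the limit over K in
  \<open>gaussian_lower\<close>.\<close>

lemma trunc_htrunc_powr_le:
  assumes "0 \<le> x"
  shows "trunc K (htrunc N b x) powr b \<le> real (Suc N) powr \<bar>b\<bar>"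
proof -
  have K: "1 / real (Suc K) \<le> 1" "1 \<le> real (Suc K)" and N: "1 / real (Suc N) \<le> 1" "1 \<le> real (Suc N)" by auto
  have pos: "0 < trunc K z" for z using trunc_bounds(1)[of K z] by (meson less_le_trans of_nat_0_less_iff zero_less_Suc zero_less_divide_1_iff)
  show ?thesis
  proof (cases "0 < b")
    case True
    have "trunc K (htrunc N b x) \<le> real (Suc N)"
    proof -
      have "max c (min C (min D x)) \<le> D" if "c \<le> 1" "1 \<le> D" for c C D :: real
        using that by (auto simp: max_def min_def)
      from this[OF K(1) N(2)] show ?thesis using True by (simp only: trunc_def htrunc_def if_True)
    qed
    then have "trunc K (htrunc N b x) powr b \<le> real (Suc N) powr b"
      by (rule powr_mono2[OF less_imp_le[OF True] less_imp_le[OF pos]])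
    then show ?thesis using True by simp
  next
    case False
    have "1 / real (Suc N) \<le> trunc K (htrunc N b x)"
    proof -
      have "d \<le> max c (min C (max d x))" if "d \<le> 1" "1 \<le> C" for c C d :: real
        using that by (auto simp: max_def min_def)
      from this[OF N(1) K(2)] show ?thesis using False by (simp only: trunc_def htrunc_def if_False)
    qed
    then have "trunc K (htrunc N b x) powr b \<le> (1 / real (Suc N)) powr b"
      using False by (intro powr_mono2') auto
    also have "\<dots> = real (Suc N) powr \<bar>b\<bar>" using False by (simp add: powr_divide powr_minus_divide)
    finally show ?thesis .
  qed
qed

text \<open>Two nested limits. For fixed N the two-sided truncation at level K is removed by
  dominated convergence, as the powers of the one-sided cuts are bounded. Then N grows: on the right
  \<open>htrunc\<close> only lowers the integrand, so the full integral is an upper bound for every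
  N, and on the left the means converge.\<close>

lemma gaussian_lower:
  fixes h :: "nat \<Rightarrow> (nat \<Rightarrow> real) \<Rightarrow> real"
  assumes Q: "\<And>e. 0 \<le> QF n m k A a e" and a: "\<And>i. i < m \<Longrightarrow> a i \<noteq> 0"
    and hm: "\<And>i. i < m \<Longrightarrow> h i \<in> borel_measurable borel" and h0: "\<And>i y. i < m \<Longrightarrow> 0 \<le> h i y"
    and hpos: "\<And>i y. i < m \<Longrightarrow> a i < 0 \<Longrightarrow> 0 < h i y"
    and hi: "\<And>i. i < m \<Longrightarrow> integrable (gauss n) (\<lambda>y. h i (lmap n (k i) (A i) (\<lambda>j. t * y j)))"
    and t: "0 \<le> t"
  shows "ennreal (Phi m a (\<lambda>i. \<integral>y. h i (lmap n (k i) (A i) (\<lambda>j. t * y j)) \<partial>gauss n)) \<le>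
    (\<integral>\<^sup>+y. ennreal (Phi m a (\<lambda>i. h i (lmap n (k i) (A i) (\<lambda>j. t * y j)))) \<partial>gauss n)"
proof -
  define u where "u i y = h i (lmap n (k i) (A i) (\<lambda>j. t * y j))" for i y
  have um [measurable]: "u i \<in> borel_measurable borel" if "i < m" for i
    unfolding u_def using hm[OF that] by measurable
  have u0: "0 \<le> u i y" if "i < m" for i y using h0[OF that] by (simp add: u_def)
  have upos: "0 < u i y" if "i < m" "a i < 0" for i y using hpos[OF that] by (simp add: u_def)
  have ui: "integrable (gauss n) (u i)" if "i < m" for i using hi[OF that] unfolding u_def .
  define e where "e i = (\<integral>y. u i y \<partial>gauss n)" for i
  have e0: "0 \<le> e i" if "i < m" for i unfolding e_def using u0[OF that] by (simp add: Bochner_Integration.integral_nonneg)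
  show ?thesis
  \<comment> \<open>A mean equal to 0 makes the left side 0 through the value of
    \<open>0 powr b\<close>. Otherwise all means are positive, where powers are continuous for
    exponents of either sign.\<close>
  proof (cases "\<exists>i<m. e i = 0")
    case True
    then have "Phi m a e = 0" unfolding Phi_def by (auto intro!: prod_zero bexI)
    then show ?thesis unfolding e_def u_def by simp
  next
    case False
    then have epos: "0 < e i" if "i < m" for i using e0[OF that] that by (auto simp: less_le)
    define w where "w N i y = htrunc N (a i) (u i y)" for N i y
    have wm: "w N i \<in> borel_measurable borel" if "i < m" for N i unfolding w_def using um[OF that] by measurable
    have wb: "0 \<le> w N i y" "w N i y \<le> u i y + 1" if "i < m" for N i y
      using htrunc_abs_le[OF u0[OF that]] by (auto simp: w_def)
    have wi: "integrable (gauss n) (w N i)" if "i < m" for N i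
    proof (rule Bochner_Integration.integrable_bound)
      show "integrable (gauss n) (\<lambda>y. u i y + 1)" using ui[OF that] by auto
      show "AE y in gauss n. norm (w N i y) \<le> norm (u i y + 1)"
        using wb[OF that] u0[OF that] by (intro AE_I2) (auto simp: abs_of_nonneg)
    qed (use wm[OF that] in measurable)
    have wl: "(\<lambda>N. w N i y) \<longlonglongrightarrow> u i y" if "i < m" for i y
      unfolding w_def by (rule htrunc_tendsto[OF u0[OF that]])
    have el: "(\<lambda>N. \<integral>y. w N i y \<partial>gauss n) \<longlonglongrightarrow> e i" if "i < m" for i
      unfolding e_def
    proof (rule integral_dominated_convergence[where w="\<lambda>y. u i y + 1"])
      show "integrable (gauss n) (\<lambda>y. u i y + 1)" using ui[OF that] by auto
    qed (use um[OF that] wm[OF that] wl[OF that] wb[OF that] in \<open>auto simp: abs_of_nonneg\<close>)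
    have stepA: "ennreal (Phi m a (\<lambda>i. \<integral>y. w N i y \<partial>gauss n)) \<le> (\<integral>\<^sup>+y. ennreal (Phi m a (\<lambda>i. w N i y)) \<partial>gauss n)"
      if wp: "\<And>i. i < m \<Longrightarrow> 0 < (\<integral>y. w N i y \<partial>gauss n)" for N
    proof -
      define v where "v K i y = trunc K (w N i y)" for K i y
      have vm: "v K i \<in> borel_measurable borel" if "i < m" for K i unfolding v_def using wm[OF that] by measurable
      have vb: "1 / real (Suc K) \<le> v K i y" "v K i y \<le> real (Suc K)" for K i y
        unfolding v_def by (rule trunc_bounds)+
      have v_pos: "0 < v K i y" for K i y using vb(1)[of K i y] by (meson less_le_trans of_nat_0_less_iff zero_less_Suc zero_less_divide_1_iff)
      have vle: "v K i y \<le> u i y + 2" if "i < m" for K i y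
      proof -
        have "v K i y \<le> w N i y + 1 / real (Suc K)" unfolding v_def by (rule trunc_le[OF wb(1)[OF that]])
        also have "1 / real (Suc K) \<le> 1" by simp
        finally show ?thesis using wb(2)[OF that, of N y] by linarith
      qed
      have vl: "(\<lambda>K. v K i y) \<longlonglongrightarrow> w N i y" if "i < m" for i y
        unfolding v_def by (rule trunc_tendsto[OF wb(1)[OF that]])
      have ineq: "Phi m a (\<lambda>i. \<integral>y. v K i y \<partial>gauss n) \<le> (\<integral>y. Phi m a (\<lambda>i. v K i y) \<partial>gauss n)" if K: "1 \<le> K" for K
      proof -
        let ?c = "1 / real (Suc K)" and ?C = "real (Suc K)"
        have c: "0 < ?c" by simp
        have "?c < 1" using K by simp
        moreover have "1 < ?C" using K by simp
        ultimately have cC: "?c < ?C" by linarith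
        have "(-1) * ((\<integral>y. Phi m a (\<lambda>i. v K i y) \<partial>gauss n) - Phi m a (\<lambda>i. \<integral>y. v K i y \<partial>gauss n)) \<le> 0"
          unfolding v_def w_def u_def
          by (rule gaussian_bounded[where c="?c" and C="?C" and h="\<lambda>i z. trunc K (htrunc N (a i) (h i z))", OF c cC _ _ _ _ t])
            (use Q hm trunc_bounds in auto)
        then show ?thesis by simp
      qed
      have l1: "(\<lambda>K. Phi m a (\<lambda>i. \<integral>y. v K i y \<partial>gauss n)) \<longlonglongrightarrow> Phi m a (\<lambda>i. \<integral>y. w N i y \<partial>gauss n)"
      proof (rule Phi_tendsto)
        fix i assume i: "i < m"
        show "(\<lambda>K. \<integral>y. v K i y \<partial>gauss n) \<longlonglongrightarrow> (\<integral>y. w N i y \<partial>gauss n)"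
        proof (rule integral_dominated_convergence[where w="\<lambda>y. u i y + 2"])
          show "integrable (gauss n) (\<lambda>y. u i y + 2)" using ui[OF i] by auto
        qed (use wm[OF i] vm[OF i] vl[OF i] vle[OF i] v_pos in \<open>auto simp: abs_of_pos\<close>)
        show "0 < (\<integral>y. w N i y \<partial>gauss n) \<or> (0 < a i \<and> (\<forall>K. 0 \<le> (\<integral>y. v K i y \<partial>gauss n)))" using wp[OF i] by simp
      qed
      define B where "B = (\<Prod>i<m. real (Suc N) powr \<bar>a i\<bar>)"
      have PB: "Phi m a (\<lambda>i. v K i y) \<le> B" for K y
        unfolding Phi_def B_def v_def w_def using u0 by (intro prod_mono conjI trunc_htrunc_powr_le) auto
      have pl: "(\<lambda>K. Phi m a (\<lambda>i. v K i y)) \<longlonglongrightarrow> Phi m a (\<lambda>i. w N i y)" for y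
      proof (rule Phi_tendsto)
        fix i assume i: "i < m"
        show "(\<lambda>K. v K i y) \<longlonglongrightarrow> w N i y" by (rule vl[OF i])
        show "0 < w N i y \<or> (0 < a i \<and> (\<forall>K. 0 \<le> v K i y))"
        proof (cases "0 < a i")
          case True
          then show ?thesis using v_pos by (simp add: less_imp_le)
        next
          case False
          then have "1 / real (Suc N) \<le> w N i y" by (simp add: w_def htrunc_def)
          moreover have "0 < 1 / real (Suc N)" by simp
          ultimately show ?thesis by linarith
        qed
      qed
      have Pwm: "(\<lambda>y. Phi m a (\<lambda>i. w N i y)) \<in> borel_measurable (gauss n)" using wm by measurable
      have Pvm: "(\<lambda>y. Phi m a (\<lambda>i. v K i y)) \<in> borel_measurable (gauss n)" for K using vm by measurable
      have l2: "(\<lambda>K. \<integral>y. Phi m a (\<lambda>i. v K i y) \<partial>gauss n) \<longlonglongrightarrow> (\<integral>y. Phi m a (\<lambda>i. w N i y) \<partial>gauss n)"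
        by (rule integral_dominated_convergence[where w="\<lambda>y. B"])
          (use Pwm Pvm pl PB in \<open>auto simp: Phi_nonneg\<close>)
      have PBw: "Phi m a (\<lambda>i. w N i y) \<le> B" for y
        by (rule LIMSEQ_le_const2[OF pl]) (use PB in auto)
      have "Phi m a (\<lambda>i. \<integral>y. w N i y \<partial>gauss n) \<le> (\<integral>y. Phi m a (\<lambda>i. w N i y) \<partial>gauss n)"
        by (rule LIMSEQ_le[OF l1 l2]) (use ineq in blast)
      moreover have "(\<integral>\<^sup>+y. ennreal (Phi m a (\<lambda>i. w N i y)) \<partial>gauss n) = ennreal (\<integral>y. Phi m a (\<lambda>i. w N i y) \<partial>gauss n)"
      proof (rule nn_integral_eq_integral)
        show "integrable (gauss n) (\<lambda>y. Phi m a (\<lambda>i. w N i y))"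
          by (rule G.integrable_const_bound[where B=B]) (use PBw Pwm in \<open>auto simp: Phi_nonneg\<close>)
      qed (simp add: Phi_nonneg)
      ultimately show ?thesis by (simp add: ennreal_leI)
    qed
    have mono: "(\<integral>\<^sup>+y. ennreal (Phi m a (\<lambda>i. w N i y)) \<partial>gauss n) \<le> (\<integral>\<^sup>+y. ennreal (Phi m a (\<lambda>i. u i y)) \<partial>gauss n)" for N
    proof (intro nn_integral_mono ennreal_leI)
      fix y
      show "Phi m a (\<lambda>i. w N i y) \<le> Phi m a (\<lambda>i. u i y)"
        unfolding Phi_def w_def using u0 upos a by (intro prod_mono conjI htrunc_powr_le) auto
    qed
    \<comment> \<open>\<open>stepA\<close> asks for positive means of the cut functions; they are
      positive from some N on because their limits are.\<close>
    have "eventually (\<lambda>N. \<forall>i\<in>{..<m}. 0 < (\<integral>y. w N i y \<partial>gauss n)) sequentially"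
      unfolding eventually_ball_finite_distrib[OF finite_lessThan]
      using order_tendstoD(1)[OF el epos] by blast
    then have ev: "eventually (\<lambda>N. ennreal (Phi m a (\<lambda>i. \<integral>y. w N i y \<partial>gauss n)) \<le> (\<integral>\<^sup>+y. ennreal (Phi m a (\<lambda>i. u i y)) \<partial>gauss n)) sequentially"
      by eventually_elim (use order_trans[OF stepA mono] in auto)
    have "(\<lambda>N. Phi m a (\<lambda>i. \<integral>y. w N i y \<partial>gauss n)) \<longlonglongrightarrow> Phi m a e"
      using el epos by (intro Phi_tendsto) auto
    then have "(\<lambda>N. ennreal (Phi m a (\<lambda>i. \<integral>y. w N i y \<partial>gauss n))) \<longlonglongrightarrow> ennreal (Phi m a e)"
      by (rule tendsto_ennrealI)
    from tendsto_upperbound[OF this ev]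
    have "ennreal (Phi m a e) \<le> (\<integral>\<^sup>+y. ennreal (Phi m a (\<lambda>i. u i y)) \<partial>gauss n)" by simp
    then show ?thesis unfolding e_def u_def .
  qed
qed

subsection \<open>Gaussian laws and linear change of variables\<close>

abbreviation leb :: "nat \<Rightarrow> (nat \<Rightarrow> real) measure" where
  "leb n \<equiv> zprod lborel n"

lemma zext_borel [measurable]: "zext n \<in> borel_measurable borel"
proof (rule borel_measurable_coordI)
  fix i show "(\<lambda>x. zext n x i) \<in> borel_measurable borel" by (cases "i < n") (auto simp: zext_def)
qed

lemma zext_zext: "zext n (zext n x) = zext n x"
  by (auto simp: zext_def)

lemma nn_integral_leb_zext:
  assumes [measurable]: "F \<in> borel_measurable borel"
  shows "(\<integral>\<^sup>+x. F (zext n x) \<partial>leb n) = (\<integral>\<^sup>+x. F x \<partial>leb n)"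
  by (subst (1 2) lb.nn_integral_zprod) (auto simp: zext_zext)

lemma nn_integral_leb_measurable [measurable]:
  assumes "case_prod F \<in> borel_measurable (borel \<Otimes>\<^sub>M borel)"
  shows "(\<lambda>x. \<integral>\<^sup>+y. F x y \<partial>leb n) \<in> borel_measurable borel"
proof -
  note [measurable] = assms
  interpret sigma_finite_measure "PiM {..<n} (\<lambda>_. lborel::real measure)" by (rule lb.sigma_finite_PiM)
  show ?thesis by (subst lb.nn_integral_zprod) measurable
qed

lemma leb_lborel_swap:
  assumes [measurable]: "case_prod F \<in> borel_measurable (borel \<Otimes>\<^sub>M borel)"
  shows "(\<integral>\<^sup>+x. \<integral>\<^sup>+y. F x y \<partial>lborel \<partial>leb n) = (\<integral>\<^sup>+y. \<integral>\<^sup>+x. F x y \<partial>leb n \<partial>lborel)"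
proof -
  interpret A: sigma_finite_measure "PiM {..<n} (\<lambda>_. lborel::real measure)" by (rule lb.sigma_finite_PiM)
  interpret pair_sigma_finite "PiM {..<n} (\<lambda>_. lborel::real measure)" lborel ..
  show ?thesis
    by (subst (1 2) lb.nn_integral_zprod, measurable, rule Fubini'[symmetric], measurable)
qed

text \<open>Covers dilations, translations and, through s = -1, the reflection used in
  \<open>leb_orth\<close>.\<close>

lemma leb_affine:
  assumes "F \<in> borel_measurable borel" and s: "s \<noteq> 0"
  shows "(\<integral>\<^sup>+x. F x \<partial>leb n) = ennreal (\<bar>s\<bar> ^ n) * (\<integral>\<^sup>+x. F (\<lambda>j. zext n c j + s * x j) \<partial>leb n)"
  using assms(1)
proof (induction n arbitrary: F)
  case 0
  then show ?case by (simp add: lb.nn_integral_zprod_0 zext_def)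
next
  case (Suc n)
  note [measurable] = Suc.prems
  have upd: "(\<lambda>j. zext (Suc n) c j + s * (x(n := y)) j) = (\<lambda>j. zext n c j + s * x j)(n := c n + s * y)" for x y
    by (auto simp: zext_def fun_eq_iff)
  have "(\<integral>\<^sup>+x. F x \<partial>leb (Suc n)) = (\<integral>\<^sup>+y. \<integral>\<^sup>+x. F (x(n := y)) \<partial>leb n \<partial>lborel)"
    by (rule lb.nn_integral_zprod_Suc) measurable
  also have "\<dots> = (\<integral>\<^sup>+y. ennreal (\<bar>s\<bar> ^ n) * (\<integral>\<^sup>+x. F ((\<lambda>j. zext n c j + s * x j)(n := y)) \<partial>leb n) \<partial>lborel)"
  proof (rule nn_integral_cong)
    fix y :: real
    show "(\<integral>\<^sup>+x. F (x(n := y)) \<partial>leb n) = ennreal (\<bar>s\<bar> ^ n) * (\<integral>\<^sup>+x. F ((\<lambda>j. zext n c j + s * x j)(n := y)) \<partial>leb n)"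
      by (rule Suc.IH[where F="\<lambda>x. F (x(n := y))"]) measurable
  qed
  also have "\<dots> = ennreal (\<bar>s\<bar> ^ n) * (\<integral>\<^sup>+y. (\<integral>\<^sup>+x. F ((\<lambda>j. zext n c j + s * x j)(n := y)) \<partial>leb n) \<partial>lborel)"
    by (rule nn_integral_cmult) measurable
  also have "(\<integral>\<^sup>+y. (\<integral>\<^sup>+x. F ((\<lambda>j. zext n c j + s * x j)(n := y)) \<partial>leb n) \<partial>lborel) = 
    ennreal \<bar>s\<bar> * (\<integral>\<^sup>+y. (\<integral>\<^sup>+x. F ((\<lambda>j. zext n c j + s * x j)(n := c n + s * y)) \<partial>leb n) \<partial>lborel)"
    by (rule nn_integral_real_affine[OF _ s]) measurable
  also have "(\<integral>\<^sup>+y. (\<integral>\<^sup>+x. F ((\<lambda>j. zext n c j + s * x j)(n := c n + s * y)) \<partial>leb n) \<partial>lborel) =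
    (\<integral>\<^sup>+x. F (\<lambda>j. zext (Suc n) c j + s * x j) \<partial>leb (Suc n))"
    unfolding upd[symmetric] by (rule lb.nn_integral_zprod_Suc[symmetric]) measurable
  finally show ?case by (simp add: ennreal_mult' mult_ac)
qed

definition gdens :: "nat \<Rightarrow> (nat \<Rightarrow> real) \<Rightarrow> real" where
  "gdens n x = (1 / sqrt (2 * pi)) ^ n * exp (- (\<Sum>j<n. (x j)\<^sup>2) / 2)"

lemma gdens_borel [measurable]: "gdens n \<in> borel_measurable borel"
  unfolding gdens_def by measurable

lemma gdens_nonneg [simp]: "0 \<le> gdens n x" by (simp add: gdens_def)

lemma gdens_prod: "(\<Prod>j<n. std_normal_density (x j)) = gdens n x"
  unfolding gdens_def std_normal_density_def prod.distrib
  by (simp add: exp_sum[symmetric] sum_negf[symmetric] sum_divide_distrib)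

lemma gauss_gdens:
  assumes "F \<in> borel_measurable borel"
  shows "(\<integral>\<^sup>+x. F x \<partial>gauss n) = (\<integral>\<^sup>+x. F x * ennreal (gdens n x) \<partial>leb n)"
  using gauss_density[OF assms] by (simp add: gdens_prod)

lemma gdens_total: "(\<integral>\<^sup>+x. ennreal (gdens n x) \<partial>leb n) = 1"
  using gauss_gdens[of "\<lambda>_. 1" n] by simp

text \<open>Orthogonality through the linear map instead of the matrix: invariance of the Gaussian
  density comes from the isometry, matching of translations from surjectivity.\<close>

definition orth :: "nat \<Rightarrow> (nat \<Rightarrow> nat \<Rightarrow> real) \<Rightarrow> bool" where
  "orth n Q \<longleftrightarrow> (\<forall>x. (\<Sum>r<n. (lmap n n Q x r)\<^sup>2) = (\<Sum>j<n. (x j)\<^sup>2)) \<and> (\<forall>y. \<exists>x. lmap n n Q x = zext n y)"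

lemma lmap_zext: "lmap n k A (zext n x) = lmap n k A x"
  by (auto simp: lmap_def zext_def)

lemma lmap_add: "lmap n k A (\<lambda>j. x j + y j) = (\<lambda>r. lmap n k A x r + lmap n k A y r)"
  by (auto simp: lmap_def sum.distrib distrib_left)

lemma lmap_scale: "lmap n k A (\<lambda>j. s * x j) = (\<lambda>r. s * lmap n k A x r)"
  by (auto simp: lmap_def sum_distrib_left mult_ac)

lemma leb_shift:
  assumes "F \<in> borel_measurable borel"
  shows "(\<integral>\<^sup>+x. F (\<lambda>j. x j + zext n c j) \<partial>leb n) = (\<integral>\<^sup>+x. F x \<partial>leb n)"
  using leb_affine[OF assms, of 1 n c] by (simp add: add.commute)

lemma leb_reflect:
  assumes "F \<in> borel_measurable borel"
  shows "(\<integral>\<^sup>+x. F (\<lambda>j. zext n c j - x j) \<partial>leb n) = (\<integral>\<^sup>+x. F x \<partial>leb n)"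
  using leb_affine[OF assms, of "-1" n c] by simp

text \<open>Integrate \<open>f (Q x - y) g y\<close> over both variables in the two orders, with \<open>g\<close> the
  rotation invariant standard Gaussian density; each order needs translations and reflections only.\<close>

lemma leb_orth:
  assumes f [measurable]: "f \<in> borel_measurable borel" and Q: "orth n Q"
  shows "(\<integral>\<^sup>+x. f (lmap n n Q x) \<partial>leb n) = (\<integral>\<^sup>+x. f x \<partial>leb n)"
proof -
  let ?S = "lmap n n Q" and ?g = "\<lambda>x. ennreal (gdens n x)"
  have Sz: "zext n (?S x) = ?S x" for x by (auto simp: zext_def lmap_def)
  have shift: "(\<integral>\<^sup>+x. h (\<lambda>j. ?S x j - zext n y j) \<partial>leb n) = (\<integral>\<^sup>+x. h (?S x) \<partial>leb n)"
    if [measurable]: "h \<in> borel_measurable borel" for h :: "_ \<Rightarrow> ennreal" and y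
  proof -
    \<comment> \<open>Surjectivity turns a shift by y after Q into a shift by c before it.\<close>
    obtain c where c: "?S c = zext n y" using Q by (auto simp: orth_def)
    have "(\<integral>\<^sup>+x. h (\<lambda>j. ?S x j - zext n y j) \<partial>leb n) = (\<integral>\<^sup>+x. h (\<lambda>j. ?S (\<lambda>j. x j + zext n c j) j - zext n y j) \<partial>leb n)"
      by (rule leb_shift[symmetric, where F="\<lambda>x. h (\<lambda>j. ?S x j - zext n y j)"]) measurable
    also have "\<dots> = (\<integral>\<^sup>+x. h (?S x) \<partial>leb n)"
      by (simp add: lmap_add lmap_zext c)
    finally show ?thesis .
  qed
  have gS: "gdens n (?S x) = gdens n x" for x
    using Q by (simp add: gdens_def orth_def)
  have "(\<integral>\<^sup>+x. f (?S x) \<partial>leb n) = (\<integral>\<^sup>+x. f (?S x) \<partial>leb n) * (\<integral>\<^sup>+y. ?g y \<partial>leb n)"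
    by (simp add: gdens_total)
  also have "\<dots> = (\<integral>\<^sup>+y. (\<integral>\<^sup>+x. f (?S x) \<partial>leb n) * ?g y \<partial>leb n)"
    by (rule nn_integral_cmult[symmetric]) measurable
  also have "\<dots> = (\<integral>\<^sup>+y. (\<integral>\<^sup>+x. f (\<lambda>j. ?S x j - zext n y j) * ?g y \<partial>leb n) \<partial>leb n)"
    by (simp add: shift nn_integral_multc)
  also have "\<dots> = (\<integral>\<^sup>+x. (\<integral>\<^sup>+y. f (\<lambda>j. ?S x j - zext n y j) * ?g y \<partial>leb n) \<partial>leb n)"
    by (rule lb.zprod_Fubini(1)) measurable
  also have "\<dots> = (\<integral>\<^sup>+x. (\<integral>\<^sup>+y. f (zext n y) * ?g (\<lambda>j. ?S x j - zext n y j) \<partial>leb n) \<partial>leb n)"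
  proof (rule nn_integral_cong)
    fix x
    have "(\<integral>\<^sup>+y. f (\<lambda>j. ?S x j - zext n y j) * ?g y \<partial>leb n) = (\<integral>\<^sup>+y. f (\<lambda>j. ?S x j - zext n (\<lambda>j. zext n (?S x) j - y j) j) * ?g (\<lambda>j. zext n (?S x) j - y j) \<partial>leb n)"
      by (rule leb_reflect[symmetric, where F="\<lambda>y. f (\<lambda>j. ?S x j - zext n y j) * ?g y"]) measurable
    also have "\<dots> = (\<integral>\<^sup>+y. f (zext n y) * ?g (\<lambda>j. ?S x j - zext n y j) \<partial>leb n)"
    proof (rule nn_integral_cong)
      fix y
      have "(\<lambda>j. ?S x j - zext n (\<lambda>j. zext n (?S x) j - y j) j) = zext n y"
        by (auto simp: zext_def lmap_def)
      moreover have "gdens n (\<lambda>j. zext n (?S x) j - y j) = gdens n (\<lambda>j. ?S x j - zext n y j)"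
        by (simp add: gdens_def zext_def)
      ultimately show "f (\<lambda>j. ?S x j - zext n (\<lambda>j. zext n (?S x) j - y j) j) * ?g (\<lambda>j. zext n (?S x) j - y j) =
        f (zext n y) * ?g (\<lambda>j. ?S x j - zext n y j)" by simp
    qed
    finally show "(\<integral>\<^sup>+y. f (\<lambda>j. ?S x j - zext n y j) * ?g y \<partial>leb n) = (\<integral>\<^sup>+y. f (zext n y) * ?g (\<lambda>j. ?S x j - zext n y j) \<partial>leb n)" .
  qed
  also have "\<dots> = (\<integral>\<^sup>+y. (\<integral>\<^sup>+x. f (zext n y) * ?g (\<lambda>j. ?S x j - zext n y j) \<partial>leb n) \<partial>leb n)"
    by (rule lb.zprod_Fubini(1)) measurable
  also have "\<dots> = (\<integral>\<^sup>+y. f (zext n y) \<partial>leb n)"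
    by (simp add: nn_integral_cmult shift[of "\<lambda>x. ennreal (gdens n x)"] gS gdens_total)
  also have "\<dots> = (\<integral>\<^sup>+y. f y \<partial>leb n)" by (rule nn_integral_leb_zext) measurable
  finally show ?thesis .
qed

lemma gauss_orth:
  assumes [measurable]: "f \<in> borel_measurable borel" and Q: "orth n Q"
  shows "(\<integral>\<^sup>+x. f (lmap n n Q x) \<partial>gauss n) = (\<integral>\<^sup>+x. f x \<partial>gauss n)"
proof -
  have gS: "gdens n (lmap n n Q x) = gdens n x" for x
    using Q by (simp add: gdens_def orth_def)
  have "(\<integral>\<^sup>+x. f (lmap n n Q x) \<partial>gauss n) = (\<integral>\<^sup>+x. f (lmap n n Q x) * ennreal (gdens n (lmap n n Q x)) \<partial>leb n)"
    unfolding gS by (rule gauss_gdens) measurable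
  also have "\<dots> = (\<integral>\<^sup>+x. f x * ennreal (gdens n x) \<partial>leb n)"
    by (rule leb_orth[OF _ Q, where f="\<lambda>x. f x * ennreal (gdens n x)"]) measurable
  also have "\<dots> = (\<integral>\<^sup>+x. f x \<partial>gauss n)" by (rule gauss_gdens[symmetric]) measurable
  finally show ?thesis .
qed

lemma gauss_marginal:
  assumes [measurable]: "f \<in> borel_measurable borel" and "d \<le> n"
  shows "(\<integral>\<^sup>+x. f (zext d x) \<partial>gauss n) = (\<integral>\<^sup>+x. f x \<partial>gauss d)"
  using assms(2)
proof (induction n rule: dec_induct)
  case base
  have "(\<integral>\<^sup>+x. f (zext d x) \<partial>gauss d) = (\<integral>\<^sup>+x. f (zext d x) \<partial>gauss d)" ..
  then show ?case by (subst (1 2) gs.nn_integral_zprod[folded gauss_def]) (auto simp: zext_zext)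
next
  case (step n)
  have z: "zext d (x(n := y)) = zext d x" for x y using step by (auto simp: zext_def)
  have "(\<integral>\<^sup>+x. f (zext d x) \<partial>gauss (Suc n)) = (\<integral>\<^sup>+y. \<integral>\<^sup>+x. f (zext d (x(n := y))) \<partial>gauss n \<partial>stdn)"
    by (rule nn_integral_gauss_Suc) measurable
  also have "\<dots> = (\<integral>\<^sup>+x. f x \<partial>gauss d)"
    unfolding z step.IH using sn.emeasure_space_1 by simp
  finally show ?case .
qed

text \<open>With the first d coordinates fixed, the last coordinate of the image is affine in y with
  slope \<open>L d d\<close>, and the others do not involve y. Fubini thus reduces the determinant
  formula to dimension one.\<close>

lemma leb_triangular:
  assumes "F \<in> borel_measurable borel" and L0: "\<And>i. i < d \<Longrightarrow> 0 < L i i" and tri: "\<And>i j. i < j \<Longrightarrow> j < d \<Longrightarrow> L i j = 0"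
  shows "(\<integral>\<^sup>+x. F x \<partial>leb d) = ennreal (\<Prod>i<d. L i i) * (\<integral>\<^sup>+x. F (lmap d d L x) \<partial>leb d)"
  using assms
proof (induction d arbitrary: F)
  case 0
  have "lmap 0 0 L (\<lambda>_. 0) = (\<lambda>_. 0)" by (simp add: lmap_def)
  with 0 show ?case by (simp add: lb.nn_integral_zprod_0)
next
  case (Suc d)
  note [measurable] = Suc.prems(1)
  define b where "b x = (\<Sum>j<d. L d j * x j)" for x :: "nat \<Rightarrow> real"
  have [measurable]: "b \<in> borel_measurable borel" unfolding b_def by measurable
  have Ld: "0 < L d d" using Suc.prems(2) by simp
  have upd: "lmap (Suc d) (Suc d) L (x(d := y)) = (lmap d d L x)(d := b x + L d d * y)" for x y
  proof
    fix r
    show "lmap (Suc d) (Suc d) L (x(d := y)) r = ((lmap d d L x)(d := b x + L d d * y)) r"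
      using Suc.prems(3)[of r d] by (auto simp: lmap_def b_def less_Suc_eq)
  qed
  have "(\<integral>\<^sup>+x. F (lmap (Suc d) (Suc d) L x) \<partial>leb (Suc d)) = (\<integral>\<^sup>+y. \<integral>\<^sup>+x. F ((lmap d d L x)(d := b x + L d d * y)) \<partial>leb d \<partial>lborel)"
    unfolding upd[symmetric] by (rule lb.nn_integral_zprod_Suc) measurable
  also have "\<dots> = (\<integral>\<^sup>+x. \<integral>\<^sup>+y. F ((lmap d d L x)(d := b x + L d d * y)) \<partial>lborel \<partial>leb d)"
    by (rule leb_lborel_swap[symmetric]) measurable
  finally have 1: "(\<integral>\<^sup>+x. F (lmap (Suc d) (Suc d) L x) \<partial>leb (Suc d)) = \<dots>" .
  have "(\<integral>\<^sup>+x. F x \<partial>leb (Suc d)) = (\<integral>\<^sup>+y. \<integral>\<^sup>+x. F (x(d := y)) \<partial>leb d \<partial>lborel)"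
    by (rule lb.nn_integral_zprod_Suc) measurable
  also have "\<dots> = (\<integral>\<^sup>+x. \<integral>\<^sup>+y. F (x(d := y)) \<partial>lborel \<partial>leb d)"
    by (rule leb_lborel_swap[symmetric]) measurable
  also have "\<dots> = ennreal (\<Prod>i<d. L i i) * (\<integral>\<^sup>+x. \<integral>\<^sup>+y. F ((lmap d d L x)(d := y)) \<partial>lborel \<partial>leb d)"
    by (rule Suc.IH[where F="\<lambda>x. \<integral>\<^sup>+y. F (x(d := y)) \<partial>lborel"]) (use Suc.prems in measurable)
  also have "(\<integral>\<^sup>+x. \<integral>\<^sup>+y. F ((lmap d d L x)(d := y)) \<partial>lborel \<partial>leb d) = 
    (\<integral>\<^sup>+x. ennreal (L d d) * (\<integral>\<^sup>+y. F ((lmap d d L x)(d := b x + L d d * y)) \<partial>lborel) \<partial>leb d)"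
  proof (rule nn_integral_cong)
    fix x
    show "(\<integral>\<^sup>+y. F ((lmap d d L x)(d := y)) \<partial>lborel) = ennreal (L d d) * (\<integral>\<^sup>+y. F ((lmap d d L x)(d := b x + L d d * y)) \<partial>lborel)"
      using nn_integral_real_affine[of "\<lambda>y. F ((lmap d d L x)(d := y))" "L d d" "b x"] Ld by simp
  qed
  also have "\<dots> = ennreal (L d d) * (\<integral>\<^sup>+x. \<integral>\<^sup>+y. F ((lmap d d L x)(d := b x + L d d * y)) \<partial>lborel \<partial>leb d)"
    by (rule nn_integral_cmult) measurable
  finally show ?case
    unfolding 1[symmetric] using Ld by (simp add: ennreal_mult' mult_ac del: fun_upd_apply)
qed

text \<open>Only the first d rows of Q enter A. Rotation invariance replaces Q y by y, the
  coordinates from d on integrate out, and a dilation by t makes the density explicit.\<close>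

lemma gauss_law:
  assumes F [measurable]: "F \<in> borel_measurable borel" and Q: "orth n Q" and d: "d \<le> n"
    and A: "\<And>r j. r < d \<Longrightarrow> j < n \<Longrightarrow> A r j = (\<Sum>l<d. L r l * Q l j)" and t: "0 < t"
  shows "(\<integral>\<^sup>+y. F (lmap n d A (\<lambda>j. t * y j)) \<partial>gauss n) = ennreal ((1 / (sqrt (2 * pi) * t)) ^ d) *
    (\<integral>\<^sup>+z. F (lmap d d L z) * ennreal (exp (- (\<Sum>j<d. (z j)\<^sup>2) / (2 * t\<^sup>2))) \<partial>leb d)"
proof -
  have AL: "lmap n d A x = lmap d d L (zext d (lmap n n Q x))" for x
  proof
    fix r
    show "lmap n d A x r = lmap d d L (zext d (lmap n n Q x)) r"
    proof (cases "r < d")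
      case True
      have "(\<Sum>j<n. A r j * x j) = (\<Sum>j<n. \<Sum>l<d. L r l * Q l j * x j)"
        using True A by (simp add: sum_distrib_right)
      also have "\<dots> = (\<Sum>l<d. L r l * (\<Sum>j<n. Q l j * x j))"
        by (subst sum.swap) (simp add: sum_distrib_left mult_ac)
      finally show ?thesis using True d by (simp add: lmap_def zext_def)
    qed (simp add: lmap_def)
  qed
  define H where "H z = F (lmap d d L (\<lambda>j. t * z j))" for z
  have [measurable]: "H \<in> borel_measurable borel" unfolding H_def by measurable
  have "(\<integral>\<^sup>+y. F (lmap n d A (\<lambda>j. t * y j)) \<partial>gauss n) = (\<integral>\<^sup>+y. H (zext d (lmap n n Q y)) \<partial>gauss n)"
  proof (rule nn_integral_cong)
    fix y
    have "zext d (lmap n n Q (\<lambda>j. t * y j)) = (\<lambda>j. t * zext d (lmap n n Q y) j)"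
      unfolding lmap_scale by (auto simp: zext_def)
    then show "F (lmap n d A (\<lambda>j. t * y j)) = H (zext d (lmap n n Q y))" by (simp add: AL H_def)
  qed
  also have "\<dots> = (\<integral>\<^sup>+y. H (zext d y) \<partial>gauss n)"
    by (rule gauss_orth[OF _ Q, where f="\<lambda>y. H (zext d y)"]) measurable
  also have "\<dots> = (\<integral>\<^sup>+y. H y \<partial>gauss d)" by (rule gauss_marginal[OF _ d]) measurable
  also have "\<dots> = (\<integral>\<^sup>+z. H z * ennreal (gdens d z) \<partial>leb d)" by (rule gauss_gdens) measurable
  also have "\<dots> = ennreal (\<bar>1 / t\<bar> ^ d) * (\<integral>\<^sup>+z. H (\<lambda>j. zext d (\<lambda>_. 0) j + (1 / t) * z j) * ennreal (gdens d (\<lambda>j. zext d (\<lambda>_. 0) j + (1 / t) * z j)) \<partial>leb d)"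
    using t by (intro leb_affine[where F="\<lambda>z. H z * ennreal (gdens d z)"]) auto
  also have "\<dots> = ennreal (\<bar>1 / t\<bar> ^ d) * (\<integral>\<^sup>+z. ennreal ((1 / sqrt (2 * pi)) ^ d) * (F (lmap d d L z) * ennreal (exp (- (\<Sum>j<d. (z j)\<^sup>2) / (2 * t\<^sup>2)))) \<partial>leb d)"
  proof (rule arg_cong[where f="\<lambda>I. ennreal (\<bar>1 / t\<bar> ^ d) * I"], rule nn_integral_cong)
    fix z
    have 0: "(\<lambda>j. zext d (\<lambda>_. 0) j + (1 / t) * z j) = (\<lambda>j. (1 / t) * z j)" by (auto simp: zext_def)
    have "(\<Sum>j<d. ((1 / t) * z j)\<^sup>2) = (\<Sum>j<d. (z j)\<^sup>2) / t\<^sup>2"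
      by (simp add: power_divide sum_divide_distrib)
    then have 1: "gdens d (\<lambda>j. (1 / t) * z j) = (1 / sqrt (2 * pi)) ^ d * exp (- (\<Sum>j<d. (z j)\<^sup>2) / (2 * t\<^sup>2))"
      unfolding gdens_def by (simp add: mult.commute)
    have 2: "H (\<lambda>j. (1 / t) * z j) = F (lmap d d L z)" using t by (simp add: H_def)
    show "H (\<lambda>j. zext d (\<lambda>_. 0) j + (1 / t) * z j) * ennreal (gdens d (\<lambda>j. zext d (\<lambda>_. 0) j + (1 / t) * z j)) =
      ennreal ((1 / sqrt (2 * pi)) ^ d) * (F (lmap d d L z) * ennreal (exp (- (\<Sum>j<d. (z j)\<^sup>2) / (2 * t\<^sup>2))))"
      unfolding 0 1 2 by (simp add: ennreal_mult' mult_ac)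
  qed
  also have "\<dots> = ennreal (\<bar>1 / t\<bar> ^ d) * (ennreal ((1 / sqrt (2 * pi)) ^ d) * (\<integral>\<^sup>+z. F (lmap d d L z) * ennreal (exp (- (\<Sum>j<d. (z j)\<^sup>2) / (2 * t\<^sup>2))) \<partial>leb d))"
    by (subst nn_integral_cmult) auto
  also have "\<dots> = ennreal ((1 / (sqrt (2 * pi) * t)) ^ d) * (\<integral>\<^sup>+z. F (lmap d d L z) * ennreal (exp (- (\<Sum>j<d. (z j)\<^sup>2) / (2 * t\<^sup>2))) \<partial>leb d)"
    using t by (simp add: ennreal_mult'[symmetric] mult.assoc[symmetric] power_mult_distrib[symmetric] abs_of_pos mult_ac)
  finally show ?thesis .
qed

subsection \<open>Passage from Gaussian to Lebesgue measure\<close>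

text \<open>The Gaussian density of standard deviation t without its normalizing constant. It
  increases to 1 with t, so monotone convergence recovers Lebesgue integrals; the constants are kept
  apart for the scaling argument.\<close>

definition gw :: "nat \<Rightarrow> real \<Rightarrow> (nat \<Rightarrow> real) \<Rightarrow> ennreal" where
  "gw d t z = ennreal (exp (- (\<Sum>j<d. (z j)\<^sup>2) / (2 * t\<^sup>2)))"

lemma gw_measurable [measurable]: "gw d t \<in> borel_measurable borel"
  unfolding gw_def by measurable

lemma gw_le_1: "gw d t z \<le> 1"
proof -
  have "0 \<le> (\<Sum>j<d. (z j)\<^sup>2) / (2 * t\<^sup>2)" by (intro divide_nonneg_nonneg sum_nonneg) auto
  then show ?thesis unfolding gw_def by (simp add: ennreal_le_1)
qed

lemma gw_incseq: "incseq (\<lambda>N. gw d (real (Suc N)) z)"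
proof (rule incseq_SucI)
  fix N
  have "(\<Sum>j<d. (z j)\<^sup>2) / (2 * (real (Suc (Suc N)))\<^sup>2) \<le> (\<Sum>j<d. (z j)\<^sup>2) / (2 * (real (Suc N))\<^sup>2)"
    by (intro divide_left_mono mult_left_mono power_mono sum_nonneg) auto
  then show "gw d (real (Suc N)) z \<le> gw d (real (Suc (Suc N))) z"
    unfolding gw_def by (intro ennreal_leI) (simp only: exp_le_cancel_iff minus_divide_left[symmetric] neg_le_iff_le)
qed

lemma gw_SUP: "(SUP N. gw d (real (Suc N)) z) = 1"
proof -
  have "(\<lambda>N. exp (- (\<Sum>j<d. (z j)\<^sup>2) / (2 * (real (Suc N))\<^sup>2))) \<longlonglongrightarrow> 1"
  proof -
    have "(\<lambda>N. exp (- s / (2 * (real (Suc N))\<^sup>2))) \<longlonglongrightarrow> 1" for s :: real by real_asymp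
    then show ?thesis .
  qed
  then have "(\<lambda>N. gw d (real (Suc N)) z) \<longlonglongrightarrow> ennreal 1" unfolding gw_def by (rule tendsto_ennrealI)
  then show ?thesis using LIMSEQ_unique[OF LIMSEQ_SUP[OF gw_incseq]] by simp
qed

lemma leb_gw_SUP:
  assumes [measurable]: "F \<in> borel_measurable borel"
  shows "(SUP N. \<integral>\<^sup>+z. F z * gw d (real (Suc N)) z \<partial>leb n) = (\<integral>\<^sup>+z. F z \<partial>leb n)"
    and "incseq (\<lambda>N. \<integral>\<^sup>+z. F z * gw d (real (Suc N)) z \<partial>leb n)"
proof -
  have inc: "incseq (\<lambda>N z. F z * gw d (real (Suc N)) z)"
    using gw_incseq by (intro monoI le_funI mult_left_mono) (auto dest: monoD)
  show "incseq (\<lambda>N. \<integral>\<^sup>+z. F z * gw d (real (Suc N)) z \<partial>leb n)"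
    using inc by (intro monoI nn_integral_mono) (auto simp: mono_def le_fun_def)
  have "(\<integral>\<^sup>+z. (SUP N. F z * gw d (real (Suc N)) z) \<partial>leb n) = (SUP N. \<integral>\<^sup>+z. F z * gw d (real (Suc N)) z \<partial>leb n)"
    using inc by (intro nn_integral_monotone_convergence_SUP) auto
  then show "(SUP N. \<integral>\<^sup>+z. F z * gw d (real (Suc N)) z \<partial>leb n) = (\<integral>\<^sup>+z. F z \<partial>leb n)"
    unfolding SUP_mult_left_ennreal[symmetric] gw_SUP by simp
qed

lemma orth_id: "orth n (\<lambda>r j. if r = j then 1 else 0)"
proof -
  have "lmap n n (\<lambda>r j. if r = j then 1 else 0) x = zext n x" for x
    by (auto simp: lmap_def zext_def if_distrib[where f="\<lambda>c. c * _"] cong: if_cong)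
  then show ?thesis unfolding orth_def by (auto simp: zext_def)
qed

lemma lmap_id: "lmap n n (\<lambda>r j. if r = j then 1 else 0) x = zext n x"
  by (auto simp: lmap_def zext_def if_distrib[where f="\<lambda>c. c * _"] cong: if_cong)

text \<open>The case of \<open>gauss_law\<close> in which all matrices are the identity, for
  functions that see only the first n coordinates.\<close>

lemma gauss_law_id:
  assumes [measurable]: "F \<in> borel_measurable borel" and t: "0 < t" and z: "\<And>x. F (zext n x) = F x"
  shows "(\<integral>\<^sup>+y. F (\<lambda>j. t * y j) \<partial>gauss n) = ennreal ((1 / (sqrt (2 * pi) * t)) ^ n) * (\<integral>\<^sup>+x. F x * gw n t x \<partial>leb n)"
proof -
  let ?I = "\<lambda>r j::nat. if r = j then 1 else (0::real)"
  have "(\<integral>\<^sup>+y. F (lmap n n ?I (\<lambda>j. t * y j)) \<partial>gauss n) = ennreal ((1 / (sqrt (2 * pi) * t)) ^ n) *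
    (\<integral>\<^sup>+x. F (lmap n n ?I x) * ennreal (exp (- (\<Sum>j<n. (x j)\<^sup>2) / (2 * t\<^sup>2))) \<partial>leb n)"
    by (rule gauss_law[where Q="?I"]) (use t orth_id in \<open>auto simp: if_distrib[where f="\<lambda>c. c * _"] cong: if_cong\<close>)
  then show ?thesis by (simp add: lmap_id z gw_def)
qed

text \<open>The situation after normalization by R: \<open>h i\<close> is to be f_i to the power
  p_i, \<open>a i\<close> is to be 1 / p_i, and \<open>A i\<close> enters through its factors.
  Below, \<open>I i\<close> is the Lebesgue integral in the normalized variable,
  \<open>J i t\<close> its Gaussian-weighted version, and \<open>cc t\<close> the normalizing
  constant per dimension.\<close>

locale bl_data =
  fixes n m :: nat and k :: "nat \<Rightarrow> nat" and A L Q :: "nat \<Rightarrow> nat \<Rightarrow> nat \<Rightarrow> real" and a :: "nat \<Rightarrow> real"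
    and h :: "nat \<Rightarrow> (nat \<Rightarrow> real) \<Rightarrow> real"
  assumes kn: "\<And>i. i < m \<Longrightarrow> k i \<le> n" and orthQ: "\<And>i. i < m \<Longrightarrow> orth n (Q i)"
    and AL: "\<And>i r j. i < m \<Longrightarrow> r < k i \<Longrightarrow> j < n \<Longrightarrow> A i r j = (\<Sum>l<k i. L i r l * Q i l j)"
    and dims: "(\<Sum>i<m. real (k i) * a i) = real n"
    and hm: "\<And>i. i < m \<Longrightarrow> h i \<in> borel_measurable borel" and h0: "\<And>i y. i < m \<Longrightarrow> 0 \<le> h i y"
    and fin: "\<And>i. i < m \<Longrightarrow> (\<integral>\<^sup>+z. ennreal (h i (lmap (k i) (k i) (L i) z)) \<partial>leb (k i)) < \<infinity>"
begin

definition "J i t = (\<integral>\<^sup>+z. ennreal (h i (lmap (k i) (k i) (L i) z)) * gw (k i) t z \<partial>leb (k i))"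
definition "I i = (\<integral>\<^sup>+z. ennreal (h i (lmap (k i) (k i) (L i) z)) \<partial>leb (k i))"
definition "G z = Phi m a (\<lambda>i. h i (lmap n (k i) (A i) z))"
definition "cc t = 1 / (sqrt (2 * pi) * t)"

lemma J_le: "J i t \<le> I i"
  unfolding J_def I_def using mult_left_mono[OF gw_le_1] by (intro nn_integral_mono) fastforce

lemma I_fin: "i < m \<Longrightarrow> I i < \<infinity>" using fin by (simp add: I_def)

lemma J_fin: "i < m \<Longrightarrow> J i t < \<infinity>" using J_le I_fin by (meson le_less_trans)

lemma G_borel [measurable]: "G \<in> borel_measurable borel"
  unfolding G_def using hm by measurable

lemma law_i:
  assumes i: "i < m" and t: "0 < t"
  shows "integrable (gauss n) (\<lambda>y. h i (lmap n (k i) (A i) (\<lambda>j. t * y j)))"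
    and "(\<integral>y. h i (lmap n (k i) (A i) (\<lambda>j. t * y j)) \<partial>gauss n) = cc t ^ k i * enn2real (J i t)"
proof -
  note [measurable] = hm[OF i]
  have l: "(\<integral>\<^sup>+y. ennreal (h i (lmap n (k i) (A i) (\<lambda>j. t * y j))) \<partial>gauss n) = ennreal (cc t ^ k i) * J i t"
    unfolding J_def gw_def cc_def
    by (rule gauss_law[OF _ orthQ[OF i] kn[OF i] AL[OF i] t, where F="\<lambda>x. ennreal (h i x)"]) measurable
  have J: "J i t = ennreal (enn2real (J i t))" using J_fin[OF i, of t] by simp
  have cc: "0 \<le> cc t" using t by (simp add: cc_def)
  then have l': "(\<integral>\<^sup>+y. ennreal (h i (lmap n (k i) (A i) (\<lambda>j. t * y j))) \<partial>gauss n) = ennreal (cc t ^ k i * enn2real (J i t))"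
    using l J by (simp add: ennreal_mult')
  then show "integrable (gauss n) (\<lambda>y. h i (lmap n (k i) (A i) (\<lambda>j. t * y j)))"
    using h0[OF i] by (intro integrableI_nonneg) auto
  show "(\<integral>y. h i (lmap n (k i) (A i) (\<lambda>j. t * y j)) \<partial>gauss n) = cc t ^ k i * enn2real (J i t)"
    using l' h0[OF i] cc by (intro integral_eq_nn_integral[THEN trans]) auto
qed

lemma law_G:
  assumes t: "0 < t"
  shows "(\<integral>\<^sup>+y. ennreal (G (\<lambda>j. t * y j)) \<partial>gauss n) = ennreal (cc t ^ n) * (\<integral>\<^sup>+z. ennreal (G z) * gw n t z \<partial>leb n)"
  unfolding cc_def
proof (rule gauss_law_id[OF _ t, where F="\<lambda>x. ennreal (G x)"])
  show "ennreal (G (zext n x)) = ennreal (G x)" for x by (simp add: G_def lmap_zext)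
qed measurable

text \<open>The scaling condition enters here: the powers of the normalizing constants combine to
  exactly the factor of \<open>law_G\<close>, so t survives only in the Gaussian weights.\<close>

lemma scaling:
  assumes t: "0 < t"
  shows "Phi m a (\<lambda>i. cc t ^ k i * enn2real (J i t)) = cc t ^ n * Phi m a (\<lambda>i. enn2real (J i t))"
proof -
  have cc: "0 < cc t" using t by (simp add: cc_def)
  have "Phi m a (\<lambda>i. cc t ^ k i * enn2real (J i t)) = (\<Prod>i<m. cc t powr (real (k i) * a i)) * Phi m a (\<lambda>i. enn2real (J i t))"
    unfolding Phi_def prod.distrib[symmetric] using cc
    by (intro prod.cong) (auto simp: powr_mult powr_powr powr_realpow[symmetric])
  also have "(\<Prod>i<m. cc t powr (real (k i) * a i)) = cc t powr (\<Sum>i<m. real (k i) * a i)"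
    using cc by (subst powr_sum) auto
  finally show ?thesis using cc by (simp add: dims powr_realpow)
qed

lemma cancel:
  assumes t: "0 < t"
  shows "ennreal (cc t ^ n) * x \<le> ennreal (cc t ^ n * y) \<longleftrightarrow> x \<le> ennreal y"
    and "ennreal (cc t ^ n * y) \<le> ennreal (cc t ^ n) * x \<longleftrightarrow> ennreal y \<le> x"
proof -
  have cc: "0 < cc t ^ n" using t by (simp add: cc_def)
  then show "ennreal (cc t ^ n) * x \<le> ennreal (cc t ^ n * y) \<longleftrightarrow> x \<le> ennreal y"
    "ennreal (cc t ^ n * y) \<le> ennreal (cc t ^ n) * x \<longleftrightarrow> ennreal y \<le> x"
  proof -
    have e: "ennreal (cc t ^ n * y) = ennreal (cc t ^ n) * ennreal y"
      using cc by (intro ennreal_mult') simp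
    have ne: "ennreal (cc t ^ n) \<noteq> 0" using cc by (simp only: ennreal_eq_zero_iff not_le)
    show "ennreal (cc t ^ n) * x \<le> ennreal (cc t ^ n * y) \<longleftrightarrow> x \<le> ennreal y"
      "ennreal (cc t ^ n * y) \<le> ennreal (cc t ^ n) * x \<longleftrightarrow> ennreal y \<le> x"
      unfolding e by (rule ennreal_mult_le_mult_iff[OF ne], simp)+
  qed
qed

text \<open>With positive exponents the weighted integrals \<open>J\<close> may be replaced by the
  larger \<open>I\<close> for every t, before the limit on the left is taken.\<close>

lemma bl_upper:
  assumes QF: "\<And>e. QF n m k A a e \<le> 0" and a: "\<And>i. i < m \<Longrightarrow> 0 < a i"
  shows "(\<integral>\<^sup>+z. ennreal (G z) \<partial>leb n) \<le> ennreal (Phi m a (\<lambda>i. enn2real (I i)))"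
proof -
  have "(\<integral>\<^sup>+z. ennreal (G z) * gw n t z \<partial>leb n) \<le> ennreal (Phi m a (\<lambda>i. enn2real (I i)))" if t: "0 < t" for t
  proof -
    have "(\<integral>\<^sup>+y. ennreal (G (\<lambda>j. t * y j)) \<partial>gauss n) \<le> ennreal (Phi m a (\<lambda>i. \<integral>y. h i (lmap n (k i) (A i) (\<lambda>j. t * y j)) \<partial>gauss n))"
      unfolding G_def by (rule gaussian_upper) (use QF a hm h0 law_i(1)[OF _ t] t in auto)
    also have "Phi m a (\<lambda>i. \<integral>y. h i (lmap n (k i) (A i) (\<lambda>j. t * y j)) \<partial>gauss n) = Phi m a (\<lambda>i. cc t ^ k i * enn2real (J i t))"
      unfolding Phi_def using law_i(2)[OF _ t] by (intro prod.cong) auto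
    finally have "(\<integral>\<^sup>+z. ennreal (G z) * gw n t z \<partial>leb n) \<le> ennreal (Phi m a (\<lambda>i. enn2real (J i t)))"
      unfolding law_G[OF t] scaling[OF t] cancel(1)[OF t] .
    also have "\<dots> \<le> ennreal (Phi m a (\<lambda>i. enn2real (I i)))"
      unfolding Phi_def using a J_le I_fin
      by (intro ennreal_leI prod_mono conjI powr_mono2 enn2real_mono) (auto simp: less_imp_le)
    finally show ?thesis .
  qed
  then have "(SUP N. \<integral>\<^sup>+z. ennreal (G z) * gw n (real (Suc N)) z \<partial>leb n) \<le> ennreal (Phi m a (\<lambda>i. enn2real (I i)))"
    by (intro SUP_least) simp
  then show ?thesis by (subst (asm) leb_gw_SUP) auto
qed

text \<open>A negative exponent reverses the effect of \<open>J i t \<le> I i\<close>, so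
  convergence of \<open>J\<close> to \<open>I\<close> is used instead of a comparison; it passes
  through the powers because no \<open>I i\<close> vanishes in the main case. On the other side the
  weight is simply bounded by 1.\<close>

lemma bl_lower:
  assumes QF: "\<And>e. 0 \<le> QF n m k A a e" and a: "\<And>i. i < m \<Longrightarrow> a i \<noteq> 0"
    and hpos: "\<And>i y. i < m \<Longrightarrow> a i < 0 \<Longrightarrow> 0 < h i y"
  shows "ennreal (Phi m a (\<lambda>i. enn2real (I i))) \<le> (\<integral>\<^sup>+z. ennreal (G z) \<partial>leb n)"
proof (cases "\<exists>i<m. enn2real (I i) = 0")
  case True
  then have "Phi m a (\<lambda>i. enn2real (I i)) = 0" unfolding Phi_def by (auto intro!: prod_zero bexI)
  then show ?thesis by simp
next
  case False
  have b: "ennreal (Phi m a (\<lambda>i. enn2real (J i t))) \<le> (\<integral>\<^sup>+z. ennreal (G z) \<partial>leb n)" if t: "0 < t" for t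
  proof -
    have "ennreal (Phi m a (\<lambda>i. \<integral>y. h i (lmap n (k i) (A i) (\<lambda>j. t * y j)) \<partial>gauss n)) \<le> (\<integral>\<^sup>+y. ennreal (G (\<lambda>j. t * y j)) \<partial>gauss n)"
      unfolding G_def by (rule gaussian_lower) (use QF a hm h0 hpos law_i(1)[OF _ t] t in auto)
    moreover have "Phi m a (\<lambda>i. \<integral>y. h i (lmap n (k i) (A i) (\<lambda>j. t * y j)) \<partial>gauss n) = Phi m a (\<lambda>i. cc t ^ k i * enn2real (J i t))"
      unfolding Phi_def using law_i(2)[OF _ t] by (intro prod.cong) auto
    ultimately have "ennreal (Phi m a (\<lambda>i. enn2real (J i t))) \<le> (\<integral>\<^sup>+z. ennreal (G z) * gw n t z \<partial>leb n)"
      unfolding law_G[OF t] by (simp only: scaling[OF t] cancel(2)[OF t])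
    also have "\<dots> \<le> (\<integral>\<^sup>+z. ennreal (G z) \<partial>leb n)"
      using mult_left_mono[OF gw_le_1] by (intro nn_integral_mono) fastforce
    finally show ?thesis .
  qed
  have Jl: "(\<lambda>N. enn2real (J i (real (Suc N)))) \<longlonglongrightarrow> enn2real (I i)" if i: "i < m" for i
  proof -
    note [measurable] = hm[OF i]
    have "(\<lambda>N. J i (real (Suc N))) \<longlonglongrightarrow> I i"
      unfolding J_def I_def
      by (subst leb_gw_SUP(1)[symmetric, where d="k i"], measurable, rule LIMSEQ_SUP, rule leb_gw_SUP(2)) measurable
    then show ?thesis using I_fin[OF i] by (intro tendsto_enn2real) auto
  qed
  have "(\<lambda>N. Phi m a (\<lambda>i. enn2real (J i (real (Suc N))))) \<longlonglongrightarrow> Phi m a (\<lambda>i. enn2real (I i))"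
    using Jl False by (intro Phi_tendsto) (auto simp: less_le)
  then have "(\<lambda>N. ennreal (Phi m a (\<lambda>i. enn2real (J i (real (Suc N)))))) \<longlonglongrightarrow> ennreal (Phi m a (\<lambda>i. enn2real (I i)))"
    by (rule tendsto_ennrealI)
  then show ?thesis by (rule LIMSEQ_le_const2) (use b in auto)
qed

end

subsection \<open>Triangular factorizations\<close>

definition lower_tri :: "nat \<Rightarrow> (nat \<Rightarrow> nat \<Rightarrow> real) \<Rightarrow> bool" where
  "lower_tri d L \<longleftrightarrow> (\<forall>i<d. 0 < L i i) \<and> (\<forall>i j. i < j \<longrightarrow> j < d \<longrightarrow> L i j = 0)"

lemma lower_tri_Suc: "lower_tri (Suc d) L \<Longrightarrow> lower_tri d L"
  by (auto simp: lower_tri_def)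

lemma forward_solve:
  assumes "lower_tri d L"
  shows "\<exists>x. \<forall>r<d. (\<Sum>l<d. L r l * x l) = b r"
  using assms
proof (induction d)
  case (Suc d)
  then obtain x where x: "\<And>r. r < d \<Longrightarrow> (\<Sum>l<d. L r l * x l) = b r" using lower_tri_Suc by blast
  define x' where "x' = x(d := (b d - (\<Sum>l<d. L d l * x l)) / L d d)"
  have s: "(\<Sum>l<d. L r l * x' l) = (\<Sum>l<d. L r l * x l)" for r by (simp add: x'_def)
  have "(\<Sum>l<Suc d. L r l * x' l) = b r" if r: "r < Suc d" for r
  proof (cases "r = d")
    case True
    have "L d d \<noteq> 0" using Suc.prems by (auto simp: lower_tri_def)
    then show ?thesis using True s by (simp add: x'_def)
  next
    case False
    then have "L r d = 0" using Suc.prems r by (auto simp: lower_tri_def)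
    then show ?thesis using s x False r by simp
  qed
  then show ?case by blast
qed auto

text \<open>The system with the transpose of L: the last unknown is determined first and moved to
  the right-hand side, which is why b is generalized in the induction.\<close>

lemma backward_solve:
  assumes "lower_tri d L"
  shows "\<exists>x. \<forall>l<d. (\<Sum>r<d. L r l * x r) = b l"
  using assms
proof (induction d arbitrary: b)
  case (Suc d)
  define z where "z = b d / L d d"
  obtain x where x: "\<And>l. l < d \<Longrightarrow> (\<Sum>r<d. L r l * x r) = b l - L d l * z"
    using Suc.IH[OF lower_tri_Suc[OF Suc.prems], of "\<lambda>l. b l - L d l * z"] by blast
  define x' where "x' = x(d := z)"
  have s: "(\<Sum>r<d. L r l * x' r) = (\<Sum>r<d. L r l * x r)" for l by (simp add: x'_def)
  have "(\<Sum>r<Suc d. L r l * x' r) = b l" if l: "l < Suc d" for l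
  proof (cases "l = d")
    case True
    have "L d d \<noteq> 0" using Suc.prems by (auto simp: lower_tri_def)
    moreover have "(\<Sum>r<d. L r d * x r) = 0" using Suc.prems by (intro sum.neutral) (auto simp: lower_tri_def)
    ultimately show ?thesis using True s by (simp add: x'_def z_def)
  next
    case False
    then show ?thesis using s x l by (simp add: x'_def)
  qed
  then show ?case by blast
qed auto

lemma lower_tri_inj:
  assumes "lower_tri d L" and "\<And>r. r < d \<Longrightarrow> (\<Sum>l<d. L r l * x l) = 0" and "i < d"
  shows "x i = 0"
  using assms
proof (induction d arbitrary: i)
  case (Suc d)
  have 0: "x j = 0" if "j < d" for j
  proof (rule Suc.IH[OF lower_tri_Suc[OF Suc.prems(1)] _ that])
    fix r assume r: "r < d"
    then have "L r d = 0" using Suc.prems(1) by (auto simp: lower_tri_def)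
    then show "(\<Sum>l<d. L r l * x l) = 0" using Suc.prems(2)[of r] r by simp
  qed
  show ?case
  proof (cases "i = d")
    case True
    have "L d d * x d = 0" using Suc.prems(2)[of d] 0 by simp
    moreover have "L d d \<noteq> 0" using Suc.prems(1) by (auto simp: lower_tri_def)
    ultimately show ?thesis using True by simp
  qed (use 0 Suc.prems(3) in auto)
qed auto

definition pos_def_fun :: "nat \<Rightarrow> (nat \<Rightarrow> nat \<Rightarrow> real) \<Rightarrow> bool" where
  "pos_def_fun d V \<longleftrightarrow> (\<forall>i<d. \<forall>j<d. V i j = V j i) \<and>
    (\<forall>x. (\<exists>i<d. x i \<noteq> 0) \<longrightarrow> 0 < (\<Sum>i<d. \<Sum>j<d. x i * V i j * x j))"

lemma gram_quad:
  fixes V L :: "nat \<Rightarrow> nat \<Rightarrow> real" and x :: "nat \<Rightarrow> real"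
  assumes "\<And>i j. i < d \<Longrightarrow> j < d \<Longrightarrow> V i j = (\<Sum>l<e. L i l * L j l)"
  shows "(\<Sum>i<d. \<Sum>j<d. x i * V i j * x j) = (\<Sum>l<e. (\<Sum>i<d. L i l * x i)\<^sup>2)"
proof -
  have "(\<Sum>i<d. \<Sum>j<d. x i * V i j * x j) = (\<Sum>i<d. \<Sum>j<d. \<Sum>l<e. (L i l * x i) * (L j l * x j))"
  proof (intro sum.cong refl)
    fix i j assume "i \<in> {..<d}" "j \<in> {..<d}"
    then have "x i * V i j * x j = (\<Sum>l<e. x i * (L i l * L j l) * x j)"
      using assms by (simp only: sum_distrib_left sum_distrib_right lessThan_iff)
    then show "x i * V i j * x j = (\<Sum>l<e. (L i l * x i) * (L j l * x j))"
      by (simp only: mult_ac)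
  qed
  also have "\<dots> = (\<Sum>i<d. \<Sum>l<e. \<Sum>j<d. (L i l * x i) * (L j l * x j))"
    by (intro sum.cong refl sum.swap)
  also have "\<dots> = (\<Sum>l<e. \<Sum>i<d. \<Sum>j<d. (L i l * x i) * (L j l * x j))"
    by (rule sum.swap)
  also have "\<dots> = (\<Sum>l<e. (\<Sum>i<d. L i l * x i)\<^sup>2)"
    by (simp add: power2_eq_square sum_product)
  finally show ?thesis .
qed

text \<open>Bordering: the new row w solves L w = last column of V, and the new diagonal entry is
  the square root of the Schur complement V d d - |w|^2.\<close>

lemma cholesky:
  assumes "pos_def_fun d V"
  shows "\<exists>L. lower_tri d L \<and> (\<forall>i<d. \<forall>j<d. V i j = (\<Sum>l<d. L i l * L j l))"
  using assms
proof (induction d)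
  case 0
  show ?case by (auto simp: lower_tri_def)
next
  case (Suc d)
  have sym: "V i j = V j i" if "i < Suc d" "j < Suc d" for i j using Suc.prems that by (auto simp: pos_def_fun_def)
  have pos: "0 < (\<Sum>i<Suc d. \<Sum>j<Suc d. x i * V i j * x j)" if "i < Suc d" "x i \<noteq> 0" for x i
    using Suc.prems that unfolding pos_def_fun_def by blast
  have "pos_def_fun d V"
    unfolding pos_def_fun_def
  proof (intro conjI allI impI)
    fix x :: "nat \<Rightarrow> real" assume "\<exists>i<d. x i \<noteq> 0"
    then obtain i where i: "i < d" "x i \<noteq> 0" by blast
    have "0 < (\<Sum>i<Suc d. \<Sum>j<Suc d. (x(d := 0)) i * V i j * (x(d := 0)) j)"
      using i by (intro pos[of i]) auto
    then show "0 < (\<Sum>i<d. \<Sum>j<d. x i * V i j * x j)" by simp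
  qed (use sym in auto)
  from Suc.IH[OF this] obtain L where L: "lower_tri d L" and VL: "\<And>i j. i < d \<Longrightarrow> j < d \<Longrightarrow> V i j = (\<Sum>l<d. L i l * L j l)"
    by blast
  obtain w where w: "\<And>r. r < d \<Longrightarrow> (\<Sum>l<d. L r l * w l) = V r d" using forward_solve[OF L, of "\<lambda>r. V r d"] by blast
  \<comment> \<open>Testing positivity with this x, extended by 1, gives exactly the Schur
    complement: the old block yields |w|^2 and the two cross terms yield -2 |w|^2.\<close>
  obtain x where x: "\<And>l. l < d \<Longrightarrow> (\<Sum>r<d. L r l * x r) = - w l" using backward_solve[OF L, of "\<lambda>l. - w l"] by blast
  have gap: "0 < V d d - (\<Sum>l<d. (w l)\<^sup>2)"
  proof -
    let ?x = "x(d := 1)"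
    have "0 < (\<Sum>i<Suc d. \<Sum>j<Suc d. ?x i * V i j * ?x j)" by (rule pos[of d]) auto
    also have "\<dots> = (\<Sum>i<d. \<Sum>j<d. x i * V i j * x j) + (\<Sum>i<d. x i * V i d) + (\<Sum>j<d. V d j * x j) + V d d"
      by (simp add: sum.distrib add_ac)
    also have "(\<Sum>i<d. \<Sum>j<d. x i * V i j * x j) = (\<Sum>l<d. (w l)\<^sup>2)"
      using gram_quad[where d=d and V=V and e=d and L=L and x=x, OF VL] x by simp
    also have "(\<Sum>j<d. V d j * x j) = (\<Sum>i<d. x i * V i d)"
      using sym by (intro sum.cong) auto
    also have "(\<Sum>i<d. x i * V i d) = - (\<Sum>l<d. (w l)\<^sup>2)"
    proof -
      have "(\<Sum>i<d. x i * V i d) = (\<Sum>i<d. \<Sum>l<d. w l * (L i l * x i))"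
        using w[symmetric] by (simp add: sum_distrib_left mult_ac)
      also have "\<dots> = (\<Sum>l<d. w l * (\<Sum>i<d. L i l * x i))"
        by (subst sum.swap) (simp add: sum_distrib_left)
      finally show ?thesis using x by (simp add: power2_eq_square sum_negf)
    qed
    finally show ?thesis by simp
  qed
  define L' where "L' i l = (if i < d then (if l < d then L i l else 0) else if l < d then w l else sqrt (V d d - (\<Sum>l<d. (w l)\<^sup>2)))" for i l
  have "lower_tri (Suc d) L'"
    using L gap by (auto simp: lower_tri_def L'_def less_Suc_eq)
  moreover have "V i j = (\<Sum>l<Suc d. L' i l * L' j l)" if ij: "i < Suc d" "j < Suc d" for i j
  proof -
    consider "i < d" "j < d" | "i < d" "j = d" | "i = d" "j < d" | "i = d" "j = d" using ij by linarith
    then show ?thesis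
    proof cases
      case 1 then show ?thesis by (simp add: L'_def VL)
    next
      case 2 then show ?thesis using w[of i] by (simp add: L'_def)
    next
      case 3 then show ?thesis using w[of j] sym[of d j] by (simp add: L'_def mult.commute)
    next
      case 4 then show ?thesis using gap by (simp add: L'_def power2_eq_square[symmetric])
    qed
  qed
  ultimately show ?case by blast
qed

definition orthonormal_rows :: "nat \<Rightarrow> nat \<Rightarrow> (nat \<Rightarrow> nat \<Rightarrow> real) \<Rightarrow> bool" where
  "orthonormal_rows d n Q \<longleftrightarrow> (\<forall>r<d. \<forall>s<d. (\<Sum>j<n. Q r j * Q s j) = (if r = s then 1 else 0))"

text \<open>Q is the inverse of L times A, found column by column. With M = Q Q^T - 1 the Gram
  hypothesis reads L M L^T = 0, and injectivity of L, used once on each side, gives M = 0.\<close>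

lemma lq_decomposition:
  assumes L: "lower_tri d L" and VL: "\<And>i j. i < d \<Longrightarrow> j < d \<Longrightarrow> (\<Sum>l<n. A i l * A j l) = (\<Sum>l<d. L i l * L j l)"
  shows "\<exists>Q. orthonormal_rows d n Q \<and> (\<forall>r<d. \<forall>j. A r j = (\<Sum>l<d. L r l * Q l j))"
proof -
  have "\<forall>j. \<exists>q. \<forall>r<d. (\<Sum>l<d. L r l * q l) = A r j" by (intro allI forward_solve[OF L])
  then have "\<exists>q. \<forall>j. \<forall>r<d. (\<Sum>l<d. L r l * q j l) = A r j" by (rule choice)
  then obtain q where q: "\<And>j r. r < d \<Longrightarrow> (\<Sum>l<d. L r l * q j l) = A r j" by blast
  define M where "M l l' = (\<Sum>j<n. q j l * q j l') - (if l = l' then 1 else 0)" for l l'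
  have LML: "(\<Sum>l<d. L r l * (\<Sum>l'<d. L s l' * M l l')) = 0" if r: "r < d" and s: "s < d" for r s
  proof -
    have s1: "(\<Sum>l'<d. L s l' * M l l') = (\<Sum>l'<d. L s l' * (\<Sum>j<n. q j l * q j l')) - L s l" if "l < d" for l
    proof -
      have "(\<Sum>l'<d. L s l' * (if l = l' then 1 else 0)) = (\<Sum>l'<d. if l = l' then L s l' else 0)"
        by (intro sum.cong) auto
      also have "\<dots> = L s l" using that by simp
      finally show ?thesis unfolding M_def right_diff_distrib sum_subtractf by simp
    qed
    have "(\<Sum>l<d. L r l * (\<Sum>l'<d. L s l' * M l l')) = (\<Sum>l<d. L r l * ((\<Sum>l'<d. L s l' * (\<Sum>j<n. q j l * q j l')) - L s l))"
      by (intro sum.cong refl) (simp add: s1)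
    also have "\<dots> = (\<Sum>l<d. L r l * (\<Sum>l'<d. L s l' * (\<Sum>j<n. q j l * q j l'))) - (\<Sum>l<d. L r l * L s l)"
      by (simp only: right_diff_distrib sum_subtractf)
    also have "(\<Sum>l<d. L r l * (\<Sum>l'<d. L s l' * (\<Sum>j<n. q j l * q j l'))) = (\<Sum>l<d. \<Sum>l'<d. \<Sum>j<n. (L r l * q j l) * (L s l' * q j l'))"
      unfolding sum_distrib_left by (intro sum.cong refl) (simp only: mult_ac)
    also have "(\<Sum>l<d. \<Sum>l'<d. \<Sum>j<n. (L r l * q j l) * (L s l' * q j l')) = (\<Sum>l<d. \<Sum>j<n. \<Sum>l'<d. (L r l * q j l) * (L s l' * q j l'))"
      by (intro sum.cong refl sum.swap)
    also have "\<dots> = (\<Sum>j<n. \<Sum>l<d. \<Sum>l'<d. (L r l * q j l) * (L s l' * q j l'))" by (rule sum.swap)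
    also have "\<dots> = (\<Sum>j<n. A r j * A s j)" using q r s by (simp add: sum_product[symmetric])
    also have "\<dots> = (\<Sum>l<d. L r l * L s l)" using VL r s by simp
    finally show ?thesis by simp
  qed
  have "(\<Sum>l'<d. L s l' * M l l') = 0" if l: "l < d" and s: "s < d" for l s
    by (rule lower_tri_inj[OF L _ l, where x="\<lambda>l. \<Sum>l'<d. L s l' * M l l'"]) (use LML s in auto)
  then have "M l l' = 0" if "l < d" "l' < d" for l l'
    using lower_tri_inj[OF L _ that(2), where x="M l"] that by auto
  then have "orthonormal_rows d n (\<lambda>l j. q j l)"
    unfolding orthonormal_rows_def M_def by simp
  then show ?thesis using q by (intro exI[of _ "\<lambda>l j. q j l"]) auto
qed

text \<open>Filling up the d rows with zero rows gives a square matrix with a zero row, hence a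
  singular one; a kernel vector is then normalized.\<close>

lemma unit_orthogonal_vector:
  fixes Q :: "nat \<Rightarrow> nat \<Rightarrow> real"
  assumes "d < n"
  shows "\<exists>v. (\<forall>r<d. (\<Sum>j<n. Q r j * v j) = 0) \<and> (\<Sum>j<n. (v j)\<^sup>2) = (1::real)"
proof -
  define M where "M = mat n n (\<lambda>(r, j). if r < d then Q r j else 0)"
  have M: "M \<in> carrier_mat n n" by (simp add: M_def)
  have "det M = 0"
  proof (rule ccontr)
    assume "det M \<noteq> 0"
    then obtain N where N: "N \<in> carrier_mat n n" "M * N = 1\<^sub>m n"
      using det_non_zero_imp_unit[OF M, of n] by (auto simp: Units_def ring_mat_def)
    have "(M * N) $$ (d, d) = row M d \<bullet> col N d" using M N(1) assms by simp
    also have "row M d = 0\<^sub>v n" using assms by (intro eq_vecI) (auto simp: M_def)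
    finally show False using N assms by simp
  qed
  then obtain v where v: "v \<in> carrier_vec n" "v \<noteq> 0\<^sub>v n" "M *\<^sub>v v = 0\<^sub>v n"
    using det_0_iff_vec_prod_zero[OF M] by blast
  have o: "(\<Sum>j<n. Q r j * vec_index v j) = 0" if "r < d" for r
  proof -
    have "(M *\<^sub>v v) $ r = (\<Sum>j<n. Q r j * vec_index v j)"
      using that assms v(1) by (simp add: M_def scalar_prod_def atLeast0LessThan)
    then show ?thesis using v(3) that assms by simp
  qed
  define s where "s = (\<Sum>j<n. (vec_index v j)\<^sup>2)"
  have "s \<noteq> 0"
  proof
    assume "s = 0"
    then have "\<forall>j<n. vec_index v j = 0" unfolding s_def by (simp add: sum_nonneg_eq_0_iff)
    then have "v = 0\<^sub>v n" using v(1) by (intro eq_vecI) auto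
    then show False using v(2) by simp
  qed
  moreover have "0 \<le> s" unfolding s_def by (simp add: sum_nonneg)
  ultimately have s: "0 < s" by simp
  show ?thesis
  proof (intro exI[of _ "\<lambda>j. vec_index v j / sqrt s"] conjI allI impI)
    fix r assume "r < d"
    then show "(\<Sum>j<n. Q r j * (vec_index v j / sqrt s)) = 0"
      using o[of r] by (simp add: sum_divide_distrib[symmetric])
  next
    show "(\<Sum>j<n. (vec_index v j / sqrt s)\<^sup>2) = 1"
      using s by (simp add: power_divide sum_divide_distrib[symmetric]) (simp add: s_def)
  qed
qed

lemma orthonormal_completion:
  assumes "orthonormal_rows d n Q" "d \<le> n"
  shows "\<exists>Q'. orthonormal_rows n n Q' \<and> (\<forall>r<d. \<forall>j. Q' r j = Q r j)"
proof -
  have "\<exists>Q'. orthonormal_rows e n Q' \<and> (\<forall>r<d. \<forall>j. Q' r j = Q r j)" if "d \<le> e" "e \<le> n" for e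
    using that
  proof (induction e rule: dec_induct)
    case base
    then show ?case using assms(1) by blast
  next
    case (step e)
    then obtain Q' where Q': "orthonormal_rows e n Q'" "\<forall>r<d. \<forall>j. Q' r j = Q r j" by auto
    obtain v where v: "\<And>r. r < e \<Longrightarrow> (\<Sum>j<n. Q' r j * v j) = 0" "(\<Sum>j<n. (v j)\<^sup>2) = 1"
      using unit_orthogonal_vector[of e n Q'] step.prems by auto
    have "orthonormal_rows (Suc e) n (Q'(e := v))"
      unfolding orthonormal_rows_def
    proof (intro allI impI)
      fix r s assume rs: "r < Suc e" "s < Suc e"
      consider "r < e" "s < e" | "r < e" "s = e" | "r = e" "s < e" | "r = e" "s = e" using rs by linarith
      then show "(\<Sum>j<n. (Q'(e := v)) r j * (Q'(e := v)) s j) = (if r = s then 1 else 0)"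
      proof cases
        case 1 then show ?thesis using Q'(1) by (auto simp: orthonormal_rows_def)
      next
        case 2 then show ?thesis using v(1)[of r] by simp
      next
        case 3 then show ?thesis using v(1)[of s] by (simp add: mult.commute)
      next
        case 4 then show ?thesis using v(2) by (simp add: power2_eq_square)
      qed
    qed
    moreover have "\<forall>r<d. \<forall>j. (Q'(e := v)) r j = Q r j" using Q'(2) step.hyps by auto
    ultimately show ?case by blast
  qed
  then show ?thesis using assms(2) by blast
qed

text \<open>Orthonormal rows give Q Q^T = 1, hence Q^T Q = 1 as the matrix is square. The latter
  yields the isometry, the former the preimage Q^T y.\<close>

lemma orthonormal_orth:
  assumes "orthonormal_rows n n Q"
  shows "orth n Q"
proof -
  define M where "M = mat n n (\<lambda>(i, j). Q i j)"
  have M: "M \<in> carrier_mat n n" by (simp add: M_def)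
  have "M * transpose_mat M = 1\<^sub>m n"
    using assms by (intro eq_matI) (auto simp: M_def orthonormal_rows_def scalar_prod_def atLeast0LessThan)
  then have MM: "transpose_mat M * M = 1\<^sub>m n"
    by (rule mat_mult_left_right_inverse[OF M, rotated]) (simp add: M)
  have cols: "(\<Sum>r<n. Q r i * Q r j) = (if i = j then 1 else 0)" if "i < n" "j < n" for i j
  proof -
    have "(transpose_mat M * M) $$ (i, j) = (\<Sum>r<n. Q r i * Q r j)"
      using that by (simp add: M_def scalar_prod_def atLeast0LessThan)
    then show ?thesis using MM that by simp
  qed
  have rows: "(\<Sum>j<n. Q r j * Q s j) = (if r = s then 1 else 0)" if "r < n" "s < n" for r s
    using assms that by (auto simp: orthonormal_rows_def)
  show ?thesis unfolding orth_def
  proof (intro conjI allI)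
    fix x :: "nat \<Rightarrow> real"
    have "(\<Sum>r<n. (lmap n n Q x r)\<^sup>2) = (\<Sum>r<n. (\<Sum>j<n. Q r j * x j)\<^sup>2)" by (simp add: lmap_def)
    also have "\<dots> = (\<Sum>i<n. \<Sum>j<n. x i * (if i = j then 1 else 0) * x j)"
      using cols by (intro gram_quad[symmetric, where L="\<lambda>j r. Q r j"]) auto
    also have "\<dots> = (\<Sum>j<n. (x j)\<^sup>2)"
      by (simp add: power2_eq_square if_distrib[where f="\<lambda>c. _ * c"] if_distrib[where f="\<lambda>c. c * _"] cong: if_cong)
    finally show "(\<Sum>r<n. (lmap n n Q x r)\<^sup>2) = (\<Sum>j<n. (x j)\<^sup>2)" .
  next
    fix y :: "nat \<Rightarrow> real"
    have "lmap n n Q (\<lambda>j. \<Sum>s<n. Q s j * y s) = zext n y"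
    proof
      fix r
      show "lmap n n Q (\<lambda>j. \<Sum>s<n. Q s j * y s) r = zext n y r"
      proof (cases "r < n")
        case True
        have "(\<Sum>j<n. Q r j * (\<Sum>s<n. Q s j * y s)) = (\<Sum>s<n. (\<Sum>j<n. Q r j * Q s j) * y s)"
          unfolding sum_distrib_left sum_distrib_right by (subst sum.swap) (simp add: mult_ac)
        also have "\<dots> = y r"
          using True rows by (simp add: if_distrib[where f="\<lambda>c. c * _"] cong: if_cong)
        finally show ?thesis using True by (simp add: lmap_def zext_def)
      qed (simp add: lmap_def zext_def)
    qed
    then show "\<exists>x. lmap n n Q x = zext n y" by blast
  qed
qed

lemma row_factorization:
  assumes L: "lower_tri d L" and VL: "\<And>i j. i < d \<Longrightarrow> j < d \<Longrightarrow> (\<Sum>l<n. A i l * A j l) = (\<Sum>l<d. L i l * L j l)" and "d \<le> n"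
  shows "\<exists>Q. orth n Q \<and> (\<forall>r<d. \<forall>j. A r j = (\<Sum>l<d. L r l * Q l j))"
proof -
  obtain Q where Q: "orthonormal_rows d n Q" "\<forall>r<d. \<forall>j. A r j = (\<Sum>l<d. L r l * Q l j)"
    using lq_decomposition[OF L VL] by blast
  obtain Q' where Q': "orthonormal_rows n n Q'" "\<forall>r<d. \<forall>j. Q' r j = Q r j"
    using orthonormal_completion[OF Q(1) \<open>d \<le> n\<close>] by blast
  then show ?thesis using Q(2) orthonormal_orth[OF Q'(1)] by (intro exI[of _ Q']) auto
qed

subsection \<open>Block matrices and Lebesgue measure on vectors\<close>

text \<open>Nested to the left, so that the last block splits off in step with
  \<open>diag_block_mat_last\<close> for block diagonal matrices.\<close>

primrec cvec :: "(nat \<Rightarrow> real vec) \<Rightarrow> nat \<Rightarrow> real vec" where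
  "cvec w 0 = 0\<^sub>v 0"
| "cvec w (Suc m) = cvec w m @\<^sub>v w m"

lemma cvec_carrier:
  "(\<And>i. i < m \<Longrightarrow> w i \<in> carrier_vec (d i)) \<Longrightarrow> cvec w m \<in> carrier_vec (\<Sum>i<m. d i)"
  by (induction m) auto

lemma cvec_scalar_prod:
  assumes "\<And>i. i < m \<Longrightarrow> x i \<in> carrier_vec (d i)" "\<And>i. i < m \<Longrightarrow> y i \<in> carrier_vec (d i)"
  shows "cvec x m \<bullet> cvec y m = (\<Sum>i<m. x i \<bullet> y i)"
  using assms
proof (induction m)
  case (Suc m)
  then show ?case
    using scalar_prod_append[OF cvec_carrier[of m x d] _ cvec_carrier[of m y d], of "x m" "d m" "y m"] by simp
qed simp

lemma diag_mat_seq_carrier: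
  assumes "\<And>i. i < m \<Longrightarrow> X i \<in> carrier_mat (d i) (d i)"
  shows "diag_mat_seq m X \<in> carrier_mat (\<Sum>i<m. d i) (\<Sum>i<m. d i)"
  using assms
proof (induction m)
  case (Suc m)
  then show ?case by (auto simp: diag_mat_seq_def diag_block_mat_last Let_def)
qed (simp add: diag_mat_seq_def)

lemma diag_mat_seq_mult:
  assumes "\<And>i. i < m \<Longrightarrow> X i \<in> carrier_mat (d i) (d i)" "\<And>i. i < m \<Longrightarrow> w i \<in> carrier_vec (d i)"
  shows "diag_mat_seq m X *\<^sub>v cvec w m = cvec (\<lambda>i. X i *\<^sub>v w i) m"
  using assms
proof (induction m)
  case 0
  show ?case by (auto simp: diag_mat_seq_def)
next
  case (Suc m)
  let ?N = "\<Sum>i<m. d i"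
  have D: "diag_mat_seq m X \<in> carrier_mat ?N ?N" using Suc.prems by (intro diag_mat_seq_carrier) auto
  have c: "cvec w m \<in> carrier_vec ?N" using Suc.prems by (intro cvec_carrier) auto
  have "diag_mat_seq (Suc m) X = four_block_mat (diag_mat_seq m X) (0\<^sub>m ?N (d m)) (0\<^sub>m (d m) ?N) (X m)"
    using D Suc.prems(1)[of m] by (auto simp: diag_mat_seq_def diag_block_mat_last Let_def)
  then show ?case
    using mult_mat_vec_split[OF D _ c, of "X m" "d m" "w m"] Suc by simp
qed

lemma stack_mat_carrier:
  assumes "\<And>i. i < m \<Longrightarrow> A i \<in> carrier_mat (d i) n"
  shows "stack_mat n m A \<in> carrier_mat (\<Sum>i<m. d i) n"
proof -
  have "length (concat (map (\<lambda>i. rows (A i)) [0..<m])) = (\<Sum>i<m. d i)"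
    using assms by (induction m) auto
  then show ?thesis unfolding stack_mat_def by (metis mat_of_rows_carrier(1))
qed

text \<open>The block form of the rows of the transpose, from which W^T v is computed block by
  block.\<close>

lemma col_stack_mat:
  assumes "\<And>i. i < m \<Longrightarrow> A i \<in> carrier_mat (d i) n" and j: "j < n"
  shows "col (stack_mat n m A) j = cvec (\<lambda>i. col (A i) j) m"
  using assms(1)
proof (induction m)
  case 0
  show ?case by (auto simp: stack_mat_def)
next
  case (Suc m)
  let ?rs = "concat (map (\<lambda>i. rows (A i)) [0..<m])"
  have S: "stack_mat n m A \<in> carrier_mat (\<Sum>i<m. d i) n" using Suc.prems by (intro stack_mat_carrier) auto
  then have len: "length ?rs = (\<Sum>i<m. d i)" using carrier_matD(1)[OF S] by (simp add: stack_mat_def)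
  have Am: "A m \<in> carrier_mat (d m) n" using Suc.prems by auto
  have "col (stack_mat n (Suc m) A) j = col (stack_mat n m A) j @\<^sub>v col (A m) j"
  proof (rule eq_vecI)
    show "dim_vec (col (stack_mat n (Suc m) A) j) = dim_vec (col (stack_mat n m A) j @\<^sub>v col (A m) j)"
      using len Am by (simp add: stack_mat_def)
    fix i assume "i < dim_vec (col (stack_mat n m A) j @\<^sub>v col (A m) j)"
    then have i: "i < length ?rs + d m" using len Am by (simp add: stack_mat_def)
    have "vec_index (col (stack_mat n (Suc m) A) j) i = vec_index ((?rs @ rows (A m)) ! i) j"
      using i Am j by (simp add: stack_mat_def mat_of_rows_index)
    also have "\<dots> = vec_index (col (stack_mat n m A) j @\<^sub>v col (A m) j) i"
    proof (cases "i < length ?rs")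
      case True
      then show ?thesis using j Am by (simp add: nth_append stack_mat_def mat_of_rows_index)
    next
      case False
      then show ?thesis using j Am i by (simp add: nth_append stack_mat_def)
    qed
    finally show "vec_index (col (stack_mat n (Suc m) A) j) i = vec_index (col (stack_mat n m A) j @\<^sub>v col (A m) j) i" .
  qed
  then show ?case using Suc by simp
qed

lemma quad_form_sum:
  assumes "M \<in> carrier_mat d d" "x \<in> carrier_vec d"
  shows "x \<bullet> (M *\<^sub>v x) = (\<Sum>i<d. \<Sum>j<d. vec_index x i * M $$ (i, j) * vec_index x j)"
  using assms by (simp add: scalar_prod_def atLeast0LessThan sum_distrib_left mult.assoc)

lemma pos_def_fun_of_mat:
  assumes B: "B \<in> carrier_mat n n" and pd: "pos_def_mat B"
  shows "pos_def_fun n (\<lambda>i j. B $$ (i, j))"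
  unfolding pos_def_fun_def
proof (intro conjI allI impI)
  fix i j assume "i < n" "j < n"
  have "transpose_mat B = B" using pd by (simp add: pos_def_mat_def symmetric_mat_def)
  then have "transpose_mat B $$ (i, j) = B $$ (i, j)" by simp
  then show "B $$ (i, j) = B $$ (j, i)" using \<open>i < n\<close> \<open>j < n\<close> B by simp
next
  fix x :: "nat \<Rightarrow> real" assume "\<exists>i<n. x i \<noteq> 0"
  then obtain i where i: "i < n" "x i \<noteq> 0" by blast
  have v: "vec n x \<in> carrier_vec n" by simp
  have "vec n x \<noteq> 0\<^sub>v n"
  proof
    assume "vec n x = 0\<^sub>v n"
    then have "vec_index (vec n x) i = 0" using i by simp
    then show False using i by simp
  qed
  then have "0 < vec n x \<bullet> (B *\<^sub>v vec n x)"
    using pd B v by (auto simp: pos_def_mat_def)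
  then show "0 < (\<Sum>i<n. \<Sum>j<n. x i * B $$ (i, j) * x j)"
    unfolding quad_form_sum[OF B v] by simp
qed

text \<open>Full rank makes the columns span the space, so w is a combination of vectors orthogonal
  to w and w \<bullet> w = 0.\<close>

lemma full_row_rank_inj:
  assumes A: "(A :: real mat) \<in> carrier_mat d n" and r: "vec_space.rank d A = d"
    and w: "w \<in> carrier_vec d" and z: "\<And>j. j < n \<Longrightarrow> col A j \<bullet> w = 0"
  shows "w = 0\<^sub>v d"
proof -
  interpret vec_space "TYPE(real)" d .
  let ?C = "set (cols A)"
  have C: "?C \<subseteq> carrier_vec d" using A cols_dim by blast
  obtain S where S: "maximal S (\<lambda>T. T \<subseteq> ?C \<and> lin_indpt T)" "finite S"
  proof -
    have "lin_indpt {}" by (auto simp: lin_dep_def)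
    then show ?thesis
      using maximal_exists_superset[of ?C "\<lambda>T. T \<subseteq> ?C \<and> lin_indpt T" "{}"] that by auto
  qed
  have Sl: "S \<subseteq> ?C" "lin_indpt S" using S(1) by (auto simp: maximal_def)
  have "card S = d" using rank_card_indpt[OF A S(1)] r by simp
  then have "basis S" using Sl C S(2) by (intro dim_li_is_basis) (auto simp: dim_is_n)
  then have sp: "span S = carrier_vec d" by (simp add: basis_def)
  have "w \<in> span S" using w sp by simp
  then obtain a T where T: "finite T" "T \<subseteq> S" and wl: "w = lincomb a T" unfolding span_def by blast
  have Tc: "T \<subseteq> carrier_vec d" using T Sl C by blast
  have "w \<bullet> w = lincomb a T \<bullet> w" using wl by simp
  also have "\<dots> = (\<Sum>v\<in>T. (a v \<cdot>\<^sub>v v) \<bullet> w)"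
  proof -
    have "lincomb a T \<bullet> w = (\<Sum>i<d. (\<Sum>v\<in>T. a v * vec_index v i) * vec_index w i)"
      using w lincomb_index[OF _ Tc] by (simp add: scalar_prod_def atLeast0LessThan)
    also have "\<dots> = (\<Sum>v\<in>T. \<Sum>i<d. a v * vec_index v i * vec_index w i)"
      unfolding sum_distrib_right by (rule sum.swap)
    also have "\<dots> = (\<Sum>v\<in>T. (a v \<cdot>\<^sub>v v) \<bullet> w)"
      using Tc w by (intro sum.cong) (auto simp: scalar_prod_def atLeast0LessThan)
    finally show ?thesis .
  qed
  also have "\<dots> = 0"
  proof (rule sum.neutral, rule ballI)
    fix v assume "v \<in> T"
    then have "v \<in> ?C" using T Sl by blast
    then obtain j where j: "j < n" "v = col A j" using A by (auto simp: cols_def)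
    then have "v \<bullet> w = 0" using z by simp
    moreover have "v \<in> carrier_vec d" using \<open>v \<in> T\<close> Tc by blast
    ultimately show "(a v \<cdot>\<^sub>v v) \<bullet> w = 0" using w by simp
  qed
  finally have "(\<Sum>i<d. vec_index w i * vec_index w i) = 0" using w by (simp add: scalar_prod_def atLeast0LessThan)
  then have "\<forall>i<d. vec_index w i * vec_index w i = 0" by (subst (asm) sum_nonneg_eq_0_iff) auto
  then show ?thesis using w by (intro eq_vecI) auto
qed

lemma det_gram_lower_tri:
  assumes L: "lower_tri d L" and M: "M \<in> carrier_mat d d"
    and Mg: "\<And>i j. i < d \<Longrightarrow> j < d \<Longrightarrow> M $$ (i, j) = (\<Sum>l<d. L i l * L j l)"
  shows "det M = (\<Prod>i<d. L i i)\<^sup>2"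
proof -
  define N where "N = mat d d (\<lambda>(i, j). L i j)"
  have N: "N \<in> carrier_mat d d" by (simp add: N_def)
  have "M = N * transpose_mat N"
    using M Mg by (intro eq_matI) (auto simp: N_def scalar_prod_def atLeast0LessThan)
  then have "det M = det N * det N" using N by (simp add: det_mult det_transpose)
  moreover have "det N = (\<Prod>i<d. L i i)"
    using L N by (subst det_lower_triangular[OF _ N]) (auto simp: N_def lower_tri_def prod_list_diag_prod atLeast0LessThan)
  ultimately show ?thesis by (simp add: power2_eq_square)
qed

section \<open>Transfer between sequences and vectors, up to null sets\<close>

abbreviation PiL :: "nat \<Rightarrow> (nat \<Rightarrow> real) measure" where
  "PiL k \<equiv> \<Pi>\<^sub>M i\<in>{..<k}. (lborel :: real measure)"

lemma zext_vec [simp]: "vec k (zext k x) = vec k x"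
  by (intro eq_vecI) (auto simp: zext_def)

lemma AE_lebesgue_vec:
  assumes "AE x in leb k. P (vec k x)"
  shows "AE v in lebesgue_vec k. P v"
proof -
  have "AE x in PiL k. P (vec k (zext k x))"
    using assms unfolding zprod_def by (rule AE_distrD[OF lb.zext_measurable])
  then have "AE x in PiL k. P (vec k x)" by simp
  then have "AE v in embed_measure (PiL k) (vec k). P v"
    by (subst AE_embed_measure'[OF inj_on_vec])
  then show ?thesis unfolding lebesgue_vec_def by (rule AE_completion)
qed

text \<open>In the applications f is Lebesgue measurable only, because \<open>lebesgue_vec\<close>
  is completed; its integral is computed through a Borel function that agrees with it almost
  everywhere.\<close>

lemma nn_integral_lebesgue_vec:
  assumes g: "g \<in> borel_measurable borel" and ae: "AE x in leb k. f (vec k x) = g x"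
  shows "(\<integral>\<^sup>+v. f v \<partial>lebesgue_vec k) = (\<integral>\<^sup>+x. g x \<partial>leb k)"
proof -
  define g' where "g' v = g (zext k (vec_index v))" for v
  have gz: "g' (vec k x) = g (zext k x)" for x
    unfolding g'_def by (rule arg_cong[where f=g]) (auto simp: zext_def)
  note [measurable] = g
  have "AE x in leb k. g (zext k x) = g x"
  proof -
    have "AE x in PiL k. g (zext k (zext k x)) = g (zext k x)" by (simp add: zext_zext)
    moreover have "{x \<in> space borel. g (zext k x) = g x} \<in> sets borel" by measurable
    ultimately show ?thesis unfolding zprod_def by (subst AE_distr_iff) auto
  qed
  then have "AE x in leb k. f (vec k x) = g' (vec k x)" using ae by eventually_elim (simp add: gz)
  then have "AE v in lebesgue_vec k. f v = g' v" by (rule AE_lebesgue_vec)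
  then have "(\<integral>\<^sup>+v. f v \<partial>lebesgue_vec k) = (\<integral>\<^sup>+v. g' v \<partial>lebesgue_vec k)" by (rule nn_integral_cong_AE)
  also have "\<dots> = (\<integral>\<^sup>+v. g' v \<partial>embed_measure (PiL k) (vec k))"
    unfolding lebesgue_vec_def by (rule nn_integral_completion)
  also have "\<dots> = (\<integral>\<^sup>+x. g' (vec k x) \<partial>PiL k)"
  proof (rule nn_integral_embed_measure'[OF inj_on_vec], rule measurable_embed_measure1)
    show "(\<lambda>x. g' (vec k x)) \<in> borel_measurable (PiL k)" unfolding gz by measurable
  qed
  also have "\<dots> = (\<integral>\<^sup>+x. g x \<partial>leb k)" unfolding gz by (rule lb.nn_integral_zprod[symmetric]) measurable
  finally show ?thesis .
qed

text \<open>The exceptional set of \<open>Q\<close> is not known to be measurable, so a measurable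
  null set containing it has to be carried over to the image measure.\<close>

lemma AE_PiL_leb:
  assumes "AE x in PiL k. Q (zext k x)"
  shows "AE x in leb k. Q x"
proof -
  obtain N where N: "N \<in> null_sets (PiL k)" "{x \<in> space (PiL k). \<not> Q (zext k x)} \<subseteq> N"
    using assms by (auto simp: eventually_ae_filter)
  have Ns [measurable]: "N \<in> sets (PiL k)" using N by auto
  \<comment> \<open>The points whose restriction lies in N, together with those not padded by zeros,
    which the image measure does not charge.\<close>
  define N' where "N' = {x. restrict x {..<k} \<in> N \<or> zext k x \<noteq> x}"
  have [measurable]: "(\<lambda>x. restrict x {..<k}) \<in> measurable borel (PiL k)"
    by (rule measurable_restrict) auto
  have "{x. restrict x {..<k} \<in> N} \<in> sets borel"
    using measurable_sets[OF \<open>(\<lambda>x. restrict x {..<k}) \<in> measurable borel (PiL k)\<close> Ns] by (simp add: vimage_def)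
  moreover have "{x. zext k x \<noteq> x} \<in> sets borel"
  proof -
    have "zext k x \<noteq> x \<longleftrightarrow> (\<exists>j\<ge>k. x j \<noteq> 0)" for x
      unfolding zext_def fun_eq_iff not_all by (metis not_le)
    then have "{x. zext k x \<noteq> x} = (\<Union>j\<in>{k..}. {x. x j \<noteq> 0})" by auto
    also have "\<dots> \<in> sets borel" by (intro sets.countable_UN') auto
    finally show ?thesis .
  qed
  ultimately have N's: "N' \<in> sets borel" unfolding N'_def by (simp add: Collect_disj_eq sets.Un)
  have "emeasure (leb k) N' = emeasure (PiL k) (zext k -` N' \<inter> space (PiL k))"
    unfolding zprod_def using N's by (intro emeasure_distr) auto
  also have "zext k -` N' \<inter> space (PiL k) = N"
  proof -
    have "restrict (zext k x) {..<k} = x" if "x \<in> space (PiL k)" for x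
      using that by (auto simp: zext_def space_PiM PiE_def extensional_def fun_eq_iff)
    then show ?thesis using sets.sets_into_space[OF Ns] by (auto simp: N'_def zext_zext)
  qed
  also have "emeasure (PiL k) N = 0" using N by auto
  finally have "N' \<in> null_sets (leb k)" using N's by auto
  moreover have "{x \<in> space (leb k). \<not> Q x} \<subseteq> N'"
  proof
    fix x assume "x \<in> {x \<in> space (leb k). \<not> Q x}"
    then have q: "\<not> Q x" by simp
    show "x \<in> N'"
    proof (cases "zext k x = x")
      case True
      have "zext k (restrict x {..<k}) = zext k x" by (auto simp: zext_def)
      then have "zext k (restrict x {..<k}) = x" using True by simp
      moreover have "restrict x {..<k} \<in> space (PiL k)" by (auto simp: space_PiM)
      ultimately have "restrict x {..<k} \<in> N" using N(2) q by auto
      then show ?thesis by (simp add: N'_def)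
    qed (simp add: N'_def)
  qed
  ultimately show ?thesis by (rule AE_I')
qed

lemma lebesgue_vec_borel_version:
  fixes f :: "real vec \<Rightarrow> real"
  assumes "f \<in> borel_measurable (lebesgue_vec k)"
  shows "\<exists>g\<in>borel_measurable borel. AE x in leb k. f (vec k x) = g x"
proof -
  obtain g where g: "g \<in> borel_measurable (embed_measure (PiL k) (vec k))"
    and ae: "AE v in embed_measure (PiL k) (vec k). f v = g v"
    using completion_ex_borel_measurable_real assms unfolding lebesgue_vec_def by blast
  have m: "(\<lambda>x. vec k (restrict x {..<k})) \<in> measurable borel (embed_measure (PiL k) (vec k))"
    by (rule measurable_compose[OF _ measurable_embed_measure2'[OF inj_on_vec]], rule measurable_restrict) auto
  have r: "vec k (restrict x {..<k}) = vec k x" for x :: "nat \<Rightarrow> real" by (intro eq_vecI) auto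
  have gm: "(\<lambda>x. g (vec k x)) \<in> borel_measurable borel"
    using measurable_compose[OF m g] by (simp add: r)
  have "AE x in PiL k. f (vec k (zext k x)) = g (vec k (zext k x))"
    using ae by (subst (asm) AE_embed_measure'[OF inj_on_vec]) simp
  then have "AE x in leb k. f (vec k x) = g (vec k x)" by (rule AE_PiL_leb)
  then show ?thesis by (intro bexI[OF _ gm])
qed

subsection \<open>The quadratic form of the matrix hypothesis\<close>

lemma scalar_mat_mult_vec:
  fixes x :: "real vec"
  assumes "x \<in> carrier_vec k"
  shows "(c \<cdot>\<^sub>m 1\<^sub>m k) *\<^sub>v x = c \<cdot>\<^sub>v x"
proof (rule eq_vecI)
  fix j assume "j < dim_vec (c \<cdot>\<^sub>v x)"
  then have j: "j < k" using assms by simp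
  have "vec_index ((c \<cdot>\<^sub>m 1\<^sub>m k) *\<^sub>v x) j = (\<Sum>l<k. (c * (if l = j then 1 else 0)) * vec_index x l)"
    using assms j by (simp add: scalar_prod_def atLeast0LessThan)
  also have "\<dots> = (\<Sum>l<k. if l = j then c * vec_index x l else 0)" by (intro sum.cong) auto
  also have "\<dots> = vec_index (c \<cdot>\<^sub>v x) j" using assms j by simp
  finally show "vec_index ((c \<cdot>\<^sub>m 1\<^sub>m k) *\<^sub>v x) j = vec_index (c \<cdot>\<^sub>v x) j" .
qed (use assms in simp)

locale bl_base =
  fixes n m :: nat and d :: "nat \<Rightarrow> nat" and p :: "nat \<Rightarrow> real" and U :: "nat \<Rightarrow> real mat" and B :: "real mat"
    and R :: "nat \<Rightarrow> nat \<Rightarrow> real"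
  assumes dn: "\<And>i. i < m \<Longrightarrow> 0 < d i \<and> d i \<le> n" and p0: "\<And>i. i < m \<Longrightarrow> p i \<noteq> 0"
    and dims: "(\<Sum>i<m. real (d i) / p i) = real n"
    and Uc: "\<And>i. i < m \<Longrightarrow> U i \<in> carrier_mat (d i) n"
    and Ur: "\<And>i. i < m \<Longrightarrow> vec_space.rank (d i) (U i) = d i"
    and Bc: "B \<in> carrier_mat n n" and Bpd: "pos_def_mat B"
    and Rt: "lower_tri n R" and BR: "\<And>i j. i < n \<Longrightarrow> j < n \<Longrightarrow> B $$ (i, j) = (\<Sum>l<n. R i l * R j l)"
begin

definition "u i r l = U i $$ (r, l)"
definition "A i r j = (\<Sum>l<n. u i r l * R l j)"
definition "V i = U i * B * transpose_mat (U i)"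
definition "a i = 1 / p i"
definition "\<rho> = (\<Prod>j<n. R j j)"

lemma Vc: "i < m \<Longrightarrow> V i \<in> carrier_mat (d i) (d i)"
  unfolding V_def using Uc[of i]
  by (intro mult_carrier_mat[OF mult_carrier_mat[OF Uc Bc]]) auto

lemma V_entries:
  assumes i: "i < m" and r: "r < d i" and s: "s < d i"
  shows "V i $$ (r, s) = (\<Sum>j<n. A i r j * A i s j)"
proof -
  note c = Uc[OF i] Bc
  have "V i $$ (r, s) = (\<Sum>k<n. (\<Sum>l<n. u i r l * B $$ (l, k)) * u i s k)"
    using c r s by (simp add: V_def u_def scalar_prod_def atLeast0LessThan del: assoc_mult_mat)
  also have "\<dots> = (\<Sum>k<n. (\<Sum>l<n. u i r l * (\<Sum>t<n. R l t * R k t)) * u i s k)"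
    using BR by (intro sum.cong refl arg_cong2[where f=times]) auto
  also have "\<dots> = (\<Sum>k<n. \<Sum>l<n. \<Sum>t<n. (u i r l * R l t) * (u i s k * R k t))"
    unfolding sum_distrib_left sum_distrib_right by (intro sum.cong refl) (simp only: mult_ac)
  also have "\<dots> = (\<Sum>k<n. \<Sum>t<n. \<Sum>l<n. (u i r l * R l t) * (u i s k * R k t))"
    by (intro sum.cong refl sum.swap)
  also have "\<dots> = (\<Sum>t<n. \<Sum>k<n. \<Sum>l<n. (u i r l * R l t) * (u i s k * R k t))"
    by (rule sum.swap)
  also have "\<dots> = (\<Sum>t<n. \<Sum>l<n. \<Sum>k<n. (u i r l * R l t) * (u i s k * R k t))"
    by (intro sum.cong refl sum.swap)
  also have "\<dots> = (\<Sum>j<n. A i r j * A i s j)"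
    unfolding A_def sum_product ..
  finally show ?thesis .
qed

text \<open>In matrix terms, A_i^T x = R^T (U_i^T x).\<close>

lemma A_combination: "(\<Sum>r<d i. A i r j * x r) = (\<Sum>l<n. R l j * (\<Sum>r<d i. u i r l * x r))"
  unfolding A_def sum_distrib_right sum_distrib_left by (subst sum.swap) (simp only: mult_ac)

lemma V_quad:
  assumes "i < m"
  shows "(\<Sum>r<d i. \<Sum>s<d i. x r * V i $$ (r, s) * x s) = (\<Sum>j<n. (\<Sum>r<d i. A i r j * x r)\<^sup>2)"
  using V_entries[OF assms] by (rule gram_quad)

lemma B_quad: "(\<Sum>i<n. \<Sum>j<n. x i * B $$ (i, j) * x j) = (\<Sum>l<n. (\<Sum>i<n. R i l * x i)\<^sup>2)"
  using BR by (rule gram_quad)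

text \<open>The quadratic form of V_i at x is that of B at U_i^T x, and full rank makes U_i^T
  injective.\<close>

lemma V_pos_def:
  assumes i: "i < m"
  shows "pos_def_fun (d i) (\<lambda>r s. V i $$ (r, s))"
  unfolding pos_def_fun_def
proof (intro conjI allI impI)
  fix r s assume "r < d i" "s < d i"
  then show "V i $$ (r, s) = V i $$ (s, r)" using V_entries[OF i] by (simp add: mult.commute)
next
  fix x :: "nat \<Rightarrow> real" assume "\<exists>r<d i. x r \<noteq> 0"
  then obtain r where r: "r < d i" "x r \<noteq> 0" by blast
  define y where "y l = (\<Sum>r<d i. u i r l * x r)" for l
  have e: "(\<Sum>r<d i. \<Sum>s<d i. x r * V i $$ (r, s) * x s) = (\<Sum>k<n. \<Sum>l<n. y k * B $$ (k, l) * y l)"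
    unfolding V_quad[OF i] A_combination B_quad y_def ..
  have "\<exists>l<n. y l \<noteq> 0"
  proof (rule ccontr)
    assume "\<not> (\<exists>l<n. y l \<noteq> 0)"
    then have y0: "y l = 0" if "l < n" for l using that by auto
    have "vec (d i) x = 0\<^sub>v (d i)"
    proof (rule full_row_rank_inj[OF Uc[OF i] Ur[OF i]])
      fix l assume l: "l < n"
      have "col (U i) l \<bullet> vec (d i) x = y l"
        using l Uc[OF i] by (simp add: scalar_prod_def y_def u_def atLeast0LessThan)
      then show "col (U i) l \<bullet> vec (d i) x = 0" using y0[OF l] by simp
    qed simp
    then have "vec_index (vec (d i) x) r = 0" using r by simp
    then show False using r by simp
  qed
  then show "0 < (\<Sum>r<d i. \<Sum>s<d i. x r * V i $$ (r, s) * x s)"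
    unfolding e using pos_def_fun_of_mat[OF Bc Bpd] unfolding pos_def_fun_def by blast
qed

lemma factorizations:
  assumes i: "i < m"
  shows "\<exists>L Q. lower_tri (d i) L \<and> (\<forall>r<d i. \<forall>s<d i. V i $$ (r, s) = (\<Sum>l<d i. L r l * L s l)) \<and>
    orth n Q \<and> (\<forall>r<d i. \<forall>j. A i r j = (\<Sum>l<d i. L r l * Q l j))"
proof -
  obtain L where L: "lower_tri (d i) L" "\<And>r s. r < d i \<Longrightarrow> s < d i \<Longrightarrow> V i $$ (r, s) = (\<Sum>l<d i. L r l * L s l)"
    using cholesky[OF V_pos_def[OF i]] by blast
  have "(\<Sum>l<n. A i r l * A i s l) = (\<Sum>l<d i. L r l * L s l)" if "r < d i" "s < d i" for r s
    using V_entries[OF i that] L(2)[OF that] by simp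
  from row_factorization[OF L(1) this] dn[OF i]
  obtain Q where "orth n Q" "\<forall>r<d i. \<forall>j. A i r j = (\<Sum>l<d i. L r l * Q l j)" by blast
  with L show ?thesis by blast
qed

definition "W = stack_mat n m U"
definition "P = diag_mat_seq m (\<lambda>i. p i \<cdot>\<^sub>m 1\<^sub>m (d i))"
definition "D = diag_mat_seq m V"

text \<open>With y = W^T v the form is y \<bullet> B y = |R^T y|^2, and R^T U_i^T is the transpose
  of A_i.\<close>

lemma WBW_quad:
  fixes w :: "nat \<Rightarrow> nat \<Rightarrow> real"
  defines "v \<equiv> cvec (\<lambda>i. vec (d i) (w i)) m"
  shows "v \<bullet> ((W * B * transpose_mat W) *\<^sub>v v) = (\<Sum>j<n. (\<Sum>i<m. \<Sum>r<d i. A i r j * w i r)\<^sup>2)"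
proof -
  let ?N = "\<Sum>i<m. d i"
  have Wc: "W \<in> carrier_mat ?N n" unfolding W_def by (rule stack_mat_carrier) (rule Uc)
  have vc: "v \<in> carrier_vec ?N" unfolding v_def by (rule cvec_carrier) simp
  define y where "y = transpose_mat W *\<^sub>v v"
  have yc: "y \<in> carrier_vec n" unfolding y_def by (rule mult_mat_vec_carrier[OF _ vc]) (use Wc in simp)
  have yl: "vec_index y l = (\<Sum>i<m. \<Sum>r<d i. u i r l * w i r)" if l: "l < n" for l
  proof -
    have "vec_index y l = col W l \<bullet> v" using l Wc by (simp add: y_def)
    also have "col W l = cvec (\<lambda>i. col (U i) l) m" unfolding W_def by (rule col_stack_mat[OF Uc l])
    also have "\<dots> \<bullet> v = (\<Sum>i<m. col (U i) l \<bullet> vec (d i) (w i))"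
      unfolding v_def
    proof (rule cvec_scalar_prod[where d=d])
      show "col (U i) l \<in> carrier_vec (d i)" if "i < m" for i
        using carrier_matD(1)[OF Uc[OF that]] by (intro carrier_vecI) simp
    qed simp
    also have "\<dots> = (\<Sum>i<m. \<Sum>r<d i. u i r l * w i r)"
    proof (intro sum.cong refl)
      fix i assume "i \<in> {..<m}"
      then have "U i \<in> carrier_mat (d i) n" using Uc by simp
      then show "col (U i) l \<bullet> vec (d i) (w i) = (\<Sum>r<d i. u i r l * w i r)"
        using l by (simp add: scalar_prod_def u_def atLeast0LessThan)
    qed
    finally show ?thesis .
  qed
  have WB: "W * B \<in> carrier_mat ?N n" by (rule mult_carrier_mat[OF Wc Bc])
  have Wt: "transpose_mat W \<in> carrier_mat n ?N" using Wc by simp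
  have "(W * B * transpose_mat W) *\<^sub>v v = (W * B) *\<^sub>v y"
    unfolding y_def by (rule assoc_mult_mat_vec[OF WB Wt vc])
  also have "\<dots> = W *\<^sub>v (B *\<^sub>v y)" by (rule assoc_mult_mat_vec[OF Wc Bc yc])
  finally have eW: "(W * B * transpose_mat W) *\<^sub>v v = W *\<^sub>v (B *\<^sub>v y)" .
  from eW have "v \<bullet> ((W * B * transpose_mat W) *\<^sub>v v) = v \<bullet> (W *\<^sub>v (B *\<^sub>v y))" by (simp only:)
  also have "\<dots> = y \<bullet> (B *\<^sub>v y)"
    unfolding y_def by (rule transpose_vec_mult_scalar[OF Wc _ vc, symmetric]) (use mult_mat_vec_carrier[OF Bc yc] in \<open>simp add: y_def\<close>)
  also have "\<dots> = (\<Sum>i<n. \<Sum>j<n. vec_index y i * B $$ (i, j) * vec_index y j)"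
    by (rule quad_form_sum[OF Bc yc])
  also have "\<dots> = (\<Sum>j<n. (\<Sum>l<n. R l j * vec_index y l)\<^sup>2)" by (rule B_quad)
  also have "\<dots> = (\<Sum>j<n. (\<Sum>i<m. \<Sum>r<d i. A i r j * w i r)\<^sup>2)"
  proof (rule sum.cong[OF refl], rule arg_cong[where f="\<lambda>x. x\<^sup>2"])
    fix j
    have "(\<Sum>l<n. R l j * vec_index y l) = (\<Sum>l<n. \<Sum>i<m. R l j * (\<Sum>r<d i. u i r l * w i r))"
      by (intro sum.cong refl) (simp add: yl sum_distrib_left)
    also have "\<dots> = (\<Sum>i<m. \<Sum>l<n. R l j * (\<Sum>r<d i. u i r l * w i r))" by (rule sum.swap)
    also have "\<dots> = (\<Sum>i<m. \<Sum>r<d i. A i r j * w i r)" by (simp only: A_combination)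
    finally show "(\<Sum>l<n. R l j * vec_index y l) = (\<Sum>i<m. \<Sum>r<d i. A i r j * w i r)" .
  qed
  finally show ?thesis .
qed

lemma PD_quad:
  fixes w :: "nat \<Rightarrow> nat \<Rightarrow> real"
  defines "v \<equiv> cvec (\<lambda>i. vec (d i) (w i)) m"
  shows "v \<bullet> ((P * D) *\<^sub>v v) = (\<Sum>i<m. p i * (\<Sum>j<n. (\<Sum>r<d i. A i r j * w i r)\<^sup>2))"
proof -
  let ?N = "\<Sum>i<m. d i"
  have Pc: "P \<in> carrier_mat ?N ?N" unfolding P_def by (rule diag_mat_seq_carrier) simp
  have Dc: "D \<in> carrier_mat ?N ?N" unfolding D_def by (rule diag_mat_seq_carrier) (rule Vc)
  have vc: "v \<in> carrier_vec ?N" unfolding v_def by (rule cvec_carrier) simp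
  have Vv: "V i *\<^sub>v vec (d i) (w i) \<in> carrier_vec (d i)" if "i < m" for i using Vc[OF that] by simp
  have "(P * D) *\<^sub>v v = P *\<^sub>v (D *\<^sub>v v)" by (rule assoc_mult_mat_vec[OF Pc Dc vc])
  also have "D *\<^sub>v v = cvec (\<lambda>i. V i *\<^sub>v vec (d i) (w i)) m"
    unfolding D_def v_def by (rule diag_mat_seq_mult[where d=d]) (use Vc in auto)
  also have "P *\<^sub>v \<dots> = cvec (\<lambda>i. (p i \<cdot>\<^sub>m 1\<^sub>m (d i)) *\<^sub>v (V i *\<^sub>v vec (d i) (w i))) m"
    unfolding P_def by (rule diag_mat_seq_mult[where d=d]) (use Vv in auto)
  finally have e: "(P * D) *\<^sub>v v = \<dots>" .
  have pv: "(p i \<cdot>\<^sub>m 1\<^sub>m (d i)) *\<^sub>v (V i *\<^sub>v vec (d i) (w i)) = p i \<cdot>\<^sub>v (V i *\<^sub>v vec (d i) (w i))" if "i < m" for i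
    by (rule scalar_mat_mult_vec[OF Vv[OF that]])
  have "v \<bullet> ((P * D) *\<^sub>v v) = (\<Sum>i<m. vec (d i) (w i) \<bullet> ((p i \<cdot>\<^sub>m 1\<^sub>m (d i)) *\<^sub>v (V i *\<^sub>v vec (d i) (w i))))"
    unfolding e unfolding v_def by (rule cvec_scalar_prod[where d=d]) (use Vv pv in auto)
  also have "\<dots> = (\<Sum>i<m. p i * (\<Sum>j<n. (\<Sum>r<d i. A i r j * w i r)\<^sup>2))"
  proof (rule sum.cong[OF refl])
    fix i assume "i \<in> {..<m}"
    then have i: "i < m" by simp
    have "vec (d i) (w i) \<bullet> ((p i \<cdot>\<^sub>m 1\<^sub>m (d i)) *\<^sub>v (V i *\<^sub>v vec (d i) (w i))) = p i * (vec (d i) (w i) \<bullet> (V i *\<^sub>v vec (d i) (w i)))"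
      unfolding pv[OF i] using Vv[OF i] by simp
    also have "vec (d i) (w i) \<bullet> (V i *\<^sub>v vec (d i) (w i)) = (\<Sum>r<d i. \<Sum>s<d i. w i r * V i $$ (r, s) * w i s)"
      using quad_form_sum[OF Vc[OF i], of "vec (d i) (w i)"] by simp
    finally show "vec (d i) (w i) \<bullet> ((p i \<cdot>\<^sub>m 1\<^sub>m (d i)) *\<^sub>v (V i *\<^sub>v vec (d i) (w i))) = p i * (\<Sum>j<n. (\<Sum>r<d i. A i r j * w i r)\<^sup>2)"
      unfolding V_quad[OF i] .
  qed
  finally show ?thesis .
qed

text \<open>With blocks a_i e_i, the identity p_i a_i^2 = a_i turns the matrix inequality into the
  sign condition met in the heat flow.\<close>

lemma QF_eq:
  fixes e :: "nat \<Rightarrow> nat \<Rightarrow> real"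
  defines "v \<equiv> cvec (\<lambda>i. vec (d i) (\<lambda>r. a i * e i r)) m"
  shows "QF n m d A a e = v \<bullet> ((W * B * transpose_mat W) *\<^sub>v v) - v \<bullet> ((P * D) *\<^sub>v v)"
proof -
  have s: "(\<Sum>r<d i. A i r j * (a i * e i r)) = a i * (\<Sum>r<d i. e i r * A i r j)" for i j
    by (simp add: sum_distrib_left mult_ac)
  have "v \<bullet> ((W * B * transpose_mat W) *\<^sub>v v) = (\<Sum>j<n. (\<Sum>i<m. a i * (\<Sum>r<d i. e i r * A i r j))\<^sup>2)"
    unfolding v_def WBW_quad s ..
  moreover have "v \<bullet> ((P * D) *\<^sub>v v) = (\<Sum>i<m. a i * (\<Sum>j<n. (\<Sum>r<d i. e i r * A i r j)\<^sup>2))"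
    unfolding v_def PD_quad s power_mult_distrib sum_distrib_left[symmetric]
  proof (rule sum.cong[OF refl])
    fix i assume "i \<in> {..<m}"
    then show "p i * ((a i)\<^sup>2 * (\<Sum>j<n. (\<Sum>r<d i. e i r * A i r j)\<^sup>2)) = a i * (\<Sum>j<n. (\<Sum>r<d i. e i r * A i r j)\<^sup>2)"
      using p0[of i] by (simp add: a_def power2_eq_square)
  qed
  ultimately show ?thesis by (simp add: QF_def)
qed

lemma loewner_quad:
  assumes "X \<le>\<^sub>L Y" "X \<in> carrier_mat N N" "Y \<in> carrier_mat N N" "v \<in> carrier_vec N"
  shows "v \<bullet> (X *\<^sub>v v) \<le> v \<bullet> (Y *\<^sub>v v)"
proof -
  have "0 \<le> v \<bullet> ((Y - X) *\<^sub>v v)"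
    using assms by (auto simp: loewner_le_def pos_semidef_mat_def)
  also have "\<dots> = v \<bullet> (Y *\<^sub>v v) - v \<bullet> (X *\<^sub>v v)"
    using assms by (simp add: minus_mult_distrib_mat_vec[where nr=N and nc=N] scalar_prod_minus_distrib[where n=N])
  finally show ?thesis by simp
qed

lemma carriers:
  "W * B * transpose_mat W \<in> carrier_mat (\<Sum>i<m. d i) (\<Sum>i<m. d i)" "P * D \<in> carrier_mat (\<Sum>i<m. d i) (\<Sum>i<m. d i)"
  "cvec (\<lambda>i. vec (d i) (w i)) m \<in> carrier_vec (\<Sum>i<m. d i)"
proof -
  have Wc: "W \<in> carrier_mat (\<Sum>i<m. d i) n" unfolding W_def by (rule stack_mat_carrier) (rule Uc)
  then show "W * B * transpose_mat W \<in> carrier_mat (\<Sum>i<m. d i) (\<Sum>i<m. d i)"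
    using mult_carrier_mat[OF mult_carrier_mat[OF Wc Bc], of "transpose_mat W"] by simp
  have "P \<in> carrier_mat (\<Sum>i<m. d i) (\<Sum>i<m. d i)" unfolding P_def by (rule diag_mat_seq_carrier) simp
  moreover have "D \<in> carrier_mat (\<Sum>i<m. d i) (\<Sum>i<m. d i)" unfolding D_def by (rule diag_mat_seq_carrier) (rule Vc)
  ultimately show "P * D \<in> carrier_mat (\<Sum>i<m. d i) (\<Sum>i<m. d i)" by (rule mult_carrier_mat)
  show "cvec (\<lambda>i. vec (d i) (w i)) m \<in> carrier_vec (\<Sum>i<m. d i)" by (rule cvec_carrier) simp
qed

lemma QF_upper:
  assumes "W * B * transpose_mat W \<le>\<^sub>L P * D"
  shows "QF n m d A a e \<le> 0"
  unfolding QF_eq using loewner_quad[OF assms carriers] by simp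

lemma QF_lower:
  assumes "P * D \<le>\<^sub>L W * B * transpose_mat W"
  shows "0 \<le> QF n m d A a e"
  unfolding QF_eq using loewner_quad[OF assms carriers(2,1,3)] by simp

text \<open>Testing with the first unit vector of block i leaves (a_i^2 - a_i) S \<le> 0, where S >
  0 is the first diagonal entry of V_i. So the upper hypothesis places a_i between 0 and 1, and a_i
  is not 0.\<close>

lemma a_pos:
  assumes QF: "\<And>e. QF n m d A a e \<le> 0" and i: "i < m"
  shows "0 < a i"
proof -
  define e where "e i' r = (if i' = i \<and> r = 0 then 1 else 0 :: real)" for i' r :: nat
  define S where "S = (\<Sum>j<n. (A i 0 j)\<^sup>2)"
  have di: "0 < d i" using dn[OF i] by simp
  have V0: "V i $$ (0, 0) = S" using V_entries[OF i di di] by (simp add: S_def power2_eq_square)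
  define x0 :: "nat \<Rightarrow> real" where "x0 r = (if r = 0 then 1 else 0)" for r
  have pd: "\<forall>x. (\<exists>r<d i. x r \<noteq> 0) \<longrightarrow> 0 < (\<Sum>r<d i. \<Sum>s<d i. x r * V i $$ (r, s) * x s)"
    using V_pos_def[OF i] unfolding pos_def_fun_def by (rule conjunct2)
  have x0: "\<exists>r<d i. x0 r \<noteq> 0" using di by (auto simp: x0_def)
  have "0 < (\<Sum>r<d i. \<Sum>s<d i. x0 r * V i $$ (r, s) * x0 s)" by (rule mp[OF spec[OF pd] x0])
  also have "\<dots> = (\<Sum>r<d i. if r = 0 then (\<Sum>s<d i. if s = 0 then V i $$ (r, s) else 0) else 0)"
  proof (rule sum.cong[OF refl])
    fix r
    show "(\<Sum>s<d i. x0 r * V i $$ (r, s) * x0 s) = (if r = 0 then (\<Sum>s<d i. if s = 0 then V i $$ (r, s) else 0) else 0)"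
    proof (cases "r = 0")
      case True
      have "(\<Sum>s<d i. x0 r * V i $$ (r, s) * x0 s) = (\<Sum>s<d i. if s = 0 then V i $$ (r, s) else 0)"
        by (rule sum.cong) (auto simp: x0_def True)
      then show ?thesis unfolding if_P[OF True] .
    next
      case False
      then have "x0 r = 0" by (simp add: x0_def)
      then show ?thesis using False by simp
    qed
  qed
  also have "\<dots> = V i $$ (0, 0)" using di by simp
  finally have S: "0 < S" using V0 by simp
  have er: "(\<Sum>r<d i'. e i' r * A i' r j) = (if i' = i then A i 0 j else 0)" for i' j
  proof (cases "i' = i")
    case True
    have "(\<Sum>r<d i. e i r * A i r j) = (\<Sum>r<d i. if r = 0 then A i r j else 0)"
      by (rule sum.cong) (auto simp: e_def)
    then show ?thesis using True di by simp
  qed (simp add: e_def)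
  have 1: "(\<Sum>i'<m. a i' * (if i' = i then A i 0 j else 0)) = a i * A i 0 j" for j
  proof -
    have "(\<Sum>i'<m. a i' * (if i' = i then A i 0 j else 0)) = (\<Sum>i'<m. if i' = i then a i' * A i 0 j else 0)"
      by (rule sum.cong) auto
    then show ?thesis using i by simp
  qed
  have 2: "(\<Sum>i'<m. a i' * (\<Sum>j<n. (if i' = i then A i 0 j else 0)\<^sup>2)) = a i * S"
  proof -
    have "(\<Sum>i'<m. a i' * (\<Sum>j<n. (if i' = i then A i 0 j else 0)\<^sup>2)) = (\<Sum>i'<m. if i' = i then a i' * S else 0)"
      by (rule sum.cong) (auto simp: S_def)
    then show ?thesis using i by simp
  qed
  have "QF n m d A a e = (\<Sum>j<n. (a i * A i 0 j)\<^sup>2) - a i * S"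
    unfolding QF_def er 1 2 ..
  also have "\<dots> = ((a i)\<^sup>2 - a i) * S"
    unfolding S_def power_mult_distrib sum_distrib_left[symmetric] left_diff_distrib ..
  finally have "((a i)\<^sup>2 - a i) * S \<le> 0" using QF[of e] by simp
  then have "(a i)\<^sup>2 \<le> a i" using S by (simp add: mult_le_0_iff)
  then have "0 \<le> a i" using zero_le_power2[of "a i"] by linarith
  moreover have "a i \<noteq> 0" using p0[OF i] by (simp add: a_def)
  ultimately show ?thesis by simp
qed

end

subsection \<open>Reduction to normalized data\<close>

lemma enn_powr_ennreal:
  assumes "0 \<le> y" "q \<noteq> 0" "q < 0 \<Longrightarrow> 0 < y"
  shows "enn_powr (ennreal y) q = ennreal (y powr q)"
  using assms by (cases "y = 0") (auto simp: enn_powr_def ennreal_eq_0_iff)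

text \<open>Otherwise the Gaussian density would integrate to 0.\<close>

lemma leb_not_null: "\<not> (AE x in leb k. False)"
proof
  assume "AE x in leb k. False"
  then have "(\<integral>\<^sup>+x. ennreal (gdens k x) \<partial>leb k) = (\<integral>\<^sup>+x. 0 \<partial>leb k)"
    by (intro nn_integral_cong_AE) (auto elim: eventually_mono)
  then show False by (simp add: gdens_total)
qed

text \<open>For q < 0 the extended power of 0 is \<infinity>, so a finite integral forces f > 0
  almost everywhere; this is what allows a representative that is positive everywhere.\<close>

lemma Lp_nonneg_borel_version:
  assumes f: "f \<in> Lp_nonneg k q" and q: "q \<noteq> 0"
  shows "\<exists>g\<in>borel_measurable borel. (\<forall>x. 0 \<le> g x) \<and> (q < 0 \<longrightarrow> (\<forall>x. 0 < g x)) \<and> (AE x in leb k. f (vec k x) = g x)"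
proof -
  have fm: "f \<in> borel_measurable (lebesgue_vec k)" and f0: "\<And>x. x \<in> carrier_vec k \<Longrightarrow> 0 \<le> f x"
    and fi: "Lp_integral k q f < \<infinity>" using f by (auto simp: Lp_nonneg_def)
  obtain g0 where g0: "g0 \<in> borel_measurable borel" "AE x in leb k. f (vec k x) = g0 x"
    using lebesgue_vec_borel_version[OF fm] by blast
  define g1 where "g1 x = max 0 (g0 x)" for x
  have g1 [measurable]: "g1 \<in> borel_measurable borel" unfolding g1_def using g0(1) by measurable
  have ae1: "AE x in leb k. f (vec k x) = g1 x"
    using g0(2)
  proof eventually_elim
    case (elim x)
    then show ?case using f0[of "vec k x"] by (simp add: g1_def)
  qed
  show ?thesis
  proof (cases "q < 0")
    case False
    then show ?thesis using g1 ae1 by (intro bexI[OF _ g1] conjI) (auto simp: g1_def)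
  next
    case True
    have m: "(\<lambda>x. if g1 x = 0 then \<infinity> else ennreal (g1 x powr q)) \<in> borel_measurable borel" by measurable
    have e: "enn_powr (ennreal (g1 x)) q = (if g1 x = 0 then \<infinity> else ennreal (g1 x powr q))" for x
      using True q by (auto simp: enn_powr_def g1_def max_def ennreal_eq_0_iff)
    have "AE x in leb k. enn_powr (ennreal (f (vec k x))) q = (if g1 x = 0 then \<infinity> else ennreal (g1 x powr q))"
      using ae1 by eventually_elim (simp add: e)
    from nn_integral_lebesgue_vec[OF m this]
    have "(\<integral>\<^sup>+x. (if g1 x = 0 then \<infinity> else ennreal (g1 x powr q)) \<partial>leb k) \<noteq> \<infinity>"
      using fi by (simp add: Lp_integral_def)
    then have "AE x in leb k. (if g1 x = 0 then \<infinity> else ennreal (g1 x powr q)) \<noteq> \<infinity>"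
      using m by (intro nn_integral_PInf_AE) auto
    then have pos: "AE x in leb k. g1 x \<noteq> 0" by eventually_elim (auto split: if_splits)
    \<comment> \<open>The zeros form a null set, on which any positive value will do.\<close>
    define g where "g x = (if g1 x = 0 then 1 else g1 x)" for x
    have gm: "g \<in> borel_measurable borel" unfolding g_def by measurable
    have "AE x in leb k. f (vec k x) = g x" using ae1 pos by eventually_elim (simp add: g_def)
    moreover have "0 < g x" for x by (auto simp: g_def g1_def max_def)
    ultimately show ?thesis by (intro bexI[OF _ gm] conjI) (auto intro: less_imp_le)
  qed
qed

text \<open>\<open>A\<^sub>i = L\<^sub>i Q\<^sub>i\<close> with \<open>Q\<^sub>i\<close> orthogonal: by rotation invariance \<open>A\<^sub>i \<xi>\<close> has the law of \<open>L\<^sub>i\<close>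
  applied to a standard Gaussian vector of dimension \<open>d i\<close>.\<close>

locale bl_full = bl_base +
  fixes L Q :: "nat \<Rightarrow> nat \<Rightarrow> nat \<Rightarrow> real"
  assumes Lt: "\<And>i. i < m \<Longrightarrow> lower_tri (d i) (L i)"
    and VL: "\<And>i r s. i < m \<Longrightarrow> r < d i \<Longrightarrow> s < d i \<Longrightarrow> V i $$ (r, s) = (\<Sum>l<d i. L i r l * L i s l)"
    and Qo: "\<And>i. i < m \<Longrightarrow> orth n (Q i)"
    and ALQ: "\<And>i r j. i < m \<Longrightarrow> r < d i \<Longrightarrow> A i r j = (\<Sum>l<d i. L i r l * Q i l j)"
begin

definition "\<l> i = (\<Prod>r<d i. L i r r)"

lemma l_pos: "i < m \<Longrightarrow> 0 < \<l> i"
  unfolding \<l>_def using Lt by (intro prod_pos) (auto simp: lower_tri_def)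

lemma rho_pos: "0 < \<rho>"
  unfolding \<rho>_def using Rt by (intro prod_pos) (auto simp: lower_tri_def)

lemma leb_L:
  assumes "F \<in> borel_measurable borel" "i < m"
  shows "(\<integral>\<^sup>+x. F x \<partial>leb (d i)) = ennreal (\<l> i) * (\<integral>\<^sup>+x. F (lmap (d i) (d i) (L i) x) \<partial>leb (d i))"
  unfolding \<l>_def using assms Lt[OF assms(2)] by (intro leb_triangular) (auto simp: lower_tri_def)

lemma leb_R:
  assumes "F \<in> borel_measurable borel"
  shows "(\<integral>\<^sup>+x. F x \<partial>leb n) = ennreal \<rho> * (\<integral>\<^sup>+x. F (lmap n n R x) \<partial>leb n)"
  unfolding \<rho>_def using assms Rt by (intro leb_triangular) (auto simp: lower_tri_def)

lemma lmap_uR: "lmap n (d i) (u i) (lmap n n R z) = lmap n (d i) (A i) z"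
proof
  fix r
  have "(\<Sum>l<n. u i r l * (\<Sum>j<n. R l j * z j)) = (\<Sum>j<n. A i r j * z j)"
    unfolding A_def sum_distrib_left sum_distrib_right by (subst sum.swap) (simp only: mult_ac)
  then show "lmap n (d i) (u i) (lmap n n R z) r = lmap n (d i) (A i) z r"
    by (simp add: lmap_def)
qed

lemma U_vec: "i < m \<Longrightarrow> U i *\<^sub>v vec n x = vec (d i) (lmap n (d i) (u i) x)"
  using Uc[of i] by (intro eq_vecI) (auto simp: lmap_def u_def scalar_prod_def atLeast0LessThan)

text \<open>This makes f_i(U_i x) depend, almost everywhere, only on the class of f_i. By
  \<open>gauss_law\<close> the image of the Gaussian measure under A_i does not charge Lebesgue null
  sets; positivity of the Gaussian density and the substitution x = R z then give the claim for
  U_i.\<close>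

lemma null_set_pullback:
  assumes i: "i < m" and N: "N \<in> null_sets (leb (d i))"
  shows "AE x in leb n. lmap n (d i) (u i) x \<notin> N"
proof -
  have Ns [measurable]: "N \<in> sets borel" using N by auto
  define F :: "(nat \<Rightarrow> real) \<Rightarrow> ennreal" where "F = indicator N"
  have [measurable]: "F \<in> borel_measurable borel" unfolding F_def by measurable
  have "(\<integral>\<^sup>+x. F x \<partial>leb (d i)) = 0" unfolding F_def using N by (simp add: null_setsD1)
  then have L0: "(\<integral>\<^sup>+x. F (lmap (d i) (d i) (L i) x) \<partial>leb (d i)) = 0"
    using leb_L[of F i] i l_pos[OF i] by simp
  have "(\<integral>\<^sup>+z. F (lmap (d i) (d i) (L i) z) * ennreal (exp (- (\<Sum>j<d i. (z j)\<^sup>2) / (2 * 1\<^sup>2))) \<partial>leb (d i)) \<le>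
    (\<integral>\<^sup>+x. F (lmap (d i) (d i) (L i) x) \<partial>leb (d i))"
  proof (rule nn_integral_mono)
    fix z
    show "F (lmap (d i) (d i) (L i) z) * ennreal (exp (- (\<Sum>j<d i. (z j)\<^sup>2) / (2 * 1\<^sup>2))) \<le> F (lmap (d i) (d i) (L i) z)"
      using mult_left_mono[OF gw_le_1[of "d i" 1 z], of "F (lmap (d i) (d i) (L i) z)"] by (simp add: gw_def)
  qed
  then have "(\<integral>\<^sup>+y. F (lmap n (d i) (A i) (\<lambda>j. 1 * y j)) \<partial>gauss n) = 0"
    using gauss_law[OF _ Qo[OF i], of F "d i" "A i" "L i" 1] dn[OF i] ALQ[OF i] L0 by simp
  then have "(\<integral>\<^sup>+y. F (lmap n (d i) (A i) y) * ennreal (gdens n y) \<partial>leb n) = 0"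
    by (subst gauss_gdens[symmetric, where F="\<lambda>y. F (lmap n (d i) (A i) y)"]) simp_all
  then have "AE y in leb n. F (lmap n (d i) (A i) y) * ennreal (gdens n y) = 0"
    by (subst (asm) nn_integral_0_iff_AE) auto
  then have "AE y in leb n. F (lmap n (d i) (A i) y) = 0"
    by eventually_elim (simp add: gdens_def)
  then have "(\<integral>\<^sup>+y. F (lmap n (d i) (A i) y) \<partial>leb n) = 0"
    by (subst nn_integral_0_iff_AE) auto
  then have "(\<integral>\<^sup>+x. F (lmap n (d i) (u i) x) \<partial>leb n) = 0"
    by (subst leb_R[where F="\<lambda>x. F (lmap n (d i) (u i) x)"]) (auto simp: lmap_uR)
  then have "AE x in leb n. F (lmap n (d i) (u i) x) = 0"
    by (subst (asm) nn_integral_0_iff_AE) auto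
  then show ?thesis by eventually_elim (auto simp: F_def)
qed

text \<open>Both kinds of determinant are squares of products of diagonal entries, which the
  exponent 1 / 2 undoes.\<close>

lemma det_factor: "(det B / (\<Prod>i<m. det (V i) powr (1 / p i))) powr (1 / 2) = \<rho> / (\<Prod>i<m. \<l> i powr a i)"
proof -
  have "det B = \<rho>\<^sup>2" unfolding \<rho>_def by (rule det_gram_lower_tri[OF Rt Bc BR])
  moreover have "(\<Prod>i<m. det (V i) powr (1 / p i)) = (\<Prod>i<m. \<l> i powr a i)\<^sup>2"
    unfolding prod_power_distrib
  proof (rule prod.cong[OF refl])
    fix i assume "i \<in> {..<m}"
    then have i: "i < m" by simp
    have "det (V i) = (\<l> i)\<^sup>2" unfolding \<l>_def by (rule det_gram_lower_tri[OF Lt[OF i] Vc[OF i] VL[OF i]])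
    then show "det (V i) powr (1 / p i) = (\<l> i powr a i)\<^sup>2"
      using l_pos[OF i] by (simp add: a_def powr_mult power2_eq_square)
  qed
  moreover have "0 < (\<Prod>i<m. \<l> i powr a i)" using l_pos by (intro prod_pos) (auto dest: l_pos)
  ultimately show ?thesis using rho_pos
    by (simp add: power_divide[symmetric] powr_half_sqrt)
qed

definition "lhs f = (\<integral>\<^sup>+ x. ennreal (\<Prod>i<m. f i (U i *\<^sub>v x)) \<partial>lebesgue_vec n)"
definition "rhs f = ennreal ((det B / (\<Prod>i<m. det (V i) powr (1 / p i))) powr (1 / 2)) * (\<Prod>i<m. Lp_norm (d i) (p i) (f i))"

text \<open>Positivity for p_i < 0 makes \<open>powr\<close> agree with the extended power and
  supplies the positivity hypothesis of \<open>bl_lower\<close>.\<close>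

definition "versions f g \<longleftrightarrow> (\<forall>i<m. g i \<in> borel_measurable borel \<and> (\<forall>x. 0 \<le> g i x) \<and> (p i < 0 \<longrightarrow> (\<forall>x. 0 < g i x)) \<and>
  (AE x in leb (d i). f i (vec (d i) x) = g i x) \<and> Lp_integral (d i) (p i) (f i) < \<infinity>)"

text \<open>The dictionary to \<open>bl_data\<close>. The substitution x = R z on the left produces
  \<rho>. On the right, substituting by L_i produces a factor \<open>\<l> i powr a i\<close> in each
  norm, which cancels the denominator of \<open>det_factor\<close>. The same factor \<rho> remains
  on both sides.\<close>

lemma lhs_rhs:
  fixes f :: "nat \<Rightarrow> real vec \<Rightarrow> real" and g :: "nat \<Rightarrow> (nat \<Rightarrow> real) \<Rightarrow> real"
  assumes v: "versions f g"
  defines "h \<equiv> \<lambda>i x. g i x powr p i"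
  shows "bl_data n m d A L Q a h"
    and "lhs f = ennreal \<rho> * (\<integral>\<^sup>+z. ennreal (\<Prod>i<m. g i (lmap n (d i) (A i) z)) \<partial>leb n)"
    and "Phi m a (\<lambda>i. h i (lmap n (d i) (A i) z)) = (\<Prod>i<m. g i (lmap n (d i) (A i) z))"
    and "rhs f = ennreal \<rho> * ennreal (Phi m a (\<lambda>i. enn2real (\<integral>\<^sup>+z. ennreal (h i (lmap (d i) (d i) (L i) z)) \<partial>leb (d i))))"
proof -
  have v': "g i \<in> borel_measurable borel \<and> (\<forall>x. 0 \<le> g i x) \<and> (p i < 0 \<longrightarrow> (\<forall>x. 0 < g i x)) \<and>
    (AE x in leb (d i). f i (vec (d i) x) = g i x) \<and> Lp_integral (d i) (p i) (f i) < \<infinity>" if "i < m" for i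
    using v that unfolding versions_def by (elim allE impE)
  have gm: "g i \<in> borel_measurable borel" if "i < m" for i using v'[OF that] by (elim conjE)
  have g0: "0 \<le> g i x" if "i < m" for i x using v'[OF that] by (elim conjE allE)
  have gpos: "0 < g i x" if "i < m" "p i < 0" for i x using v'[OF that(1)] that(2) by (elim conjE) blast
  have ae: "AE x in leb (d i). f i (vec (d i) x) = g i x" if "i < m" for i using v'[OF that] by (elim conjE)
  have fin: "Lp_integral (d i) (p i) (f i) < \<infinity>" if "i < m" for i using v'[OF that] by (elim conjE)
  have hm: "h i \<in> borel_measurable borel" if "i < m" for i unfolding h_def using gm[OF that] by measurable
  have Lp: "Lp_integral (d i) (p i) (f i) = ennreal (\<l> i) * (\<integral>\<^sup>+z. ennreal (h i (lmap (d i) (d i) (L i) z)) \<partial>leb (d i))"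
    "Lp_integral (d i) (p i) (f i) = (\<integral>\<^sup>+x. ennreal (h i x) \<partial>leb (d i))" if i: "i < m" for i
  proof -
    note [measurable] = hm[OF i]
    have hb: "(\<lambda>x. ennreal (h i x)) \<in> borel_measurable borel" by measurable
    have "AE x in leb (d i). enn_powr (ennreal (f i (vec (d i) x))) (p i) = ennreal (h i x)"
      using ae[OF i] by eventually_elim (simp add: h_def enn_powr_ennreal g0[OF i] p0[OF i] gpos[OF i])
    from nn_integral_lebesgue_vec[OF hb this]
    show 2: "Lp_integral (d i) (p i) (f i) = (\<integral>\<^sup>+x. ennreal (h i x) \<partial>leb (d i))" by (simp add: Lp_integral_def)
    show "Lp_integral (d i) (p i) (f i) = ennreal (\<l> i) * (\<integral>\<^sup>+z. ennreal (h i (lmap (d i) (d i) (L i) z)) \<partial>leb (d i))"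
      unfolding 2 by (rule leb_L[OF hb i])
  qed
  define I where "I i = (\<integral>\<^sup>+z. ennreal (h i (lmap (d i) (d i) (L i) z)) \<partial>leb (d i))" for i
  have Ifin: "I i < \<infinity>" if i: "i < m" for i
    using fin[OF i] Lp(1)[OF i] l_pos[OF i] unfolding I_def[symmetric] by (auto simp: ennreal_mult_less_top top_unique)
  show "bl_data n m d A L Q a h"
  proof
    show "(\<Sum>i<m. real (d i) * a i) = real n" using dims by (simp add: a_def)
    show "(\<integral>\<^sup>+z. ennreal (h i (lmap (d i) (d i) (L i) z)) \<partial>leb (d i)) < \<infinity>" if "i < m" for i
      using Ifin[OF that] unfolding I_def .
  qed (use dn Qo ALQ hm in \<open>auto simp: h_def\<close>)
  show Phi: "Phi m a (\<lambda>i. h i (lmap n (d i) (A i) z)) = (\<Prod>i<m. g i (lmap n (d i) (A i) z))" for z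
    unfolding Phi_def h_def a_def using p0 g0 by (intro prod.cong) (auto simp: powr_powr)
  have um: "(\<lambda>x. g i (lmap n (d i) (u i) x)) \<in> borel_measurable borel" if "i < m" for i
    using gm[OF that] by measurable
  have Gm: "(\<lambda>x. ennreal (\<Prod>i<m. g i (lmap n (d i) (u i) x))) \<in> borel_measurable borel"
    using um by (intro measurable_compose[OF _ measurable_ennreal] borel_measurable_prod) auto
  have aei: "AE x in leb n. f i (U i *\<^sub>v vec n x) = g i (lmap n (d i) (u i) x)" if i: "i < m" for i
  proof -
    obtain N where N: "N \<in> null_sets (leb (d i))" "{x \<in> space (leb (d i)). \<not> f i (vec (d i) x) = g i x} \<subseteq> N"
      using ae[OF i] unfolding eventually_ae_filter by blast
    show ?thesis
      using null_set_pullback[OF i N(1)]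
      by eventually_elim (use N(2) in \<open>auto simp: U_vec[OF i]\<close>)
  qed
  have "AE x in leb n. \<forall>i\<in>{..<m}. f i (U i *\<^sub>v vec n x) = g i (lmap n (d i) (u i) x)"
    using aei by (subst AE_finite_all) auto
  then have "AE x in leb n. ennreal (\<Prod>i<m. f i (U i *\<^sub>v vec n x)) = ennreal (\<Prod>i<m. g i (lmap n (d i) (u i) x))"
    by eventually_elim (auto intro!: arg_cong[where f=ennreal] prod.cong)
  from nn_integral_lebesgue_vec[OF Gm this]
  have "lhs f = (\<integral>\<^sup>+x. ennreal (\<Prod>i<m. g i (lmap n (d i) (u i) x)) \<partial>leb n)" unfolding lhs_def .
  also have "\<dots> = ennreal \<rho> * (\<integral>\<^sup>+z. ennreal (\<Prod>i<m. g i (lmap n (d i) (u i) (lmap n n R z))) \<partial>leb n)"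
    by (rule leb_R[OF Gm])
  finally show "lhs f = ennreal \<rho> * (\<integral>\<^sup>+z. ennreal (\<Prod>i<m. g i (lmap n (d i) (A i) z)) \<partial>leb n)" by (simp only: lmap_uR)
  have Lpn: "Lp_norm (d i) (p i) (f i) = ennreal (\<l> i powr a i * enn2real (I i) powr a i)" if i: "i < m" for i
  proof -
    have e: "Lp_integral (d i) (p i) (f i) = ennreal (\<l> i * enn2real (I i))"
      unfolding Lp(1)[OF i] I_def[symmetric] using Ifin[OF i] l_pos[OF i] by (simp add: ennreal_mult)
    \<comment> \<open>If the integral were 0 with a negative exponent, the extended power would be
      \<infinity> whereas \<open>powr\<close> returns 0. Positivity of h everywhere rules this
      out.\<close>
    have pos: "0 < \<l> i * enn2real (I i)" if neg: "1 / p i < 0"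
    proof (rule ccontr)
      assume "\<not> 0 < \<l> i * enn2real (I i)"
      then have "Lp_integral (d i) (p i) (f i) = 0" unfolding e by (simp add: ennreal_neg)
      then have "(\<integral>\<^sup>+x. ennreal (h i x) \<partial>leb (d i)) = 0" using Lp(2)[OF i] by simp
      then have hz: "AE x in leb (d i). ennreal (h i x) = 0" using hm[OF i] by (subst (asm) nn_integral_0_iff_AE) auto
      have hp: "0 < h i x" for x using gpos[OF i, of x] neg by (simp add: h_def)
      have "AE x in leb (d i). False"
        using hz by (rule eventually_mono) (metis hp ennreal_eq_0_iff not_le)
      then show False using leb_not_null by blast
    qed
    have "Lp_norm (d i) (p i) (f i) = ennreal ((\<l> i * enn2real (I i)) powr (1 / p i))"
      unfolding Lp_norm_def e using p0[OF i] l_pos[OF i] pos by (intro enn_powr_ennreal) auto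
    then show ?thesis using l_pos[OF i] by (simp add: a_def powr_mult)
  qed
  have "(\<Prod>i<m. Lp_norm (d i) (p i) (f i)) = ennreal (\<Prod>i<m. \<l> i powr a i * enn2real (I i) powr a i)"
    using Lpn by (simp add: prod_ennreal)
  also have "(\<Prod>i<m. \<l> i powr a i * enn2real (I i) powr a i) = (\<Prod>i<m. \<l> i powr a i) * Phi m a (\<lambda>i. enn2real (I i))"
    by (simp add: Phi_def prod.distrib)
  finally have "rhs f = ennreal (\<rho> / (\<Prod>i<m. \<l> i powr a i)) * ennreal ((\<Prod>i<m. \<l> i powr a i) * Phi m a (\<lambda>i. enn2real (I i)))"
    unfolding rhs_def det_factor by simp
  also have "\<dots> = ennreal (\<rho> / (\<Prod>i<m. \<l> i powr a i) * ((\<Prod>i<m. \<l> i powr a i) * Phi m a (\<lambda>i. enn2real (I i))))"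
    using rho_pos by (intro ennreal_mult[symmetric]) (auto intro!: divide_nonneg_nonneg prod_nonneg mult_nonneg_nonneg Phi_nonneg)
  also have "\<dots> = ennreal (\<rho> * Phi m a (\<lambda>i. enn2real (I i)))"
  proof -
    have "0 < (\<Prod>i<m. \<l> i powr a i)" by (intro prod_pos) (auto dest: l_pos)
    moreover have "r / x * (x * y) = r * y" if "0 < x" for r x y :: real using that by simp
    ultimately have "\<rho> / (\<Prod>i<m. \<l> i powr a i) * ((\<Prod>i<m. \<l> i powr a i) * Phi m a (\<lambda>i. enn2real (I i))) = \<rho> * Phi m a (\<lambda>i. enn2real (I i))"
      by iprover
    then show ?thesis by (simp only:)
  qed
  also have "\<dots> = ennreal \<rho> * ennreal (Phi m a (\<lambda>i. enn2real (I i)))"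
    using rho_pos by (intro ennreal_mult) (auto intro: Phi_nonneg)
  finally show "rhs f = ennreal \<rho> * ennreal (Phi m a (\<lambda>i. enn2real (\<integral>\<^sup>+z. ennreal (h i (lmap (d i) (d i) (L i) z)) \<partial>leb (d i))))"
    unfolding I_def .
qed

lemma borel_versions:
  assumes f: "\<And>i. i < m \<Longrightarrow> f i \<in> Lp_nonneg (d i) (p i)"
  shows "\<exists>g. versions f g"
proof -
  let ?P = "\<lambda>i g. g \<in> borel_measurable borel \<and> (\<forall>x. 0 \<le> g x) \<and> (p i < 0 \<longrightarrow> (\<forall>x. 0 < g x)) \<and>
    (AE x in leb (d i). f i (vec (d i) x) = g x) \<and> Lp_integral (d i) (p i) (f i) < \<infinity>"
  have "\<forall>i. \<exists>g. i < m \<longrightarrow> ?P i g"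
  proof
    fix i show "\<exists>g. i < m \<longrightarrow> ?P i g"
    proof (cases "i < m")
      case True
      have "Lp_integral (d i) (p i) (f i) < \<infinity>" using f[OF True] by (simp add: Lp_nonneg_def)
      then show ?thesis using Lp_nonneg_borel_version[OF f[OF True] p0[OF True]]
        by (elim bexE conjE) (rule exI, intro impI conjI, (assumption | rule mp)+)
    qed auto
  qed
  then have "\<exists>g. \<forall>i. i < m \<longrightarrow> ?P i (g i)" by (rule choice)
  then show ?thesis unfolding versions_def .
qed

lemma upper_bound:
  assumes f: "\<And>i. i < m \<Longrightarrow> f i \<in> Lp_nonneg (d i) (p i)" and QF: "\<And>e. QF n m d A a e \<le> 0"
  shows "lhs f \<le> rhs f"
proof -
  obtain g where "versions f g" using borel_versions[OF f] by blast
  note lr = lhs_rhs[OF this]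
  interpret bl: bl_data n m d A L Q a "\<lambda>i x. g i x powr p i" by (rule lr(1))
  show ?thesis
    unfolding lr(2,4) unfolding lr(3)[symmetric]
    by (rule mult_left_mono, rule bl.bl_upper[unfolded bl.G_def bl.I_def], rule QF, rule a_pos[OF QF]) auto
qed

lemma lower_bound:
  assumes f: "\<And>i. i < m \<Longrightarrow> f i \<in> Lp_nonneg (d i) (p i)" and QF: "\<And>e. 0 \<le> QF n m d A a e"
  shows "rhs f \<le> lhs f"
proof -
  obtain g where v: "versions f g" using borel_versions[OF f] by blast
  note lr = lhs_rhs[OF v]
  interpret bl: bl_data n m d A L Q a "\<lambda>i x. g i x powr p i" by (rule lr(1))
  have a0: "a i \<noteq> 0" if "i < m" for i using p0[OF that] by (simp add: a_def)
  have hp: "0 < g i y powr p i" if "i < m" "a i < 0" for i y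
  proof -
    have "0 < g i y" using v that unfolding versions_def a_def by (auto simp: divide_less_0_iff)
    then show ?thesis by simp
  qed
  show ?thesis
    unfolding lr(2,4) unfolding lr(3)[symmetric]
    by (rule mult_left_mono, rule bl.bl_lower[unfolded bl.G_def bl.I_def], rule QF, erule a0, erule (1) hp) auto
qed

end

subsection \<open>The Gaussian equality case\<close>

text \<open>The normalized Gaussian density, dilated by sqrt 2.\<close>

lemma leb_exp_square: "(\<integral>\<^sup>+z. ennreal (exp (- (\<Sum>j<k. (z j)\<^sup>2))) \<partial>leb k) = ennreal (sqrt pi ^ k)"
proof -
  let ?X = "\<integral>\<^sup>+z. ennreal (exp (- (\<Sum>j<k. (z j)\<^sup>2))) \<partial>leb k"
  have g: "gdens k (\<lambda>j. zext k (\<lambda>_. 0) j + sqrt 2 * z j) = (1 / sqrt (2 * pi)) ^ k * exp (- (\<Sum>j<k. (z j)\<^sup>2))" for z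
  proof -
    have "(\<Sum>j<k. (zext k (\<lambda>_. 0) j + sqrt 2 * z j)\<^sup>2) = (\<Sum>j<k. 2 * (z j)\<^sup>2)"
      by (intro sum.cong) (auto simp: zext_def power_mult_distrib)
    then show ?thesis unfolding gdens_def by (simp add: sum_distrib_left[symmetric])
  qed
  have "1 = ennreal (\<bar>sqrt 2\<bar> ^ k) * (\<integral>\<^sup>+z. ennreal (gdens k (\<lambda>j. zext k (\<lambda>_. 0) j + sqrt 2 * z j)) \<partial>leb k)"
    using leb_affine[of "\<lambda>x. ennreal (gdens k x)" "sqrt 2" k "\<lambda>_. 0"] by (simp add: gdens_total)
  also have "(\<integral>\<^sup>+z. ennreal (gdens k (\<lambda>j. zext k (\<lambda>_. 0) j + sqrt 2 * z j)) \<partial>leb k) = ennreal ((1 / sqrt (2 * pi)) ^ k) * ?X"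
    unfolding g by (subst nn_integral_cmult[symmetric]) (auto simp: ennreal_mult' intro!: nn_integral_cong)
  finally have "1 = ennreal (sqrt 2 ^ k) * (ennreal ((1 / sqrt (2 * pi)) ^ k) * ?X)" by simp
  also have "\<dots> = ennreal (sqrt 2 ^ k * (1 / sqrt (2 * pi)) ^ k) * ?X"
    by (simp add: ennreal_mult mult.assoc)
  also have "sqrt 2 ^ k * (1 / sqrt (2 * pi)) ^ k = (1 / sqrt pi) ^ k"
    by (simp add: power_mult_distrib[symmetric] real_sqrt_mult)
  finally have 1: "1 = ennreal ((1 / sqrt pi) ^ k) * ?X" .
  have "ennreal (sqrt pi ^ k) = ennreal (sqrt pi ^ k) * (ennreal ((1 / sqrt pi) ^ k) * ?X)" using 1 by simp
  also have "\<dots> = ennreal (sqrt pi ^ k * (1 / sqrt pi) ^ k) * ?X" by (simp add: ennreal_mult mult.assoc)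
  also have "sqrt pi ^ k * (1 / sqrt pi) ^ k = 1" by (simp add: power_mult_distrib[symmetric])
  finally show ?thesis by simp
qed

context bl_full
begin

definition "VI i = the (mat_inverse (V i))"

lemma VI:
  assumes i: "i < m"
  shows "VI i \<in> carrier_mat (d i) (d i)" "V i * VI i = 1\<^sub>m (d i)"
proof -
  have "det (V i) = (\<Prod>r<d i. L i r r)\<^sup>2" by (rule det_gram_lower_tri[OF Lt[OF i] Vc[OF i] VL[OF i]])
  then have "det (V i) = (\<l> i)\<^sup>2" by (simp only: \<l>_def)
  then have "det (V i) \<noteq> 0" using l_pos[OF i] by (simp only: power_eq_0_iff) simp
  then have u: "V i \<in> Units (ring_mat TYPE(real) (d i) undefined)" by (rule det_non_zero_imp_unit[OF Vc[OF i]])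
  then obtain X where "mat_inverse (V i) = Some X"
    using mat_inverse(1)[OF Vc[OF i], where b=undefined] by (cases "mat_inverse (V i)") auto
  then show "VI i \<in> carrier_mat (d i) (d i)" "V i * VI i = 1\<^sub>m (d i)"
    using mat_inverse(2)[OF Vc[OF i]] by (auto simp: VI_def)
qed

definition "q i y = (VI i *\<^sub>v vec (d i) y) \<bullet> vec (d i) y"

lemma q_measurable:
  assumes i: "i < m"
  shows "q i \<in> borel_measurable borel"
proof -
  have "q i y = (\<Sum>r<d i. (\<Sum>s<d i. VI i $$ (r, s) * y s) * y r)" for y
    using VI(1)[OF i] by (simp add: q_def scalar_prod_def atLeast0LessThan)
  then have "q i = (\<lambda>y. \<Sum>r<d i. (\<Sum>s<d i. VI i $$ (r, s) * y s) * y r)" by (rule ext)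
  then show ?thesis by simp
qed

text \<open>w is the inverse of V_i applied to y. In the computations with q below, the inverse
  matrix enters only through these two equations.\<close>

lemma q_witness:
  assumes i: "i < m"
  obtains w where "\<And>r. r < d i \<Longrightarrow> y r = (\<Sum>s<d i. V i $$ (r, s) * w s)" "q i y = (\<Sum>r<d i. w r * y r)"
proof -
  define v where "v = VI i *\<^sub>v vec (d i) y"
  have v: "v \<in> carrier_vec (d i)" unfolding v_def using VI(1)[OF i] by (rule mult_mat_vec_carrier) simp
  have "V i *\<^sub>v v = (V i * VI i) *\<^sub>v vec (d i) y"
    unfolding v_def by (rule assoc_mult_mat_vec[symmetric, OF Vc[OF i] VI(1)[OF i]]) simp
  then have Vv: "V i *\<^sub>v v = vec (d i) y" using VI(2)[OF i] by simp
  show ?thesis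
  proof (rule that[of "vec_index v"])
    fix r assume r: "r < d i"
    have "y r = vec_index (V i *\<^sub>v v) r" using Vv r by simp
    also have "\<dots> = (\<Sum>s<d i. V i $$ (r, s) * vec_index v s)"
      using r Vc[OF i] v by (simp add: scalar_prod_def atLeast0LessThan)
    finally show "y r = (\<Sum>s<d i. V i $$ (r, s) * vec_index v s)" .
  next
    show "q i y = (\<Sum>r<d i. vec_index v r * y r)"
      unfolding q_def v_def[symmetric] using v by (simp add: scalar_prod_def atLeast0LessThan)
  qed
qed

text \<open>As V = L L^T, the equation L z = V w gives z = L^T w by injectivity of L, and then w
  \<bullet> L z = z \<bullet> z.\<close>

lemma q_L:
  assumes i: "i < m"
  shows "q i (lmap (d i) (d i) (L i) z) = (\<Sum>l<d i. (z l)\<^sup>2)"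
proof -
  let ?y = "lmap (d i) (d i) (L i) z"
  obtain w where w: "\<And>r. r < d i \<Longrightarrow> ?y r = (\<Sum>s<d i. V i $$ (r, s) * w s)" "q i ?y = (\<Sum>r<d i. w r * ?y r)"
    using q_witness[OF i, of ?y] by blast
  have y: "?y r = (\<Sum>l<d i. L i r l * z l)" if "r < d i" for r using that by (simp add: lmap_def)
  have 0: "(\<Sum>l<d i. L i r l * (z l - (\<Sum>s<d i. L i s l * w s))) = 0" if r: "r < d i" for r
  proof -
    have "(\<Sum>s<d i. V i $$ (r, s) * w s) = (\<Sum>s<d i. \<Sum>l<d i. L i r l * (L i s l * w s))"
      by (rule sum.cong[OF refl]) (use VL[OF i r] in \<open>simp add: sum_distrib_right mult.assoc\<close>)
    also have "\<dots> = (\<Sum>l<d i. \<Sum>s<d i. L i r l * (L i s l * w s))" by (rule sum.swap)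
    also have "\<dots> = (\<Sum>l<d i. L i r l * (\<Sum>s<d i. L i s l * w s))" by (simp only: sum_distrib_left)
    finally show ?thesis using w(1)[OF r] y[OF r] by (simp add: right_diff_distrib sum_subtractf)
  qed
  have zl: "z l = (\<Sum>s<d i. L i s l * w s)" if l: "l < d i" for l
    using lower_tri_inj[OF Lt[OF i] 0 l] by simp
  have "q i ?y = (\<Sum>r<d i. \<Sum>l<d i. z l * (L i r l * w r))"
    unfolding w(2) by (rule sum.cong[OF refl]) (simp add: y sum_distrib_left mult_ac)
  also have "\<dots> = (\<Sum>l<d i. \<Sum>r<d i. z l * (L i r l * w r))" by (rule sum.swap)
  also have "\<dots> = (\<Sum>l<d i. z l * z l)"
    by (rule sum.cong[OF refl]) (simp only: sum_distrib_left[symmetric] zl[symmetric] lessThan_iff)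
  finally show ?thesis by (simp add: power2_eq_square)
qed

text \<open>Testing the quadratic form with the vectors \<open>w\<close> bounds \<open>T = \<Sum> a\<^sub>i A\<^sub>i\<^sup>* w\<^sub>i\<close> by
  \<open>\<bar>T\<bar>\<^sup>2 \<le> \<langle>z, T\<rangle>\<close>, which forces \<open>\<langle>z, T\<rangle> \<le> \<bar>z\<bar>\<^sup>2\<close>.\<close>

lemma q_sum_le:
  assumes QF: "\<And>e. QF n m d A a e \<le> 0"
  shows "(\<Sum>i<m. a i * q i (lmap n (d i) (A i) z)) \<le> (\<Sum>j<n. (z j)\<^sup>2)"
proof -
  let ?y = "\<lambda>i. lmap n (d i) (A i) z"
  let ?P = "\<lambda>i w. (\<forall>r<d i. ?y i r = (\<Sum>s<d i. V i $$ (r, s) * w s)) \<and> q i (?y i) = (\<Sum>r<d i. w r * ?y i r)"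
  have "\<forall>i. \<exists>w. i < m \<longrightarrow> ?P i w"
  proof
    fix i show "\<exists>w. i < m \<longrightarrow> ?P i w"
    proof (cases "i < m")
      case True
      obtain w where "\<And>r. r < d i \<Longrightarrow> ?y i r = (\<Sum>s<d i. V i $$ (r, s) * w s)" "q i (?y i) = (\<Sum>r<d i. w r * ?y i r)"
        using q_witness[OF True, of "?y i"] by blast
      then show ?thesis by (intro exI[of _ w] impI conjI allI)
    qed auto
  qed
  then have "\<exists>w. \<forall>i. i < m \<longrightarrow> ?P i (w i)" by (rule choice)
  then obtain w where w: "\<forall>i. i < m \<longrightarrow> ?P i (w i)" by (rule exE)
  define S where "S i j = (\<Sum>r<d i. w i r * A i r j)" for i j
  define T where "T j = (\<Sum>i<m. a i * S i j)" for j
  define s where "s = (\<Sum>i<m. a i * q i (?y i))"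
  have q1: "q i (?y i) = (\<Sum>j<n. z j * S i j)" if i: "i < m" for i
  proof -
    have "q i (?y i) = (\<Sum>r<d i. \<Sum>j<n. z j * (w i r * A i r j))"
    proof -
      have "q i (?y i) = (\<Sum>r<d i. w i r * ?y i r)" using w i by blast
      also have "\<dots> = (\<Sum>r<d i. \<Sum>j<n. z j * (w i r * A i r j))"
        by (rule sum.cong[OF refl]) (simp add: lmap_def sum_distrib_left mult_ac)
      finally show ?thesis .
    qed
    also have "\<dots> = (\<Sum>j<n. \<Sum>r<d i. z j * (w i r * A i r j))" by (rule sum.swap)
    finally show ?thesis by (simp only: S_def sum_distrib_left)
  qed
  have q2: "q i (?y i) = (\<Sum>j<n. (S i j)\<^sup>2)" if i: "i < m" for i
  proof -
    have "q i (?y i) = (\<Sum>r<d i. w i r * ?y i r)" using w i by blast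
    also have "\<dots> = (\<Sum>r<d i. w i r * (\<Sum>s<d i. V i $$ (r, s) * w i s))"
      using w i by (intro sum.cong refl) auto
    also have "\<dots> = (\<Sum>r<d i. \<Sum>s<d i. w i r * V i $$ (r, s) * w i s)"
      by (simp only: sum_distrib_left mult.assoc)
    also have "\<dots> = (\<Sum>j<n. (S i j)\<^sup>2)" unfolding V_quad[OF i] S_def by (simp only: mult.commute)
    finally show ?thesis .
  qed
  have s1: "s = (\<Sum>j<n. z j * T j)"
  proof -
    have "s = (\<Sum>i<m. \<Sum>j<n. a i * (z j * S i j))" unfolding s_def by (rule sum.cong[OF refl]) (simp add: q1 sum_distrib_left)
    also have "\<dots> = (\<Sum>j<n. \<Sum>i<m. a i * (z j * S i j))" by (rule sum.swap)
    also have "\<dots> = (\<Sum>j<n. z j * T j)" unfolding T_def sum_distrib_left by (simp only: mult.left_commute)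
    finally show ?thesis .
  qed
  have s2: "s = (\<Sum>i<m. a i * (\<Sum>j<n. (S i j)\<^sup>2))" unfolding s_def by (rule sum.cong[OF refl]) (simp add: q2)
  have TT: "(\<Sum>j<n. (T j)\<^sup>2) \<le> s" using QF[of w] unfolding QF_def S_def[symmetric] T_def[symmetric] s2[symmetric] by simp
  have "0 \<le> (\<Sum>j<n. (z j - T j)\<^sup>2)" by (intro sum_nonneg) auto
  also have "\<dots> = (\<Sum>j<n. (z j)\<^sup>2 + (T j)\<^sup>2 - 2 * (z j * T j))"
    by (rule sum.cong[OF refl]) (simp add: power2_diff)
  also have "\<dots> = (\<Sum>j<n. (z j)\<^sup>2) + (\<Sum>j<n. (T j)\<^sup>2) - 2 * s"
    unfolding s1 sum_distrib_left by (simp only: sum_subtractf sum.distrib)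
  finally show ?thesis using TT unfolding s_def[symmetric] by linarith
qed

text \<open>Only the lower estimate is new. Here f_i to the power p_i is exp (- q_i), so by
  \<open>q_L\<close> the normalized integrals are powers of sqrt pi, and by the scaling condition
  the right side is \<rho> times the n-th power. By \<open>q_sum_le\<close> the integrand on the
  left dominates exp (- |z|^2), whose integral is that same power.\<close>

lemma gaussian_equality:
  assumes f: "\<And>i. i < m \<Longrightarrow> f i \<in> Lp_nonneg (d i) (p i)" and QF: "\<And>e. QF n m d A a e \<le> 0"
    and fe: "\<And>i x. i < m \<Longrightarrow> x \<in> carrier_vec (d i) \<Longrightarrow> f i x = exp (- (1 / p i) * ((the (mat_inverse (V i)) *\<^sub>v x) \<bullet> x))"
  shows "lhs f = rhs f"
proof (rule antisym)
  show "lhs f \<le> rhs f" by (rule upper_bound[OF f QF])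
  define g where "g i x = exp (- (1 / p i) * q i x)" for i x
  have fin: "Lp_integral (d i) (p i) (f i) < \<infinity>" if "i < m" for i using f[OF that] by (simp add: Lp_nonneg_def)
  have gm: "g i \<in> borel_measurable borel" if "i < m" for i unfolding g_def using q_measurable[OF that] by measurable
  have g0: "0 \<le> g i x" and gp: "0 < g i x" for i x by (auto simp: g_def)
  have ae: "AE x in leb (d i). f i (vec (d i) x) = g i x" if "i < m" for i
    using fe[OF that] by (intro AE_I2) (simp add: g_def q_def VI_def)
  have "versions f g" unfolding versions_def using gm g0 gp ae fin by (intro allI impI conjI)
  note lr = lhs_rhs[OF this]
  have h: "g i x powr p i = exp (- q i x)" if "i < m" for i x
    using p0[OF that] by (simp add: g_def powr_def)
  have I: "(\<integral>\<^sup>+z. ennreal (g i (lmap (d i) (d i) (L i) z) powr p i) \<partial>leb (d i)) = ennreal (sqrt pi ^ d i)" if i: "i < m" for i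
    unfolding h[OF i] q_L[OF i] by (rule leb_exp_square)
  have "Phi m a (\<lambda>i. enn2real (\<integral>\<^sup>+z. ennreal (g i (lmap (d i) (d i) (L i) z) powr p i) \<partial>leb (d i))) = (\<Prod>i<m. sqrt pi powr (real (d i) * a i))"
    unfolding Phi_def
  proof (rule prod.cong[OF refl])
    fix i assume "i \<in> {..<m}"
    then have i: "i < m" by simp
    show "enn2real (\<integral>\<^sup>+z. ennreal (g i (lmap (d i) (d i) (L i) z) powr p i) \<partial>leb (d i)) powr a i = sqrt pi powr (real (d i) * a i)"
      unfolding I[OF i] by (simp add: powr_powr[symmetric] powr_realpow)
  qed
  also have "\<dots> = sqrt pi powr (\<Sum>i<m. real (d i) * a i)" by (subst powr_sum) auto
  also have "(\<Sum>i<m. real (d i) * a i) = real n" using dims by (simp add: a_def)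
  also have "sqrt pi powr real n = sqrt pi ^ n" by (rule powr_realpow) simp
  finally have r: "rhs f = ennreal \<rho> * ennreal (sqrt pi ^ n)" unfolding lr(4) by (simp only:)
  have "ennreal (sqrt pi ^ n) \<le> (\<integral>\<^sup>+z. ennreal (\<Prod>i<m. g i (lmap n (d i) (A i) z)) \<partial>leb n)"
    unfolding leb_exp_square[symmetric]
  proof (intro nn_integral_mono ennreal_leI)
    fix z
    have "(\<Prod>i<m. g i (lmap n (d i) (A i) z)) = exp (\<Sum>i<m. - (1 / p i) * q i (lmap n (d i) (A i) z))"
      unfolding g_def by (simp only: exp_sum[OF finite_lessThan])
    also have "(\<Sum>i<m. - (1 / p i) * q i (lmap n (d i) (A i) z)) = - (\<Sum>i<m. a i * q i (lmap n (d i) (A i) z))"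
      by (simp add: a_def sum_negf)
    finally show "exp (- (\<Sum>j<n. (z j)\<^sup>2)) \<le> (\<Prod>i<m. g i (lmap n (d i) (A i) z))"
      using q_sum_le[OF QF, of z] by simp
  qed
  then show "rhs f \<le> lhs f" unfolding r lr(2) by (rule mult_left_mono) simp
qed

end

theorem theorem2:
  fixes n m :: nat and d :: "nat \<Rightarrow> nat" and p :: "nat \<Rightarrow> real"
    and U :: "nat \<Rightarrow> real mat" and B :: "real mat"
    and f :: "nat \<Rightarrow> real vec \<Rightarrow> real"
  assumes "0 < n" and "0 < m"
    and "\<And>i. i < m \<Longrightarrow> 0 < d i \<and> d i \<le> n"
    and "\<And>i. i < m \<Longrightarrow> p i \<noteq> 0"
    and "(\<Sum>i<m. real (d i) / p i) = real n"
    and "\<And>i. i < m \<Longrightarrow> U i \<in> carrier_mat (d i) n"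
    and "\<And>i. i < m \<Longrightarrow> vec_space.rank (d i) (U i) = d i"
    and "B \<in> carrier_mat n n" and "pos_def_mat B"
    and "\<And>i. i < m \<Longrightarrow> f i \<in> Lp_nonneg (d i) (p i)"
  shows
    "let W = stack_mat n m U;
         P = diag_mat_seq m (\<lambda>i. p i \<cdot>\<^sub>m 1\<^sub>m (d i));
         V = (\<lambda>i. U i * B * transpose_mat (U i));
         D = diag_mat_seq m V;
         lhs = (\<integral>\<^sup>+ x. ennreal (\<Prod>i<m. f i (U i *\<^sub>v x)) \<partial>lebesgue_vec n);
         rhs = ennreal ((det B / (\<Prod>i<m. det (V i) powr (1 / p i))) powr (1 / 2))
                 * (\<Prod>i<m. Lp_norm (d i) (p i) (f i))
     in (W * B * transpose_mat W \<le>\<^sub>L P * D \<longrightarrow>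
           lhs \<le> rhs \<and>
           ((\<forall>i<m. \<forall>x\<in>carrier_vec (d i).
               f i x = exp (- (1 / p i) * ((the (mat_inverse (V i)) *\<^sub>v x) \<bullet> x))) \<longrightarrow>
             lhs = rhs)) \<and>
        (P * D \<le>\<^sub>L W * B * transpose_mat W \<longrightarrow> rhs \<le> lhs)"
proof -
  obtain R where R: "lower_tri n R" "\<And>i j. i < n \<Longrightarrow> j < n \<Longrightarrow> B $$ (i, j) = (\<Sum>l<n. R i l * R j l)"
    using cholesky[OF pos_def_fun_of_mat[OF assms(8,9)]] by blast
  interpret base: bl_base n m d p U B R
    by unfold_locales (use assms R in auto)
  let ?P = "\<lambda>i L Q. lower_tri (d i) L \<and> (\<forall>r<d i. \<forall>s<d i. base.V i $$ (r, s) = (\<Sum>l<d i. L r l * L s l)) \<and>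
    orth n Q \<and> (\<forall>r<d i. \<forall>j. base.A i r j = (\<Sum>l<d i. L r l * Q l j))"
  \<comment> \<open>Pairing the two factors lets a single choice function select both.\<close>
  have "\<forall>i. \<exists>LQ. i < m \<longrightarrow> ?P i (fst LQ) (snd LQ)"
  proof
    fix i show "\<exists>LQ. i < m \<longrightarrow> ?P i (fst LQ) (snd LQ)"
    proof (cases "i < m")
      case True
      from base.factorizations[OF True] obtain L Q where "?P i L Q" by (elim exE)
      then have "?P i (fst (L, Q)) (snd (L, Q))" unfolding fst_conv snd_conv .
      then show ?thesis by (intro exI[of _ "(L, Q)"] impI)
    qed auto
  qed
  then have "\<exists>LQ. \<forall>i. i < m \<longrightarrow> ?P i (fst (LQ i)) (snd (LQ i))" by (rule choice)
  then obtain LQ where LQ: "\<forall>i. i < m \<longrightarrow> ?P i (fst (LQ i)) (snd (LQ i))" by (rule exE)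
  interpret bl: bl_full n m d p U B R "\<lambda>i. fst (LQ i)" "\<lambda>i. snd (LQ i)"
    by unfold_locales (use LQ in auto)
  have V: "(\<lambda>i. U i * B * transpose_mat (U i)) = base.V" by (simp add: base.V_def fun_eq_iff)
  show ?thesis
    unfolding Let_def V base.W_def[symmetric] base.P_def[symmetric] base.D_def[symmetric]
      bl.lhs_def[symmetric] bl.rhs_def[symmetric]
  proof (intro conjI impI)
    assume le: "base.W * B * transpose_mat base.W \<le>\<^sub>L base.P * base.D"
    show "bl.lhs f \<le> bl.rhs f" by (rule bl.upper_bound[OF assms(10) base.QF_upper[OF le]])
    assume "\<forall>i<m. \<forall>x\<in>carrier_vec (d i). f i x = exp (- (1 / p i) * ((the (mat_inverse (base.V i)) *\<^sub>v x) \<bullet> x))"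
    then show "bl.lhs f = bl.rhs f" by (intro bl.gaussian_equality[OF assms(10) base.QF_upper[OF le]]) auto
  next
    assume ge: "base.P * base.D \<le>\<^sub>L base.W * B * transpose_mat base.W"
    show "bl.rhs f \<le> bl.lhs f" by (rule bl.lower_bound[OF assms(10) base.QF_lower[OF ge]])
  qed
qed

end
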